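(* Fix $\sigma>2$ and $0<\gamma<1$. There exist constants $c>0$ and $C>0$, depending only on $\sigma$ and $\gamma$, such that the following holds. Suppose that $g(t,\xi)$ is a solution of (CR) over a time interval $[0,M]$ with initial data $g_0=g(t=0)$ such that $g_0,\nabla g_0\in X^{\sigma+1}(\mathbb{R}^2)$ ((CR) is globally well-posed for such initial data). Denote $$B=\sup_{t\in[0,M]}\|g(t)\|_{X^{\sigma+1}(\mathbb{R}^2)}+\|\nabla g(t)\|_{X^{\sigma+1}(\mathbb{R}^2)}.$$ If $L>1$ and $0<\epsilon<cL^{-1-\gamma}B^{-1}$, then the solution $\{\widetilde a_K(t)\}_{K\in\mathbb{Z}^2_L}$ of $$-i\partial_t\widetilde a_K(t)=\frac{\epsilon^2}{L^4}\sum_{(K_1,K_2,K_3)\in\mathcal{S}(K)}\widetilde a_{K_1}(t)\overline{\widetilde a_{K_2}(t)}\widetilde a_{K_3}(t)e^{4\pi^2i\Omega t}$$ with initial data $\widetilde a_K(0)=g_0(K)$ satisfies $$\Big\|\widetilde a_K(t)-g\big(\tfrac{t}{T^*},K\big)\Big\|_{X^\sigma_L(\mathbb{Z}^2_L)}\lesssim\frac{B}{(\log L)^{1-\gamma}},\qquad T^*=\frac{\zeta(2)L^2}{2\epsilon^2\log L},$$ for all $0\le t\le T^*\min\left(M,\frac{\gamma\log\log L}{CB^2}\right)$, with an implicit constant depending only on $\sigma,\gamma$. In particular, if $L$ is chosen so that $L\ge\exp\exp(C\gamma^{-1}MB^2)$, then this estimate holds for all $t\in[0,MT^*]$ (the full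 domain of definition of $g(\frac{t}{T^*})$).
   Context: Notation: $\langle x\rangle=\sqrt{1+|x|^2}$; $\mathbb{Z}^2_L=L^{-1}\mathbb{Z}^2$; $x^\perp$ is the rotation of $x\in\mathbb{R}^2$ by $+\pi/2$; $\zeta(2)=\pi^2/6$. $\|g\|_{X^\sigma(\mathbb{R}^2)}=\|\langle x\rangle^\sigma g\|_{L^\infty(\mathbb{R}^2)}$, and for sequences $\|a_K\|_{X^\sigma_L}=\sup_{K\in\mathbb{Z}^2_L}\langle K\rangle^\sigma|a_K|$. (CR) is the equation $-i\partial_tg=\mathcal{T}(g,g,g)$ for $g=g(t,\xi)$, $\xi\in\mathbb{R}^2$, with $$\mathcal{T}(f,g,h)(\xi)=\int_{-1}^1\int_{\mathbb{R}^2}f(\xi+x)\,\overline{g(\xi+x+\lambda x^\perp)}\,h(\xi+\lambda x^\perp)\,dx\,d\lambda.$$ For $K\in\mathbb{Z}_L^2$, $\mathcal{S}(K)=\{(K_1,K_2,K_3)\in(\mathbb{Z}^2_L)^3:K_1-K_2+K_3=K\}$ and $\Omega=|K_1|^2-|K_2|^2+|K_3|^2-|K|^2$. The system for $\widetilde a_K$ is the Fourier-side form, with $\widetilde a_K(t)=e^{-4\pi^2i|K|^2t}\int_{[0,L]^2}u(t,x)e^{-2\pi iK\cdot x}dx$, of the cubic nonlinear Schrödinger equation $-i\partial_tu+\Delta u=\epsilon^2|u|^2u$ on the periodic box $[0,L]^2$. *)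

theory Defs
  imports "HOL-Analysis.Analysis" "HOL-Probability.Essential_Supremum"
begin

definition japanese_bracket :: "'a::real_normed_vector \<Rightarrow> real" where
  "japanese_bracket x = sqrt (1 + (norm x)\<^sup>2)"

definition perp :: "real^2 \<Rightarrow> real^2" where
  "perp x = vector [- (x $ 2), x $ 1]"

definition lattice_L :: "real \<Rightarrow> (real^2) set" where
  "lattice_L L = (\<lambda>n. (1 / L) *\<^sub>R n) ` {n. \<forall>i. n $ i \<in> \<int>}"

text \<open>The weighted norms take values in [0,\<infinity>]; a function belongs to the corresponding space
  iff its norm is finite (note that the essential supremum of a non-measurable function is
  \<infinity>).\<close>

definition X_norm :: "real \<Rightarrow> (real^2 \<Rightarrow> 'a::real_normed_vector) \<Rightarrow> ennreal" where
  "X_norm \<sigma> f = esssup lborel (\<lambda>x. ennreal (japanese_bracket x powr \<sigma> * norm (f x)))"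

definition XL_norm :: "real \<Rightarrow> real \<Rightarrow> (real^2 \<Rightarrow> complex) \<Rightarrow> ennreal" where
  "XL_norm L \<sigma> a = (SUP K\<in>lattice_L L. ennreal (japanese_bracket K powr \<sigma> * norm (a K)))"

text \<open>As the gradient is only required to lie in a weighted \<open>L\<^sup>\<infinity>\<close> space, it is the weak gradient.
  Test functions are compactly supported \<open>C\<^sup>1\<close> functions; by mollification
  this is the same as testing with compactly supported smooth functions.\<close>

definition weak_gradient :: "(real^2 \<Rightarrow> complex) \<Rightarrow> (real^2 \<Rightarrow> complex^2) \<Rightarrow> bool" where
  "weak_gradient f G \<longleftrightarrow>
     (\<forall>S. compact S \<longrightarrow> set_integrable lborel S f \<and> set_integrable lborel S G) \<and>
     (\<forall>\<phi> D. (\<forall>x. GDERIV \<phi> x :> D x) \<and> continuous_on UNIV D \<and> compact (closure {x. \<phi> x \<noteq> 0}) \<longrightarrow>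
        (\<forall>i. (\<integral>x. (D x $ i) *\<^sub>R f x \<partial>lborel) = - (\<integral>x. \<phi> x *\<^sub>R (G x $ i) \<partial>lborel)))"

definition CR_T :: "(real^2 \<Rightarrow> complex) \<Rightarrow> (real^2 \<Rightarrow> complex) \<Rightarrow> (real^2 \<Rightarrow> complex) \<Rightarrow> real^2 \<Rightarrow> complex"
  where
  "CR_T f g h \<xi> =
     (LBINT l:{-1..1}.
        (\<integral>x. f (\<xi> + x) * cnj (g (\<xi> + x + l *\<^sub>R perp x)) * h (\<xi> + l *\<^sub>R perp x) \<partial>lborel))"

text \<open>\<open>- i \<partial>\<^sub>t g = T(g,g,g)\<close> on \<open>[0,M]\<close>. Continuity in \<open>\<xi>\<close> selects the
  continuous representative of \<open>g(t)\<close>, whose values at lattice points make sense. For solutions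
  bounded in \<open>X\<^sup>s\<close> with \<open>s > 2\<close>, the pointwise derivative in time is also the derivative
  in \<open>X\<^sup>s\<close>, because \<open>T\<close> is bounded and trilinear on that space.\<close>

definition CR_solution :: "real \<Rightarrow> (real \<Rightarrow> real^2 \<Rightarrow> complex) \<Rightarrow> bool" where
  "CR_solution M g \<longleftrightarrow>
     (\<forall>t\<in>{0..M}. continuous_on UNIV (g t)) \<and>
     (\<forall>t\<in>{0..M}. \<forall>\<xi>. ((\<lambda>s. g s \<xi>) has_vector_derivative
        \<i> * CR_T (g t) (g t) (g t) \<xi>) (at t within {0..M}))"

definition interactions :: "real \<Rightarrow> real^2 \<Rightarrow> ((real^2) \<times> (real^2) \<times> (real^2)) set" where
  "interactions L K = {(K1, K2, K3). K1 \<in> lattice_L L \<and> K2 \<in> lattice_L L \<and> K3 \<in> lattice_L L \<and>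
      K1 - K2 + K3 = K}"

definition Omega :: "real^2 \<Rightarrow> real^2 \<Rightarrow> real^2 \<Rightarrow> real^2 \<Rightarrow> real" where
  "Omega K K1 K2 K3 = (norm K1)\<^sup>2 - (norm K2)\<^sup>2 + (norm K3)\<^sup>2 - (norm K)\<^sup>2"

text \<open>Solutions on \<open>[0,\<tau>]\<close> of the Fourier-side NLS system (only the values \<open>a t K\<close> with \<open>K\<close> in
  the lattice matter). They are taken to be bounded in time with values in \<open>\<ell>\<^sup>1\<close>, so that the
  sum over interactions converges absolutely. This class is larger than the weighted
  sequence spaces \<open>X\<^sub>L\<^sup>\<sigma>\<close> with \<open>\<sigma> > 2\<close>, and contains the Fourier coefficients of \<open>H\<^sup>s\<close>
  solutions with \<open>s > 1\<close>.\<close>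

definition NLS_solution ::
    "real \<Rightarrow> real \<Rightarrow> (real^2 \<Rightarrow> complex) \<Rightarrow> real \<Rightarrow> (real \<Rightarrow> real^2 \<Rightarrow> complex) \<Rightarrow> bool" where
  "NLS_solution L \<epsilon> a0 \<tau> a \<longleftrightarrow>
     (\<forall>t\<in>{0..\<tau>}. (\<lambda>K. norm (a t K)) summable_on lattice_L L) \<and>
     bdd_above ((\<lambda>t. \<Sum>\<^sub>\<infinity>K\<in>lattice_L L. norm (a t K)) ` {0..\<tau>}) \<and>
     (\<forall>K\<in>lattice_L L. a 0 K = a0 K) \<and>
     (\<forall>t\<in>{0..\<tau>}. \<forall>K\<in>lattice_L L. ((\<lambda>s. a s K) has_vector_derivative
        \<i> * (complex_of_real (\<epsilon>\<^sup>2 / L ^ 4) *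
          (\<Sum>\<^sub>\<infinity>(K1, K2, K3)\<in>interactions L K.
             a t K1 * cnj (a t K2) * a t K3 *
             exp (\<i> * complex_of_real (4 * pi\<^sup>2 * Omega K K1 K2 K3 * t)))))
        (at t within {0..\<tau>}))"

text \<open>The factor \<open>pi\<^sup>2 / 6\<close> is \<open>\<zeta>(2)\<close>.\<close>

definition T_star :: "real \<Rightarrow> real \<Rightarrow> real" where
  "T_star L \<epsilon> = (pi\<^sup>2 / 6) * L\<^sup>2 / (2 * \<epsilon>\<^sup>2 * ln L)"

text \<open>The NLS system with data \<open>g(0,K)\<close> has exactly one solution on \<open>[0,\<tau>]\<close>, and it stays within
  \<open>\<delta>\<close> of the rescaled \<open>g\<close>.\<close>

definition NLS_approximated ::
    "real \<Rightarrow> real \<Rightarrow> real \<Rightarrow> (real \<Rightarrow> real^2 \<Rightarrow> complex) \<Rightarrow> real \<Rightarrow> real \<Rightarrow> bool" where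
  "NLS_approximated \<sigma> L \<epsilon> g \<delta> \<tau> \<longleftrightarrow>
     (\<exists>a. NLS_solution L \<epsilon> (g 0) \<tau> a \<and>
        (\<forall>b. NLS_solution L \<epsilon> (g 0) \<tau> b \<longrightarrow> (\<forall>t\<in>{0..\<tau>}. \<forall>K\<in>lattice_L L. b t K = a t K)) \<and>
        (\<forall>t\<in>{0..\<tau>}. XL_norm L \<sigma> (\<lambda>K. a t K - g (t / T_star L \<epsilon>) K) \<le> ennreal \<delta>))"

end

theory Submission
  imports Defs
begin

text \<open>
Put \<open>K1 = K + p\<close>, \<open>K3 = K + q\<close>, \<open>K2 = K + p + q\<close>. Then \<open>\<Omega> = - 2 p \<cdot> q\<close>, so that the resonant interactions
are the rectangles with a corner at \<open>K\<close>. All estimates are made in the weighted sup norm, in which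
every lattice sum over such parallelograms reproduces the weight at \<open>K\<close>: one of the three other corners is about
as far from the origin as \<open>K\<close>, and the remaining two weights are summed.

The limit operator comes from counting rectangles (\<open>resonant_sum_asymptotics\<close>). Sort them by the primitive
direction \<open>w\<close> of the side \<open>p\<close>. The rectangles of a direction of length at most \<open>L\<close> form a Riemann sum for \<open>L\<^sup>2\<close>
times an integral \<open>Psi w\<close> over all rectangles in that direction, and \<open>Psi\<close> is homogeneous of degree \<open>-2\<close>.
The sum of \<open>Psi\<close> over all nonzero lattice points of a box of size \<open>N\<close> is close to an integral over an
annulus, and linear changes of variables evaluate that integral exactly as
\<open>2 ln (2 N + 1)\<close> times the operator of the limit equation (\<open>annulus_cone\<close>). Passing from all to primitive
lattice points divides by \<open>\<zeta>(2)\<close>; this is done by inverting an averaging operator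
(\<open>average_inversion\<close>), without Moebius function. Altogether the resonant sum is
\<open>2 L\<^sup>2 ln L / \<zeta>(2)\<close> times the limit operator, with an error of order \<open>L\<^sup>2\<close>, that is, a relative error
of \<open>1 / ln L\<close>. It is here that the gradient is needed: \<open>profile_of_X_norm\<close> turns the weak gradient into a
weighted Lipschitz bound by testing it against explicit functions.

The non-resonant interactions have frequencies of at least the order \<open>1 / L\<^sup>2\<close>, so their time integral
gains \<open>L\<^sup>2 / |p \<cdot> q|\<close> (\<open>oscillatory_integral\<close>), and the weighted sum of \<open>1 / |p \<cdot> q|\<close> is only of
order \<open>L\<^sup>2 ln L\<close> (\<open>nonres_sum\<close>). They therefore contribute a correction of relative size
\<open>(\<epsilon> B)\<^sup>2 L\<^sup>2\<close>, up to logarithms, which is small by the condition on \<open>\<epsilon>\<close>.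

For the dynamics, the nonlinearity is truncated to a ball of twice the size of the limit profile. The
truncated system is globally Lipschitz in the weighted norm and has a solution by Picard iteration. The
difference of this solution and the rescaled limit profile, corrected by the time integral of the
non-resonant part, satisfies a Gronwall inequality (\<open>truncated_close\<close>) whose
rate is of order \<open>B\<^sup>2 / T_star\<close>; on the given time interval the exponential is a small
power of \<open>ln L\<close>, and the error stays below \<open>B\<close> (\<open>error_budget\<close>). Hence the truncation is never active.
Uniqueness holds already in \<open>\<ell>\<^sup>1\<close>, where the convolution structure makes the nonlinearity locally
Lipschitz.
\<close>

section \<open>Weights on the plane and on lines\<close>

definition vec2 :: "real \<Rightarrow> real \<Rightarrow> real^2" where
  "vec2 a b = vector [a, b]"

definition ivec :: "int \<times> int \<Rightarrow> real^2" where
  "ivec n = vec2 (of_int (fst n)) (of_int (snd n))"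

definition wt :: "real \<Rightarrow> 'a::real_normed_vector \<Rightarrow> real" where
  "wt \<sigma> x = japanese_bracket x powr (- \<sigma>)"

text \<open>Half the exponent of the plane weight: a product of two of these dominates it, and for \<open>\<sigma> > 2\<close> the
  decay is still integrable on the line.\<close>
definition line_wt :: "real \<Rightarrow> real \<Rightarrow> real" where
  "line_wt \<sigma> t = (1 + t\<^sup>2) powr (- (\<sigma> / 4))"

lemma vec2_nth [simp]: "vec2 a b $ 1 = a" "vec2 a b $ 2 = b"
  by (auto simp: vec2_def)

lemma vec2_eq_iff: "vec2 a b = x \<longleftrightarrow> a = x $ 1 \<and> b = x $ 2"
  by (auto simp: vec_eq_iff forall_2)

lemma norm_real2: "(norm (x::real^2))\<^sup>2 = (x $ 1)\<^sup>2 + (x $ 2)\<^sup>2"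
  by (simp add: norm_vec_def L2_set_def UNIV_2 sum_nonneg)

lemma inner_real2: "(x::real^2) \<bullet> y = x $ 1 * y $ 1 + x $ 2 * y $ 2"
  by (simp add: inner_vec_def UNIV_2)

lemma perp_nth [simp]: "perp x $ 1 = - (x $ 2)" "perp x $ 2 = x $ 1"
  by (auto simp: perp_def)

lemma norm_perp [simp]: "norm (perp x) = norm x"
proof -
  have "(norm (perp x))\<^sup>2 = (norm x)\<^sup>2" by (simp add: norm_real2)
  then show ?thesis by simp
qed

lemma linear_perp: "linear perp"
  by (rule linearI) (auto simp: vec_eq_iff forall_2)

lemma perp_scaleR: "perp (c *\<^sub>R x) = c *\<^sub>R perp x"
  and perp_diff: "perp (x - y) = perp x - perp y"
  and perp_add: "perp (x + y) = perp x + perp y"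
  and perp_minus: "perp (- x) = - perp x"
  and perp_perp: "perp (perp x) = - x"
  and perp_zero: "perp 0 = 0"
  by (auto simp: vec_eq_iff forall_2)

lemma continuous_on_perp [continuous_intros]:
  "continuous_on S f \<Longrightarrow> continuous_on S (\<lambda>x. perp (f x))"
  using linear_continuous_on[of perp] linear_perp linear_conv_bounded_linear
    continuous_on_compose2[of UNIV perp S f] by blast

lemma ivec_nth [simp]: "ivec n $ 1 = of_int (fst n)" "ivec n $ 2 = of_int (snd n)"
  by (auto simp: ivec_def)

lemma ivec_add: "ivec (m + n) = ivec m + ivec n"
  and ivec_diff: "ivec (m - n) = ivec m - ivec n"
  and ivec_minus: "ivec (- n) = - ivec n"
  by (auto simp: vec_eq_iff forall_2)

lemma ivec_eq_0 [simp]: "ivec n = 0 \<longleftrightarrow> n = 0"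
  by (auto simp: vec_eq_iff forall_2 prod_eq_iff)

lemma ivec_inj: "ivec m = ivec n \<longleftrightarrow> m = n"
  by (auto simp: vec_eq_iff forall_2 prod_eq_iff)

lemma jb_ge_1: "japanese_bracket x \<ge> 1"
  by (simp add: japanese_bracket_def)

lemma jb_pos: "japanese_bracket x > 0"
  using jb_ge_1[of x] by linarith

lemma jb_sq: "(japanese_bracket x)\<^sup>2 = 1 + (norm x)\<^sup>2"
  by (simp add: japanese_bracket_def)

lemma norm_le_jb: "norm x \<le> japanese_bracket x"
  by (simp add: japanese_bracket_def real_le_rsqrt)

lemma jb_triangle: "japanese_bracket x \<le> japanese_bracket y + norm (x - y)"
proof -
  have n: "norm x \<le> norm y + norm (x - y)" by norm
  have "(japanese_bracket x)\<^sup>2 \<le> 1 + (norm y + norm (x - y))\<^sup>2"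
    using n by (simp add: jb_sq power_mono)
  also have "\<dots> \<le> (japanese_bracket y + norm (x - y))\<^sup>2"
    using mult_right_mono[OF norm_le_jb[of y], of "norm (x - y)"]
    by (simp add: power2_sum jb_sq)
  finally show ?thesis
    using jb_pos[of y] by (meson add_nonneg_nonneg less_imp_le norm_ge_zero power2_le_imp_le)
qed

lemma wt_pos: "wt \<sigma> x > 0"
  using jb_pos[of x] by (simp add: wt_def)

lemma wt_nonneg: "wt \<sigma> x \<ge> 0"
  using wt_pos[of \<sigma> x] by simp

lemma wt_le_1: "\<sigma> \<ge> 0 \<Longrightarrow> wt \<sigma> x \<le> 1"
  unfolding wt_def using jb_ge_1[of x] by (simp add: powr_minus ge_one_powr_ge_zero inverse_le_1_iff)

lemma wt_alt: "wt \<sigma> x = (1 + (norm x)\<^sup>2) powr (- (\<sigma> / 2))"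
proof -
  have "japanese_bracket x = (1 + (norm x)\<^sup>2) powr (1/2)"
    by (simp add: japanese_bracket_def powr_half_sqrt)
  then show ?thesis by (simp add: wt_def powr_powr)
qed

text \<open>By the triangle inequality for the bracket the weights vary slowly, so that a value at one point of
  a cell controls those at all others.\<close>
lemma wt_compare:
  assumes "norm (x - y) \<le> D" "\<sigma> \<ge> 0"
  shows "wt \<sigma> y \<le> (1 + D) powr \<sigma> * wt \<sigma> x"
proof -
  have D: "D \<ge> 0" using assms(1) norm_ge_zero order_trans by blast
  have "japanese_bracket x \<le> japanese_bracket y + D"
    using jb_triangle[of x y] assms by linarith
  also have "\<dots> \<le> (1 + D) * japanese_bracket y"
    using mult_left_mono[OF jb_ge_1[of y] D] by (simp add: algebra_simps)
  finally have "japanese_bracket x powr \<sigma> \<le> ((1 + D) * japanese_bracket y) powr \<sigma>"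
    using jb_pos[of x] assms by (intro powr_mono2) auto
  also have "\<dots> = (1 + D) powr \<sigma> * japanese_bracket y powr \<sigma>"
    using D jb_pos[of y] by (simp add: powr_mult)
  finally show ?thesis
    using jb_pos[of x] jb_pos[of y] by (simp add: wt_def powr_minus field_simps)
qed

lemma wt_Suc_jb: "wt (\<sigma> + 1) x * japanese_bracket x = wt \<sigma> x"
  using jb_pos[of x] by (simp add: wt_def powr_diff powr_minus field_simps powr_add)

lemma wt_mono_exp: "\<sigma> \<le> \<sigma>' \<Longrightarrow> wt \<sigma>' x \<le> wt \<sigma> x"
  unfolding wt_def by (intro powr_mono jb_ge_1) auto

text \<open>As \<open>K = K1 - K2 + K3\<close>, one of the three points has a bracket of at least a third of that of \<open>K\<close>; its
  weight supplies the decay in \<open>K\<close>, and the other two remain available for summation.\<close>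
lemma wt_triple:
  assumes "\<sigma> \<ge> 0" and K: "K = K1 - K2 + K3"
  shows "wt \<sigma> K1 * wt \<sigma> K2 * wt \<sigma> K3
     \<le> 3 powr \<sigma> * wt \<sigma> K * (wt \<sigma> K2 * wt \<sigma> K3 + wt \<sigma> K1 * wt \<sigma> K3 + wt \<sigma> K1 * wt \<sigma> K2)"
proof -
  have "japanese_bracket K \<le> japanese_bracket K1 + norm (K - K1)" by (rule jb_triangle)
  also have "norm (K - K1) \<le> norm K2 + norm K3"
    using K norm_triangle_ineq4[of K3 K2] by simp
  finally have le: "japanese_bracket K \<le> japanese_bracket K1 + japanese_bracket K2 + japanese_bracket K3"
    using norm_le_jb[of K2] norm_le_jb[of K3] by linarith
  have key: "wt \<sigma> X \<le> 3 powr \<sigma> * wt \<sigma> K" if "japanese_bracket K \<le> 3 * japanese_bracket X" for X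
  proof -
    have "japanese_bracket K powr \<sigma> \<le> (3 * japanese_bracket X) powr \<sigma>"
      using that jb_pos[of K] assms by (intro powr_mono2) auto
    also have "\<dots> = 3 powr \<sigma> * japanese_bracket X powr \<sigma>"
      using jb_pos[of X] by (simp add: powr_mult)
    finally show ?thesis using jb_pos[of K] jb_pos[of X]
      by (simp add: wt_def powr_minus field_simps)
  qed
  have nn: "wt \<sigma> K1 \<ge> 0" "wt \<sigma> K2 \<ge> 0" "wt \<sigma> K3 \<ge> 0" "3 powr \<sigma> * wt \<sigma> K \<ge> 0"
    by (simp_all add: wt_nonneg)
  consider "japanese_bracket K \<le> 3 * japanese_bracket K1" | "japanese_bracket K \<le> 3 * japanese_bracket K2"
    | "japanese_bracket K \<le> 3 * japanese_bracket K3" using le by linarith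
  then show ?thesis
  proof cases
    case 1
    have "wt \<sigma> K1 * (wt \<sigma> K2 * wt \<sigma> K3) \<le> 3 powr \<sigma> * wt \<sigma> K * (wt \<sigma> K2 * wt \<sigma> K3)"
      by (intro mult_right_mono key[OF 1]) (simp add: nn)
    moreover have "0 \<le> 3 powr \<sigma> * wt \<sigma> K * (wt \<sigma> K1 * wt \<sigma> K3 + wt \<sigma> K1 * wt \<sigma> K2)"
      using nn by simp
    ultimately show ?thesis by (simp add: algebra_simps)
  next
    case 2
    have "wt \<sigma> K2 * (wt \<sigma> K1 * wt \<sigma> K3) \<le> 3 powr \<sigma> * wt \<sigma> K * (wt \<sigma> K1 * wt \<sigma> K3)"
      by (intro mult_right_mono key[OF 2]) (simp add: nn)
    moreover have "0 \<le> 3 powr \<sigma> * wt \<sigma> K * (wt \<sigma> K2 * wt \<sigma> K3 + wt \<sigma> K1 * wt \<sigma> K2)"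
      using nn by simp
    ultimately show ?thesis by (simp add: algebra_simps)
  next
    case 3
    have "wt \<sigma> K3 * (wt \<sigma> K1 * wt \<sigma> K2) \<le> 3 powr \<sigma> * wt \<sigma> K * (wt \<sigma> K1 * wt \<sigma> K2)"
      by (intro mult_right_mono key[OF 3]) (simp add: nn)
    moreover have "0 \<le> 3 powr \<sigma> * wt \<sigma> K * (wt \<sigma> K2 * wt \<sigma> K3 + wt \<sigma> K1 * wt \<sigma> K3)"
      using nn by simp
    ultimately show ?thesis by (simp add: algebra_simps)
  qed
qed

lemma line_wt_nonneg: "line_wt \<sigma> t \<ge> 0"
  by (simp add: line_wt_def)

lemma line_wt_measurable [measurable]: "line_wt \<sigma> \<in> borel_measurable borel"
  unfolding line_wt_def by measurable

lemma wt_le_line_wt: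
  assumes "\<sigma> \<ge> 0" "\<bar>t\<bar> \<le> norm x"
  shows "wt \<sigma> x \<le> line_wt \<sigma> t"
proof -
  have "t\<^sup>2 \<le> (norm x)\<^sup>2" using assms(2) by (metis abs_ge_zero power2_abs power_mono)
  then have "wt \<sigma> x \<le> (1 + t\<^sup>2) powr (- (\<sigma> / 2))"
    unfolding wt_alt using assms by (intro powr_mono2') (auto simp: add_pos_nonneg)
  also have "\<dots> \<le> line_wt \<sigma> t" unfolding line_wt_def
    using assms by (intro powr_mono) auto
  finally show ?thesis .
qed

lemma wt_line:
  assumes "\<sigma> \<ge> 0" "x \<noteq> 0"
  shows "wt \<sigma> (c + u *\<^sub>R x) \<le> line_wt \<sigma> ((c \<bullet> x) / norm x + u * norm x)"
proof (rule wt_le_line_wt[OF assms(1)])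
  have "(c \<bullet> x) / norm x + u * norm x = ((c + u *\<^sub>R x) \<bullet> x) / norm x"
    using assms by (simp add: inner_add_left field_simps power2_norm_eq_inner[symmetric] power2_eq_square)
  moreover have "\<bar>(c + u *\<^sub>R x) \<bullet> x\<bar> \<le> norm (c + u *\<^sub>R x) * norm x"
    by (rule Cauchy_Schwarz_ineq2)
  ultimately show "\<bar>(c \<bullet> x) / norm x + u * norm x\<bar> \<le> norm (c + u *\<^sub>R x)"
    using assms by (simp add: field_simps)
qed

lemma wt_le_prod_line_wt:
  assumes "\<sigma> \<ge> 0"
  shows "wt \<sigma> (x::real^2) \<le> line_wt \<sigma> (x $ 1) * line_wt \<sigma> (x $ 2)"
proof -
  let ?a = "1 + (x $ 1)\<^sup>2" and ?b = "1 + (x $ 2)\<^sup>2" and ?n = "1 + (norm x)\<^sup>2"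
  have "wt \<sigma> x = ?n powr (- (\<sigma>/4)) * ?n powr (- (\<sigma>/4))"
    unfolding wt_alt by (simp add: powr_add[symmetric])
  also have "\<dots> \<le> ?a powr (- (\<sigma>/4)) * ?b powr (- (\<sigma>/4))"
    using assms by (intro mult_mono powr_mono2') (auto simp: norm_real2 add_pos_nonneg)
  finally show ?thesis by (simp add: line_wt_def)
qed

definition line_mass :: "real \<Rightarrow> real" where
  "line_mass \<sigma> = enn2real (\<integral>\<^sup>+ t. ennreal (line_wt \<sigma> t) \<partial>lborel)"

lemma line_wt_integral:
  assumes "\<sigma> > 2"
  shows "(\<integral>\<^sup>+ t. ennreal (line_wt \<sigma> t) \<partial>lborel) = ennreal (line_mass \<sigma>)"
proof -
  define I where "I = - (1 powr (- (\<sigma>/2) + 1)) / (- (\<sigma>/2) + 1)"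
  have hi: "((\<lambda>x. x powr (- (\<sigma>/2))) has_integral I) {1..}"
    unfolding I_def using assms by (intro has_integral_powr_to_inf) auto
  have e: "(\<integral>\<^sup>+ x. ennreal (indicator {1..} x * (x powr (- (\<sigma>/2)))) \<partial>lborel) = ennreal I"
    using nn_integral_has_integral_lebesgue[OF _ hi] by (simp add: mult.commute ennreal_mult'' indicator_def)
  have e': "(\<integral>\<^sup>+ x. ennreal (indicator {1..} (-x) * ((-x) powr (- (\<sigma>/2)))) \<partial>lborel) = ennreal I"
    using nn_integral_real_affine[of "\<lambda>x. ennreal (indicator {1..} x * (x powr (- (\<sigma>/2))))" "-1" 0] e by simp
  have le: "ennreal (line_wt \<sigma> t) \<le> indicator {-1..1} t + ennreal (indicator {1..} t * (t powr (- (\<sigma>/2)))) + ennreal (indicator {1..} (-t) * ((-t) powr (- (\<sigma>/2))))" for t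
  proof -
    have p: "line_wt \<sigma> t \<le> \<bar>t\<bar> powr (- (\<sigma>/2))" if "\<bar>t\<bar> \<ge> 1"
    proof -
      have "line_wt \<sigma> t \<le> (\<bar>t\<bar> powr 2) powr (- (\<sigma>/4))" unfolding line_wt_def
        using that assms by (intro powr_mono2') (auto simp: add_pos_nonneg)
      then show ?thesis unfolding powr_powr by simp
    qed
    have q: "line_wt \<sigma> t \<le> 1" unfolding line_wt_def
      using assms by (simp add: powr_minus inverse_le_1_iff ge_one_powr_ge_zero)
    consider "t \<ge> 1" | "t \<le> -1" | "-1 < t" "t < 1" by linarith
    then show ?thesis
    proof cases
      case 1
      then have "ennreal (line_wt \<sigma> t) \<le> ennreal (indicator {1..} t * (t powr (- (\<sigma>/2))))"
        using p by (intro ennreal_leI) auto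
      then show ?thesis by (simp add: add_increasing add_increasing2)
    next
      case 2
      then have "ennreal (line_wt \<sigma> t) \<le> ennreal (indicator {1..} (-t) * ((-t) powr (- (\<sigma>/2))))"
        using p by (intro ennreal_leI) auto
      then show ?thesis by (simp add: add_increasing add_increasing2)
    next
      case 3
      then have "ennreal (line_wt \<sigma> t) \<le> indicator {-1..1} t"
        using q by simp
      then show ?thesis by (simp add: add_increasing add_increasing2)
    qed
  qed
  have "(\<integral>\<^sup>+ t. ennreal (line_wt \<sigma> t) \<partial>lborel) \<le> (\<integral>\<^sup>+ t. indicator {-1..1} t + ennreal (indicator {1..} t * (t powr (- (\<sigma>/2)))) + ennreal (indicator {1..} (-t) * ((-t) powr (- (\<sigma>/2)))) \<partial>lborel)"
    by (intro nn_integral_mono le)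
  also have "\<dots> = 2 + ennreal I + ennreal I"
    by (simp add: nn_integral_add e e')
  finally have "(\<integral>\<^sup>+ t. ennreal (line_wt \<sigma> t) \<partial>lborel) < \<infinity>"
    by (simp add: order_le_less_trans)
  then show ?thesis unfolding line_mass_def by (simp add: less_top)
qed

lemma line_mass_nonneg: "line_mass \<sigma> \<ge> 0"
  by (simp add: line_mass_def)

lemma line_wt_affine_integral:
  assumes "\<sigma> > 2" "h > 0"
  shows "(\<integral>\<^sup>+ u. ennreal (line_wt \<sigma> (s + u * h)) \<partial>lborel) = ennreal (line_mass \<sigma> / h)"
proof -
  have "ennreal (line_mass \<sigma>) = ennreal h * (\<integral>\<^sup>+ u. ennreal (line_wt \<sigma> (s + u * h)) \<partial>lborel)"
    using nn_integral_real_affine[of "\<lambda>t. ennreal (line_wt \<sigma> t)" h s] assms line_wt_integral[OF assms(1)]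
    by (simp add: mult.commute)
  moreover have "ennreal (1/h) * (ennreal h * (\<integral>\<^sup>+ u. ennreal (line_wt \<sigma> (s + u * h)) \<partial>lborel))
     = (\<integral>\<^sup>+ u. ennreal (line_wt \<sigma> (s + u * h)) \<partial>lborel)"
    using assms by (simp add: mult.assoc[symmetric] ennreal_mult'[symmetric])
  ultimately have "(\<integral>\<^sup>+ u. ennreal (line_wt \<sigma> (s + u * h)) \<partial>lborel) = ennreal (1/h) * ennreal (line_mass \<sigma>)"
    by simp
  then show ?thesis
    using assms by (simp add: ennreal_mult'[symmetric] line_mass_nonneg)
qed

lemma line_wt_compare:
  assumes "\<sigma> \<ge> 0" "\<bar>x - y\<bar> \<le> 1"
  shows "line_wt \<sigma> x \<le> 3 powr (\<sigma>/4) * line_wt \<sigma> y"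
proof -
  have "(x - y)\<^sup>2 \<le> 1" using assms(2) by (simp add: abs_square_le_1)
  moreover have "1 + y\<^sup>2 \<le> 1 + 2 * x\<^sup>2 + 2 * (x - y)\<^sup>2"
    using sum_squares_ge_zero[of "2*x-y" 0] by (simp add: power2_eq_square algebra_simps)
  ultimately have "1 + y\<^sup>2 \<le> 3 * (1 + x\<^sup>2)" 
    by (smt (verit) zero_le_power2)
  then have "(3 * (1 + x\<^sup>2)) powr (- (\<sigma>/4)) \<le> (1 + y\<^sup>2) powr (- (\<sigma>/4))"
    using assms by (intro powr_mono2') (auto simp: add_pos_nonneg)
  moreover have "(3 * (1 + x\<^sup>2)) powr (- (\<sigma>/4)) = 3 powr (- (\<sigma>/4)) * line_wt \<sigma> x"
    unfolding line_wt_def by (subst powr_mult) auto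
  ultimately have "3 powr (\<sigma>/4) * (3 powr (- (\<sigma>/4)) * line_wt \<sigma> x) \<le> 3 powr (\<sigma>/4) * line_wt \<sigma> y"
    by (intro mult_left_mono) (auto simp: line_wt_def)
  then show ?thesis by (simp add: powr_minus mult.assoc[symmetric])
qed

text \<open>Being slowly varying, the weight at a point is at most a constant times its mean over the window of
  length \<open>min h 1\<close> to the right; the windows of an arithmetic progression of step \<open>h\<close> are disjoint.\<close>
lemma line_wt_sum:
  assumes "\<sigma> > 2" "h > 0"
  shows "(\<integral>\<^sup>+ j. ennreal (line_wt \<sigma> (s + of_int j * h)) \<partial>count_space (UNIV::int set))
    \<le> ennreal (3 powr (\<sigma>/4) * line_mass \<sigma> * (1 + 1 / h))"
proof -
  define m where "m = min h 1"
  have m: "m > 0" "m \<le> 1" "m \<le> h" using assms by (auto simp: m_def)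
  define I where "I = (\<lambda>j::int. {s + of_int j * h ..< s + of_int j * h + m})"
  have one: "ennreal (line_wt \<sigma> (s + of_int j * h))
     \<le> ennreal (3 powr (\<sigma>/4) / m) * (\<integral>\<^sup>+ y. indicator (I j) y * ennreal (line_wt \<sigma> y) \<partial>lborel)" for j
  proof -
    have "ennreal (m * line_wt \<sigma> (s + of_int j * h)) = (\<integral>\<^sup>+ y. ennreal (line_wt \<sigma> (s + of_int j * h)) * indicator (I j) y \<partial>lborel)"
      using m by (simp add: nn_integral_cmult_indicator I_def ennreal_mult' mult.commute)
    also have "\<dots> \<le> (\<integral>\<^sup>+ y. ennreal (3 powr (\<sigma>/4)) * (indicator (I j) y * ennreal (line_wt \<sigma> y)) \<partial>lborel)"
    proof (intro nn_integral_mono)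
      fix y
      show "ennreal (line_wt \<sigma> (s + of_int j * h)) * indicator (I j) y
         \<le> ennreal (3 powr (\<sigma>/4)) * (indicator (I j) y * ennreal (line_wt \<sigma> y))"
      proof (cases "y \<in> I j")
        case True
        then have "line_wt \<sigma> (s + of_int j * h) \<le> 3 powr (\<sigma>/4) * line_wt \<sigma> y"
          using m assms by (intro line_wt_compare) (auto simp: I_def)
        then show ?thesis using True by (simp add: ennreal_mult'[symmetric] ennreal_leI)
      qed simp
    qed
    also have "\<dots> = ennreal (3 powr (\<sigma>/4)) * (\<integral>\<^sup>+ y. indicator (I j) y * ennreal (line_wt \<sigma> y) \<partial>lborel)"
      by (intro nn_integral_cmult) (simp add: I_def)
    finally have "ennreal (1/m) * ennreal (m * line_wt \<sigma> (s + of_int j * h)) \<le> ennreal (1/m) * (ennreal (3 powr (\<sigma>/4)) * (\<integral>\<^sup>+ y. indicator (I j) y * ennreal (line_wt \<sigma> y) \<partial>lborel))"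
      by (rule mult_left_mono) simp
    then show ?thesis using m by (simp add: ennreal_mult'[symmetric] mult.assoc[symmetric])
  qed
  have disj: "(\<integral>\<^sup>+ j. indicator (I j) y \<partial>count_space UNIV) \<le> (1::ennreal)" for y
  proof -
    have "indicator (I j) y \<le> (indicator {\<lfloor>(y - s) / h\<rfloor>} j :: ennreal)" for j
    proof (cases "y \<in> I j")
      case True
      then have "of_int j \<le> (y - s) / h" "(y - s) / h < of_int j + 1"
        using m assms by (auto simp: I_def field_simps)
      then have "\<lfloor>(y - s) / h\<rfloor> = j" by linarith
      then show ?thesis by (auto simp: indicator_def)
    qed simp
    then have "(\<integral>\<^sup>+ j. indicator (I j) y \<partial>count_space UNIV) \<le> (\<integral>\<^sup>+ j. indicator {\<lfloor>(y - s) / h\<rfloor>} j \<partial>count_space UNIV)"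
      by (intro nn_integral_mono) auto
    then show ?thesis by simp
  qed
  have "(\<integral>\<^sup>+ j. ennreal (line_wt \<sigma> (s + of_int j * h)) \<partial>count_space UNIV)
     \<le> (\<integral>\<^sup>+ j. ennreal (3 powr (\<sigma>/4) / m) * (\<integral>\<^sup>+ y. indicator (I j) y * ennreal (line_wt \<sigma> y) \<partial>lborel) \<partial>count_space UNIV)"
    by (intro nn_integral_mono one)
  also have "\<dots> = ennreal (3 powr (\<sigma>/4) / m) * (\<integral>\<^sup>+ j. (\<integral>\<^sup>+ y. indicator (I j) y * ennreal (line_wt \<sigma> y) \<partial>lborel) \<partial>count_space UNIV)"
    by (intro nn_integral_cmult) simp
  also have "(\<integral>\<^sup>+ j. (\<integral>\<^sup>+ y. indicator (I j) y * ennreal (line_wt \<sigma> y) \<partial>lborel) \<partial>count_space UNIV)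
     = (\<integral>\<^sup>+ y. (\<integral>\<^sup>+ j. indicator (I j) y * ennreal (line_wt \<sigma> y) \<partial>count_space UNIV) \<partial>lborel)"
    by (rule nn_integral_count_space_nn_integral[symmetric]) (auto simp: I_def)
  also have "\<dots> \<le> (\<integral>\<^sup>+ y. ennreal (line_wt \<sigma> y) \<partial>lborel)"
  proof (intro nn_integral_mono)
    fix y
    have "(\<integral>\<^sup>+ j. indicator (I j) y * ennreal (line_wt \<sigma> y) \<partial>count_space UNIV)
       = (\<integral>\<^sup>+ j. indicator (I j) y \<partial>count_space UNIV) * ennreal (line_wt \<sigma> y)"
      by (intro nn_integral_multc) simp
    also have "\<dots> \<le> 1 * ennreal (line_wt \<sigma> y)" by (intro mult_right_mono disj) simp
    finally show "(\<integral>\<^sup>+ j. indicator (I j) y * ennreal (line_wt \<sigma> y) \<partial>count_space UNIV) \<le> ennreal (line_wt \<sigma> y)" by simp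
  qed
  also have "ennreal (3 powr (\<sigma>/4) / m) * (\<integral>\<^sup>+ y. ennreal (line_wt \<sigma> y) \<partial>lborel) = ennreal (3 powr (\<sigma>/4) * line_mass \<sigma> * (1/m))"
    unfolding line_wt_integral[OF assms(1)] using m by (simp add: ennreal_mult'[symmetric] line_mass_nonneg)
  also have "\<dots> \<le> ennreal (3 powr (\<sigma>/4) * line_mass \<sigma> * (1 + 1/h))"
    using assms by (intro ennreal_leI mult_left_mono) (auto simp: m_def min_def line_mass_nonneg field_simps)
  finally show ?thesis by (simp add: mult_left_mono)
qed

section \<open>Sums of weights over lattices\<close>

abbreviation nsum :: "('a \<Rightarrow> ennreal) \<Rightarrow> 'a set \<Rightarrow> ennreal" where
  "nsum f A \<equiv> nn_integral (count_space A) f"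

lemma nsum_indicator: "nsum f A = nsum (\<lambda>x. f x * indicator A x) UNIV"
  by (subst nn_integral_count_space_indicator) auto

lemma nsum_mono: "(\<And>x. x \<in> A \<Longrightarrow> f x \<le> g x) \<Longrightarrow> nsum f A \<le> nsum g A"
  by (intro nn_integral_mono) auto

lemma nsum_subset: "A \<subseteq> B \<Longrightarrow> nsum f A \<le> nsum f B"
  unfolding nsum_indicator[where A=A] nsum_indicator[where A=B]
  by (intro nn_integral_mono) (auto simp: indicator_def)

lemma nsum_add: "nsum (\<lambda>x. f x + g x) A = nsum f A + nsum g A"
  by (intro nn_integral_add) auto

lemma nsum_cmult: "nsum (\<lambda>x. c * f x) A = c * nsum f A"
  by (intro nn_integral_cmult) auto

lemma nsum_multc: "nsum (\<lambda>x. f x * c) A = nsum f A * c"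
  by (intro nn_integral_multc) auto

lemma nsum_pair: "nsum f (A \<times> B) = nsum (\<lambda>x. nsum (\<lambda>y. f (x, y)) B) A"
proof -
  have "nsum f (A \<times> B) = nsum (\<lambda>z. f z * indicator (A \<times> B) z) UNIV" by (rule nsum_indicator)
  also have "\<dots> = nsum (\<lambda>x. nsum (\<lambda>y. f (x, y) * indicator (A \<times> B) (x, y)) UNIV) UNIV"
    by (rule nn_integral_fst_count_space[symmetric])
  also have "\<dots> = nsum (\<lambda>x. nsum (\<lambda>y. f (x, y) * indicator B y) UNIV * indicator A x) UNIV"
    by (intro nn_integral_cong) (auto simp: indicator_def)
  also have "\<dots> = nsum (\<lambda>x. nsum (\<lambda>y. f (x, y)) B) A"
    by (simp add: nsum_indicator[symmetric])
  finally show ?thesis .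
qed

lemma nsum_pair_swap: "nsum f (A \<times> B) = nsum (\<lambda>y. nsum (\<lambda>x. f (x, y)) A) B"
proof -
  have "nsum f (A \<times> B) = nsum (\<lambda>z. f (snd z, fst z)) (B \<times> A)"
    by (rule nn_integral_bij_count_space[symmetric, of "\<lambda>z. (snd z, fst z)" "B \<times> A" "A \<times> B" f])
       (auto simp: bij_betw_def inj_on_def image_iff)
  then show ?thesis by (simp add: nsum_pair)
qed

lemma nsum_Un: "nsum f (A \<union> B) \<le> nsum f A + nsum f B"
proof -
  have "nsum f (A \<union> B) = nsum (\<lambda>x. f x * indicator (A \<union> B) x) UNIV" by (rule nsum_indicator)
  also have "\<dots> \<le> nsum (\<lambda>x. f x * indicator A x + f x * indicator B x) UNIV"
    by (intro nn_integral_mono) (auto simp: indicator_def)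
  also have "\<dots> = nsum f A + nsum f B"
    by (simp add: nsum_add nsum_indicator[symmetric])
  finally show ?thesis .
qed

lemma nsum_bij: "bij_betw g A B \<Longrightarrow> nsum f B = nsum (\<lambda>x. f (g x)) A"
  by (simp add: nn_integral_bij_count_space)

lemma nsum_mult_le:
  assumes "\<And>x. x \<in> A \<Longrightarrow> nsum (g x) B \<le> M" "nsum f A \<le> N"
  shows "nsum (\<lambda>x. nsum (\<lambda>y. f x * g x y) B) A \<le> M * N"
proof -
  have "nsum (\<lambda>x. nsum (\<lambda>y. f x * g x y) B) A \<le> nsum (\<lambda>x. f x * M) A"
    by (intro nsum_mono) (auto simp: nsum_cmult intro!: mult_left_mono assms)
  also have "\<dots> = M * nsum f A" unfolding nsum_multc by (rule mult.commute)
  also have "\<dots> \<le> M * N" using assms by (intro mult_left_mono) auto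
  finally show ?thesis .
qed

abbreviation ewt :: "real \<Rightarrow> real^2 \<Rightarrow> ennreal" where
  "ewt \<sigma> x \<equiv> ennreal (wt \<sigma> x)"

definition lsum_const :: "real \<Rightarrow> real" where
  "lsum_const \<sigma> = 3 powr (\<sigma>/4) * line_mass \<sigma> + 1"

lemma lsum_const_ge_1: "lsum_const \<sigma> \<ge> 1"
  by (simp add: lsum_const_def line_mass_nonneg)

lemma line_wt_sum':
  assumes "\<sigma> > 2" "h > 0"
  shows "nsum (\<lambda>j. ennreal (line_wt \<sigma> (s + of_int j * h))) (UNIV::int set)
    \<le> ennreal (lsum_const \<sigma> * (1 + 1 / h))"
proof -
  have "3 powr (\<sigma>/4) * line_mass \<sigma> * (1 + 1 / h) \<le> lsum_const \<sigma> * (1 + 1 / h)"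
    unfolding lsum_const_def using assms by (intro mult_right_mono) auto
  then show ?thesis using line_wt_sum[OF assms, of s] ennreal_leI order_trans by blast
qed

lemma wt_line_sum:
  assumes "\<sigma> > 2" "x \<noteq> (0::real^2)"
  shows "nsum (\<lambda>j. ewt \<sigma> (c + of_int j *\<^sub>R x)) (UNIV::int set) \<le> ennreal (lsum_const \<sigma> * (1 + 1 / norm x))"
proof -
  have "nsum (\<lambda>j. ewt \<sigma> (c + of_int j *\<^sub>R x)) (UNIV::int set)
      \<le> nsum (\<lambda>j. ennreal (line_wt \<sigma> ((c \<bullet> x) / norm x + of_int j * norm x))) UNIV"
    using assms by (intro nsum_mono ennreal_leI wt_line) auto
  also have "\<dots> \<le> ennreal (lsum_const \<sigma> * (1 + 1 / norm x))"
    using assms by (intro line_wt_sum') auto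
  finally show ?thesis .
qed

lemma wt_line_integral:
  assumes "\<sigma> > 2" "x \<noteq> (0::real^2)"
  shows "(\<integral>\<^sup>+ u. ewt \<sigma> (c + u *\<^sub>R x) \<partial>lborel) \<le> ennreal (lsum_const \<sigma> / norm x * 1)"
proof -
  have m: "line_mass \<sigma> \<le> lsum_const \<sigma>"
    unfolding lsum_const_def using assms mult_right_mono[of 1 "3 powr (\<sigma>/4)" "line_mass \<sigma>"]
    by (simp add: line_mass_nonneg ge_one_powr_ge_zero)
  have "(\<integral>\<^sup>+ u. ewt \<sigma> (c + u *\<^sub>R x) \<partial>lborel)
      \<le> (\<integral>\<^sup>+ u. ennreal (line_wt \<sigma> ((c \<bullet> x) / norm x + u * norm x)) \<partial>lborel)"
    using assms by (intro nn_integral_mono ennreal_leI wt_line) auto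
  also have "\<dots> = ennreal (line_mass \<sigma> / norm x)"
    using assms by (intro line_wt_affine_integral) auto
  also have "\<dots> \<le> ennreal (lsum_const \<sigma> / norm x * 1)"
    using m assms by (intro ennreal_leI) (simp add: divide_right_mono)
  finally show ?thesis .
qed

lemma wt_lattice_sum:
  assumes "\<sigma> > 2" "L \<ge> 1"
  shows "nsum (\<lambda>n. ewt \<sigma> (c + (1/L) *\<^sub>R ivec n)) UNIV \<le> ennreal (4 * (lsum_const \<sigma>)\<^sup>2 * L\<^sup>2)"
proof -
  have one: "nsum (\<lambda>j. ennreal (line_wt \<sigma> (s + of_int j * (1/L)))) (UNIV::int set) \<le> ennreal (lsum_const \<sigma> * (2 * L))" for s
  proof -
    have "nsum (\<lambda>j. ennreal (line_wt \<sigma> (s + of_int j * (1/L)))) (UNIV::int set) \<le> ennreal (lsum_const \<sigma> * (1 + 1 / (1/L)))"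
      using assms by (intro line_wt_sum') auto
    also have "\<dots> \<le> ennreal (lsum_const \<sigma> * (2 * L))"
      using assms lsum_const_ge_1[of \<sigma>] by (intro ennreal_leI mult_left_mono) auto
    finally show ?thesis .
  qed
  have "nsum (\<lambda>n. ewt \<sigma> (c + (1/L) *\<^sub>R ivec n)) (UNIV \<times> UNIV)
    \<le> nsum (\<lambda>n. ennreal (line_wt \<sigma> (c$1 + of_int (fst n) * (1/L))) * ennreal (line_wt \<sigma> (c$2 + of_int (snd n) * (1/L)))) (UNIV \<times> UNIV)"
  proof (intro nsum_mono)
    fix n :: "int \<times> int"
    have "wt \<sigma> (c + (1/L) *\<^sub>R ivec n) \<le> line_wt \<sigma> (c$1 + of_int (fst n) * (1/L)) * line_wt \<sigma> (c$2 + of_int (snd n) * (1/L))"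
      using wt_le_prod_line_wt[of \<sigma> "c + (1/L) *\<^sub>R ivec n"] assms by (simp add: mult.commute)
    then show "ewt \<sigma> (c + (1/L) *\<^sub>R ivec n) \<le> ennreal (line_wt \<sigma> (c$1 + of_int (fst n) * (1/L))) * ennreal (line_wt \<sigma> (c$2 + of_int (snd n) * (1/L)))"
      by (simp add: ennreal_mult'[symmetric] line_wt_nonneg ennreal_leI)
  qed
  also have "\<dots> = nsum (\<lambda>x. nsum (\<lambda>y. ennreal (line_wt \<sigma> (c$1 + of_int x * (1/L))) * ennreal (line_wt \<sigma> (c$2 + of_int y * (1/L)))) UNIV) UNIV"
    by (simp only: nsum_pair fst_conv snd_conv)
  also have "\<dots> \<le> ennreal (lsum_const \<sigma> * (2 * L)) * ennreal (lsum_const \<sigma> * (2 * L))"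
    by (intro nsum_mult_le one)
  also have "\<dots> = ennreal (4 * (lsum_const \<sigma>)\<^sup>2 * L\<^sup>2)"
    using assms lsum_const_ge_1[of \<sigma>] by (simp add: ennreal_mult'[symmetric] power2_eq_square algebra_simps)
  finally show ?thesis by simp
qed

definition rect_wt :: "real \<Rightarrow> real^2 \<Rightarrow> real^2 \<Rightarrow> real^2 \<Rightarrow> real" where
  "rect_wt \<sigma> K y z = wt \<sigma> (K + y) * wt \<sigma> (K + y + z) * wt \<sigma> (K + z)"

lemma rect_wt_nonneg: "rect_wt \<sigma> K y z \<ge> 0"
  by (simp add: rect_wt_def wt_nonneg)

text \<open>Of the three pairs of weights left by \<open>wt_triple\<close>, each is written so that one of the two sides of
  the parallelogram occurs in one of its factors only and can be summed first.\<close>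
lemma rect_wt_le:
  assumes "\<sigma> \<ge> 0"
  shows "ennreal (rect_wt \<sigma> K y z) \<le> ennreal (3 powr \<sigma> * wt \<sigma> K) *
     (ewt \<sigma> (K + z) * ewt \<sigma> (K + z + y) + ewt \<sigma> (K + z) * ewt \<sigma> (K + y) + ewt \<sigma> (K + y) * ewt \<sigma> (K + y + z))"
proof -
  have "rect_wt \<sigma> K y z \<le> 3 powr \<sigma> * wt \<sigma> K * (wt \<sigma> (K + y + z) * wt \<sigma> (K + z) + wt \<sigma> (K + y) * wt \<sigma> (K + z) + wt \<sigma> (K + y) * wt \<sigma> (K + y + z))"
    unfolding rect_wt_def by (rule wt_triple) (use assms in auto)
  also have "\<dots> = 3 powr \<sigma> * wt \<sigma> K * (wt \<sigma> (K + z) * wt \<sigma> (K + z + y) + wt \<sigma> (K + z) * wt \<sigma> (K + y) + wt \<sigma> (K + y) * wt \<sigma> (K + y + z))"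
    by (simp add: ac_simps)
  finally show ?thesis
    by (simp add: ennreal_mult'[symmetric] ennreal_plus[symmetric] wt_nonneg ennreal_leI del: ennreal_plus)
qed

text \<open>In each of the three terms of \<open>rect_wt_le\<close> one of the sums is bounded uniformly in the other variable, after
  which a single weight is left to be summed.\<close>
lemma rect_sum_le:
  fixes Y :: "'a \<Rightarrow> real^2" and Z :: "'b \<Rightarrow> real^2"
  assumes "\<sigma> \<ge> 0"
    and Y: "\<And>c. nsum (\<lambda>x. ewt \<sigma> (c + Y x)) A \<le> M"
    and Z: "\<And>c. nsum (\<lambda>x. ewt \<sigma> (c + Z x)) B \<le> N"
  shows "nsum (\<lambda>x. nsum (\<lambda>y. ennreal (rect_wt \<sigma> K (Y x) (Z y))) B) A \<le> ennreal (3 * 3 powr \<sigma> * wt \<sigma> K) * (M * N)"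
proof -
  let ?c = "ennreal (3 powr \<sigma> * wt \<sigma> K)"
  have "nsum (\<lambda>x. nsum (\<lambda>y. ennreal (rect_wt \<sigma> K (Y x) (Z y))) B) A
    \<le> nsum (\<lambda>x. nsum (\<lambda>y. ?c * (ewt \<sigma> (K + Z y) * ewt \<sigma> (K + Z y + Y x) + ewt \<sigma> (K + Z y) * ewt \<sigma> (K + Y x) + ewt \<sigma> (K + Y x) * ewt \<sigma> (K + Y x + Z y))) B) A"
    by (intro nsum_mono rect_wt_le assms)
  also have "\<dots> = ?c * (nsum (\<lambda>x. nsum (\<lambda>y. ewt \<sigma> (K + Z y) * ewt \<sigma> (K + Z y + Y x)) B) A
      + nsum (\<lambda>x. nsum (\<lambda>y. ewt \<sigma> (K + Z y) * ewt \<sigma> (K + Y x)) B) A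
      + nsum (\<lambda>x. nsum (\<lambda>y. ewt \<sigma> (K + Y x) * ewt \<sigma> (K + Y x + Z y)) B) A)"
    by (simp add: nsum_cmult nsum_add)
  also have "nsum (\<lambda>x. nsum (\<lambda>y. ewt \<sigma> (K + Z y) * ewt \<sigma> (K + Z y + Y x)) B) A = nsum (\<lambda>y. nsum (\<lambda>x. ewt \<sigma> (K + Z y) * ewt \<sigma> (K + Z y + Y x)) A) B"
    using nsum_pair[where f="\<lambda>(x,y). ewt \<sigma> (K + Z y) * ewt \<sigma> (K + Z y + Y x)" and A=A and B=B] nsum_pair_swap[where f="\<lambda>(x,y). ewt \<sigma> (K + Z y) * ewt \<sigma> (K + Z y + Y x)" and A=A and B=B] by simp
  also have "nsum (\<lambda>x. nsum (\<lambda>y. ewt \<sigma> (K + Z y) * ewt \<sigma> (K + Y x)) B) A = nsum (\<lambda>y. nsum (\<lambda>x. ewt \<sigma> (K + Z y) * ewt \<sigma> (K + Y x)) A) B"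
    using nsum_pair[where f="\<lambda>(x,y). ewt \<sigma> (K + Z y) * ewt \<sigma> (K + Y x)" and A=A and B=B] nsum_pair_swap[where f="\<lambda>(x,y). ewt \<sigma> (K + Z y) * ewt \<sigma> (K + Y x)" and A=A and B=B] by simp
  also have "?c * (nsum (\<lambda>y. nsum (\<lambda>x. ewt \<sigma> (K + Z y) * ewt \<sigma> (K + Z y + Y x)) A) B
      + nsum (\<lambda>y. nsum (\<lambda>x. ewt \<sigma> (K + Z y) * ewt \<sigma> (K + Y x)) A) B
      + nsum (\<lambda>x. nsum (\<lambda>y. ewt \<sigma> (K + Y x) * ewt \<sigma> (K + Y x + Z y)) B) A)
      \<le> ?c * (M * N + M * N + N * M)"
    by (intro mult_left_mono add_mono nsum_mult_le Y Z) auto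
  also have "\<dots> = ennreal (3 * 3 powr \<sigma> * wt \<sigma> K) * (M * N)"
  proof -
    have "ennreal (3 * 3 powr \<sigma> * wt \<sigma> K) = 3 * ?c"
      by (simp add: ennreal_mult'[symmetric] ennreal_numeral[symmetric] mult.assoc del: ennreal_numeral)
    moreover have "M * N + M * N + N * M = 3 * (M * N)"
    proof -
      have "(3::ennreal) = 1 + 1 + 1" by simp
      then show ?thesis by (simp only: distrib_right mult_1 mult.commute[of N M])
    qed
    ultimately show ?thesis by (simp add: ac_simps)
  qed
  finally show ?thesis .
qed

lemma full_sum:
  assumes "\<sigma> > 2" "L \<ge> 1"
  shows "nsum (\<lambda>(p, q). ennreal (rect_wt \<sigma> K ((1/L) *\<^sub>R ivec p) ((1/L) *\<^sub>R ivec q))) UNIV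
    \<le> ennreal (48 * 3 powr \<sigma> * lsum_const \<sigma> ^ 4 * L ^ 4 * wt \<sigma> K)"
proof -
  let ?S = "ennreal (4 * (lsum_const \<sigma>)\<^sup>2 * L\<^sup>2)"
  have "nsum (\<lambda>(p, q). ennreal (rect_wt \<sigma> K ((1/L) *\<^sub>R ivec p) ((1/L) *\<^sub>R ivec q))) (UNIV \<times> UNIV)
     = nsum (\<lambda>p. nsum (\<lambda>q. ennreal (rect_wt \<sigma> K ((1/L) *\<^sub>R ivec p) ((1/L) *\<^sub>R ivec q))) UNIV) UNIV"
    by (simp only: nsum_pair case_prod_conv)
  also have "\<dots> \<le> ennreal (3 * 3 powr \<sigma> * wt \<sigma> K) * (?S * ?S)"
    using assms by (intro rect_sum_le wt_lattice_sum) auto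
  also have "\<dots> = ennreal (48 * 3 powr \<sigma> * lsum_const \<sigma> ^ 4 * L ^ 4 * wt \<sigma> K)"
    using assms by (simp add: ennreal_mult'[symmetric] wt_nonneg power2_eq_square power4_eq_xxxx ac_simps)
  finally show ?thesis by simp
qed

text \<open>Counting in squares instead of discs: the sets \<open>supn n = k\<close> have exactly \<open>8 k\<close> elements, and the
  unit cells around the lattice points of a square tile a square.\<close>
definition supn :: "int \<times> int \<Rightarrow> nat" where
  "supn n = max (nat \<bar>fst n\<bar>) (nat \<bar>snd n\<bar>)"

lemma supn_0_iff: "supn n = 0 \<longleftrightarrow> n = 0"
  by (auto simp: supn_def prod_eq_iff max_def)

lemma box_eq: "{n. supn n \<le> N} = {- int N..int N} \<times> {- int N..int N}"
  by (auto simp: supn_def)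

lemma card_box: "card {n. supn n \<le> N} = (2 * N + 1) * (2 * N + 1)"
proof -
  have "card {- int N..int N} = 2 * N + 1" by (auto simp: nat_mult_distrib)
  then show ?thesis unfolding box_eq card_cartesian_product by simp
qed

lemma finite_box: "finite {n. supn n \<le> N}"
  unfolding box_eq by simp

lemma supn_le_norm: "real (supn n) \<le> norm (ivec n)"
  using component_le_norm_cart[of "ivec n" 1] component_le_norm_cart[of "ivec n" 2]
  by (auto simp: supn_def max_def)

lemma norm_le_supn: "norm (ivec n) \<le> 2 * real (supn n)"
proof -
  have "norm (ivec n) \<le> \<bar>ivec n $ 1\<bar> + \<bar>ivec n $ 2\<bar>"
    using norm_le_l1_cart[of "ivec n"] by (simp add: UNIV_2)
  then show ?thesis by (auto simp: supn_def max_def)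
qed

lemma sum_box:
  fixes f :: "nat \<Rightarrow> real"
  shows "(\<Sum>n | supn n \<le> N \<and> n \<noteq> 0. f (supn n)) = (\<Sum>k=1..N. 8 * real k * f k)"
proof (induction N)
  case 0
  have e: "{n. supn n \<le> 0 \<and> n \<noteq> 0} = {}" using supn_0_iff by auto
  show ?case unfolding e by simp
next
  case (Suc N)
  have fin: "finite {n. supn n \<le> N \<and> n \<noteq> 0}" "finite {n. supn n = Suc N}"
    by (auto intro: finite_subset[OF _ finite_box[of N]] finite_subset[OF _ finite_box[of "Suc N"]])
  have split: "{n. supn n \<le> Suc N \<and> n \<noteq> 0} = {n. supn n \<le> N \<and> n \<noteq> 0} \<union> {n. supn n = Suc N}"
  proof -
    have "n \<noteq> 0" if "supn n = Suc N" for n using that supn_0_iff[of n] by auto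
    then show ?thesis by (auto simp: le_Suc_eq)
  qed
  have "{n. supn n = Suc N} = {n. supn n \<le> Suc N} - {n. supn n \<le> N}" by auto
  moreover have "card ({n. supn n \<le> Suc N} - {n. supn n \<le> N}) = card {n. supn n \<le> Suc N} - card {n. supn n \<le> N}"
    by (intro card_Diff_subset finite_box) auto
  ultimately have "card {n. supn n = Suc N} = (2 * Suc N + 1) * (2 * Suc N + 1) - (2 * N + 1) * (2 * N + 1)"
    unfolding card_box by simp
  also have "(2 * Suc N + 1) * (2 * Suc N + 1) = (2 * N + 1) * (2 * N + 1) + 8 * Suc N"
    by (simp add: algebra_simps)
  finally have card: "card {n. supn n = Suc N} = 8 * Suc N" by simp
  have "(\<Sum>n | supn n \<le> Suc N \<and> n \<noteq> 0. f (supn n)) = (\<Sum>n | supn n \<le> N \<and> n \<noteq> 0. f (supn n)) + (\<Sum>n | supn n = Suc N. f (supn n))"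
    unfolding split by (intro sum.union_disjoint fin) auto
  also have "(\<Sum>n | supn n = Suc N. f (supn n)) = (\<Sum>n | supn n = Suc N. f (Suc N))"
    by (intro sum.cong) auto
  also have "\<dots> = 8 * real (Suc N) * f (Suc N)" by (simp add: card)
  finally show ?case using Suc by simp
qed

lemma harm_le: "N \<ge> 1 \<Longrightarrow> (harm N :: real) \<le> 1 + ln (real N)"
proof (induction N rule: nat_induct_at_least)
  case base then show ?case by (simp add: harm_def)
next
  case (Suc n)
  have "ln (real n) - ln (real (Suc n)) \<le> (real n - real (Suc n)) / real (Suc n)"
    using Suc by (intro ln_diff_le) auto
  then have "ln (real n) + inverse (real (Suc n)) \<le> ln (real (Suc n))" by (simp add: field_simps)
  then show ?case using Suc by (simp add: harm_Suc)
qed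

section \<open>Orthogonality in the lattice and non-resonant sums\<close>

definition idot :: "int \<times> int \<Rightarrow> int \<times> int \<Rightarrow> int" where
  "idot p q = fst p * fst q + snd p * snd q"

definition iperp :: "int \<times> int \<Rightarrow> int \<times> int" where
  "iperp p = (- snd p, fst p)"

definition iscale :: "int \<Rightarrow> int \<times> int \<Rightarrow> int \<times> int" where
  "iscale a p = (a * fst p, a * snd p)"

definition primitive :: "(int \<times> int) set" where
  "primitive = {w. coprime (fst w) (snd w)}"

lemma idot_commute: "idot p q = idot q p"
  by (simp add: idot_def mult.commute)

lemma ivec_0 [simp]: "ivec 0 = 0"
  by simp

lemma ivec_iscale: "ivec (iscale a p) = of_int a *\<^sub>R ivec p"
  by (simp add: vec_eq_iff forall_2 iscale_def)

lemma ivec_iperp: "ivec (iperp p) = perp (ivec p)"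
  by (simp add: vec_eq_iff forall_2 iperp_def)

lemma inner_ivec: "ivec p \<bullet> ivec q = of_int (idot p q)"
  by (simp add: inner_real2 idot_def)

lemma primitive_nonzero: "w \<in> primitive \<Longrightarrow> w \<noteq> 0"
  by (auto simp: primitive_def)

lemma norm_ivec_ge_1: "n \<noteq> 0 \<Longrightarrow> norm (ivec n) \<ge> 1"
  using supn_le_norm[of n] supn_0_iff[of n] by linarith

lemma bij_primitive:
  "bij_betw (\<lambda>(w, a). iscale a w) (primitive \<times> {1..}) {p. p \<noteq> 0}"
proof (rule bij_betwI')
  fix x y assume x: "x \<in> primitive \<times> {1::int..}" and y: "y \<in> primitive \<times> {1::int..}"
  obtain w a where xe: "x = (w, a)" by (cases x)
  obtain v b where ye: "y = (v, b)" by (cases y)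
  have g: "gcd (fst (iscale a w)) (snd (iscale a w)) = a" if "w \<in> primitive" "a \<ge> 1" for a w
    using that by (simp add: iscale_def gcd_mult_left primitive_def coprime_iff_gcd_eq_1)
  show "((case x of (w, a) \<Rightarrow> iscale a w) = (case y of (w, a) \<Rightarrow> iscale a w)) = (x = y)"
  proof
    assume e: "(case x of (w, a) \<Rightarrow> iscale a w) = (case y of (w, a) \<Rightarrow> iscale a w)"
    then have "a = b" using g[of w a] g[of v b] x y xe ye by auto
    then show "x = y" using e x y xe ye by (auto simp: iscale_def prod_eq_iff)
  qed auto
next
  fix x assume "x \<in> primitive \<times> {1::int..}"
  then show "(case x of (w, a) \<Rightarrow> iscale a w) \<in> {p. p \<noteq> 0}"
    by (auto simp: primitive_def iscale_def prod_eq_iff)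
next
  fix p :: "int \<times> int" assume "p \<in> {p. p \<noteq> 0}"
  then have p: "fst p \<noteq> 0 \<or> snd p \<noteq> 0" by (auto simp: prod_eq_iff)
  define d where "d = gcd (fst p) (snd p)"
  have d: "d \<ge> 1" using p unfolding d_def
    by (metis gcd_eq_0_iff gcd_ge_0_int int_one_le_iff_zero_less order_le_less)
  have "coprime (fst p div d) (snd p div d)" unfolding d_def using p by (intro div_gcd_coprime) auto
  moreover have "iscale d (fst p div d, snd p div d) = p" by (simp add: iscale_def d_def)
  ultimately show "\<exists>x\<in>primitive \<times> {1::int..}. p = (case x of (w, a) \<Rightarrow> iscale a w)"
    using d by (intro bexI[of _ "((fst p div d, snd p div d), d)"]) (auto simp: primitive_def)
qed

lemma bij_iperp: "bij_betw iperp {p. p \<noteq> 0} {p. p \<noteq> 0}"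
  by (rule bij_betw_byWitness[where f'="\<lambda>p. (snd p, - fst p)"])
     (auto simp: iperp_def prod_eq_iff)

text \<open>A Bezout vector \<open>v\<close> with \<open>v \<cdot> w = 1\<close> and the vector \<open>w\<close> turned by a right angle form a basis of the
  lattice, in which the first coordinate is the inner product with \<open>w\<close>.\<close>
lemma bezout_fibration:
  assumes "w \<in> primitive"
  shows "\<exists>v. bij (\<lambda>(k, j). iscale k v + iscale j (iperp w))
    \<and> (\<forall>k j. idot (iscale k v + iscale j (iperp w)) w = k)"
proof -
  obtain x y where w: "w = (x, y)" by (cases w)
  obtain u v where uv: "u * x + v * y = 1"
    using assms bezout_int[of x y] by (auto simp: w primitive_def coprime_iff_gcd_eq_1)
  have b: "bij (\<lambda>(k, j). iscale k (u, v) + iscale j (iperp w))"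
  proof (rule bij_betw_byWitness[where f'="\<lambda>p. (x * fst p + y * snd p, u * snd p - v * fst p)"])
    show "\<forall>a\<in>UNIV. (\<lambda>p. (x * fst p + y * snd p, u * snd p - v * fst p)) ((\<lambda>(k, j). iscale k (u, v) + iscale j (iperp w)) a) = a"
    proof
      fix a :: "int \<times> int"
      obtain k j where a: "a = (k, j)" by (cases a)
      have "x * (k * u - j * y) + y * (k * v + j * x) = k * (u * x + v * y)" by algebra
      moreover have "u * (k * v + j * x) - v * (k * u - j * y) = j * (u * x + v * y)" by algebra
      ultimately show "(\<lambda>p. (x * fst p + y * snd p, u * snd p - v * fst p)) ((\<lambda>(k, j). iscale k (u, v) + iscale j (iperp w)) a) = a"
        by (simp add: a w iscale_def iperp_def uv)
    qed
    show "\<forall>p\<in>UNIV. (\<lambda>(k, j). iscale k (u, v) + iscale j (iperp w)) (x * fst p + y * snd p, u * snd p - v * fst p) = p"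
    proof
      fix p :: "int \<times> int"
      obtain k j where p: "p = (k, j)" by (cases p)
      have "(x * k + y * j) * u - (u * j - v * k) * y = k * (u * x + v * y)" by algebra
      moreover have "(x * k + y * j) * v + (u * j - v * k) * x = j * (u * x + v * y)" by algebra
      ultimately show "(\<lambda>(k, j). iscale k (u, v) + iscale j (iperp w)) (x * fst p + y * snd p, u * snd p - v * fst p) = p"
        by (simp add: p w iscale_def iperp_def uv)
    qed
  qed auto
  have "idot (iscale k (u, v) + iscale j (iperp w)) w = k" for k j
  proof -
    have "(k * u - j * y) * x + (k * v + j * x) * y = k * (u * x + v * y)" by algebra
    then show ?thesis by (simp add: idot_def iscale_def iperp_def w uv)
  qed
  with b show ?thesis by (intro exI[of _ "(u, v)"]) simp
qed

lemma orthogonal_to_primitive: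
  assumes "w \<in> primitive" "idot q w = 0"
  shows "\<exists>b. q = iscale b (iperp w)"
proof -
  obtain v where vv: "bij (\<lambda>(k, j). iscale k v + iscale j (iperp w)) \<and> (\<forall>k j. idot (iscale k v + iscale j (iperp w)) w = k)"
    using bezout_fibration[OF assms(1)] ..
  have v: "bij (\<lambda>(k, j). iscale k v + iscale j (iperp w))" using vv by (rule conjunct1)
  have d: "\<forall>k j. idot (iscale k v + iscale j (iperp w)) w = k" using vv by (rule conjunct2)
  obtain k j where q: "q = iscale k v + iscale j (iperp w)"
    using bij_is_surj[OF v] by (metis (mono_tags, lifting) case_prod_conv surj_def surj_pair)
  have "k = 0" using d[rule_format, of k j] q assms by simp
  then show ?thesis using q by (auto simp: iscale_def zero_prod_def[symmetric])
qed

text \<open>The rectangles are sorted by the primitive direction of their first side; the second side lies on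
  the orthogonal lattice line. The degenerate ones with \<open>p = 0\<close> have no direction.\<close>
lemma bij_orthogonal:
  "bij_betw (\<lambda>(w, a, b). (iscale a w, iscale b (iperp w))) (primitive \<times> {1..} \<times> UNIV)
     {(p, q). p \<noteq> 0 \<and> idot p q = 0}"
proof -
  let ?f = "\<lambda>(w, a, b). (iscale a w, iscale b (iperp w))"
  have inj: "inj_on ?f (primitive \<times> {1..} \<times> UNIV)"
  proof (rule inj_onI)
    fix x y assume x: "x \<in> primitive \<times> {1::int..} \<times> (UNIV::int set)" and y: "y \<in> primitive \<times> {1::int..} \<times> (UNIV::int set)"
      and e: "?f x = ?f y"
    obtain w a b where xe: "x = (w, a, b)" by (cases x)
    obtain v c d where ye: "y = (v, c, d)" by (cases y)
    have "(w, a) = (v, c)"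
      using bij_betw_imp_inj_on[OF bij_primitive] x y e unfolding xe ye
      by (auto simp: inj_on_def)
    then have wv: "w = v" "a = c" by auto
    have "b = d"
    proof -
      have "fst w \<noteq> 0 \<or> snd w \<noteq> 0" using x xe by (auto simp: primitive_def)
      then show ?thesis using e unfolding xe ye wv by (auto simp: iscale_def iperp_def)
    qed
    then show "x = y" using wv xe ye by simp
  qed
  have img: "?f ` (primitive \<times> {1..} \<times> UNIV) = {(p, q). p \<noteq> 0 \<and> idot p q = 0}"
  proof (intro equalityI subsetI)
    fix z assume "z \<in> ?f ` (primitive \<times> {1..} \<times> UNIV)"
    then obtain w a b where "w \<in> primitive" "a \<ge> 1" and z: "z = (iscale a w, iscale b (iperp w))" by auto
    moreover from this have "iscale a w \<noteq> 0"
      using bij_betw_apply[OF bij_primitive, of "(w, a)"] by auto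
    ultimately show "z \<in> {(p, q). p \<noteq> 0 \<and> idot p q = 0}"
      by (auto simp: idot_def iscale_def iperp_def)
  next
    fix z :: "(int \<times> int) \<times> (int \<times> int)" assume z: "z \<in> {(p, q). p \<noteq> 0 \<and> idot p q = 0}"
    obtain p q where ze: "z = (p, q)" by (cases z)
    have "p \<in> (\<lambda>(w, a). iscale a w) ` (primitive \<times> {1..})"
      using z ze bij_betw_imp_surj_on[OF bij_primitive] by auto
    then obtain w a where w: "w \<in> primitive" "a \<ge> 1" "p = iscale a w" by auto
    have "a * idot q w = 0" using z ze w by (simp add: idot_def iscale_def algebra_simps)
    then have "idot q w = 0" using w by simp
    then obtain b where "q = iscale b (iperp w)" using orthogonal_to_primitive w by blast
    then show "z \<in> ?f ` (primitive \<times> {1..} \<times> UNIV)"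
      using w ze by (intro image_eqI[of _ _ "(w, a, b)"]) auto
  qed
  show ?thesis using inj img by (simp add: bij_betw_def)
qed

text \<open>Write \<open>q = d w\<close> with \<open>w\<close> primitive. On the line \<open>p \<cdot> w = k\<close> the weights add up to at most
  \<open>1 + L / |w|\<close>, and \<open>1 / |p \<cdot> q| \<le> 1 / |k|\<close>. The lines with \<open>|k| \<le> L\<^sup>2\<close> give a harmonic sum, hence the
  logarithm; on the others \<open>1 / |k| < 1 / L\<^sup>2\<close> compensates for the \<open>L\<^sup>2\<close> lattice points per unit area.
  The term \<open>p \<cdot> q = 0\<close> vanishes because \<open>1 / 0 = 0\<close>.\<close>
lemma nonres_inner_sum:
  assumes "\<sigma> > 2" "L \<ge> exp 1" "q \<noteq> 0"
  shows "nsum (\<lambda>p. ewt \<sigma> (c + (1/L) *\<^sub>R ivec p) * ennreal (1 / \<bar>of_int (idot p q)\<bar>)) UNIV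
     \<le> ennreal (20 * (lsum_const \<sigma>)\<^sup>2 * ln L * (1 + L / norm (ivec q)))"
proof -
  have L: "L \<ge> 1" "L > 0" using assms exp_ge_add_one_self[of 1] by linarith+
  have lnL: "ln L \<ge> 1" using assms by (metis L(2) ln_ge_iff)
  define S where "S = lsum_const \<sigma>"
  have S: "S \<ge> 1" unfolding S_def by (rule lsum_const_ge_1)
  have "q \<in> (\<lambda>(w, a). iscale a w) ` (primitive \<times> {1..})"
    using assms bij_betw_imp_surj_on[OF bij_primitive] by auto
  then obtain w d where w: "w \<in> primitive" and d: "d \<ge> 1" and q: "q = iscale d w" by auto
  obtain v where vv: "bij (\<lambda>(k, j). iscale k v + iscale j (iperp w)) \<and> (\<forall>k j. idot (iscale k v + iscale j (iperp w)) w = k)"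
    using bezout_fibration[OF w] ..
  have v: "bij (\<lambda>(k, j). iscale k v + iscale j (iperp w))" using vv by (rule conjunct1)
  have dk: "\<forall>k j. idot (iscale k v + iscale j (iperp w)) w = k" using vv by (rule conjunct2)
  define W where "W = norm (ivec w)"
  have W: "W \<ge> 1" unfolding W_def using primitive_nonzero[OF w] by (rule norm_ivec_ge_1)
  have nq: "norm (ivec q) = of_int d * W" using d by (simp add: q ivec_iscale W_def)
  define pt where "pt = (\<lambda>k j. c + (1/L) *\<^sub>R ivec (iscale k v + iscale j (iperp w)))"
  define T where "T = (\<lambda>k. nsum (\<lambda>j. ewt \<sigma> (pt k j)) UNIV)"
  define M where "M = S * (1 + L / W)"
  have M: "M \<ge> 0" using S L W by (simp add: M_def)
  have T_le: "T k \<le> ennreal M" for k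
  proof -
    have "pt k j = (c + (1/L) *\<^sub>R ivec (iscale k v)) + of_int j *\<^sub>R ((1/L) *\<^sub>R ivec (iperp w))" for j
      by (simp add: pt_def ivec_add ivec_iscale scaleR_add_right)
    moreover have "(1/L) *\<^sub>R ivec (iperp w) \<noteq> 0"
    proof -
      have "norm (ivec (iperp w)) \<ge> 1" using W by (simp add: ivec_iperp W_def)
      then have "ivec (iperp w) \<noteq> 0" by auto
      then show ?thesis using L by (simp del: ivec_eq_0)
    qed
    moreover have "norm ((1/L) *\<^sub>R ivec (iperp w)) = W / L"
      using L by (simp add: ivec_iperp W_def)
    ultimately show ?thesis
      using wt_line_sum[OF assms(1), of "(1/L) *\<^sub>R ivec (iperp w)" "c + (1/L) *\<^sub>R ivec (iscale k v)"]
      by (simp add: T_def M_def S_def)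
  qed
  have T_sum: "nsum T UNIV \<le> ennreal (4 * S\<^sup>2 * L\<^sup>2)"
  proof -
    have "nsum T UNIV = nsum (\<lambda>(k, j). ewt \<sigma> (pt k j)) (UNIV \<times> UNIV)"
      by (simp only: nsum_pair T_def case_prod_conv)
    also have "\<dots> = nsum (\<lambda>n. ewt \<sigma> (c + (1/L) *\<^sub>R ivec n)) UNIV"
      using nsum_bij[OF v, of "\<lambda>n. ewt \<sigma> (c + (1/L) *\<^sub>R ivec n)"] by (simp add: pt_def case_prod_beta')
    also have "\<dots> \<le> ennreal (4 * S\<^sup>2 * L\<^sup>2)" unfolding S_def by (rule wt_lattice_sum[OF assms(1) L(1)])
    finally show ?thesis .
  qed
  define N where "N = nat \<lceil>L\<^sup>2\<rceil>"
  have L2: "L\<^sup>2 \<ge> 1" using L by (simp add: one_le_power)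
  have N: "real N \<ge> L\<^sup>2" "real N \<le> 2 * L\<^sup>2" "N \<ge> 1"
    using L2 unfolding N_def by linarith+
  define A where "A = {- int N..int N} - {0}"
  have pw: "T k * ennreal (1 / \<bar>of_int (d * k)\<bar>) \<le> ennreal M * (ennreal (1 / \<bar>of_int k\<bar> / of_int d) * indicator A k) + T k * ennreal (1 / L\<^sup>2)" for k
  proof (cases "k = 0")
    case False
    show ?thesis
    proof (cases "k \<in> A")
      case True
      have "T k * ennreal (1 / \<bar>of_int (d * k)\<bar>) \<le> ennreal M * ennreal (1 / \<bar>of_int k\<bar> / of_int d)"
        using d by (intro mult_mono T_le ennreal_leI) (auto simp: abs_mult field_simps)
      then show ?thesis using True by (simp add: add_increasing2)
    next
      case F: False
      have k: "real_of_int \<bar>k\<bar> \<ge> L\<^sup>2" using F False N unfolding A_def by (auto; linarith)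
      have "1 * L\<^sup>2 \<le> real_of_int d * real_of_int \<bar>k\<bar>" using d k L by (intro mult_mono) auto
      then have "1 / \<bar>real_of_int (d * k)\<bar> \<le> 1 / L\<^sup>2"
        using d L2 False by (intro divide_left_mono) (auto simp: abs_mult intro!: mult_pos_pos)
      then have "T k * ennreal (1 / \<bar>of_int (d * k)\<bar>) \<le> T k * ennreal (1 / L\<^sup>2)"
        by (intro mult_left_mono ennreal_leI) auto
      then show ?thesis by (simp add: add_increasing)
    qed
  qed simp
  have hsum: "nsum (\<lambda>k. ennreal (1 / \<bar>of_int k\<bar> / of_int d) * indicator A k) UNIV \<le> ennreal (8 * ln L / of_int d)"
  proof -
    have fin: "finite A" by (simp add: A_def)
    have "nsum (\<lambda>k. ennreal (1 / \<bar>of_int k\<bar> / of_int d) * indicator A k) UNIV = (\<Sum>k\<in>A. ennreal (1 / \<bar>of_int k\<bar> / of_int d))"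
      by (simp only: nsum_indicator[symmetric] nn_integral_count_space_finite[OF fin])
    also have "\<dots> = ennreal (\<Sum>k\<in>A. 1 / \<bar>of_int k\<bar> / of_int d)" using d by (intro sum_ennreal) auto
    also have "(\<Sum>k\<in>A. 1 / \<bar>of_int k\<bar> / of_int d) = (\<Sum>k\<in>A. 1 / \<bar>real_of_int k\<bar>) / of_int d"
      by (simp add: sum_divide_distrib)
    also have "(\<Sum>k\<in>A. 1 / \<bar>real_of_int k\<bar>) = 2 * harm N"
    proof -
      have Ae: "A = int ` {1..N} \<union> (\<lambda>n. - int n) ` {1..N}"
      proof (intro equalityI subsetI)
        fix k assume k: "k \<in> A"
        show "k \<in> int ` {1..N} \<union> (\<lambda>n. - int n) ` {1..N}"
        proof (cases "k > 0")
          case True then show ?thesis using k by (auto simp: A_def image_iff intro!: bexI[of _ "nat k"])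
        next
          case False then show ?thesis using k by (auto simp: A_def image_iff intro!: bexI[of _ "nat (-k)"])
        qed
      qed (auto simp: A_def)
      have "(\<Sum>k\<in>A. 1 / \<bar>real_of_int k\<bar>) = (\<Sum>k\<in>int ` {1..N}. 1 / \<bar>real_of_int k\<bar>) + (\<Sum>k\<in>(\<lambda>n. - int n) ` {1..N}. 1 / \<bar>real_of_int k\<bar>)"
        unfolding Ae by (intro sum.union_disjoint) auto
      also have "\<dots> = 2 * harm N"
        by (simp add: sum.reindex inj_on_def harm_def inverse_eq_divide)
      finally show ?thesis .
    qed
    also have "2 * harm N \<le> 8 * ln L"
    proof -
      have "ln (real N) \<le> ln (2 * L\<^sup>2)" using N L2 by (subst ln_le_cancel_iff) auto
      also have "\<dots> = ln 2 + 2 * ln L" using L by (simp add: ln_mult ln_realpow)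
      also have "\<dots> \<le> 1 + 2 * ln L" using ln_2_less_1 by simp
      finally show ?thesis using harm_le[OF N(3)] lnL by linarith
    qed
    finally show ?thesis using d by (simp add: ennreal_leI divide_right_mono)
  qed
  have "nsum (\<lambda>p. ewt \<sigma> (c + (1/L) *\<^sub>R ivec p) * ennreal (1 / \<bar>of_int (idot p q)\<bar>)) UNIV
     = nsum (\<lambda>(k, j). ewt \<sigma> (pt k j) * ennreal (1 / \<bar>of_int (d * k)\<bar>)) (UNIV \<times> UNIV)"
  proof -
    have "idot p q = d * idot p w" for p by (simp add: q idot_def iscale_def algebra_simps)
    then show ?thesis
      using nsum_bij[OF v, of "\<lambda>p. ewt \<sigma> (c + (1/L) *\<^sub>R ivec p) * ennreal (1 / \<bar>of_int (idot p q)\<bar>)"]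
      by (simp add: pt_def case_prod_beta' dk)
  qed
  also have "\<dots> = nsum (\<lambda>k. T k * ennreal (1 / \<bar>of_int (d * k)\<bar>)) UNIV"
    by (simp only: nsum_pair T_def case_prod_conv nsum_multc)
  also have "\<dots> \<le> nsum (\<lambda>k. ennreal M * (ennreal (1 / \<bar>of_int k\<bar> / of_int d) * indicator A k) + T k * ennreal (1 / L\<^sup>2)) UNIV"
    by (intro nsum_mono pw)
  also have "\<dots> = ennreal M * nsum (\<lambda>k. ennreal (1 / \<bar>of_int k\<bar> / of_int d) * indicator A k) UNIV + nsum T UNIV * ennreal (1 / L\<^sup>2)"
    by (simp only: nsum_add nsum_cmult nsum_multc)
  also have "\<dots> \<le> ennreal M * ennreal (8 * ln L / of_int d) + ennreal (4 * S\<^sup>2 * L\<^sup>2) * ennreal (1 / L\<^sup>2)"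
    by (intro add_mono mult_left_mono mult_right_mono hsum T_sum) auto
  also have "\<dots> = ennreal (M * (8 * ln L / of_int d) + 4 * S\<^sup>2)"
    using M lnL d L by (simp add: ennreal_mult'[symmetric] ennreal_plus[symmetric] del: ennreal_plus)
  also have "\<dots> \<le> ennreal (20 * S\<^sup>2 * ln L * (1 + L / norm (ivec q)))"
  proof (rule ennreal_leI)
    have d1: "real_of_int d \<ge> 1" using d by linarith
    have "M / of_int d = S * (1 / of_int d + L / norm (ivec q))"
      using d1 W by (simp add: M_def nq field_simps)
    also have "\<dots> \<le> S * (1 + L / norm (ivec q))"
      using S d1 by (intro mult_left_mono add_right_mono) (auto simp: field_simps)
    also have "\<dots> \<le> S\<^sup>2 * (1 + L / norm (ivec q))"
      using S L by (intro mult_right_mono) (auto simp: power2_eq_square)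
    finally have 1: "M / of_int d * (8 * ln L) \<le> S\<^sup>2 * (1 + L / norm (ivec q)) * (8 * ln L)"
      using lnL by (intro mult_right_mono) auto
    define x where "x = S\<^sup>2 * ln L * (1 + L / norm (ivec q))"
    have "S\<^sup>2 * 1 * 1 \<le> x" unfolding x_def
      using S lnL L by (intro mult_mono) auto
    moreover have "M * (8 * ln L / of_int d) \<le> 8 * x"
    proof -
      have "M * (8 * ln L / of_int d) = M / of_int d * (8 * ln L)" by simp
      also note 1
      also have "S\<^sup>2 * (1 + L / norm (ivec q)) * (8 * ln L) = 8 * x"
        unfolding x_def by (simp only: ac_simps)
      finally show ?thesis .
    qed
    moreover have "0 \<le> x" using S lnL L by (simp add: x_def)
    ultimately have "M * (8 * ln L / of_int d) + 4 * S\<^sup>2 \<le> 20 * x" by linarith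
    then show "M * (8 * ln L / of_int d) + 4 * S\<^sup>2 \<le> 20 * S\<^sup>2 * ln L * (1 + L / norm (ivec q))"
      by (simp add: x_def mult.assoc)
  qed
  finally show ?thesis by (simp add: S_def)
qed

text \<open>The singularity \<open>1 / |q|\<close> is summable in the plane: the points with \<open>supn q \<le> L\<close> contribute
  \<open>\<Sum>k\<le>L. 8 k (L / k)\<close>, and beyond them the factor is bounded.\<close>
lemma singular_lattice_sum:
  assumes "\<sigma> > 2" "L \<ge> 1"
  shows "nsum (\<lambda>q. ewt \<sigma> (c + (1/L) *\<^sub>R ivec q) * ennreal (1 + L / norm (ivec q))) (-{0})
     \<le> ennreal (16 * (lsum_const \<sigma>)\<^sup>2 * L\<^sup>2)"
proof -
  define S where "S = lsum_const \<sigma>"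
  have S: "S \<ge> 1" unfolding S_def by (rule lsum_const_ge_1)
  define N where "N = nat \<lfloor>L\<rfloor>"
  have N: "real N \<le> L" "L < real N + 1" using assms by (auto simp: N_def)
  define A where "A = {n. supn n \<le> N \<and> n \<noteq> 0}"
  have finA: "finite A" unfolding A_def by (rule finite_subset[OF _ finite_box[of N]]) auto
  have pw: "ewt \<sigma> (c + (1/L) *\<^sub>R ivec q) * ennreal (1 + L / norm (ivec q))
     \<le> 2 * ewt \<sigma> (c + (1/L) *\<^sub>R ivec q) + ennreal (L * (1 / real (supn q))) * indicator A q" if "q \<noteq> 0" for q
  proof -
    have s1: "real (supn q) \<ge> 1" using that supn_0_iff[of q] by linarith
    have nn: "norm (ivec q) \<ge> real (supn q)" by (rule supn_le_norm)
    have a: "wt \<sigma> (c + (1/L) *\<^sub>R ivec q) * (1 + L / norm (ivec q)) \<le> 2 * wt \<sigma> (c + (1/L) *\<^sub>R ivec q) + L * (1 / real (supn q)) * indicator A q"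
    proof (cases "q \<in> A")
      case True
      have "wt \<sigma> (c + (1/L) *\<^sub>R ivec q) * (L / norm (ivec q)) \<le> 1 * (L / real (supn q))"
        using assms s1 nn that by (intro mult_mono wt_le_1 divide_left_mono) (auto intro!: mult_pos_pos)
      then show ?thesis using True wt_nonneg[of \<sigma> "c + (1/L) *\<^sub>R ivec q"] by (simp add: distrib_left)
    next
      case False
      then have "L \<le> norm (ivec q)" using that N nn by (auto simp: A_def)
      then have "L / norm (ivec q) \<le> 1" using s1 nn by (simp add: divide_le_eq_1)
      then have "wt \<sigma> (c + (1/L) *\<^sub>R ivec q) * (1 + L / norm (ivec q)) \<le> wt \<sigma> (c + (1/L) *\<^sub>R ivec q) * 2"
        by (intro mult_left_mono wt_nonneg) auto
      then show ?thesis using False by simp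
    qed
    have "ewt \<sigma> (c + (1/L) *\<^sub>R ivec q) * ennreal (1 + L / norm (ivec q)) = ennreal (wt \<sigma> (c + (1/L) *\<^sub>R ivec q) * (1 + L / norm (ivec q)))"
      by (rule ennreal_mult'[symmetric]) (rule wt_nonneg)
    also have "\<dots> \<le> ennreal (2 * wt \<sigma> (c + (1/L) *\<^sub>R ivec q) + L * (1 / real (supn q)) * indicator A q)"
      by (rule ennreal_leI[OF a])
    also have "\<dots> = 2 * ewt \<sigma> (c + (1/L) *\<^sub>R ivec q) + ennreal (L * (1 / real (supn q))) * indicator A q"
      using assms by (simp add: ennreal_mult' wt_nonneg ennreal_indicator indicator_def)
    finally show ?thesis .
  qed
  have "nsum (\<lambda>q. ewt \<sigma> (c + (1/L) *\<^sub>R ivec q) * ennreal (1 + L / norm (ivec q))) (-{0})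
     \<le> nsum (\<lambda>q. 2 * ewt \<sigma> (c + (1/L) *\<^sub>R ivec q) + ennreal (L * (1 / real (supn q))) * indicator A q) (-{0})"
    by (intro nsum_mono pw) auto
  also have "\<dots> \<le> nsum (\<lambda>q. 2 * ewt \<sigma> (c + (1/L) *\<^sub>R ivec q) + ennreal (L * (1 / real (supn q))) * indicator A q) UNIV"
    by (rule nsum_subset) auto
  also have "\<dots> = 2 * nsum (\<lambda>q. ewt \<sigma> (c + (1/L) *\<^sub>R ivec q)) UNIV + (\<Sum>q\<in>A. ennreal (L * (1 / real (supn q))))"
    by (simp only: nsum_add nsum_cmult nsum_indicator[where A=A, symmetric] nn_integral_count_space_finite[OF finA])
  also have "(\<Sum>q\<in>A. ennreal (L * (1 / real (supn q)))) = ennreal (\<Sum>q\<in>A. L * (1 / real (supn q)))"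
    using assms by (intro sum_ennreal) auto
  also have "(\<Sum>q\<in>A. L * (1 / real (supn q))) = (\<Sum>k=1..N. 8 * real k * (L * (1 / real k)))"
    unfolding A_def by (rule sum_box)
  also have "\<dots> = (\<Sum>k=1..N. 8 * L)" by (intro sum.cong) auto
  also have "\<dots> = 8 * L * real N" by simp
  also have "2 * nsum (\<lambda>q. ewt \<sigma> (c + (1/L) *\<^sub>R ivec q)) UNIV + ennreal (8 * L * real N)
      \<le> 2 * ennreal (4 * S\<^sup>2 * L\<^sup>2) + ennreal (8 * S\<^sup>2 * L\<^sup>2)"
  proof (intro add_mono mult_left_mono ennreal_leI)
    have "8 * L * real N \<le> 8 * L * L" using N assms by (intro mult_left_mono) auto
    also have "\<dots> = 8 * 1 * L\<^sup>2" by (simp add: power2_eq_square)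
    also have "\<dots> \<le> 8 * S\<^sup>2 * L\<^sup>2" using S by (intro mult_right_mono) (auto simp: one_le_power)
    finally show "8 * L * real N \<le> 8 * S\<^sup>2 * L\<^sup>2" .
  qed (auto simp: S_def intro!: wt_lattice_sum assms)
  also have "\<dots> = ennreal (16 * S\<^sup>2 * L\<^sup>2)"
    by (simp add: ennreal_mult'[symmetric] ennreal_numeral[symmetric] ennreal_plus[symmetric] del: ennreal_plus ennreal_numeral)
  finally show ?thesis by (simp add: S_def)
qed

definition nonres_const :: "real \<Rightarrow> real" where
  "nonres_const \<sigma> = 960 * 3 powr \<sigma> * lsum_const \<sigma> ^ 4"

text \<open>The inner sum of each term of \<open>rect_wt_le\<close> is \<open>nonres_inner_sum\<close>; the singular factor which it
  leaves is absorbed by \<open>singular_lattice_sum\<close>.\<close>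
lemma nonres_sum:
  assumes \<sigma>: "\<sigma> > 2" and L: "L \<ge> exp 1"
  shows "nsum (\<lambda>(p, q). ennreal (rect_wt \<sigma> K ((1/L) *\<^sub>R ivec p) ((1/L) *\<^sub>R ivec q)) * ennreal (1 / \<bar>of_int (idot p q)\<bar>)) UNIV
    \<le> ennreal (nonres_const \<sigma> * L\<^sup>2 * ln L * wt \<sigma> K)"
proof -
  have L1: "L \<ge> 1" "L > 0" using L exp_ge_add_one_self[of 1] by linarith+
  have lnL: "ln L \<ge> 1" using L by (metis L1(2) ln_ge_iff)
  define S where "S = lsum_const \<sigma>"
  define c where "c = ennreal (3 powr \<sigma> * wt \<sigma> K)"
  define P where "P = (\<lambda>p. (1/L) *\<^sub>R ivec p)"
  define d where "d = (\<lambda>p q. ennreal (1 / \<bar>of_int (idot p q)\<bar>))"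
  have dz: "d p 0 = 0" "d 0 p = 0" for p by (auto simp: d_def idot_def)
  have dc: "d p q = d q p" for p q by (simp add: d_def idot_commute)
  define E where "E = ennreal (320 * S ^ 4 * L\<^sup>2 * ln L)"
  \<comment> \<open>the common form of the three terms: an inner sum over \<open>p\<close>, then one over \<open>q\<close>\<close>
  have gen: "nsum (\<lambda>q. nsum (\<lambda>p. ewt \<sigma> (K + P q) * (ewt \<sigma> (f q + P p) * d p q)) UNIV) UNIV \<le> E" for f
  proof -
    have "nsum (\<lambda>q. nsum (\<lambda>p. ewt \<sigma> (K + P q) * (ewt \<sigma> (f q + P p) * d p q)) UNIV) UNIV
       = nsum (\<lambda>q. ewt \<sigma> (K + P q) * nsum (\<lambda>p. ewt \<sigma> (f q + P p) * d p q) UNIV) UNIV"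
      by (simp only: nsum_cmult)
    also have "\<dots> \<le> nsum (\<lambda>q. ewt \<sigma> (K + P q) * (ennreal (20 * S\<^sup>2 * ln L) * ennreal (1 + L / norm (ivec q))) * indicator (-{0}) q) UNIV"
    proof (intro nsum_mono)
      fix q :: "int \<times> int"
      show "ewt \<sigma> (K + P q) * nsum (\<lambda>p. ewt \<sigma> (f q + P p) * d p q) UNIV
        \<le> ewt \<sigma> (K + P q) * (ennreal (20 * S\<^sup>2 * ln L) * ennreal (1 + L / norm (ivec q))) * indicator (-{0}) q"
      proof (cases "q = 0")
        case False
        then have "nsum (\<lambda>p. ewt \<sigma> (f q + P p) * d p q) UNIV \<le> ennreal (20 * S\<^sup>2 * ln L * (1 + L / norm (ivec q)))"
          unfolding P_def d_def S_def by (intro nonres_inner_sum \<sigma> L)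
        also have "\<dots> = ennreal (20 * S\<^sup>2 * ln L) * ennreal (1 + L / norm (ivec q))"
          using lnL by (intro ennreal_mult') auto
        finally show ?thesis using False by (simp add: mult_left_mono)
      qed (simp add: dz)
    qed
    also have "\<dots> = nsum (\<lambda>q. ennreal (20 * S\<^sup>2 * ln L) * (ewt \<sigma> (K + P q) * ennreal (1 + L / norm (ivec q)))) (-{0})"
      unfolding nsum_indicator[symmetric] by (simp only: ac_simps)
    also have "\<dots> = ennreal (20 * S\<^sup>2 * ln L) * nsum (\<lambda>q. ewt \<sigma> (K + P q) * ennreal (1 + L / norm (ivec q))) (-{0})"
      by (simp only: nsum_cmult)
    also have "\<dots> \<le> ennreal (20 * S\<^sup>2 * ln L) * ennreal (16 * S\<^sup>2 * L\<^sup>2)"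
      unfolding P_def S_def by (intro mult_left_mono singular_lattice_sum \<sigma> L1) auto
    also have "\<dots> = E" unfolding E_def using lnL lsum_const_ge_1[of \<sigma>]
      by (subst ennreal_mult'[symmetric]) (auto simp: power2_eq_square power4_eq_xxxx ac_simps S_def)
    finally show ?thesis .
  qed
  have "nsum (\<lambda>(p, q). ennreal (rect_wt \<sigma> K (P p) (P q)) * d p q) (UNIV \<times> UNIV)
    \<le> nsum (\<lambda>(p, q). c * (ewt \<sigma> (K + P q) * (ewt \<sigma> ((K + P q) + P p) * d p q) + ewt \<sigma> (K + P q) * (ewt \<sigma> (K + P p) * d p q)
         + ewt \<sigma> (K + P p) * (ewt \<sigma> ((K + P p) + P q) * d q p))) (UNIV \<times> UNIV)"
  proof (intro nsum_mono, clarify)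
    fix p q
    have "ennreal (rect_wt \<sigma> K (P p) (P q)) * d p q \<le> c * (ewt \<sigma> (K + P q) * ewt \<sigma> (K + P q + P p) + ewt \<sigma> (K + P q) * ewt \<sigma> (K + P p) + ewt \<sigma> (K + P p) * ewt \<sigma> (K + P p + P q)) * d p q"
      unfolding c_def using \<sigma> by (intro mult_right_mono rect_wt_le) auto
    also have "\<dots> = c * (ewt \<sigma> (K + P q) * (ewt \<sigma> ((K + P q) + P p) * d p q) + ewt \<sigma> (K + P q) * (ewt \<sigma> (K + P p) * d p q)
         + ewt \<sigma> (K + P p) * (ewt \<sigma> ((K + P p) + P q) * d q p))"
      unfolding dc[of q p] by (simp only: distrib_right mult.assoc)
    finally show "ennreal (rect_wt \<sigma> K (P p) (P q)) * d p q \<le> c * (ewt \<sigma> (K + P q) * (ewt \<sigma> ((K + P q) + P p) * d p q) + ewt \<sigma> (K + P q) * (ewt \<sigma> (K + P p) * d p q)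
         + ewt \<sigma> (K + P p) * (ewt \<sigma> ((K + P p) + P q) * d q p))" .
  qed
  also have "\<dots> = c * (nsum (\<lambda>(p, q). ewt \<sigma> (K + P q) * (ewt \<sigma> ((K + P q) + P p) * d p q)) (UNIV \<times> UNIV)
     + nsum (\<lambda>(p, q). ewt \<sigma> (K + P q) * (ewt \<sigma> (K + P p) * d p q)) (UNIV \<times> UNIV)
     + nsum (\<lambda>(p, q). ewt \<sigma> (K + P p) * (ewt \<sigma> ((K + P p) + P q) * d q p)) (UNIV \<times> UNIV))"
    by (simp only: case_prod_beta' nsum_cmult nsum_add)
  also have "nsum (\<lambda>(p, q). ewt \<sigma> (K + P q) * (ewt \<sigma> ((K + P q) + P p) * d p q)) (UNIV \<times> UNIV) \<le> E"
    unfolding nsum_pair_swap case_prod_conv by (rule gen)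
  also have "nsum (\<lambda>(p, q). ewt \<sigma> (K + P q) * (ewt \<sigma> (K + P p) * d p q)) (UNIV \<times> UNIV) \<le> E"
    unfolding nsum_pair_swap case_prod_conv by (rule gen)
  also have "nsum (\<lambda>(p, q). ewt \<sigma> (K + P p) * (ewt \<sigma> ((K + P p) + P q) * d q p)) (UNIV \<times> UNIV) \<le> E"
    unfolding nsum_pair case_prod_conv by (rule gen)
  also have "c * (E + E + E) = ennreal (nonres_const \<sigma> * L\<^sup>2 * ln L * wt \<sigma> K)"
    unfolding c_def E_def nonres_const_def S_def using lnL
    by (simp add: ennreal_mult'[symmetric] ennreal_plus[symmetric] wt_nonneg ac_simps del: ennreal_plus)
  finally show ?thesis unfolding P_def d_def by (simp add: add_mono mult_left_mono)
qed

section \<open>Resonant sums\<close>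

abbreviation lrect :: "real \<Rightarrow> real \<Rightarrow> real^2 \<Rightarrow> int \<times> int \<Rightarrow> int \<times> int \<Rightarrow> ennreal" where
  "lrect \<sigma> L K p q \<equiv> ennreal (rect_wt \<sigma> K ((1/L) *\<^sub>R ivec p) ((1/L) *\<^sub>R ivec q))"

lemma line_lattice_sum:
  assumes "\<sigma> > 2" "L > 0" "w \<noteq> 0"
  shows "nsum (\<lambda>a. ewt \<sigma> (c + (1/L) *\<^sub>R ivec (iscale a w))) UNIV \<le> ennreal (lsum_const \<sigma> * (1 + L / norm (ivec w)))"
proof -
  have "(1/L) *\<^sub>R ivec w \<noteq> 0" using assms by simp
  from wt_line_sum[OF assms(1) this, of c] show ?thesis
    using assms by (simp add: ivec_iscale)
qed

lemma iperp_eq_0 [simp]: "iperp w = 0 \<longleftrightarrow> w = 0"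
  by (auto simp: iperp_def prod_eq_iff)

lemma norm_iperp [simp]: "norm (ivec (iperp w)) = norm (ivec w)"
  by (simp add: ivec_iperp)

text \<open>For a fixed direction both sides of the rectangle run through an arithmetic progression of step
  \<open>|w| / L\<close>.\<close>
lemma resonant_fibre_sum:
  assumes "\<sigma> > 2" "L > 0" "w \<noteq> 0"
  shows "nsum (\<lambda>a. nsum (\<lambda>b. lrect \<sigma> L K (iscale a w) (iscale b (iperp w))) UNIV) UNIV
     \<le> ennreal (3 * 3 powr \<sigma> * wt \<sigma> K * (lsum_const \<sigma> * (1 + L / norm (ivec w)))\<^sup>2)"
proof -
  let ?M = "ennreal (lsum_const \<sigma> * (1 + L / norm (ivec w)))"
  have "nsum (\<lambda>a. nsum (\<lambda>b. lrect \<sigma> L K (iscale a w) (iscale b (iperp w))) UNIV) UNIV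
     \<le> ennreal (3 * 3 powr \<sigma> * wt \<sigma> K) * (?M * ?M)"
  proof (rule rect_sum_le)
    show "nsum (\<lambda>x. ewt \<sigma> (c + (1 / L) *\<^sub>R ivec (iscale x (iperp w)))) UNIV \<le> ?M" for c
      using line_lattice_sum[of \<sigma> L "iperp w" c] assms by simp
  qed (use assms in \<open>auto intro!: line_lattice_sum\<close>)
  also have "\<dots> = ennreal (3 * 3 powr \<sigma> * wt \<sigma> K * (lsum_const \<sigma> * (1 + L / norm (ivec w)))\<^sup>2)"
    using assms lsum_const_ge_1[of \<sigma>] by (simp add: ennreal_mult'[symmetric] wt_nonneg power2_eq_square)
  finally show ?thesis .
qed

lemma rect_wt_degenerate:
  assumes "\<sigma> \<ge> 0"
  shows "rect_wt \<sigma> K y 0 \<le> wt \<sigma> K * wt \<sigma> (K + y)" "rect_wt \<sigma> K 0 y \<le> wt \<sigma> K * wt \<sigma> (K + y)"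
proof -
  have "wt \<sigma> (K + y) * (wt \<sigma> (K + y) * wt \<sigma> K) \<le> 1 * (wt \<sigma> (K + y) * wt \<sigma> K)"
    using assms by (intro mult_right_mono wt_le_1) (auto simp: wt_nonneg)
  then show "rect_wt \<sigma> K y 0 \<le> wt \<sigma> K * wt \<sigma> (K + y)" "rect_wt \<sigma> K 0 y \<le> wt \<sigma> K * wt \<sigma> (K + y)"
    by (simp_all add: rect_wt_def ac_simps)
qed

lemma degenerate_sum:
  assumes "\<sigma> > 2" "L \<ge> 1"
  shows "nsum (\<lambda>q. lrect \<sigma> L K 0 q) UNIV \<le> ennreal (4 * (lsum_const \<sigma>)\<^sup>2 * L\<^sup>2 * wt \<sigma> K)"
    and "nsum (\<lambda>p. lrect \<sigma> L K p 0) UNIV \<le> ennreal (4 * (lsum_const \<sigma>)\<^sup>2 * L\<^sup>2 * wt \<sigma> K)"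
proof -
  have z: "ivec 0 = 0" by simp
  have "nsum (\<lambda>q. ewt \<sigma> K * ewt \<sigma> (K + (1/L) *\<^sub>R ivec q)) UNIV \<le> ewt \<sigma> K * ennreal (4 * (lsum_const \<sigma>)\<^sup>2 * L\<^sup>2)"
    unfolding nsum_cmult by (intro mult_left_mono wt_lattice_sum assms) auto
  also have "\<dots> = ennreal (4 * (lsum_const \<sigma>)\<^sup>2 * L\<^sup>2 * wt \<sigma> K)"
    by (subst ennreal_mult'[symmetric]) (auto simp: wt_nonneg mult.commute)
  finally have e: "nsum (\<lambda>q. ewt \<sigma> K * ewt \<sigma> (K + (1/L) *\<^sub>R ivec q)) UNIV \<le> ennreal (4 * (lsum_const \<sigma>)\<^sup>2 * L\<^sup>2 * wt \<sigma> K)" .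
  have "nsum (\<lambda>q. lrect \<sigma> L K 0 q) UNIV \<le> nsum (\<lambda>q. ewt \<sigma> K * ewt \<sigma> (K + (1/L) *\<^sub>R ivec q)) UNIV"
    using assms rect_wt_degenerate(2)[of \<sigma> K] unfolding z
    by (intro nsum_mono) (auto simp: ennreal_mult'[symmetric] wt_nonneg intro!: ennreal_leI)
  with e show "nsum (\<lambda>q. lrect \<sigma> L K 0 q) UNIV \<le> ennreal (4 * (lsum_const \<sigma>)\<^sup>2 * L\<^sup>2 * wt \<sigma> K)" by order
  have "nsum (\<lambda>q. lrect \<sigma> L K q 0) UNIV \<le> nsum (\<lambda>q. ewt \<sigma> K * ewt \<sigma> (K + (1/L) *\<^sub>R ivec q)) UNIV"
    using assms rect_wt_degenerate(1)[of \<sigma> K] unfolding z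
    by (intro nsum_mono) (auto simp: ennreal_mult'[symmetric] wt_nonneg intro!: ennreal_leI)
  with e show "nsum (\<lambda>q. lrect \<sigma> L K q 0) UNIV \<le> ennreal (4 * (lsum_const \<sigma>)\<^sup>2 * L\<^sup>2 * wt \<sigma> K)" by order
qed

lemma nsum_primitive: "nsum (\<lambda>w. nsum (\<lambda>a. f (iscale a w)) {1..}) primitive = nsum f {p. p \<noteq> 0}"
proof -
  have "nsum f {p. p \<noteq> 0} = nsum (\<lambda>x. f (case x of (w, a) \<Rightarrow> iscale a w)) (primitive \<times> {1..})"
    by (rule nsum_bij[OF bij_primitive])
  then show ?thesis by (simp add: nsum_pair)
qed

lemma nsum_primitive_perp: "nsum (\<lambda>w. nsum (\<lambda>a. f (iscale a (iperp w))) {1..}) primitive = nsum f {p. p \<noteq> 0}"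
proof -
  have "iscale a (iperp w) = iperp (iscale a w)" for a w by (simp add: iscale_def iperp_def)
  then have "nsum (\<lambda>w. nsum (\<lambda>a. f (iscale a (iperp w))) {1..}) primitive = nsum (\<lambda>p. f (iperp p)) {p. p \<noteq> 0}"
    using nsum_primitive[of "\<lambda>p. f (iperp p)"] by simp
  also have "\<dots> = nsum f {p. p \<noteq> 0}" by (rule nsum_bij[OF bij_iperp, symmetric])
  finally show ?thesis .
qed

lemma nsum_primitive_perp_neg: "nsum (\<lambda>w. nsum (\<lambda>a. f (iscale a (iperp w))) {..-1}) primitive = nsum f {p. p \<noteq> 0}"
proof -
  have b: "bij_betw uminus {1..} {..-1::int}"
    by (rule bij_betw_byWitness[where f'=uminus]) auto
  have e: "iscale (- a) (iperp w) = - iscale a (iperp w)" for a w by (simp add: iscale_def iperp_def)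
  have "nsum (\<lambda>w. nsum (\<lambda>a. f (iscale a (iperp w))) {..-1}) primitive = nsum (\<lambda>w. nsum (\<lambda>a. f (- iscale a (iperp w))) {1..}) primitive"
    using nsum_bij[OF b] by (simp add: e)
  also have "\<dots> = nsum (\<lambda>p. f (- p)) {p. p \<noteq> 0}"
    by (rule nsum_primitive_perp)
  also have "\<dots> = nsum f {p. p \<noteq> 0}"
    by (rule nsum_bij[symmetric], rule bij_betw_byWitness[where f'=uminus]) (auto simp: prod_eq_iff)
  finally show ?thesis .
qed

text \<open>A line of step larger than one carries only boundedly many points at unit scale, so that the sum over
  one side of the rectangle costs a constant. The other side then runs through all lattice points,
  each with a single direction, and costs \<open>L\<^sup>2\<close>: these directions produce no logarithm.\<close>
lemma large_direction_sum:
  assumes \<sigma>: "\<sigma> > 2" and L: "L \<ge> 1" and N: "real N + 1 > L"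
  shows "nsum (\<lambda>w. nsum (\<lambda>a. nsum (\<lambda>b. lrect \<sigma> L K (iscale a w) (iscale b (iperp w))) UNIV) {1..}) (primitive - {w. supn w \<le> N})
     \<le> ennreal (44 * 3 powr \<sigma> * lsum_const \<sigma> ^ 3 * L\<^sup>2 * wt \<sigma> K)"
proof -
  define S where "S = lsum_const \<sigma>"
  have S: "S \<ge> 1" unfolding S_def by (rule lsum_const_ge_1)
  define c where "c = ennreal (3 powr \<sigma> * wt \<sigma> K)"
  define P where "P = (\<lambda>p. (1/L) *\<^sub>R ivec p)"
  define Q where "Q = primitive - {w. supn w \<le> N}"
  have Q: "w \<noteq> 0" "norm (ivec w) \<ge> L" "w \<in> primitive" if "w \<in> Q" for w
    using that N supn_le_norm[of w] primitive_nonzero[of w] by (auto simp: Q_def)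
  have ln: "nsum (\<lambda>a. ewt \<sigma> (d + P (iscale a w))) UNIV \<le> ennreal (2 * S)" if "w \<noteq> 0" "norm (ivec w) \<ge> L" for w d
  proof -
    have "nsum (\<lambda>a. ewt \<sigma> (d + P (iscale a w))) UNIV \<le> ennreal (S * (1 + L / norm (ivec w)))"
      unfolding P_def S_def using L that by (intro line_lattice_sum \<sigma>) auto
    also have "\<dots> \<le> ennreal (S * (1 + 1))"
      using S L that by (intro ennreal_leI mult_left_mono add_left_mono) (auto simp: divide_le_eq_1)
    finally show ?thesis by (simp add: mult.commute)
  qed
  have ln1: "nsum (\<lambda>a. ewt \<sigma> (d + P (iscale a w))) {1..} \<le> ennreal (2 * S)" if "w \<in> Q" for w d
    using order_trans[OF nsum_subset ln] Q[OF that] by blast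
  have ln2: "nsum (\<lambda>a. ewt \<sigma> (d + P (iscale a (iperp w)))) (-{0}) \<le> ennreal (2 * S)" if "w \<in> Q" for w d
    by (rule order_trans[OF nsum_subset ln]) (use Q[OF that] in auto)
  define X where "X = (\<lambda>w. nsum (\<lambda>a. ewt \<sigma> (K + P (iscale a w))) {1..})"
  define Y where "Y = (\<lambda>w. nsum (\<lambda>b. ewt \<sigma> (K + P (iscale b (iperp w)))) (-{0}))"
  define Z where "Z = (\<lambda>w. nsum (\<lambda>a. lrect \<sigma> L K (iscale a w) 0) {1..})"
  have latt: "nsum (\<lambda>p. ewt \<sigma> (K + P p)) {p. p \<noteq> 0} \<le> ennreal (4 * S\<^sup>2 * L\<^sup>2)"
    unfolding P_def S_def by (rule order_trans[OF nsum_subset wt_lattice_sum[OF \<sigma> L]]) auto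
  have QP: "Q \<subseteq> primitive" by (auto simp: Q_def)
  have X: "nsum X Q \<le> ennreal (4 * S\<^sup>2 * L\<^sup>2)"
  proof -
    have "nsum X Q \<le> nsum X primitive" by (rule nsum_subset[OF QP])
    also have "\<dots> = nsum (\<lambda>p. ewt \<sigma> (K + P p)) {p. p \<noteq> 0}"
      unfolding X_def by (rule nsum_primitive)
    finally show ?thesis using latt by order
  qed
  have Y: "nsum Y Q \<le> ennreal (8 * S\<^sup>2 * L\<^sup>2)"
  proof -
    have m: "- {0::int} = {1..} \<union> {..-1}" by auto
    have "nsum Y Q \<le> nsum Y primitive" by (rule nsum_subset[OF QP])
    also have "\<dots> \<le> nsum (\<lambda>w. nsum (\<lambda>b. ewt \<sigma> (K + P (iscale b (iperp w)))) {1..} + nsum (\<lambda>b. ewt \<sigma> (K + P (iscale b (iperp w)))) {..-1}) primitive"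
      unfolding Y_def m by (intro nsum_mono nsum_Un)
    also have "\<dots> = nsum (\<lambda>p. ewt \<sigma> (K + P p)) {p. p \<noteq> 0} + nsum (\<lambda>p. ewt \<sigma> (K + P p)) {p. p \<noteq> 0}"
      unfolding nsum_add using nsum_primitive_perp[of "\<lambda>p. ewt \<sigma> (K + P p)"] nsum_primitive_perp_neg[of "\<lambda>p. ewt \<sigma> (K + P p)"] by simp
    also have "\<dots> \<le> ennreal (4 * S\<^sup>2 * L\<^sup>2) + ennreal (4 * S\<^sup>2 * L\<^sup>2)" by (intro add_mono latt)
    also have "\<dots> = ennreal (8 * S\<^sup>2 * L\<^sup>2)" by (simp add: ennreal_plus[symmetric] del: ennreal_plus)
    finally show ?thesis .
  qed
  have Z: "nsum Z Q \<le> ennreal (4 * S\<^sup>2 * L\<^sup>2 * wt \<sigma> K)"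
  proof -
    have "nsum Z Q \<le> nsum Z primitive" by (rule nsum_subset[OF QP])
    also have "\<dots> = nsum (\<lambda>p. lrect \<sigma> L K p 0) {p. p \<noteq> 0}"
      unfolding Z_def by (rule nsum_primitive)
    also have "\<dots> \<le> nsum (\<lambda>p. lrect \<sigma> L K p 0) UNIV" by (rule nsum_subset) auto
    also have "\<dots> \<le> ennreal (4 * S\<^sup>2 * L\<^sup>2 * wt \<sigma> K)" unfolding S_def by (rule degenerate_sum[OF \<sigma> L])
    finally show ?thesis .
  qed
  have fib: "nsum (\<lambda>a. nsum (\<lambda>b. lrect \<sigma> L K (iscale a w) (iscale b (iperp w))) UNIV) {1..}
     \<le> c * (ennreal (2 * S) * Y w + ennreal (2 * S) * Y w + ennreal (2 * S) * X w) + Z w" if w: "w \<in> Q" for w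
  proof -
    define A where "A = (\<lambda>a. P (iscale a w))"
    define B where "B = (\<lambda>b. P (iscale b (iperp w)))"
    have U: "(UNIV::int set) = (-{0}) \<union> {0}" by auto
    have z: "iscale 0 (iperp w) = 0" by (simp add: iscale_def zero_prod_def)
    have "nsum (\<lambda>a. nsum (\<lambda>b. lrect \<sigma> L K (iscale a w) (iscale b (iperp w))) UNIV) {1..}
      \<le> nsum (\<lambda>a. nsum (\<lambda>b. lrect \<sigma> L K (iscale a w) (iscale b (iperp w))) (-{0}) + lrect \<sigma> L K (iscale a w) 0) {1..}"
    proof (intro nsum_mono)
      fix a :: int
      have "nsum (\<lambda>b. lrect \<sigma> L K (iscale a w) (iscale b (iperp w))) UNIV
        \<le> nsum (\<lambda>b. lrect \<sigma> L K (iscale a w) (iscale b (iperp w))) (-{0}) + nsum (\<lambda>b. lrect \<sigma> L K (iscale a w) (iscale b (iperp w))) {0}"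
        by (subst U) (rule nsum_Un)
      then show "nsum (\<lambda>b. lrect \<sigma> L K (iscale a w) (iscale b (iperp w))) UNIV
        \<le> nsum (\<lambda>b. lrect \<sigma> L K (iscale a w) (iscale b (iperp w))) (-{0}) + lrect \<sigma> L K (iscale a w) 0"
        by (simp add: nn_integral_count_space_finite z)
    qed
    also have "\<dots> = nsum (\<lambda>a. nsum (\<lambda>b. ennreal (rect_wt \<sigma> K (A a) (B b))) (-{0})) {1..} + Z w"
      unfolding nsum_add Z_def A_def B_def P_def ..
    also have "nsum (\<lambda>a. nsum (\<lambda>b. ennreal (rect_wt \<sigma> K (A a) (B b))) (-{0})) {1..}
      \<le> nsum (\<lambda>a. nsum (\<lambda>b. c * (ewt \<sigma> (K + B b) * ewt \<sigma> (K + B b + A a) + ewt \<sigma> (K + B b) * ewt \<sigma> (K + A a) + ewt \<sigma> (K + A a) * ewt \<sigma> (K + A a + B b))) (-{0})) {1..}"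
      unfolding c_def using \<sigma> by (intro nsum_mono rect_wt_le) auto
    also have "\<dots> = c * (nsum (\<lambda>a. nsum (\<lambda>b. ewt \<sigma> (K + B b) * ewt \<sigma> (K + B b + A a)) (-{0})) {1..}
       + nsum (\<lambda>a. nsum (\<lambda>b. ewt \<sigma> (K + B b) * ewt \<sigma> (K + A a)) (-{0})) {1..}
       + nsum (\<lambda>a. nsum (\<lambda>b. ewt \<sigma> (K + A a) * ewt \<sigma> (K + A a + B b)) (-{0})) {1..})"
      by (simp add: nsum_cmult nsum_add)
    also have "nsum (\<lambda>a. nsum (\<lambda>b. ewt \<sigma> (K + B b) * ewt \<sigma> (K + B b + A a)) (-{0})) {1..}
       = nsum (\<lambda>b. nsum (\<lambda>a. ewt \<sigma> (K + B b) * ewt \<sigma> (K + B b + A a)) {1..}) (-{0})"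
      using nsum_pair[where f="\<lambda>(a,b). ewt \<sigma> (K + B b) * ewt \<sigma> (K + B b + A a)" and A="{1..}" and B="-{0}"]
        nsum_pair_swap[where f="\<lambda>(a,b). ewt \<sigma> (K + B b) * ewt \<sigma> (K + B b + A a)" and A="{1..}" and B="-{0}"] by simp
    also have "nsum (\<lambda>a. nsum (\<lambda>b. ewt \<sigma> (K + B b) * ewt \<sigma> (K + A a)) (-{0})) {1..}
       = nsum (\<lambda>b. nsum (\<lambda>a. ewt \<sigma> (K + B b) * ewt \<sigma> (K + A a)) {1..}) (-{0})"
      using nsum_pair[where f="\<lambda>(a,b). ewt \<sigma> (K + B b) * ewt \<sigma> (K + A a)" and A="{1..}" and B="-{0}"]
        nsum_pair_swap[where f="\<lambda>(a,b). ewt \<sigma> (K + B b) * ewt \<sigma> (K + A a)" and A="{1..}" and B="-{0}"] by simp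
    also have "c * (nsum (\<lambda>b. nsum (\<lambda>a. ewt \<sigma> (K + B b) * ewt \<sigma> (K + B b + A a)) {1..}) (-{0})
      + nsum (\<lambda>b. nsum (\<lambda>a. ewt \<sigma> (K + B b) * ewt \<sigma> (K + A a)) {1..}) (-{0})
      + nsum (\<lambda>a. nsum (\<lambda>b. ewt \<sigma> (K + A a) * ewt \<sigma> (K + A a + B b)) (-{0})) {1..})
      \<le> c * (ennreal (2 * S) * Y w + ennreal (2 * S) * Y w + ennreal (2 * S) * X w)"
      unfolding A_def B_def X_def Y_def
      by (intro mult_left_mono add_mono nsum_mult_le ln1 ln2 w order.refl) auto
    finally show ?thesis by (simp add: add_right_mono)
  qed
  have "nsum (\<lambda>w. nsum (\<lambda>a. nsum (\<lambda>b. lrect \<sigma> L K (iscale a w) (iscale b (iperp w))) UNIV) {1..}) Q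
    \<le> nsum (\<lambda>w. c * (ennreal (2 * S) * Y w + ennreal (2 * S) * Y w + ennreal (2 * S) * X w) + Z w) Q"
    by (intro nsum_mono fib)
  also have "\<dots> = c * (ennreal (2 * S) * nsum Y Q + ennreal (2 * S) * nsum Y Q + ennreal (2 * S) * nsum X Q) + nsum Z Q"
    by (simp add: nsum_cmult nsum_add)
  also have "\<dots> \<le> c * (ennreal (2 * S) * ennreal (8 * S\<^sup>2 * L\<^sup>2) + ennreal (2 * S) * ennreal (8 * S\<^sup>2 * L\<^sup>2) + ennreal (2 * S) * ennreal (4 * S\<^sup>2 * L\<^sup>2)) + ennreal (4 * S\<^sup>2 * L\<^sup>2 * wt \<sigma> K)"
    by (intro add_mono mult_left_mono X Y Z) auto
  also have "\<dots> = ennreal (3 powr \<sigma> * wt \<sigma> K * (2 * S * (8 * S\<^sup>2 * L\<^sup>2) + 2 * S * (8 * S\<^sup>2 * L\<^sup>2) + 2 * S * (4 * S\<^sup>2 * L\<^sup>2)) + 4 * S\<^sup>2 * L\<^sup>2 * wt \<sigma> K)"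
    unfolding c_def using S
    by (simp only: ennreal_mult'[symmetric] ennreal_plus[symmetric] wt_nonneg mult_nonneg_nonneg add_nonneg_nonneg zero_le_power2 powr_ge_zero zero_le_numeral order_trans[OF zero_le_one])
  also have "\<dots> \<le> ennreal (44 * 3 powr \<sigma> * S ^ 3 * L\<^sup>2 * wt \<sigma> K)"
  proof (rule ennreal_leI)
    have "1 * S\<^sup>2 * (L\<^sup>2 * wt \<sigma> K) \<le> 3 powr \<sigma> * S ^ 3 * (L\<^sup>2 * wt \<sigma> K)"
      using S \<sigma> by (intro mult_right_mono mult_mono power_increasing) (auto simp: wt_nonneg ge_one_powr_ge_zero)
    then show "3 powr \<sigma> * wt \<sigma> K * (2 * S * (8 * S\<^sup>2 * L\<^sup>2) + 2 * S * (8 * S\<^sup>2 * L\<^sup>2) + 2 * S * (4 * S\<^sup>2 * L\<^sup>2)) + 4 * S\<^sup>2 * L\<^sup>2 * wt \<sigma> K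
       \<le> 44 * 3 powr \<sigma> * S ^ 3 * L\<^sup>2 * wt \<sigma> K"
      by (simp add: algebra_simps power2_eq_square power3_eq_cube)
  qed
  finally show ?thesis unfolding Q_def S_def .
qed

lemma nsum_orthogonal:
  "nsum f {(p, q). p \<noteq> 0 \<and> idot p q = 0} = nsum (\<lambda>w. nsum (\<lambda>a. nsum (\<lambda>b. f (iscale a w, iscale b (iperp w))) UNIV) {1..}) primitive"
proof -
  have "nsum f {(p, q). p \<noteq> 0 \<and> idot p q = 0} = nsum (\<lambda>x. f (case x of (w, a, b) \<Rightarrow> (iscale a w, iscale b (iperp w)))) (primitive \<times> {1..} \<times> UNIV)"
    by (rule nsum_bij[OF bij_orthogonal])
  then show ?thesis by (simp add: nsum_pair)
qed

definition res_const :: "real \<Rightarrow> real" where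
  "res_const \<sigma> = 480 * 3 powr \<sigma> * lsum_const \<sigma> ^ 3"

text \<open>The directions of length at most \<open>L\<close> contribute \<open>(L / |w|)\<^sup>2\<close> each, and \<open>\<Sum>k\<le>L. 8 k (L / k)\<^sup>2\<close> is the
  source of the factor \<open>L\<^sup>2 ln L\<close>. Long directions and degenerate rectangles only contribute \<open>L\<^sup>2\<close>.\<close>
lemma res_sum:
  assumes \<sigma>: "\<sigma> > 2" and L: "L \<ge> exp 1"
  shows "nsum (\<lambda>(p, q). lrect \<sigma> L K p q) {(p, q). idot p q = 0} \<le> ennreal (res_const \<sigma> * L\<^sup>2 * ln L * wt \<sigma> K)"
proof -
  have L1: "L \<ge> 1" "L > 0" using L exp_ge_add_one_self[of 1] by linarith+
  have lnL: "ln L \<ge> 1" using L by (metis L1(2) ln_ge_iff)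
  define S where "S = lsum_const \<sigma>"
  have S: "S \<ge> 1" unfolding S_def by (rule lsum_const_ge_1)
  define N where "N = nat \<lfloor>L\<rfloor>"
  have N: "real N \<le> L" "L < real N + 1" "N \<ge> 1" using L1 by (auto simp: N_def le_nat_iff)
  define A where "A = {n. supn n \<le> N \<and> n \<noteq> 0}"
  have finA: "finite A" unfolding A_def by (rule finite_subset[OF _ finite_box[of N]]) auto
  define F where "F = (\<lambda>w. nsum (\<lambda>a. nsum (\<lambda>b. lrect \<sigma> L K (iscale a w) (iscale b (iperp w))) UNIV) {1..})"
  have "nsum (\<lambda>(p, q). lrect \<sigma> L K p q) {(p, q). idot p q = 0}
     \<le> nsum (\<lambda>(p, q). lrect \<sigma> L K p q) ({0} \<times> UNIV \<union> {(p, q). p \<noteq> 0 \<and> idot p q = 0})"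
    by (rule nsum_subset) auto
  also have "\<dots> \<le> nsum (\<lambda>(p, q). lrect \<sigma> L K p q) ({0} \<times> UNIV) + nsum (\<lambda>(p, q). lrect \<sigma> L K p q) {(p, q). p \<noteq> 0 \<and> idot p q = 0}"
    by (rule nsum_Un)
  also have "nsum (\<lambda>(p, q). lrect \<sigma> L K p q) ({0} \<times> UNIV) = nsum (\<lambda>q. lrect \<sigma> L K 0 q) UNIV"
    by (simp only: nsum_pair case_prod_conv) (simp add: nn_integral_count_space_finite)
  also have "\<dots> \<le> ennreal (4 * S\<^sup>2 * L\<^sup>2 * wt \<sigma> K)" unfolding S_def by (rule degenerate_sum[OF \<sigma> L1(1)])
  also have "nsum (\<lambda>(p, q). lrect \<sigma> L K p q) {(p, q). p \<noteq> 0 \<and> idot p q = 0} = nsum F primitive"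
    unfolding nsum_orthogonal F_def by simp
  also have "nsum F primitive \<le> nsum F (A \<union> (primitive - {w. supn w \<le> N}))"
    by (rule nsum_subset) (auto simp: A_def dest: primitive_nonzero)
  also have "\<dots> \<le> nsum F A + nsum F (primitive - {w. supn w \<le> N})" by (rule nsum_Un)
  also have "nsum F (primitive - {w. supn w \<le> N}) \<le> ennreal (44 * 3 powr \<sigma> * S ^ 3 * L\<^sup>2 * wt \<sigma> K)"
    unfolding F_def S_def using N by (intro large_direction_sum \<sigma> L1) auto
  also have "nsum F A \<le> ennreal (432 * 3 powr \<sigma> * S\<^sup>2 * L\<^sup>2 * ln L * wt \<sigma> K)"
  proof -
    have "nsum F A \<le> nsum (\<lambda>w. ennreal (27 * 3 powr \<sigma> * wt \<sigma> K * S\<^sup>2 * L\<^sup>2 * (1 / (real (supn w))\<^sup>2))) A"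
    proof (intro nsum_mono)
      fix w assume w: "w \<in> A"
      then have w0: "w \<noteq> 0" and wN: "supn w \<le> N" by (auto simp: A_def)
      have s1: "real (supn w) \<ge> 1" using w0 supn_0_iff[of w] by linarith
      have "F w \<le> nsum (\<lambda>a. nsum (\<lambda>b. lrect \<sigma> L K (iscale a w) (iscale b (iperp w))) UNIV) UNIV"
        unfolding F_def by (rule nsum_subset) auto
      also have "\<dots> \<le> ennreal (3 * 3 powr \<sigma> * wt \<sigma> K * (S * (1 + L / norm (ivec w)))\<^sup>2)"
        unfolding S_def using L1 w0 by (intro resonant_fibre_sum \<sigma>) auto
      also have "\<dots> \<le> ennreal (27 * 3 powr \<sigma> * wt \<sigma> K * S\<^sup>2 * L\<^sup>2 * (1 / (real (supn w))\<^sup>2))"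
      proof (rule ennreal_leI)
        have "1 \<le> L / real (supn w)" using s1 wN N by (simp add: field_simps)
        moreover have "L / norm (ivec w) \<le> L / real (supn w)"
          using s1 supn_le_norm[of w] L1 by (intro divide_left_mono) (auto intro!: mult_pos_pos)
        ultimately have "1 + L / norm (ivec w) \<le> 3 * (L / real (supn w))" by linarith
        then have "(S * (1 + L / norm (ivec w)))\<^sup>2 \<le> (S * (3 * (L / real (supn w))))\<^sup>2"
          using S L1 by (intro power_mono mult_left_mono) auto
        then have "3 * 3 powr \<sigma> * wt \<sigma> K * (S * (1 + L / norm (ivec w)))\<^sup>2 \<le> 3 * 3 powr \<sigma> * wt \<sigma> K * (S * (3 * (L / real (supn w))))\<^sup>2"
          by (intro mult_left_mono) (auto simp: wt_nonneg)
        also have "\<dots> = 27 * 3 powr \<sigma> * wt \<sigma> K * S\<^sup>2 * L\<^sup>2 * (1 / (real (supn w))\<^sup>2)"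
          by (simp add: power_mult_distrib power_divide)
        finally show "3 * 3 powr \<sigma> * wt \<sigma> K * (S * (1 + L / norm (ivec w)))\<^sup>2 \<le> 27 * 3 powr \<sigma> * wt \<sigma> K * S\<^sup>2 * L\<^sup>2 * (1 / (real (supn w))\<^sup>2)" .
      qed
      finally show "F w \<le> ennreal (27 * 3 powr \<sigma> * wt \<sigma> K * S\<^sup>2 * L\<^sup>2 * (1 / (real (supn w))\<^sup>2))" .
    qed
    also have "\<dots> = ennreal (\<Sum>w\<in>A. 27 * 3 powr \<sigma> * wt \<sigma> K * S\<^sup>2 * L\<^sup>2 * (1 / (real (supn w))\<^sup>2))"
      unfolding nn_integral_count_space_finite[OF finA] by (intro sum_ennreal) (auto simp: wt_nonneg)
    also have "(\<Sum>w\<in>A. 27 * 3 powr \<sigma> * wt \<sigma> K * S\<^sup>2 * L\<^sup>2 * (1 / (real (supn w))\<^sup>2)) = 27 * 3 powr \<sigma> * wt \<sigma> K * S\<^sup>2 * L\<^sup>2 * (\<Sum>w\<in>A. 1 / (real (supn w))\<^sup>2)"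
      by (simp add: sum_distrib_left)
    also have "(\<Sum>w\<in>A. 1 / (real (supn w))\<^sup>2) = (\<Sum>k=1..N. 8 * real k * (1 / (real k)\<^sup>2))"
      unfolding A_def by (rule sum_box)
    also have "\<dots> = 8 * harm N"
      unfolding harm_def sum_distrib_left by (intro sum.cong) (auto simp: power2_eq_square field_simps)
    also have "ennreal (27 * 3 powr \<sigma> * wt \<sigma> K * S\<^sup>2 * L\<^sup>2 * (8 * harm N)) \<le> ennreal (27 * 3 powr \<sigma> * wt \<sigma> K * S\<^sup>2 * L\<^sup>2 * (16 * ln L))"
    proof (intro ennreal_leI mult_left_mono)
      have "harm N \<le> 1 + ln (real N)" by (rule harm_le[OF N(3)])
      also have "ln (real N) \<le> ln L" using N by (subst ln_le_cancel_iff) auto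
      finally show "8 * harm N \<le> 16 * ln L" using lnL by linarith
    qed (auto simp: wt_nonneg)
    also have "27 * 3 powr \<sigma> * wt \<sigma> K * S\<^sup>2 * L\<^sup>2 * (16 * ln L) = 432 * 3 powr \<sigma> * S\<^sup>2 * L\<^sup>2 * ln L * wt \<sigma> K" by simp
    finally show ?thesis .
  qed
  also have "ennreal (4 * S\<^sup>2 * L\<^sup>2 * wt \<sigma> K) + (ennreal (432 * 3 powr \<sigma> * S\<^sup>2 * L\<^sup>2 * ln L * wt \<sigma> K) + ennreal (44 * 3 powr \<sigma> * S ^ 3 * L\<^sup>2 * wt \<sigma> K))
     = ennreal (4 * S\<^sup>2 * L\<^sup>2 * wt \<sigma> K + (432 * 3 powr \<sigma> * S\<^sup>2 * L\<^sup>2 * ln L * wt \<sigma> K + 44 * 3 powr \<sigma> * S ^ 3 * L\<^sup>2 * wt \<sigma> K))"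
    using S lnL by (simp add: wt_nonneg)
  also have "\<dots> \<le> ennreal (res_const \<sigma> * L\<^sup>2 * ln L * wt \<sigma> K)"
  proof (rule ennreal_leI)
    define x where "x = L\<^sup>2 * wt \<sigma> K"
    have x: "x \<ge> 0" by (simp add: x_def wt_nonneg)
    have t: "3 powr \<sigma> \<ge> 1" using \<sigma> by (simp add: ge_one_powr_ge_zero)
    have S23: "S\<^sup>2 \<le> S ^ 3" using S by (intro power_increasing) auto
    have 1: "1 * S\<^sup>2 * 1 * x \<le> 3 powr \<sigma> * S ^ 3 * ln L * x"
      using x t S23 lnL S by (intro mult_right_mono mult_mono) auto
    have 2: "3 powr \<sigma> * S\<^sup>2 * ln L * x \<le> 3 powr \<sigma> * S ^ 3 * ln L * x"
      using x t S23 lnL S by (intro mult_right_mono mult_mono) auto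
    have 3: "3 powr \<sigma> * S ^ 3 * 1 * x \<le> 3 powr \<sigma> * S ^ 3 * ln L * x"
      using x t S23 lnL S by (intro mult_right_mono mult_mono) auto
    show "4 * S\<^sup>2 * L\<^sup>2 * wt \<sigma> K + (432 * 3 powr \<sigma> * S\<^sup>2 * L\<^sup>2 * ln L * wt \<sigma> K + 44 * 3 powr \<sigma> * S ^ 3 * L\<^sup>2 * wt \<sigma> K)
       \<le> res_const \<sigma> * L\<^sup>2 * ln L * wt \<sigma> K"
      using 1 2 3 by (simp add: res_const_def S_def[symmetric] x_def algebra_simps)
  qed
  finally show ?thesis by (simp add: add_mono)
qed

section \<open>Sums as integrals over cells\<close>

lemma summable_of_nsum:
  fixes c :: "'a \<Rightarrow> 'b::banach"
  assumes le: "nsum (\<lambda>i. ennreal (norm (c i))) I \<le> ennreal C" and C: "C \<ge> 0"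
  shows "(\<lambda>i. norm (c i)) summable_on I" "c summable_on I" "norm (infsum c I) \<le> C"
    "infsum (\<lambda>i. norm (c i)) I \<le> C"
proof -
  have fin: "(\<Sum>i\<in>F. norm (c i)) \<le> C" if "finite F" "F \<subseteq> I" for F
  proof -
    have "ennreal (\<Sum>i\<in>F. norm (c i)) = (\<Sum>i\<in>F. ennreal (norm (c i)))" by (rule sum_ennreal[symmetric]) auto
    also have "\<dots> = nsum (\<lambda>i. ennreal (norm (c i))) F" using that by (simp add: nn_integral_count_space_finite)
    also have "\<dots> \<le> nsum (\<lambda>i. ennreal (norm (c i))) I" by (rule nsum_subset[OF that(2)])
    finally show ?thesis using le C by (meson ennreal_le_iff order_trans)
  qed
  show s: "(\<lambda>i. norm (c i)) summable_on I"
    by (rule nonneg_bdd_above_summable_on) (auto intro!: bdd_aboveI[where M=C] fin)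
  then show "c summable_on I" by (rule abs_summable_summable)
  show i: "infsum (\<lambda>i. norm (c i)) I \<le> C"
    by (rule infsum_le_finite_sums[OF s]) (auto intro: fin)
  show "norm (infsum c I) \<le> C" using norm_infsum_bound[OF s] i by linarith
qed

lemma integrable_count_space_iff:
  fixes f :: "'a \<Rightarrow> 'b::{banach, second_countable_topology}"
  shows "integrable (count_space I) f \<longleftrightarrow> (\<lambda>i. norm (f i)) summable_on I"
  using abs_summable_equivalent[of f I] unfolding Infinite_Set_Sum.abs_summable_on_def by simp

lemma integral_count_space_eq_infsum:
  fixes f :: "'a \<Rightarrow> 'b::{banach, second_countable_topology}"
  assumes "integrable (count_space I) f"
  shows "integral\<^sup>L (count_space I) f = infsum f I"
  using infsetsum_infsum[of f I] assms unfolding infsetsum_def Infinite_Set_Sum.abs_summable_on_def by simp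

lemma nsum_of_summable:
  fixes f :: "'a \<Rightarrow> real"
  assumes "f summable_on I" "\<And>i. i \<in> I \<Longrightarrow> f i \<ge> 0"
  shows "nsum (\<lambda>i. ennreal (f i)) I = ennreal (infsum f I)"
proof -
  have "(\<lambda>i. norm (f i)) summable_on I"
    using assms(1) by (rule summable_on_cong[THEN iffD1, rotated]) (use assms(2) in auto)
  then have i: "integrable (count_space I) f"
    by (simp add: integrable_count_space_iff)
  have "nsum (\<lambda>i. ennreal (f i)) I = ennreal (integral\<^sup>L (count_space I) f)"
    using i by (rule nn_integral_eq_integral) (use assms in \<open>auto simp: AE_count_space\<close>)
  also have "integral\<^sup>L (count_space I) f = infsum f I"
    by (rule integral_count_space_eq_infsum[OF i])
  finally show ?thesis .
qed

text \<open>Each term of the sum differs from the mean of the integrand over its cell of unit measure by at most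
  the mean of \<open>m\<close> over the cell. This serves both for the rectangles of one direction and for the
  directions themselves.\<close>
lemma cell_sum:
  fixes f :: "'a \<Rightarrow> complex" and c :: "'i \<Rightarrow> complex" and m :: "'a \<Rightarrow> ennreal"
  assumes I: "countable I" and M: "sigma_finite_measure M"
    and Q: "\<And>i. i \<in> I \<Longrightarrow> Q i \<in> sets M" "disjoint_family_on Q I" "\<And>i. i \<in> I \<Longrightarrow> emeasure M (Q i) = 1"
    and f: "integrable M (\<lambda>x. indicator (\<Union>i\<in>I. Q i) x *\<^sub>R f x)" and fm [measurable]: "f \<in> borel_measurable M"
    and m [measurable]: "m \<in> borel_measurable M"
    and le: "\<And>i x. i \<in> I \<Longrightarrow> x \<in> Q i \<Longrightarrow> ennreal (norm (c i - f x)) \<le> m x"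
    and E: "(\<integral>\<^sup>+x. m x \<partial>M) \<le> ennreal E" "E \<ge> 0"
  shows "c summable_on I" "(\<lambda>i. norm (c i)) summable_on I"
    "norm (infsum c I - (\<integral>x. indicator (\<Union>i\<in>I. Q i) x *\<^sub>R f x \<partial>M)) \<le> E"
proof -
  define S where "S = (\<Union>i\<in>I. Q i)"
  interpret M: sigma_finite_measure M by fact
  interpret P: pair_sigma_finite "count_space I" M
    by (intro pair_sigma_finite.intro sigma_finite_measure_count_space_countable I M)
  have Sm [measurable]: "S \<in> sets M" unfolding S_def using I Q(1) by (intro sets.countable_UN') auto
  have one: "nsum (\<lambda>i. indicator (Q i) x) I = indicator S x" for x
  proof (cases "x \<in> S")
    case True
    then obtain j where j: "j \<in> I" "x \<in> Q j" by (auto simp: S_def)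
    have "nsum (\<lambda>i. indicator (Q i) x) I = nsum (\<lambda>i. indicator {j} i) I"
    proof (intro nn_integral_cong)
      fix i assume "i \<in> space (count_space I)"
      then have "i \<in> I" by simp
      then show "(indicator (Q i) x :: ennreal) = indicator {j} i"
        using j Q(2) by (auto simp: disjoint_family_on_def indicator_def)
    qed
    then show ?thesis using j True by (simp add: one_ennreal_def[symmetric])
  next
    case False
    then have "nsum (\<lambda>i. indicator (Q i) x) I = nsum (\<lambda>i. 0) I"
      by (intro nn_integral_cong) (auto simp: S_def indicator_def)
    then show ?thesis using False by simp
  qed
  define H where "H = (\<lambda>i x. indicator (Q i) x *\<^sub>R f x)"
  have Hm: "(\<lambda>(i, x). H i x) \<in> borel_measurable (count_space I \<Otimes>\<^sub>M M)"
  proof (rule measurable_pair_measure_countable1[OF I])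
    fix i assume "i \<in> I"
    then have [measurable]: "Q i \<in> sets M" by (rule Q(1))
    show "(\<lambda>y. (\<lambda>(i, x). H i x) (i, y)) \<in> borel_measurable M" unfolding H_def by simp
  qed
  have Hi: "integrable (count_space I \<Otimes>\<^sub>M M) (\<lambda>(i, x). H i x)"
  proof (rule integrableI_bounded[OF Hm])
    have "(\<integral>\<^sup>+z. ennreal (norm (case z of (i, x) \<Rightarrow> H i x)) \<partial>(count_space I \<Otimes>\<^sub>M M))
       = (\<integral>\<^sup>+x. nsum (\<lambda>i. ennreal (norm (H i x))) I \<partial>M)"
      using Hm by (subst P.nn_integral_snd[symmetric]) auto
    also have "\<dots> = (\<integral>\<^sup>+x. ennreal (norm (indicator S x *\<^sub>R f x)) \<partial>M)"
    proof (intro nn_integral_cong)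
      fix x
      have "nsum (\<lambda>i. ennreal (norm (H i x))) I = nsum (\<lambda>i. ennreal (norm (f x)) * indicator (Q i) x) I"
        by (intro nn_integral_cong) (auto simp: H_def indicator_def)
      also have "\<dots> = ennreal (norm (f x)) * indicator S x" by (simp add: nsum_cmult one)
      finally show "nsum (\<lambda>i. ennreal (norm (H i x))) I = ennreal (norm (indicator S x *\<^sub>R f x))"
        by (simp add: indicator_def)
    qed
    also have "\<dots> < \<infinity>" using f unfolding S_def[symmetric] by (simp add: integrable_iff_bounded)
    finally show "(\<integral>\<^sup>+z. ennreal (norm (case z of (i, x) \<Rightarrow> H i x)) \<partial>(count_space I \<Otimes>\<^sub>M M)) < \<infinity>" .
  qed
  define a where "a = (\<lambda>i. \<integral>x. H i x \<partial>M)"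
  have ai: "integrable (count_space I) a" unfolding a_def by (rule P.integrable_fst[OF Hi])
  have a_abs: "(\<lambda>i. norm (a i)) summable_on I"
    using ai by (simp add: integrable_count_space_iff)
  have asum: "infsum a I = (\<integral>x. indicator S x *\<^sub>R f x \<partial>M)"
  proof -
    have "infsum a I = integral\<^sup>L (count_space I) a"
      by (rule integral_count_space_eq_infsum[OF ai, symmetric])
    also have "\<dots> = (\<integral>x. (\<integral>i. H i x \<partial>count_space I) \<partial>M)"
      unfolding a_def using P.Fubini_integral[OF Hi] by simp
    also have "\<dots> = (\<integral>x. indicator S x *\<^sub>R f x \<partial>M)"
    proof (intro Bochner_Integration.integral_cong refl)
      fix x
      have "(\<integral>i. H i x \<partial>count_space I) = (\<integral>i. indicator (Q i) x \<partial>count_space I) *\<^sub>R f x"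
        unfolding H_def by (rule integral_scaleR_left) 
          (auto simp: integrable_iff_bounded one ennreal_indicator, auto simp: indicator_def)
      also have "(\<integral>i. indicator (Q i) x \<partial>count_space I) = (indicator S x :: real)"
      proof -
        have "(\<integral>i. indicator (Q i) x \<partial>count_space I) = enn2real (nsum (\<lambda>i. ennreal (indicator (Q i) x)) I)"
          by (rule integral_eq_nn_integral) auto
        also have "\<dots> = enn2real (indicator S x)" by (simp only: ennreal_indicator one)
        finally show ?thesis by (cases "x \<in> S") auto
      qed
      finally show "(\<integral>i. H i x \<partial>count_space I) = indicator S x *\<^sub>R f x" .
    qed
    finally show ?thesis .
  qed
  have fQ: "integrable M (H i)" if i: "i \<in> I" for i
  proof -
    have [measurable]: "Q i \<in> sets M" by (rule Q(1)[OF i])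
    show ?thesis
      by (rule Bochner_Integration.integrable_bound[OF f])
         (use i in \<open>auto simp: H_def indicator_def\<close>)
  qed
  have diff: "ennreal (norm (c i - a i)) \<le> (\<integral>\<^sup>+x. indicator (Q i) x * m x \<partial>M)" if i: "i \<in> I" for i
  proof -
    have [measurable]: "Q i \<in> sets M" by (rule Q(1)[OF i])
    have ic: "integrable M (\<lambda>x. indicator (Q i) x *\<^sub>R c i)"
      using Q(3)[OF i] by (intro integrable_scaleR_left) (simp add: integrable_indicator_iff)
    have "(\<integral>x. indicator (Q i) x *\<^sub>R c i \<partial>M) = c i"
      using Q(3)[OF i] by (simp add: measure_def)
    then have "c i - a i = (\<integral>x. indicator (Q i) x *\<^sub>R c i - H i x \<partial>M)"
      unfolding a_def using ic fQ[OF i] by simp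
    then have "ennreal (norm (c i - a i)) \<le> (\<integral>\<^sup>+x. ennreal (norm (indicator (Q i) x *\<^sub>R c i - H i x)) \<partial>M)"
      using integral_norm_bound_ennreal[of M "\<lambda>x. indicator (Q i) x *\<^sub>R c i - H i x"] ic fQ[OF i] by simp
    also have "\<dots> \<le> (\<integral>\<^sup>+x. indicator (Q i) x * m x \<partial>M)"
      using le[OF i] by (intro nn_integral_mono) (auto simp: H_def indicator_def)
    finally show ?thesis .
  qed
  have dsum: "nsum (\<lambda>i. ennreal (norm (c i - a i))) I \<le> ennreal E"
  proof -
    have "nsum (\<lambda>i. ennreal (norm (c i - a i))) I \<le> nsum (\<lambda>i. \<integral>\<^sup>+x. indicator (Q i) x * m x \<partial>M) I"
      by (intro nsum_mono diff)
    also have "\<dots> = (\<integral>\<^sup>+x. nsum (\<lambda>i. indicator (Q i) x * m x) I \<partial>M)"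
      by (rule nn_integral_count_space_nn_integral[OF I, symmetric]) (use Q(1) in measurable)
    also have "\<dots> = (\<integral>\<^sup>+x. indicator S x * m x \<partial>M)" by (simp add: nsum_multc one)
    also have "\<dots> \<le> (\<integral>\<^sup>+x. m x \<partial>M)" by (intro nn_integral_mono) (auto simp: indicator_def)
    finally show ?thesis using E by order
  qed
  note d = summable_of_nsum[OF dsum E(2)]
  have c_abs: "(\<lambda>i. norm (c i)) summable_on I"
  proof (rule summable_on_comparison_test[OF summable_on_add[OF d(1) a_abs]])
    show "norm (c i) \<le> norm (c i - a i) + norm (a i)" for i by (metis diff_add_cancel norm_triangle_ineq)
  qed auto
  then show "(\<lambda>i. norm (c i)) summable_on I" .
  show cs: "c summable_on I" by (rule abs_summable_summable[OF c_abs])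
  have "infsum c I - infsum a I = infsum (\<lambda>i. c i - a i) I"
    using infsum_add[OF d(2) abs_summable_summable[OF a_abs]] by simp
  then show "norm (infsum c I - (\<integral>x. indicator (\<Union>i\<in>I. Q i) x *\<^sub>R f x \<partial>M)) \<le> E"
    using d(3) asum by (simp add: S_def)
qed

lemma Basis_real2: "(Basis :: (real^2) set) = {axis 1 1, axis 2 1}"
  by (auto simp: Basis_vec_def UNIV_2)

lemma axis_12: "axis 1 1 \<noteq> (axis 2 1 :: real^2)"
  by (simp add: axis_eq_axis)

lemma box_real2: "box l u = {x::real^2. l$1 < x$1 \<and> x$1 < u$1 \<and> l$2 < x$2 \<and> x$2 < u$2}"
  by (auto simp: box_def Basis_real2 inner_axis)

lemma vec2_alt: "vec2 a b = a *\<^sub>R axis 1 1 + b *\<^sub>R axis 2 1"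
  by (simp add: vec_eq_iff forall_2 axis_def)

lemma vec2_measurable [measurable (raw)]:
  "f \<in> borel_measurable M \<Longrightarrow> g \<in> borel_measurable M \<Longrightarrow> (\<lambda>x. vec2 (f x) (g x)) \<in> borel_measurable M"
  unfolding vec2_alt by (intro borel_measurable_add borel_measurable_scaleR borel_measurable_const)

lemma perp_measurable [measurable]: "perp \<in> borel_measurable borel"
  by (intro borel_measurable_continuous_onI continuous_on_perp continuous_on_id)

lemma prod_Basis_real2: "(\<Prod>b\<in>(Basis::(real^2) set). (u - l) \<bullet> b) = (u$1 - l$1) * (u$2 - l$2)"
  by (simp add: Basis_real2 axis_12 inner_axis)

lemma lborel_real2: "(lborel :: (real^2) measure) = distr (lborel \<Otimes>\<^sub>M lborel) borel (\<lambda>(a, b). vec2 a b)"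
proof (rule lborel_eqI)
  fix l u :: "real^2"
  assume le: "\<And>b. b \<in> Basis \<Longrightarrow> l \<bullet> b \<le> u \<bullet> b"
  have le': "l$1 \<le> u$1" "l$2 \<le> u$2"
    using le[of "axis 1 1"] le[of "axis 2 1"] by (auto simp: Basis_real2 inner_axis)
  have "(\<lambda>(a, b). vec2 a b) -` box l u = {l$1<..<u$1} \<times> {l$2<..<u$2}"
    by (auto simp: box_real2)
  then have "emeasure (distr (lborel \<Otimes>\<^sub>M lborel) borel (\<lambda>(a, b). vec2 a b)) (box l u)
      = emeasure (lborel \<Otimes>\<^sub>M lborel) ({l$1<..<u$1} \<times> {l$2<..<u$2})"
    by (subst emeasure_distr) (auto simp: space_pair_measure)
  also have "\<dots> = emeasure lborel {l$1<..<u$1} * emeasure lborel {l$2<..<u$2}"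
    by (rule lborel.emeasure_pair_measure_Times) auto
  also have "\<dots> = ennreal ((u$1 - l$1) * (u$2 - l$2))" using le' by (simp add: ennreal_mult)
  finally show "emeasure (distr (lborel \<Otimes>\<^sub>M lborel) borel (\<lambda>(a, b). vec2 a b)) (box l u) = (\<Prod>b\<in>Basis. (u - l) \<bullet> b)"
    unfolding prod_Basis_real2 .
qed simp

lemma nn_integral_real2:
  assumes [measurable]: "f \<in> borel_measurable borel"
  shows "(\<integral>\<^sup>+x. f x \<partial>(lborel :: (real^2) measure)) = (\<integral>\<^sup>+a. \<integral>\<^sup>+b. f (vec2 a b) \<partial>lborel \<partial>lborel)"
    and "(\<integral>\<^sup>+x. f x \<partial>(lborel :: (real^2) measure)) = (\<integral>\<^sup>+b. \<integral>\<^sup>+a. f (vec2 a b) \<partial>lborel \<partial>lborel)"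
proof -
  have e: "(\<integral>\<^sup>+x. f x \<partial>(lborel :: (real^2) measure)) = (\<integral>\<^sup>+z. f (vec2 (fst z) (snd z)) \<partial>(lborel \<Otimes>\<^sub>M lborel))"
    by (subst lborel_real2, subst nn_integral_distr) (auto simp: case_prod_beta')
  show "(\<integral>\<^sup>+x. f x \<partial>(lborel :: (real^2) measure)) = (\<integral>\<^sup>+a. \<integral>\<^sup>+b. f (vec2 a b) \<partial>lborel \<partial>lborel)"
    unfolding e by (subst lborel.nn_integral_fst[symmetric]) auto
  show "(\<integral>\<^sup>+x. f x \<partial>(lborel :: (real^2) measure)) = (\<integral>\<^sup>+b. \<integral>\<^sup>+a. f (vec2 a b) \<partial>lborel \<partial>lborel)"
    unfolding e by (subst lborel_pair.nn_integral_snd[symmetric]) auto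
qed

lemma integral_real2:
  fixes f :: "real^2 \<Rightarrow> 'a::{banach, second_countable_topology}"
  assumes f: "integrable lborel f"
  shows "(\<integral>x. f x \<partial>lborel) = (\<integral>a. \<integral>b. f (vec2 a b) \<partial>lborel \<partial>lborel)"
proof -
  have [measurable]: "f \<in> borel_measurable borel" using f by auto
  have i: "integrable (lborel \<Otimes>\<^sub>M lborel) (\<lambda>(a, b). f (vec2 a b))"
    using f by (subst (asm) lborel_real2, subst (asm) integrable_distr_eq) (auto simp: case_prod_beta')
  have "(\<integral>x. f x \<partial>lborel) = (\<integral>z. f (vec2 (fst z) (snd z)) \<partial>(lborel \<Otimes>\<^sub>M lborel))"
    by (subst lborel_real2, subst integral_distr) (auto simp: case_prod_beta')
  also have "\<dots> = (\<integral>a. \<integral>b. f (vec2 a b) \<partial>lborel \<partial>lborel)"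
    using lborel_pair.integral_fst[OF i] by (simp add: case_prod_beta')
  finally show ?thesis .
qed

lemma lborel_perp: "(lborel :: (real^2) measure) = distr lborel borel perp"
proof (rule lborel_eqI)
  fix l u :: "real^2"
  assume le: "\<And>b. b \<in> Basis \<Longrightarrow> l \<bullet> b \<le> u \<bullet> b"
  have le': "l$1 \<le> u$1" "l$2 \<le> u$2"
    using le[of "axis 1 1"] le[of "axis 2 1"] by (auto simp: Basis_real2 inner_axis)
  have "perp -` box l u = box (vec2 (l$2) (- u$1)) (vec2 (u$2) (- l$1))"
    by (auto simp: box_real2)
  then have "emeasure (distr lborel borel perp) (box l u) = emeasure lborel (box (vec2 (l$2) (- u$1)) (vec2 (u$2) (- l$1)))"
    by (subst emeasure_distr) auto
  also have "\<dots> = ennreal (\<Prod>b\<in>Basis. (vec2 (u$2) (- l$1) - vec2 (l$2) (- u$1)) \<bullet> b)"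
    using le' by (intro emeasure_lborel_box) (auto simp: Basis_real2 inner_axis)
  also have "\<dots> = (\<Prod>b\<in>Basis. (u - l) \<bullet> b)"
    unfolding prod_Basis_real2 by (simp add: mult.commute)
  finally show "emeasure (distr lborel borel perp) (box l u) = (\<Prod>b\<in>Basis. (u - l) \<bullet> b)" .
qed simp

lemma integral_perp:
  fixes f :: "real^2 \<Rightarrow> 'a::{banach, second_countable_topology}"
  assumes [measurable]: "f \<in> borel_measurable borel"
  shows "(\<integral>x. f (perp x) \<partial>lborel) = (\<integral>x. f x \<partial>lborel)"
proof -
  have "(\<integral>x. f x \<partial>lborel) = (\<integral>x. f x \<partial>(distr lborel borel perp))" by (subst lborel_perp) simp
  also have "\<dots> = (\<integral>x. f (perp x) \<partial>lborel)" by (rule integral_distr) auto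
  finally show ?thesis by simp
qed

lemma nn_integral_scaleR:
  fixes f :: "'a::euclidean_space \<Rightarrow> ennreal"
  assumes [measurable]: "f \<in> borel_measurable borel" and c: "c \<noteq> 0"
  shows "(\<integral>\<^sup>+x. f x \<partial>lborel) = ennreal (\<bar>c\<bar> ^ DIM('a)) * (\<integral>\<^sup>+x. f (t + c *\<^sub>R x) \<partial>lborel)"
  by (subst lborel_affine[OF c, of t])
     (simp add: nn_integral_density nn_integral_distr nn_integral_cmult)

lemma integral_scaleR_arg:
  fixes f :: "'a::euclidean_space \<Rightarrow> 'b::{banach, second_countable_topology}"
  assumes [measurable]: "f \<in> borel_measurable borel" and c: "c \<noteq> 0"
  shows "(\<integral>x. f x \<partial>lborel) = (\<bar>c\<bar> ^ DIM('a)) *\<^sub>R (\<integral>x. f (t + c *\<^sub>R x) \<partial>lborel)"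
  by (subst lborel_affine[OF c, of t])
     (simp add: integral_density integral_distr)

section \<open>Profiles and fans of rectangles\<close>

lemma wt_continuous: "continuous_on UNIV (wt \<sigma> :: 'a::real_normed_vector \<Rightarrow> real)"
proof -
  have "continuous_on UNIV (\<lambda>x::'a. (1 + (norm x)\<^sup>2) powr (- (\<sigma> / 2)))"
    by (intro continuous_intros) (auto simp: add_pos_nonneg less_imp_neq[symmetric])
  then show ?thesis by (simp add: wt_alt[abs_def])
qed

lemma wt_measurable [measurable]: "(wt \<sigma> :: real^2 \<Rightarrow> real) \<in> borel_measurable borel"
  by (rule borel_measurable_continuous_onI[OF wt_continuous])

lemma rect_wt_integral:
  assumes \<sigma>: "\<sigma> > 2" and x: "x \<noteq> 0"
  shows "(\<integral>\<^sup>+z. ennreal (rect_wt \<sigma> K (z$1 *\<^sub>R x) (z$2 *\<^sub>R perp x)) \<partial>(lborel :: (real^2) measure))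
    \<le> ennreal (3 * 3 powr \<sigma> * wt \<sigma> K * (lsum_const \<sigma> / norm x)\<^sup>2)"
proof -
  define M where "M = ennreal (lsum_const \<sigma> / norm x)"
  define c where "c = ennreal (3 powr \<sigma> * wt \<sigma> K)"
  have px: "perp x \<noteq> 0" using x norm_perp[of x] by fastforce
  have A: "(\<integral>\<^sup>+u. ewt \<sigma> (d + u *\<^sub>R x) \<partial>lborel) \<le> M" for d
    using wt_line_integral[OF \<sigma> x, of d] by (simp add: M_def)
  have A': "(\<integral>\<^sup>+u. ewt \<sigma> (d + u *\<^sub>R perp x) \<partial>lborel) \<le> M" for d
    using wt_line_integral[OF \<sigma> px, of d] by (simp add: M_def)
  have prod: "(\<integral>\<^sup>+u. \<integral>\<^sup>+v. f u * g u v \<partial>lborel \<partial>lborel) \<le> M * M"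
    if [measurable]: "f \<in> borel_measurable lborel" "\<And>u. g u \<in> borel_measurable lborel"
      and g: "\<And>u. (\<integral>\<^sup>+v. g u v \<partial>lborel) \<le> M" and f: "(\<integral>\<^sup>+u. f u \<partial>lborel) \<le> M"
    for f :: "real \<Rightarrow> ennreal" and g :: "real \<Rightarrow> real \<Rightarrow> ennreal"
  proof -
    have "(\<integral>\<^sup>+u. \<integral>\<^sup>+v. f u * g u v \<partial>lborel \<partial>lborel) \<le> (\<integral>\<^sup>+u. f u * M \<partial>lborel)"
      using g by (intro nn_integral_mono) (simp add: nn_integral_cmult mult_left_mono)
    also have "\<dots> = (\<integral>\<^sup>+u. f u \<partial>lborel) * M" by (rule nn_integral_multc) simp
    also have "\<dots> \<le> M * M" by (intro mult_right_mono f) simp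
    finally show ?thesis .
  qed
  have 1: "(\<integral>\<^sup>+z. ewt \<sigma> (K + z$2 *\<^sub>R perp x) * ewt \<sigma> (K + z$2 *\<^sub>R perp x + z$1 *\<^sub>R x) \<partial>(lborel :: (real^2) measure)) \<le> M * M"
    by (subst nn_integral_real2(2)) (auto intro!: prod A A')
  have 2: "(\<integral>\<^sup>+z. ewt \<sigma> (K + z$2 *\<^sub>R perp x) * ewt \<sigma> (K + z$1 *\<^sub>R x) \<partial>(lborel :: (real^2) measure)) \<le> M * M"
    by (subst nn_integral_real2(2)) (auto intro!: prod A A')
  have 3: "(\<integral>\<^sup>+z. ewt \<sigma> (K + z$1 *\<^sub>R x) * ewt \<sigma> (K + z$1 *\<^sub>R x + z$2 *\<^sub>R perp x) \<partial>(lborel :: (real^2) measure)) \<le> M * M"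
    by (subst nn_integral_real2(1)) (auto intro!: prod A A')
  have "(\<integral>\<^sup>+z. ennreal (rect_wt \<sigma> K (z$1 *\<^sub>R x) (z$2 *\<^sub>R perp x)) \<partial>(lborel :: (real^2) measure))
    \<le> (\<integral>\<^sup>+z. c * (ewt \<sigma> (K + z$2 *\<^sub>R perp x) * ewt \<sigma> (K + z$2 *\<^sub>R perp x + z$1 *\<^sub>R x)
        + ewt \<sigma> (K + z$2 *\<^sub>R perp x) * ewt \<sigma> (K + z$1 *\<^sub>R x)
        + ewt \<sigma> (K + z$1 *\<^sub>R x) * ewt \<sigma> (K + z$1 *\<^sub>R x + z$2 *\<^sub>R perp x)) \<partial>(lborel :: (real^2) measure))"
    unfolding c_def using \<sigma> by (intro nn_integral_mono rect_wt_le) auto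
  also have "\<dots> = c * ((\<integral>\<^sup>+z. ewt \<sigma> (K + z$2 *\<^sub>R perp x) * ewt \<sigma> (K + z$2 *\<^sub>R perp x + z$1 *\<^sub>R x) \<partial>(lborel :: (real^2) measure))
     + (\<integral>\<^sup>+z. ewt \<sigma> (K + z$2 *\<^sub>R perp x) * ewt \<sigma> (K + z$1 *\<^sub>R x) \<partial>(lborel :: (real^2) measure))
     + (\<integral>\<^sup>+z. ewt \<sigma> (K + z$1 *\<^sub>R x) * ewt \<sigma> (K + z$1 *\<^sub>R x + z$2 *\<^sub>R perp x) \<partial>(lborel :: (real^2) measure)))"
    by (simp add: nn_integral_cmult nn_integral_add)
  also have "\<dots> \<le> c * (M * M + M * M + M * M)"
    by (intro mult_left_mono add_mono 1 2 3) auto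
  also have "\<dots> = ennreal (3 * 3 powr \<sigma> * wt \<sigma> K * (lsum_const \<sigma> / norm x)\<^sup>2)"
  proof -
    have "0 \<le> lsum_const \<sigma> / norm x" using lsum_const_ge_1[of \<sigma>] by simp
    then have "c * (M * M + M * M + M * M) = ennreal (3 powr \<sigma> * wt \<sigma> K * (lsum_const \<sigma> / norm x * (lsum_const \<sigma> / norm x) + lsum_const \<sigma> / norm x * (lsum_const \<sigma> / norm x) + lsum_const \<sigma> / norm x * (lsum_const \<sigma> / norm x)))"
      unfolding M_def c_def
      by (simp only: ennreal_mult'[symmetric] ennreal_plus[symmetric] wt_nonneg mult_nonneg_nonneg add_nonneg_nonneg powr_ge_zero)
    then show ?thesis by (simp add: power2_eq_square algebra_simps)
  qed
  finally show ?thesis .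
qed

lemma rect_wt_mono_exp: "\<sigma> \<le> \<sigma>' \<Longrightarrow> rect_wt \<sigma>' K y z \<le> rect_wt \<sigma> K y z"
  unfolding rect_wt_def by (intro mult_mono wt_mono_exp) (auto simp: wt_nonneg)

text \<open>Each side is as long as the opposite one, whose end points are corners other than \<open>K\<close>, and is bounded
  by the brackets of those. The extra power of the weights is thus what pays for displacements that
  are proportional to the size of the rectangle.\<close>
lemma rect_wt_gain:
  "(norm y + norm z) * rect_wt (\<sigma> + 1) K y z \<le> 6 * rect_wt \<sigma> K y z"
proof -
  define a where "a = japanese_bracket (K + y)"
  define b where "b = japanese_bracket (K + y + z)"
  define c where "c = japanese_bracket (K + z)"
  have y: "norm y \<le> b + c"
    using norm_triangle_ineq4[of "K + y + z" "K + z"] norm_le_jb[of "K + y + z"] norm_le_jb[of "K + z"]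
    by (simp add: b_def c_def)
  have z: "norm z \<le> a + b"
    using norm_triangle_ineq4[of "K + y + z" "K + y"] norm_le_jb[of "K + y + z"] norm_le_jb[of "K + y"]
    by (simp add: b_def a_def)
  have pos: "a > 0" "b > 0" "c > 0" by (simp_all add: a_def b_def c_def jb_pos)
  have ma: "a * rect_wt (\<sigma> + 1) K y z \<le> rect_wt \<sigma> K y z"
  proof -
    have "wt (\<sigma> + 1) (K + y) * a * wt (\<sigma> + 1) (K + y + z) * wt (\<sigma> + 1) (K + z) \<le> wt \<sigma> (K + y) * wt \<sigma> (K + y + z) * wt \<sigma> (K + z)"
      unfolding a_def wt_Suc_jb by (intro mult_mono wt_mono_exp) (auto simp: wt_nonneg)
    then show ?thesis by (simp add: rect_wt_def ac_simps)
  qed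
  have mb: "b * rect_wt (\<sigma> + 1) K y z \<le> rect_wt \<sigma> K y z"
  proof -
    have "wt (\<sigma> + 1) (K + y) * (wt (\<sigma> + 1) (K + y + z) * b) * wt (\<sigma> + 1) (K + z) \<le> wt \<sigma> (K + y) * wt \<sigma> (K + y + z) * wt \<sigma> (K + z)"
      unfolding b_def wt_Suc_jb by (intro mult_mono wt_mono_exp) (auto simp: wt_nonneg)
    then show ?thesis by (simp add: rect_wt_def ac_simps)
  qed
  have mc: "c * rect_wt (\<sigma> + 1) K y z \<le> rect_wt \<sigma> K y z"
  proof -
    have "wt (\<sigma> + 1) (K + y) * wt (\<sigma> + 1) (K + y + z) * (wt (\<sigma> + 1) (K + z) * c) \<le> wt \<sigma> (K + y) * wt \<sigma> (K + y + z) * wt \<sigma> (K + z)"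
      unfolding c_def wt_Suc_jb by (intro mult_mono wt_mono_exp) (auto simp: wt_nonneg)
    then show ?thesis by (simp add: rect_wt_def ac_simps)
  qed
  have "(norm y + norm z) * rect_wt (\<sigma> + 1) K y z \<le> (a + 2 * b + c) * rect_wt (\<sigma> + 1) K y z"
    using y z by (intro mult_right_mono rect_wt_nonneg) auto
  then have "(norm y + norm z) * rect_wt (\<sigma> + 1) K y z \<le> a * rect_wt (\<sigma> + 1) K y z + 2 * (b * rect_wt (\<sigma> + 1) K y z) + c * rect_wt (\<sigma> + 1) K y z"
    by (simp add: algebra_simps)
  then show ?thesis using ma mb mc rect_wt_nonneg[of \<sigma> K y z] by linarith
qed

definition tri :: "(real^2 \<Rightarrow> complex) \<Rightarrow> real^2 \<Rightarrow> real^2 \<Rightarrow> real^2 \<Rightarrow> complex" where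
  "tri g K y z = g (K + y) * cnj (g (K + y + z)) * g (K + z)"

lemma tri_swap: "tri g K y z = tri g K z y"
  by (simp add: tri_def algebra_simps)

text \<open>What the estimates at a fixed time need to know of a solution: the weighted bound and a weighted
  Lipschitz bound on its continuous representative, with one power more than the weights of the result.\<close>
locale profile =
  fixes \<sigma> B :: real and g :: "real^2 \<Rightarrow> complex"
  assumes \<sigma>: "\<sigma> > 2" and B: "B \<ge> 0"
    and cont: "continuous_on UNIV g"
    and bound: "\<And>x. norm (g x) \<le> B * wt (\<sigma> + 1) x"
    and lip: "\<And>x y. norm (x - y) \<le> 1 \<Longrightarrow> norm (g x - g y) \<le> B * norm (x - y) * wt (\<sigma> + 1) x"
begin

lemma g_measurable [measurable]: "g \<in> borel_measurable borel"
  by (rule borel_measurable_continuous_onI[OF cont])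

lemma tri_bound: "norm (tri g K y z) \<le> B ^ 3 * rect_wt (\<sigma> + 1) K y z"
proof -
  have "norm (tri g K y z) \<le> (B * wt (\<sigma> + 1) (K + y)) * (B * wt (\<sigma> + 1) (K + y + z)) * (B * wt (\<sigma> + 1) (K + z))"
    unfolding tri_def norm_mult complex_mod_cnj using B
    by (intro mult_mono bound) (auto simp: wt_nonneg)
  then show ?thesis by (simp add: rect_wt_def power3_eq_cube ac_simps)
qed

lemma tri_bound': "norm (tri g K y z) \<le> B ^ 3 * rect_wt \<sigma> K y z"
  using tri_bound[of K y z] mult_left_mono[OF rect_wt_mono_exp[of \<sigma> "\<sigma> + 1" K y z], of "B ^ 3"] B
  by simp

text \<open>Telescoping if \<open>D \<le> 1\<close>, and otherwise bounding both terms separately. Since the right-hand side only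
  has weights at the corners of a common rectangle, it can be summed by the bounds on rectangle sums.\<close>
lemma tri_diff:
  assumes "norm (y - y') \<le> D" "norm (z - z') \<le> D" "norm ((y + z) - (y' + z')) \<le> D"
  shows "norm (tri g K y z - tri g K y' z')
     \<le> 3 * 4 powr (\<sigma> + 1) * B ^ 3 * D * (rect_wt (\<sigma> + 1) K y z + rect_wt (\<sigma> + 1) K y' z')"
proof -
  define s where "s = \<sigma> + 1"
  have s: "s \<ge> 0" using \<sigma> by (simp add: s_def)
  have D: "D \<ge> 0" using assms(1) norm_ge_zero order_trans by blast
  have four: "4 powr s \<ge> 1" using s by (simp add: ge_one_powr_ge_zero)
  have B3: "B ^ 3 \<ge> 0" using B by simp
  note rn = rect_wt_nonneg[of s K y z] rect_wt_nonneg[of s K y' z']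
  show ?thesis
  proof (cases "D \<le> 1")
    case True
    define a where "a = g (K + y)"
    define b where "b = cnj (g (K + y + z))"
    define c where "c = g (K + z)"
    define a' where "a' = g (K + y')"
    define b' where "b' = cnj (g (K + y' + z'))"
    define c' where "c' = g (K + z')"
    have cmp: "wt s p' \<le> 2 powr s * wt s p" if "norm (p - p') \<le> D" for p p' :: "real^2"
    proof -
      have "wt s p' \<le> (1 + 1) powr s * wt s p" using that True s by (intro wt_compare) auto
      then show ?thesis by simp
    qed
    define wa where "wa = B * wt s (K + y)"
    define wb where "wb = B * wt s (K + y + z)"
    define wc where "wc = B * wt s (K + z)"
    have wnn: "wa \<ge> 0" "wb \<ge> 0" "wc \<ge> 0" using B by (simp_all add: wa_def wb_def wc_def wt_nonneg)
    have na: "norm (a - a') \<le> D * wa"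
    proof -
      have "norm (a - a') \<le> B * norm (y - y') * wt s (K + y)"
        using lip[of "K + y" "K + y'"] assms True by (simp add: a_def a'_def s_def)
      also have "\<dots> \<le> B * D * wt s (K + y)" using assms B by (intro mult_right_mono mult_left_mono) (auto simp: wt_nonneg)
      finally show ?thesis by (simp add: wa_def ac_simps)
    qed
    have nb: "norm (b - b') \<le> D * wb"
    proof -
      have e: "(K + y + z) - (K + y' + z') = (y + z) - (y' + z')" by simp
      have "norm (b - b') = norm (g (K + y + z) - g (K + y' + z'))"
        unfolding b_def b'_def by (simp flip: complex_cnj_diff)
      also have "\<dots> \<le> B * norm ((y + z) - (y' + z')) * wt s (K + y + z)"
        using lip[of "K + y + z" "K + y' + z'"] assms(3) True unfolding e s_def by simp
      also have "\<dots> \<le> B * D * wt s (K + y + z)" using assms B by (intro mult_right_mono mult_left_mono) (auto simp: wt_nonneg)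
      finally show ?thesis by (simp add: wb_def ac_simps)
    qed
    have nc: "norm (c - c') \<le> D * wc"
    proof -
      have "norm (c - c') \<le> B * norm (z - z') * wt s (K + z)"
        using lip[of "K + z" "K + z'"] assms True by (simp add: c_def c'_def s_def)
      also have "\<dots> \<le> B * D * wt s (K + z)" using assms B by (intro mult_right_mono mult_left_mono) (auto simp: wt_nonneg)
      finally show ?thesis by (simp add: wc_def ac_simps)
    qed
    have ba: "norm a' \<le> 2 powr s * wa"
    proof -
      have "norm a' \<le> B * wt s (K + y')" unfolding a'_def s_def by (rule bound)
      also have "\<dots> \<le> B * (2 powr s * wt s (K + y))" using assms B by (intro mult_left_mono cmp) auto
      finally show ?thesis by (simp add: wa_def ac_simps)
    qed
    have bb: "norm b' \<le> 2 powr s * wb"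
    proof -
      have "norm b' \<le> B * wt s (K + y' + z')" unfolding b'_def s_def complex_mod_cnj by (rule bound)
      also have "\<dots> \<le> B * (2 powr s * wt s (K + y + z))"
        using assms B by (intro mult_left_mono cmp) (auto simp: add.assoc)
      finally show ?thesis by (simp add: wb_def ac_simps)
    qed
    have bb0: "norm b \<le> wb" unfolding b_def complex_mod_cnj wb_def s_def by (rule bound)
    have bc0: "norm c \<le> wc" unfolding c_def wc_def s_def by (rule bound)
    have "tri g K y z - tri g K y' z' = (a - a') * b * c + a' * (b - b') * c + a' * b' * (c - c')"
      unfolding tri_def a_def b_def c_def a'_def b'_def c'_def by (simp add: algebra_simps)
    then have "norm (tri g K y z - tri g K y' z') \<le> norm ((a - a') * b * c) + norm (a' * (b - b') * c) + norm (a' * b' * (c - c'))"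
      by (simp add: norm_triangle_mono)
    also have "\<dots> \<le> (D * wa) * wb * wc + (2 powr s * wa) * (D * wb) * wc + (2 powr s * wa) * (2 powr s * wb) * (D * wc)"
      unfolding norm_mult using D wnn na nb nc ba bb bb0 bc0 by (intro add_mono mult_mono) auto
    also have "\<dots> = (1 + 2 powr s + 2 powr s * 2 powr s) * (D * (wa * wb * wc))"
      by (simp add: algebra_simps)
    also have "\<dots> \<le> (3 * 4 powr s) * (D * (wa * wb * wc))"
    proof (intro mult_right_mono)
      have e: "2 powr s * 2 powr s = 4 powr s" by (simp flip: powr_mult)
      have "1 * 2 powr s \<le> 2 powr s * 2 powr s" using s by (intro mult_right_mono) (auto simp: ge_one_powr_ge_zero)
      then show "1 + 2 powr s + 2 powr s * 2 powr s \<le> 3 * 4 powr s" using e four by linarith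
    qed (use D wnn in auto)
    also have "wa * wb * wc = B ^ 3 * rect_wt s K y z"
      by (simp add: wa_def wb_def wc_def rect_wt_def power3_eq_cube ac_simps)
    also have "3 * 4 powr s * (D * (B ^ 3 * rect_wt s K y z)) \<le> 3 * 4 powr s * (D * (B ^ 3 * (rect_wt s K y z + rect_wt s K y' z')))"
      using D B3 rn by (intro mult_left_mono) auto
    finally show ?thesis by (simp add: s_def ac_simps)
  next
    case False
    have "norm (tri g K y z - tri g K y' z') \<le> norm (tri g K y z) + norm (tri g K y' z')" by (rule norm_triangle_ineq4)
    also have "\<dots> \<le> 1 * 1 * (B ^ 3 * (rect_wt s K y z + rect_wt s K y' z'))"
      using tri_bound[of K y z] tri_bound[of K y' z'] by (simp add: s_def distrib_left)
    also have "\<dots> \<le> (3 * 4 powr s) * D * (B ^ 3 * (rect_wt s K y z + rect_wt s K y' z'))"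
      using False D four B3 rn by (intro mult_right_mono mult_mono) auto
    finally show ?thesis by (simp add: s_def ac_simps)
  qed
qed

text \<open>The contribution of all rectangles with one side in the direction \<open>x\<close>, their proportions being
  restricted to \<open>R\<close>: the continuous counterpart of the sum over one primitive direction.\<close>
definition fan_integral :: "(real^2) set \<Rightarrow> real^2 \<Rightarrow> real^2 \<Rightarrow> complex" where
  "fan_integral R K x = (\<integral>z. indicator R z *\<^sub>R tri g K (z$1 *\<^sub>R x) (z$2 *\<^sub>R perp x) \<partial>(lborel :: (real^2) measure))"

definition psi_const :: real where
  "psi_const = 3 * 3 powr \<sigma> * (lsum_const \<sigma>)\<^sup>2"

lemma psi_const_nonneg: "psi_const \<ge> 0"
  by (simp add: psi_const_def)

lemma tri_measurable [measurable (raw)]: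
  assumes [measurable]: "f \<in> borel_measurable M" "h \<in> borel_measurable M"
  shows "(\<lambda>x. tri g K (f x) (h x)) \<in> borel_measurable M"
proof -
  have c: "cnj \<in> borel_measurable borel"
    by (intro borel_measurable_continuous_onI continuous_intros)
  have "(\<lambda>x. K + f x) \<in> borel_measurable M" "(\<lambda>x. K + f x + h x) \<in> borel_measurable M"
    "(\<lambda>x. K + h x) \<in> borel_measurable M"
    by measurable
  then show ?thesis unfolding tri_def
    by (intro borel_measurable_times measurable_compose[OF _ g_measurable] measurable_compose[OF _ c])
qed

lemma rect_wt_fan:
  assumes "x \<noteq> 0"
  shows "(\<integral>\<^sup>+z. ennreal (rect_wt \<sigma> K (z$1 *\<^sub>R x) (z$2 *\<^sub>R perp x)) \<partial>(lborel :: (real^2) measure))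
    \<le> ennreal (psi_const * wt \<sigma> K / (norm x)\<^sup>2)"
  using rect_wt_integral[OF \<sigma> assms, of K] by (simp add: psi_const_def power_divide ac_simps)

lemma fan_nn_integral:
  assumes "x \<noteq> 0"
  shows "(\<integral>\<^sup>+z. ennreal (norm (tri g K (z$1 *\<^sub>R x) (z$2 *\<^sub>R perp x))) \<partial>(lborel :: (real^2) measure))
    \<le> ennreal (psi_const * (B ^ 3 * wt \<sigma> K) / (norm x)\<^sup>2)"
proof -
  have [measurable]: "(\<lambda>z::real^2. rect_wt \<sigma> K (z$1 *\<^sub>R x) (z$2 *\<^sub>R perp x)) \<in> borel_measurable borel"
    unfolding rect_wt_def by measurable
  have "(\<integral>\<^sup>+z. ennreal (norm (tri g K (z$1 *\<^sub>R x) (z$2 *\<^sub>R perp x))) \<partial>(lborel :: (real^2) measure))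
     \<le> (\<integral>\<^sup>+z. ennreal (B ^ 3) * ennreal (rect_wt \<sigma> K (z$1 *\<^sub>R x) (z$2 *\<^sub>R perp x)) \<partial>(lborel :: (real^2) measure))"
    using B by (intro nn_integral_mono) (simp add: ennreal_mult'[symmetric] ennreal_leI tri_bound')
  also have "\<dots> = ennreal (B ^ 3) * (\<integral>\<^sup>+z. ennreal (rect_wt \<sigma> K (z$1 *\<^sub>R x) (z$2 *\<^sub>R perp x)) \<partial>(lborel :: (real^2) measure))"
    by (rule nn_integral_cmult) simp
  also have "\<dots> \<le> ennreal (B ^ 3) * ennreal (psi_const * wt \<sigma> K / (norm x)\<^sup>2)"
    by (intro mult_left_mono rect_wt_fan assms) auto
  also have "\<dots> = ennreal (psi_const * (B ^ 3 * wt \<sigma> K) / (norm x)\<^sup>2)"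
    using B by (simp add: ennreal_mult'[symmetric] ac_simps)
  finally show ?thesis .
qed

lemma fan_integrable:
  assumes [measurable]: "R \<in> sets borel" and "x \<noteq> 0"
  shows "integrable (lborel :: (real^2) measure) (\<lambda>z. indicator R z *\<^sub>R tri g K (z$1 *\<^sub>R x) (z$2 *\<^sub>R perp x))"
proof (rule integrableI_bounded)
  have "(\<integral>\<^sup>+z. ennreal (norm (indicator R z *\<^sub>R tri g K (z$1 *\<^sub>R x) (z$2 *\<^sub>R perp x))) \<partial>(lborel :: (real^2) measure))
     \<le> (\<integral>\<^sup>+z. ennreal (norm (tri g K (z$1 *\<^sub>R x) (z$2 *\<^sub>R perp x))) \<partial>(lborel :: (real^2) measure))"
    by (intro nn_integral_mono ennreal_leI) (auto simp: indicator_def)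
  also have "\<dots> < \<infinity>" using fan_nn_integral[OF assms(2), of K] by (simp add: order_le_less_trans)
  finally show "(\<integral>\<^sup>+z. ennreal (norm (indicator R z *\<^sub>R tri g K (z$1 *\<^sub>R x) (z$2 *\<^sub>R perp x))) \<partial>(lborel :: (real^2) measure)) < \<infinity>" .
qed measurable

lemma fan_bound:
  assumes [measurable]: "R \<in> sets borel" and x: "x \<noteq> 0"
  shows "norm (fan_integral R K x) \<le> psi_const * (B ^ 3 * wt \<sigma> K) / (norm x)\<^sup>2"
proof -
  have "ennreal (norm (fan_integral R K x)) \<le> (\<integral>\<^sup>+z. ennreal (norm (indicator R z *\<^sub>R tri g K (z$1 *\<^sub>R x) (z$2 *\<^sub>R perp x))) \<partial>(lborel :: (real^2) measure))"
    unfolding fan_integral_def by (rule integral_norm_bound_ennreal[OF fan_integrable[OF assms]])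
  also have "\<dots> \<le> (\<integral>\<^sup>+z. ennreal (norm (tri g K (z$1 *\<^sub>R x) (z$2 *\<^sub>R perp x))) \<partial>(lborel :: (real^2) measure))"
    by (intro nn_integral_mono ennreal_leI) (auto simp: indicator_def)
  also note fan_nn_integral[OF x, of K]
  finally show ?thesis
    using psi_const_nonneg B by (subst (asm) ennreal_le_iff) (auto simp: wt_nonneg)
qed

abbreviation half_plane :: "(real^2) set" where "half_plane \<equiv> {z. 0 < z$1}"

lemma half_plane_sets [measurable]: "half_plane \<in> sets borel"
  by simp

text \<open>Rescaling \<open>z\<close> leaves the half plane invariant and multiplies the area by \<open>c\<^sup>2\<close>. The sum over the multiples
  of a primitive direction therefore produces \<open>\<Sum>d. 1 / d\<^sup>2 = \<zeta>(2)\<close>.\<close>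
lemma fan_homogeneous:
  assumes c: "c > 0"
  shows "fan_integral half_plane K (c *\<^sub>R x) = (1 / c\<^sup>2) *\<^sub>R fan_integral half_plane K x"
proof -
  let ?F = "\<lambda>z::real^2. indicator half_plane z *\<^sub>R tri g K (z$1 *\<^sub>R x) (z$2 *\<^sub>R perp x)"
  have "fan_integral half_plane K x = (\<bar>c\<bar> ^ 2) *\<^sub>R (\<integral>z. ?F (0 + c *\<^sub>R z) \<partial>lborel)"
    unfolding fan_integral_def using c by (subst integral_scaleR_arg[of ?F c 0]) auto
  also have "(\<integral>z. ?F (0 + c *\<^sub>R z) \<partial>lborel) = fan_integral half_plane K (c *\<^sub>R x)"
    unfolding fan_integral_def using c
    by (intro Bochner_Integration.integral_cong) (auto simp: indicator_def perp_scaleR zero_less_mult_iff mult.commute)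
  finally show ?thesis using c by simp
qed

end

section \<open>Riemann sums over a fan\<close>

lemma cell_real2_sets [measurable, simp]:
  "{z::real^2. l1 < z$1 \<and> z$1 \<le> u1 \<and> l2 < z$2 \<and> z$2 \<le> u2} \<in> sets borel"
proof -
  have "{z \<in> space (borel :: (real^2) measure). l1 < z$1 \<and> z$1 \<le> u1 \<and> l2 < z$2 \<and> z$2 \<le> u2} \<in> sets borel"
    by measurable
  then show ?thesis by simp
qed

lemma emeasure_cell_real2:
  assumes "l1 \<le> u1" "l2 \<le> u2"
  shows "emeasure lborel {z::real^2. l1 < z$1 \<and> z$1 \<le> u1 \<and> l2 < z$2 \<and> z$2 \<le> u2} = ennreal ((u1 - l1) * (u2 - l2))"
proof -
  let ?C = "{z::real^2. l1 < z$1 \<and> z$1 \<le> u1 \<and> l2 < z$2 \<and> z$2 \<le> u2}"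
  have "(\<lambda>(a, b). vec2 a b) -` ?C = {l1<..u1} \<times> {l2<..u2}" by auto
  then have "emeasure lborel ?C = emeasure (lborel \<Otimes>\<^sub>M lborel) ({l1<..u1} \<times> {l2<..u2})"
    by (subst lborel_real2, subst emeasure_distr) (auto simp: space_pair_measure)
  also have "\<dots> = emeasure lborel {l1<..u1} * emeasure lborel {l2<..u2}"
    by (rule lborel.emeasure_pair_measure_Times) auto
  finally show ?thesis using assms by (simp add: ennreal_mult)
qed

lemma rect_wt_compare:
  assumes "s \<ge> 0" "norm (y - y') \<le> D" "norm (z - z') \<le> D" "norm ((y + z) - (y' + z')) \<le> D"
  shows "rect_wt s K y z \<le> ((1 + D) powr s) ^ 3 * rect_wt s K y' z'"
proof -
  have "wt s (K + y) \<le> (1 + D) powr s * wt s (K + y')"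
    using assms by (intro wt_compare) (auto simp: norm_minus_commute)
  moreover have "wt s (K + z) \<le> (1 + D) powr s * wt s (K + z')"
    using assms by (intro wt_compare) (auto simp: norm_minus_commute)
  moreover have "wt s (K + y + z) \<le> (1 + D) powr s * wt s (K + y' + z')"
  proof (rule wt_compare)
    have e: "(K + y' + z') - (K + y + z) = - ((y + z) - (y' + z'))" by simp
    show "norm ((K + y' + z') - (K + y + z)) \<le> D" unfolding e norm_minus_cancel by (rule assms)
  qed (rule assms)
  ultimately have "rect_wt s K y z \<le> ((1 + D) powr s * wt s (K + y')) * ((1 + D) powr s * wt s (K + y' + z')) * ((1 + D) powr s * wt s (K + z'))"
    unfolding rect_wt_def by (intro mult_mono) (auto simp: wt_nonneg)
  then show ?thesis by (simp add: rect_wt_def power3_eq_cube ac_simps)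
qed

context profile
begin

definition riem_const :: real where
  "riem_const = 6 * 4 powr (\<sigma> + 1) * ((5 powr (\<sigma> + 1)) ^ 3 + 1) * psi_const"

lemma rect_wt_fan_measurable [measurable]:
  "(\<lambda>z::real^2. rect_wt s K (z$1 *\<^sub>R x) (z$2 *\<^sub>R perp x)) \<in> borel_measurable borel"
  unfolding rect_wt_def by measurable

text \<open>The sum is a Riemann sum with cells of side \<open>|w| / L\<close>, in the coordinates \<open>z\<close> of area \<open>1 / L\<^sup>2\<close>. The
  displacement within a cell is of order \<open>|w| / L\<close>, which by \<open>tri_diff\<close> is the relative error of a fan
  integral of size \<open>(L / |w|)\<^sup>2\<close>.\<close>
lemma riemann_fan:
  fixes K :: "real^2"
  assumes w: "w \<noteq> 0" and L: "L > 0" and wL: "norm (ivec w) \<le> 2 * L"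
  defines "c \<equiv> \<lambda>(a, b). tri g K ((1/L) *\<^sub>R ivec (iscale a w)) ((1/L) *\<^sub>R ivec (iscale b (iperp w)))"
  shows "c summable_on {1..} \<times> UNIV"
    "norm (infsum c ({1..} \<times> UNIV) - L\<^sup>2 *\<^sub>R fan_integral half_plane K (ivec w))
       \<le> riem_const * (B ^ 3 * wt \<sigma> K) * (L / norm (ivec w))"
proof -
  define x where "x = (1/L) *\<^sub>R ivec w"
  have x0: "x \<noteq> 0" using w L by (simp add: x_def)
  have nx: "norm x = norm (ivec w) / L" using L by (simp add: x_def)
  have nx2: "norm x \<le> 2" using wL L by (simp add: nx field_simps)
  have nw: "norm (ivec w) > 0" using w by simp
  define s where "s = \<sigma> + 1"
  have s: "s \<ge> 0" using \<sigma> by (simp add: s_def)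
  define Cm where "Cm = 3 * 4 powr s * B ^ 3 * (2 * norm x) * ((5 powr s) ^ 3 + 1)"
  have Cm: "Cm \<ge> 0" using B by (simp add: Cm_def)
  define f where "f = (\<lambda>z::real^2. tri g K (z$1 *\<^sub>R x) (z$2 *\<^sub>R perp x))"
  define Q where "Q = (\<lambda>(a::int, b::int). {z::real^2. of_int a - 1 < z$1 \<and> z$1 \<le> of_int a \<and> of_int b - 1 < z$2 \<and> z$2 \<le> of_int b})"
  define I where "I = ({1..} \<times> UNIV :: (int \<times> int) set)"
  define m where "m = (\<lambda>z::real^2. ennreal (Cm * rect_wt \<sigma> K (z$1 *\<^sub>R x) (z$2 *\<^sub>R perp x)))"
  have cf: "c (a, b) = tri g K (of_int a *\<^sub>R x) (of_int b *\<^sub>R perp x)" for a b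
    by (simp add: c_def x_def ivec_iscale ivec_iperp perp_scaleR)
  have QI: "z \<in> Q i \<longleftrightarrow> i = (\<lceil>z$1\<rceil>, \<lceil>z$2\<rceil>)" for z i
    by (cases i) (auto simp: Q_def ceiling_eq_iff eq_commute[of _ "\<lceil>_\<rceil>"])
  have UQ: "(\<Union>i\<in>I. Q i) = half_plane"
    by (auto simp: QI I_def)
  have fm [measurable]: "f \<in> borel_measurable borel" unfolding f_def by measurable
  have E0: "riem_const * (B ^ 3 * wt \<sigma> K) * (L / norm (ivec w)) \<ge> 0"
    using B L psi_const_nonneg by (simp add: riem_const_def wt_nonneg)
  have p1: "countable I" by auto
  have p2: "sigma_finite_measure (lborel :: (real^2) measure)"
    by (rule lborel.sigma_finite_measure_axioms)
  have p3: "Q i \<in> sets lborel" for i by (cases i; simp add: Q_def)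
  have p4: "disjoint_family_on Q I" by (auto simp: disjoint_family_on_def QI)
  have p5: "emeasure lborel (Q i) = 1" for i
    by (cases i; simp add: Q_def emeasure_cell_real2)
  have p6: "integrable lborel (\<lambda>z. indicator (\<Union>i\<in>I. Q i) z *\<^sub>R f z)"
    unfolding UQ f_def by (rule fan_integrable[OF half_plane_sets x0])
  have p7: "f \<in> borel_measurable lborel" by simp
  have p8: "m \<in> borel_measurable lborel" unfolding m_def by measurable
  have p9: "integral\<^sup>N lborel m \<le> ennreal (riem_const * (B ^ 3 * wt \<sigma> K) * (L / norm (ivec w)))"
    proof -
      have "integral\<^sup>N lborel m = ennreal Cm * (\<integral>\<^sup>+z. ennreal (rect_wt \<sigma> K (z$1 *\<^sub>R x) (z$2 *\<^sub>R perp x)) \<partial>(lborel :: (real^2) measure))"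
        unfolding m_def using Cm by (subst nn_integral_cmult[symmetric]) (auto simp: ennreal_mult' intro!: nn_integral_cong)
      also have "\<dots> \<le> ennreal Cm * ennreal (psi_const * wt \<sigma> K / (norm x)\<^sup>2)"
        by (intro mult_left_mono rect_wt_fan x0) auto
      also have "\<dots> = ennreal (Cm * (psi_const * wt \<sigma> K / (norm x)\<^sup>2))" using Cm by (rule ennreal_mult'[symmetric])
      also have "Cm * (psi_const * wt \<sigma> K / (norm x)\<^sup>2) = riem_const * (B ^ 3 * wt \<sigma> K) * (L / norm (ivec w))"
      proof -
        have rc: "riem_const = 6 * 4 powr s * ((5 powr s) ^ 3 + 1) * psi_const"
          by (simp only: riem_const_def s_def)
        show ?thesis unfolding rc Cm_def nx using L nw by (simp add: power2_eq_square field_simps)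
      qed
      finally show "integral\<^sup>N lborel m \<le> ennreal (riem_const * (B ^ 3 * wt \<sigma> K) * (L / norm (ivec w)))" .
    qed
    have le: "ennreal (norm (c i - f z)) \<le> m z" if "z \<in> Q i" for i z
    proof -
      obtain a b where i: "i = (a, b)" by (cases i)
      have d: "\<bar>of_int a - z$1\<bar> \<le> 1" "\<bar>of_int b - z$2\<bar> \<le> 1" using that by (auto simp: Q_def i)
      have d1: "norm (of_int a *\<^sub>R x - (z$1) *\<^sub>R x) \<le> norm x"
        unfolding scaleR_diff_left[symmetric] using d by (simp add: mult_left_le_one_le)
      have d2: "norm (of_int b *\<^sub>R perp x - (z$2) *\<^sub>R perp x) \<le> norm x"
        unfolding scaleR_diff_left[symmetric] using d by (simp add: mult_left_le_one_le)
      have d3: "norm ((of_int a *\<^sub>R x + of_int b *\<^sub>R perp x) - ((z$1) *\<^sub>R x + (z$2) *\<^sub>R perp x)) \<le> 2 * norm x"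
        using norm_triangle_mono[OF d1 d2] by (simp add: algebra_simps)
      note dd = order_trans[OF d1, of "2 * norm x", simplified] order_trans[OF d2, of "2 * norm x", simplified] d3
      have "norm (c i - f z) \<le> 3 * 4 powr s * B ^ 3 * (2 * norm x) * (rect_wt s K (of_int a *\<^sub>R x) (of_int b *\<^sub>R perp x) + rect_wt s K (z$1 *\<^sub>R x) (z$2 *\<^sub>R perp x))"
        unfolding i cf f_def s_def by (rule tri_diff[OF dd])
      also have "\<dots> \<le> 3 * 4 powr s * B ^ 3 * (2 * norm x) * ((5 powr s) ^ 3 * rect_wt s K (z$1 *\<^sub>R x) (z$2 *\<^sub>R perp x) + rect_wt s K (z$1 *\<^sub>R x) (z$2 *\<^sub>R perp x))"
      proof (intro mult_left_mono add_right_mono)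
        have "rect_wt s K (of_int a *\<^sub>R x) (of_int b *\<^sub>R perp x) \<le> ((1 + 4) powr s) ^ 3 * rect_wt s K (z$1 *\<^sub>R x) (z$2 *\<^sub>R perp x)"
          using dd nx2 by (intro rect_wt_compare s) linarith+
        then show "rect_wt s K (of_int a *\<^sub>R x) (of_int b *\<^sub>R perp x) \<le> (5 powr s) ^ 3 * rect_wt s K (z$1 *\<^sub>R x) (z$2 *\<^sub>R perp x)" by simp
      qed (use B in auto)
      also have "\<dots> = Cm * rect_wt s K (z$1 *\<^sub>R x) (z$2 *\<^sub>R perp x)" by (simp add: Cm_def algebra_simps)
      also have "\<dots> \<le> Cm * rect_wt \<sigma> K (z$1 *\<^sub>R x) (z$2 *\<^sub>R perp x)"
        using Cm by (intro mult_left_mono rect_wt_mono_exp) (auto simp: s_def)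
      finally show ?thesis unfolding m_def by (rule ennreal_leI)
    qed
  have p10: "ennreal (norm (c i - f z)) \<le> m z" if "i \<in> I" "z \<in> Q i" for i z
    by (rule le[OF that(2)])
  note cells = cell_sum(1,3)[where M=lborel and Q=Q and f=f and m=m and c=c,
      OF p1 p2 p3 p4 p5 p6 p7 p8 p10 p9 E0]
  show "c summable_on {1..} \<times> UNIV" using cells(1) by (simp add: I_def)
  have "(\<integral>z. indicator (\<Union>i\<in>I. Q i) z *\<^sub>R f z \<partial>lborel) = fan_integral half_plane K x"
    unfolding UQ f_def fan_integral_def ..
  also have "\<dots> = L\<^sup>2 *\<^sub>R fan_integral half_plane K (ivec w)"
    unfolding x_def using L by (subst fan_homogeneous) (auto simp: power_divide)
  finally show "norm (infsum c ({1..} \<times> UNIV) - L\<^sup>2 *\<^sub>R fan_integral half_plane K (ivec w))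
       \<le> riem_const * (B ^ 3 * wt \<sigma> K) * (L / norm (ivec w))"
    using cells(2) by (simp add: I_def)
qed

definition cell_const :: real where
  "cell_const = 162 * 4 powr (\<sigma> + 1) * psi_const"

lemma cell_const_nonneg: "cell_const \<ge> 0"
  using psi_const_nonneg by (simp add: cell_const_def)

text \<open>Moving \<open>n\<close> by at most one turns the rectangles of the fan by a displacement of at most their size
  divided by \<open>|n|\<close>. By \<open>rect_wt_gain\<close> the size is absorbed by the weights, which leaves one factor
  \<open>1 / |n|\<close> more than in \<open>fan_bound\<close>.\<close>
lemma cell_fan:
  assumes n: "n \<noteq> 0" and x: "\<bar>x$1 - ivec n$1\<bar> \<le> 1/2" "\<bar>x$2 - ivec n$2\<bar> \<le> 1/2" and R [measurable]: "R \<in> sets borel"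
  shows "norm (fan_integral R K (ivec n) - fan_integral R K x) \<le> cell_const * (B ^ 3 * wt \<sigma> K) / real (supn n) ^ 3"
proof -
  define k where "k = real (supn n)"
  have k: "k \<ge> 1" using n supn_0_iff[of n] by (simp add: k_def)
  define y where "y = ivec n"
  have ny: "norm y \<ge> k" unfolding y_def k_def by (rule supn_le_norm)
  have nx: "norm x \<ge> k / 2"
  proof -
    have "k = \<bar>ivec n $ 1\<bar> \<or> k = \<bar>ivec n $ 2\<bar>" by (auto simp: k_def supn_def max_def)
    then have "k - 1/2 \<le> \<bar>x$1\<bar> \<or> k - 1/2 \<le> \<bar>x$2\<bar>" using x by linarith
    then show ?thesis using component_le_norm_cart[of x 1] component_le_norm_cart[of x 2] k by linarith
  qed
  have x0: "x \<noteq> 0" and y0: "y \<noteq> 0" using nx ny k by auto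
  have nxy: "norm (y - x) \<le> 1"
  proof -
    have "norm (y - x) \<le> \<bar>(y - x)$1\<bar> + \<bar>(y - x)$2\<bar>" using norm_le_l1_cart[of "y - x"] by (simp add: UNIV_2)
    then show ?thesis using x by (simp add: y_def abs_minus_commute)
  qed
  define s where "s = \<sigma> + 1"
  define P where "P = (\<lambda>x (z::real^2). rect_wt \<sigma> K (z$1 *\<^sub>R x) (z$2 *\<^sub>R perp x))"
  define C where "C = 18 * 4 powr s * B ^ 3"
  have C: "C \<ge> 0" using B by (simp add: C_def)
  let ?f = "\<lambda>x (z::real^2). tri g K (z$1 *\<^sub>R x) (z$2 *\<^sub>R perp x)"
  have pw: "norm (?f y z - ?f x z) \<le> C * (P y z / norm y) + C * (P x z / norm x)" for z
  proof -
    define D where "D = \<bar>z$1\<bar> + \<bar>z$2\<bar>"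
    have d1: "norm (z$1 *\<^sub>R y - z$1 *\<^sub>R x) \<le> \<bar>z$1\<bar>"
      unfolding scaleR_diff_right[symmetric] using nxy by (simp add: mult_left_le)
    have d2: "norm (z$2 *\<^sub>R perp y - z$2 *\<^sub>R perp x) \<le> \<bar>z$2\<bar>"
      unfolding scaleR_diff_right[symmetric] perp_diff[symmetric] using nxy by (simp add: mult_left_le)
    have d3: "norm ((z$1 *\<^sub>R y + z$2 *\<^sub>R perp y) - (z$1 *\<^sub>R x + z$2 *\<^sub>R perp x)) \<le> D"
      unfolding D_def using norm_triangle_mono[OF d1 d2] by (simp add: algebra_simps)
    have gain: "D * rect_wt s K (z$1 *\<^sub>R v) (z$2 *\<^sub>R perp v) \<le> 6 * (P v z / norm v)" if "v \<noteq> 0" for v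
    proof -
      have "norm v * (D * rect_wt s K (z$1 *\<^sub>R v) (z$2 *\<^sub>R perp v)) \<le> 6 * P v z"
        using rect_wt_gain[of "z$1 *\<^sub>R v" "z$2 *\<^sub>R perp v" \<sigma> K] by (simp add: P_def D_def s_def algebra_simps)
      then show ?thesis using that by (simp add: field_simps)
    qed
    have "norm (?f y z - ?f x z) \<le> 3 * 4 powr s * B ^ 3 * D * (rect_wt s K (z$1 *\<^sub>R y) (z$2 *\<^sub>R perp y) + rect_wt s K (z$1 *\<^sub>R x) (z$2 *\<^sub>R perp x))"
      unfolding s_def using d1 d2 d3 by (intro tri_diff) (auto simp: D_def)
    also have "\<dots> = 3 * 4 powr s * B ^ 3 * (D * rect_wt s K (z$1 *\<^sub>R y) (z$2 *\<^sub>R perp y) + D * rect_wt s K (z$1 *\<^sub>R x) (z$2 *\<^sub>R perp x))"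
      by (simp add: algebra_simps)
    also have "\<dots> \<le> 3 * 4 powr s * B ^ 3 * (6 * (P y z / norm y) + 6 * (P x z / norm x))"
      using B by (intro mult_left_mono add_mono gain x0 y0) auto
    also have "\<dots> = C * (P y z / norm y) + C * (P x z / norm x)" by (simp add: C_def algebra_simps)
    finally show ?thesis .
  qed
  have Pm [measurable]: "P v \<in> borel_measurable borel" for v unfolding P_def by measurable
  have Pi: "(\<integral>\<^sup>+z. ennreal (C * (P v z / norm v)) \<partial>lborel) \<le> ennreal (C * (psi_const * wt \<sigma> K) / norm v ^ 3)" if "v \<noteq> 0" for v
  proof -
    have "(\<integral>\<^sup>+z. ennreal (C * (P v z / norm v)) \<partial>lborel) = (\<integral>\<^sup>+z. ennreal (C / norm v) * ennreal (P v z) \<partial>lborel)"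
      using C by (intro nn_integral_cong) (simp add: ennreal_mult'[symmetric])
    also have "\<dots> = ennreal (C / norm v) * (\<integral>\<^sup>+z. ennreal (P v z) \<partial>lborel)" by (rule nn_integral_cmult) simp
    also have "\<dots> \<le> ennreal (C / norm v) * ennreal (psi_const * wt \<sigma> K / (norm v)\<^sup>2)"
      unfolding P_def by (intro mult_left_mono rect_wt_fan that) auto
    also have "\<dots> = ennreal (C * (psi_const * wt \<sigma> K) / norm v ^ 3)"
      using C by (simp add: ennreal_mult'[symmetric] power2_eq_square power3_eq_cube mult.assoc)
    finally show ?thesis .
  qed
  note iy = fan_integrable[OF R y0, of K] and ix = fan_integrable[OF R x0, of K]
  have Pnn: "P v z \<ge> 0" for v z unfolding P_def by (rule rect_wt_nonneg)
  have "fan_integral R K y - fan_integral R K x = (\<integral>z. indicator R z *\<^sub>R ?f y z - indicator R z *\<^sub>R ?f x z \<partial>lborel)"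
    unfolding fan_integral_def by (rule Bochner_Integration.integral_diff[OF iy ix, symmetric])
  then have "ennreal (norm (fan_integral R K y - fan_integral R K x)) \<le> (\<integral>\<^sup>+z. ennreal (norm (indicator R z *\<^sub>R ?f y z - indicator R z *\<^sub>R ?f x z)) \<partial>lborel)"
    using integral_norm_bound_ennreal[OF Bochner_Integration.integrable_diff[OF iy ix]] by simp
  also have "\<dots> \<le> (\<integral>\<^sup>+z. ennreal (C * (P y z / norm y)) + ennreal (C * (P x z / norm x)) \<partial>lborel)"
  proof (intro nn_integral_mono)
    fix z
    have "norm (indicator R z *\<^sub>R ?f y z - indicator R z *\<^sub>R ?f x z) \<le> norm (?f y z - ?f x z)" by (auto simp: indicator_def)
    also note pw[of z]
    finally show "ennreal (norm (indicator R z *\<^sub>R ?f y z - indicator R z *\<^sub>R ?f x z)) \<le> ennreal (C * (P y z / norm y)) + ennreal (C * (P x z / norm x))"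
      using C Pnn by (simp add: ennreal_plus[symmetric] ennreal_leI del: ennreal_plus)
  qed
  also have "\<dots> = (\<integral>\<^sup>+z. ennreal (C * (P y z / norm y)) \<partial>lborel) + (\<integral>\<^sup>+z. ennreal (C * (P x z / norm x)) \<partial>lborel)"
    by (rule nn_integral_add) auto
  also have "\<dots> \<le> ennreal (C * (psi_const * wt \<sigma> K) / norm y ^ 3) + ennreal (C * (psi_const * wt \<sigma> K) / norm x ^ 3)"
    by (intro add_mono Pi x0 y0)
  also have "\<dots> = ennreal (C * (psi_const * wt \<sigma> K) / norm y ^ 3 + C * (psi_const * wt \<sigma> K) / norm x ^ 3)"
    using C psi_const_nonneg by (simp add: wt_nonneg)
  finally have "norm (fan_integral R K y - fan_integral R K x) \<le> C * (psi_const * wt \<sigma> K) / norm y ^ 3 + C * (psi_const * wt \<sigma> K) / norm x ^ 3"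
    using C psi_const_nonneg by (subst (asm) ennreal_le_iff) (auto simp: wt_nonneg)
  also have "\<dots> \<le> C * (psi_const * wt \<sigma> K) / k ^ 3 + C * (psi_const * wt \<sigma> K) / (k / 2) ^ 3"
    using k ny nx C psi_const_nonneg by (intro add_mono divide_left_mono power_mono mult_pos_pos) (auto simp: wt_nonneg)
  also have "\<dots> = cell_const * (B ^ 3 * wt \<sigma> K) / k ^ 3"
  proof -
    have cc: "cell_const = 162 * 4 powr s * psi_const" by (simp only: cell_const_def s_def)
    show ?thesis unfolding cc C_def using k by (simp add: power_divide field_simps)
  qed
  finally show ?thesis by (simp add: y_def k_def)
qed

end

section \<open>Fan integrals over an annulus\<close>

lemma nth_measurable [measurable (raw)]:
  fixes f :: "'a \<Rightarrow> real^2"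
  assumes "f \<in> borel_measurable M"
  shows "(\<lambda>x. f x $ i) \<in> borel_measurable M"
proof -
  have "(\<lambda>x::real^2. x $ i) \<in> borel_measurable borel"
    by (intro borel_measurable_continuous_onI continuous_intros)
  then show ?thesis by (rule measurable_compose[OF assms])
qed

lemma perp_measurable' [measurable (raw)]:
  "f \<in> borel_measurable M \<Longrightarrow> (\<lambda>x. perp (f x)) \<in> borel_measurable M"
  by (rule measurable_compose[OF _ perp_measurable])

definition supnorm :: "real^2 \<Rightarrow> real" where
  "supnorm x = max \<bar>x$1\<bar> \<bar>x$2\<bar>"

lemma supnorm_le_norm: "supnorm x \<le> norm x"
  using component_le_norm_cart[of x 1] component_le_norm_cart[of x 2] by (simp add: supnorm_def)

lemma supnorm_scaleR: "supnorm (c *\<^sub>R x) = \<bar>c\<bar> * supnorm x"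
  by (simp add: supnorm_def abs_mult max_mult_distrib_left)

lemma supnorm_perp: "supnorm (perp x) = supnorm x"
  by (simp add: supnorm_def max.commute)

lemma supnorm_pos: "x \<noteq> 0 \<Longrightarrow> supnorm x > 0"
  by (auto simp: supnorm_def vec_eq_iff forall_2 less_max_iff_disj)

lemma supnorm_measurable [measurable]: "supnorm \<in> borel_measurable borel"
  unfolding supnorm_def by measurable

text \<open>The union, up to a null set, of the unit cells around the nonzero lattice points with \<open>supn n \<le> N\<close>.\<close>
definition annulus :: "nat \<Rightarrow> (real^2) set" where
  "annulus N = {x. 1/2 < supnorm x \<and> supnorm x < real N + 1/2}"

lemma annulus_sets [measurable, simp]: "annulus N \<in> sets borel"
proof -
  have "{x \<in> space (borel :: (real^2) measure). 1/2 < supnorm x \<and> supnorm x < real N + 1/2} \<in> sets borel"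
    by measurable
  then show ?thesis by (simp add: annulus_def)
qed

lemma perp_annulus: "perp x \<in> annulus N \<longleftrightarrow> x \<in> annulus N"
  by (simp add: annulus_def supnorm_perp)

lemma annulus_nonzero: "x \<in> annulus N \<Longrightarrow> x \<noteq> 0"
  by (auto simp: annulus_def supnorm_def)

lemma annulus_norm: "x \<in> annulus N \<Longrightarrow> norm x \<ge> 1/2"
  using supnorm_le_norm[of x] by (auto simp: annulus_def)

lemma emeasure_annulus_finite: "emeasure lborel (annulus N) < \<infinity>"
proof -
  have "annulus N \<subseteq> cbox (vec2 (- real N - 1) (- real N - 1)) (vec2 (real N + 1) (real N + 1))"
    by (auto simp: annulus_def supnorm_def cbox_def Basis_real2 inner_axis)
  then have "emeasure lborel (annulus N) \<le> emeasure lborel (cbox (vec2 (- real N - 1) (- real N - 1)) (vec2 (real N + 1) (real N + 1)))"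
    by (intro emeasure_mono) auto
  also have "\<dots> < \<infinity>" by (simp add: emeasure_lborel_cbox_eq)
  finally show ?thesis .
qed

lemma log_nn_integral:
  assumes "0 < a" "a < b"
  shows "(\<integral>\<^sup>+u. ennreal (indicator {a<..<b} u * (1 / u)) \<partial>lborel) = ennreal (ln (b / a))"
proof -
  have "(\<integral>\<^sup>+u. ennreal (indicator {a<..<b} u * (1 / u)) \<partial>lborel) = (\<integral>\<^sup>+u. ennreal (1 / u) * indicator {a..b} u \<partial>lborel)"
  proof (rule nn_integral_cong_AE)
    have "AE u in lborel. u \<noteq> a" "AE u in lborel. u \<noteq> b" by (rule AE_lborel_singleton)+
    then show "AE u in lborel. ennreal (indicator {a<..<b} u * (1 / u)) = ennreal (1 / u) * indicator {a..b} u"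
      by eventually_elim (auto simp: indicator_def)
  qed
  also have "\<dots> = ennreal (ln b - ln a)"
  proof (rule nn_integral_FTC_Icc)
    show "(ln has_real_derivative 1 / x) (at x)" if "x \<in> {a..b}" for x
      by (rule DERIV_ln_divide) (use that assms in auto)
    show "0 \<le> 1 / x" if "x \<in> {a..b}" for x using that assms by auto
  qed (use assms in auto)
  also have "ln b - ln a = ln (b / a)" using assms by (simp add: ln_div)
  finally show ?thesis .
qed

text \<open>The dilates \<open>y / u\<close> lie in the annulus exactly for \<open>u\<close> in an interval whose end points have the ratio
  \<open>(N + 1/2) / (1/2) = 2 N + 1\<close>, independently of \<open>y\<close>. Hence the logarithm.\<close>
lemma dilation_measure:
  assumes "y \<noteq> 0" "N \<ge> 1"
  shows "(\<integral>\<^sup>+u. ennreal (indicator {0<..} u * indicator (annulus N) ((1/u) *\<^sub>R y) * (1 / u)) \<partial>lborel) = ennreal (ln (2 * real N + 1))"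
    and "(\<integral>u. indicator {0<..} u * indicator (annulus N) ((1/u) *\<^sub>R y) * (1 / u) \<partial>lborel) = ln (2 * real N + 1)"
proof -
  define a where "a = supnorm y / (real N + 1/2)"
  define b where "b = 2 * supnorm y"
  have sp: "supnorm y > 0" by (rule supnorm_pos[OF assms(1)])
  have ab: "0 < a" "a < b" using sp assms(2) by (auto simp: a_def b_def field_simps)
  have e: "indicator {0<..} u * indicator (annulus N) ((1/u) *\<^sub>R y) * (1 / u) = indicator {a<..<b} u * (1 / u)" for u :: real
  proof (cases "u > 0")
    case True
    have "(1/u) *\<^sub>R y \<in> annulus N \<longleftrightarrow> a < u \<and> u < b"
      using True unfolding annulus_def a_def b_def by (auto simp: supnorm_scaleR field_simps)
    then show ?thesis using True by (auto simp: indicator_def)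
  next
    case False
    then show ?thesis using ab by (auto simp: indicator_def)
  qed
  have r: "b / a = 2 * real N + 1" using sp by (simp add: a_def b_def field_simps)
  show 1: "(\<integral>\<^sup>+u. ennreal (indicator {0<..} u * indicator (annulus N) ((1/u) *\<^sub>R y) * (1 / u)) \<partial>lborel) = ennreal (ln (2 * real N + 1))"
    unfolding e using log_nn_integral[OF ab] r by simp
  have "(\<integral>u. indicator {0<..} u * indicator (annulus N) ((1/u) *\<^sub>R y) * (1 / u) \<partial>lborel)
     = enn2real (\<integral>\<^sup>+u. ennreal (indicator {0<..} u * indicator (annulus N) ((1/u) *\<^sub>R y) * (1 / u)) \<partial>lborel)"
    by (rule integral_eq_nn_integral) (auto simp: indicator_def)
  then show "(\<integral>u. indicator {0<..} u * indicator (annulus N) ((1/u) *\<^sub>R y) * (1 / u) \<partial>lborel) = ln (2 * real N + 1)"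
    unfolding 1 by simp
qed

lemma AE_linear_nonzero:
  assumes "a \<noteq> (0::real^2)"
  shows "AE z in lborel. a \<bullet> z \<noteq> 0"
proof -
  have "negligible {z. a \<bullet> z = 0}" using assms by (intro negligible_hyperplane) auto
  moreover have s: "{z. a \<bullet> z = 0} \<in> sets borel" by (intro borel_closed closed_hyperplane)
  ultimately have "{z. a \<bullet> z = 0} \<in> null_sets lborel"
    by (simp add: negligible_iff_null_sets null_sets_completion_iff[symmetric])
  then show ?thesis by (intro AE_I'[of "{z. a \<bullet> z = 0}"]) auto
qed

lemma wt_plane_integral:
  assumes \<sigma>: "\<sigma> > 2"
  shows "(\<integral>\<^sup>+x. ewt \<sigma> (K + x) \<partial>lborel) < \<infinity>"
proof -
  have "(\<integral>\<^sup>+x. ewt \<sigma> (K + x) \<partial>lborel) = (\<integral>\<^sup>+a. \<integral>\<^sup>+b. ewt \<sigma> (K + vec2 a b) \<partial>lborel \<partial>lborel)"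
    by (rule nn_integral_real2) measurable
  also have "\<dots> \<le> (\<integral>\<^sup>+a. \<integral>\<^sup>+b. ennreal (line_wt \<sigma> (K$1 + a * 1)) * ennreal (line_wt \<sigma> (K$2 + b * 1)) \<partial>lborel \<partial>lborel)"
  proof (intro nn_integral_mono)
    fix a b
    have "wt \<sigma> (K + vec2 a b) \<le> line_wt \<sigma> (K$1 + a * 1) * line_wt \<sigma> (K$2 + b * 1)"
      using wt_le_prod_line_wt[of \<sigma> "K + vec2 a b"] \<sigma> by simp
    then show "ewt \<sigma> (K + vec2 a b) \<le> ennreal (line_wt \<sigma> (K$1 + a * 1)) * ennreal (line_wt \<sigma> (K$2 + b * 1))"
      by (simp add: ennreal_mult'[symmetric] line_wt_nonneg ennreal_leI)
  qed
  also have "\<dots> = ennreal (line_mass \<sigma> / 1) * ennreal (line_mass \<sigma> / 1)"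
    using line_wt_affine_integral[OF \<sigma>, of 1] by (simp add: nn_integral_cmult nn_integral_multc)
  also have "\<dots> < \<infinity>" by (simp add: ennreal_mult_less_top)
  finally show ?thesis .
qed

context profile
begin

text \<open>A quarter turn exchanges the two sides of the rectangle and maps the sectors above and below the
  diagonals to the two halves of the central sector.\<close>
lemma fan_rotate:
  "fan_integral {z. 0 < z$1 \<and> z$1 < z$2} K x = fan_integral {z. 0 < z$1 \<and> - z$1 < z$2 \<and> z$2 < 0} K (perp x)"
  "fan_integral {z. 0 < z$1 \<and> z$1 < - z$2} K x = fan_integral {z. 0 < z$1 \<and> 0 < z$2 \<and> z$2 < z$1} K (perp (perp (perp x)))"
proof -
  have S [measurable]: "{z::real^2. 0 < z$1 \<and> z$1 < z$2} \<in> sets borel" "{z::real^2. 0 < z$1 \<and> z$1 < - z$2} \<in> sets borel"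
  proof -
    have "{z\<in>space (borel :: (real^2) measure). 0 < z$1 \<and> z$1 < z$2} \<in> sets borel" 
      "{z\<in>space (borel :: (real^2) measure). 0 < z$1 \<and> z$1 < - z$2} \<in> sets borel" by measurable
    then show "{z::real^2. 0 < z$1 \<and> z$1 < z$2} \<in> sets borel" "{z::real^2. 0 < z$1 \<and> z$1 < - z$2} \<in> sets borel" by simp_all
  qed
  let ?f = "\<lambda>z::real^2. indicator {z. 0 < z$1 \<and> z$1 < z$2} z *\<^sub>R tri g K (z$1 *\<^sub>R x) (z$2 *\<^sub>R perp x)"
  have "fan_integral {z. 0 < z$1 \<and> z$1 < z$2} K x = (\<integral>z. ?f (perp z) \<partial>lborel)"
    unfolding fan_integral_def by (rule integral_perp[symmetric]) measurable
  also have "\<dots> = fan_integral {z. 0 < z$1 \<and> - z$1 < z$2 \<and> z$2 < 0} K (perp x)"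
    unfolding fan_integral_def
  proof (intro Bochner_Integration.integral_cong refl)
    fix z :: "real^2"
    show "?f (perp z) = indicator {z. 0 < z$1 \<and> - z$1 < z$2 \<and> z$2 < 0} z *\<^sub>R tri g K (z$1 *\<^sub>R perp x) (z$2 *\<^sub>R perp (perp x))"
      using tri_swap[of g K "z$1 *\<^sub>R perp x" "- (z$2 *\<^sub>R x)"] by (auto simp: indicator_def perp_perp)
  qed
  finally show "fan_integral {z. 0 < z$1 \<and> z$1 < z$2} K x = fan_integral {z. 0 < z$1 \<and> - z$1 < z$2 \<and> z$2 < 0} K (perp x)" .
  let ?h = "\<lambda>z::real^2. indicator {z. 0 < z$1 \<and> z$1 < - z$2} z *\<^sub>R tri g K (z$1 *\<^sub>R x) (z$2 *\<^sub>R perp x)"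
  have "fan_integral {z. 0 < z$1 \<and> z$1 < - z$2} K x = (\<integral>z. ?h z \<partial>lborel)" by (simp only: fan_integral_def)
  also have "\<dots> = (\<integral>z. ?h (perp z) \<partial>lborel)" by (rule integral_perp[symmetric]) measurable
  also have "\<dots> = (\<integral>z. ?h (perp (perp z)) \<partial>lborel)" by (rule integral_perp[symmetric, of "\<lambda>z. ?h (perp z)"]) measurable
  also have "\<dots> = (\<integral>z. ?h (perp (perp (perp z))) \<partial>lborel)" by (rule integral_perp[symmetric, of "\<lambda>z. ?h (perp (perp z))"]) measurable
  also have "\<dots> = fan_integral {z. 0 < z$1 \<and> 0 < z$2 \<and> z$2 < z$1} K (perp (perp (perp x)))"
    unfolding fan_integral_def
  proof (intro Bochner_Integration.integral_cong refl)
    fix z :: "real^2"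
    show "?h (perp (perp (perp z))) = indicator {z. 0 < z$1 \<and> 0 < z$2 \<and> z$2 < z$1} z *\<^sub>R tri g K (z$1 *\<^sub>R perp (perp (perp x))) (z$2 *\<^sub>R perp (perp (perp (perp x))))"
      using tri_swap[of g K "z$2 *\<^sub>R x" "- (z$1 *\<^sub>R perp x)"] by (auto simp: indicator_def perp_perp perp_minus)
  qed
  finally show "fan_integral {z. 0 < z$1 \<and> z$1 < - z$2} K x = fan_integral {z. 0 < z$1 \<and> 0 < z$2 \<and> z$2 < z$1} K (perp (perp (perp x)))" .
qed

lemma fan_measurable [measurable]:
  assumes [measurable]: "R \<in> sets borel"
  shows "fan_integral R K \<in> borel_measurable borel"
proof -
  have "(\<lambda>x. \<integral>z. indicator R z *\<^sub>R tri g K (z$1 *\<^sub>R x) (z$2 *\<^sub>R perp x) \<partial>(lborel::(real^2) measure)) \<in> borel_measurable borel"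
    by (intro lborel.borel_measurable_lebesgue_integral) measurable
  then show ?thesis by (simp add: fan_integral_def[abs_def])
qed

lemma annulus_fan_integrable:
  assumes [measurable]: "R \<in> sets borel"
  shows "integrable lborel (\<lambda>x. indicator (annulus N) x *\<^sub>R fan_integral R K x)"
proof (rule Bochner_Integration.integrable_bound)
  show "integrable lborel (\<lambda>x. indicator (annulus N) x *\<^sub>R (4 * (psi_const * (B ^ 3 * wt \<sigma> K))))"
    using emeasure_annulus_finite[of N] by (intro integrable_scaleR_left) (simp add: integrable_indicator_iff)
  show "AE x in lborel. norm (indicator (annulus N) x *\<^sub>R fan_integral R K x) \<le> norm (indicator (annulus N) x *\<^sub>R (4 * (psi_const * (B ^ 3 * wt \<sigma> K))))"
  proof (rule AE_I2)
    fix x :: "real^2"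
    have nn: "psi_const * (B ^ 3 * wt \<sigma> K) \<ge> 0" using psi_const_nonneg B by (simp add: wt_nonneg)
    show "norm (indicator (annulus N) x *\<^sub>R fan_integral R K x) \<le> norm (indicator (annulus N) x *\<^sub>R (4 * (psi_const * (B ^ 3 * wt \<sigma> K))))"
    proof (cases "x \<in> annulus N")
      case True
      have "norm (fan_integral R K x) \<le> psi_const * (B ^ 3 * wt \<sigma> K) / (norm x)\<^sup>2"
        by (rule fan_bound[OF assms annulus_nonzero[OF True]])
      also have "\<dots> \<le> psi_const * (B ^ 3 * wt \<sigma> K) / (1/2)\<^sup>2"
        using annulus_norm[OF True] nn annulus_nonzero[OF True] by (intro divide_left_mono power_mono) auto
      finally show ?thesis using True nn by (simp add: power_divide)
    qed simp
  qed
qed measurable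

abbreviation cone :: "(real^2) set" where "cone \<equiv> {z. 0 < z$1 \<and> \<bar>z$2\<bar> \<le> z$1}"

lemma sector_sets [measurable, simp]:
  "{z::real^2. 0 < z$1 \<and> \<bar>z$2\<bar> \<le> z$1} \<in> sets borel"
  "{z::real^2. 0 < z$1 \<and> z$1 < z$2} \<in> sets borel"
  "{z::real^2. 0 < z$1 \<and> z$1 < - z$2} \<in> sets borel"
  "{z::real^2. 0 < z$1 \<and> - z$1 < z$2 \<and> z$2 < 0} \<in> sets borel"
  "{z::real^2. 0 < z$1 \<and> 0 < z$2 \<and> z$2 < z$1} \<in> sets borel"
proof -
  have "{z\<in>space (borel :: (real^2) measure). 0 < z$1 \<and> \<bar>z$2\<bar> \<le> z$1} \<in> sets borel"
    "{z\<in>space (borel :: (real^2) measure). 0 < z$1 \<and> z$1 < z$2} \<in> sets borel"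
    "{z\<in>space (borel :: (real^2) measure). 0 < z$1 \<and> z$1 < - z$2} \<in> sets borel"
    "{z\<in>space (borel :: (real^2) measure). 0 < z$1 \<and> - z$1 < z$2 \<and> z$2 < 0} \<in> sets borel"
    "{z\<in>space (borel :: (real^2) measure). 0 < z$1 \<and> 0 < z$2 \<and> z$2 < z$1} \<in> sets borel"
    by measurable
  then show "{z::real^2. 0 < z$1 \<and> \<bar>z$2\<bar> \<le> z$1} \<in> sets borel"
  "{z::real^2. 0 < z$1 \<and> z$1 < z$2} \<in> sets borel"
  "{z::real^2. 0 < z$1 \<and> z$1 < - z$2} \<in> sets borel"
  "{z::real^2. 0 < z$1 \<and> - z$1 < z$2 \<and> z$2 < 0} \<in> sets borel"
  "{z::real^2. 0 < z$1 \<and> 0 < z$2 \<and> z$2 < z$1} \<in> sets borel" by simp_all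
qed

text \<open>The half plane consists of the central sector and the two sectors of \<open>fan_rotate\<close>, which together
  contribute a second copy of it because the annulus is invariant under quarter turns.\<close>
lemma annulus_half_plane:
  "(\<integral>x. indicator (annulus N) x *\<^sub>R fan_integral half_plane K x \<partial>lborel)
     = 2 *\<^sub>R (\<integral>x. indicator (annulus N) x *\<^sub>R fan_integral cone K x \<partial>lborel)"
proof -
  let ?U = "{z::real^2. 0 < z$1 \<and> z$1 < z$2}" and ?V = "{z::real^2. 0 < z$1 \<and> z$1 < - z$2}"
  let ?m = "{z::real^2. 0 < z$1 \<and> - z$1 < z$2 \<and> z$2 < 0}" and ?p = "{z::real^2. 0 < z$1 \<and> 0 < z$2 \<and> z$2 < z$1}"
  define J where "J = (\<lambda>R. \<integral>x. indicator (annulus N) x *\<^sub>R fan_integral R K x \<partial>lborel)"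
  have split: "indicator (annulus N) x *\<^sub>R fan_integral half_plane K x = indicator (annulus N) x *\<^sub>R fan_integral cone K x
      + (indicator (annulus N) x *\<^sub>R fan_integral ?U K x + indicator (annulus N) x *\<^sub>R fan_integral ?V K x)" for x
  proof (cases "x \<in> annulus N")
    case True
    note x0 = annulus_nonzero[OF True]
    have "fan_integral half_plane K x = fan_integral cone K x + (fan_integral ?U K x + fan_integral ?V K x)"
      unfolding fan_integral_def
      by (subst Bochner_Integration.integral_add[symmetric], (intro fan_integrable x0 sector_sets)+)
         (subst Bochner_Integration.integral_add[symmetric], (intro fan_integrable Bochner_Integration.integrable_add x0 sector_sets)+,
          auto intro!: Bochner_Integration.integral_cong simp: indicator_def)
    then show ?thesis using True by simp
  qed simp
  have 1: "J half_plane = J cone + (J ?U + J ?V)"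
    unfolding J_def split
    by (simp add: annulus_fan_integrable Bochner_Integration.integrable_add)
  have U: "J ?U = J ?m"
  proof -
    have "J ?U = (\<integral>x. indicator (annulus N) (perp x) *\<^sub>R fan_integral ?m K (perp x) \<partial>lborel)"
      unfolding J_def fan_rotate by (simp add: indicator_def perp_annulus)
    also have "\<dots> = J ?m" unfolding J_def
      by (rule integral_perp[of "\<lambda>x. indicator (annulus N) x *\<^sub>R fan_integral ?m K x"]) measurable
    finally show ?thesis .
  qed
  have V: "J ?V = J ?p"
  proof -
    let ?h = "\<lambda>x. indicator (annulus N) x *\<^sub>R fan_integral ?p K x"
    have "J ?V = (\<integral>x. ?h (perp (perp (perp x))) \<partial>lborel)"
      unfolding J_def fan_rotate by (simp add: indicator_def perp_annulus)
    also have "\<dots> = (\<integral>x. ?h (perp (perp x)) \<partial>lborel)" by (rule integral_perp[of "\<lambda>x. ?h (perp (perp x))"]) measurable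
    also have "\<dots> = (\<integral>x. ?h (perp x) \<partial>lborel)" by (rule integral_perp[of "\<lambda>x. ?h (perp x)"]) measurable
    also have "\<dots> = J ?p" unfolding J_def by (rule integral_perp[of ?h]) measurable
    finally show ?thesis .
  qed
  have mp: "J ?m + J ?p = J cone"
  proof -
    have "fan_integral ?m K x + fan_integral ?p K x = fan_integral cone K x" if x0: "x \<noteq> 0" for x
    proof -
      have "fan_integral ?m K x + fan_integral ?p K x = (\<integral>z. indicator ?m z *\<^sub>R tri g K (z$1 *\<^sub>R x) (z$2 *\<^sub>R perp x) + indicator ?p z *\<^sub>R tri g K (z$1 *\<^sub>R x) (z$2 *\<^sub>R perp x) \<partial>lborel)"
        unfolding fan_integral_def
        by (rule Bochner_Integration.integral_add[symmetric]; intro fan_integrable x0 sector_sets)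
      also have "\<dots> = fan_integral cone K x" unfolding fan_integral_def
      proof (rule integral_cong_AE)
        have "AE z in lborel. vec2 0 1 \<bullet> z \<noteq> 0" "AE z in lborel. vec2 1 1 \<bullet> z \<noteq> 0" "AE z in lborel. vec2 1 (-1) \<bullet> z \<noteq> 0"
          by (intro AE_linear_nonzero; simp add: vec2_eq_iff)+
        then show "AE z in lborel. indicator ?m z *\<^sub>R tri g K (z$1 *\<^sub>R x) (z$2 *\<^sub>R perp x) + indicator ?p z *\<^sub>R tri g K (z$1 *\<^sub>R x) (z$2 *\<^sub>R perp x)
           = indicator cone z *\<^sub>R tri g K (z$1 *\<^sub>R x) (z$2 *\<^sub>R perp x)"
          by eventually_elim (auto simp: indicator_def inner_real2)
      qed measurable
      finally show ?thesis .
    qed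
    then have "indicator (annulus N) x *\<^sub>R fan_integral ?m K x + indicator (annulus N) x *\<^sub>R fan_integral ?p K x = indicator (annulus N) x *\<^sub>R fan_integral cone K x" for x
      using annulus_nonzero[of x N] by (cases "x \<in> annulus N") auto
    moreover have "J ?m + J ?p = (\<integral>x. indicator (annulus N) x *\<^sub>R fan_integral ?m K x + indicator (annulus N) x *\<^sub>R fan_integral ?p K x \<partial>lborel)"
      unfolding J_def by (rule Bochner_Integration.integral_add[symmetric]; intro annulus_fan_integrable sector_sets)
    ultimately show ?thesis by (simp add: J_def)
  qed
  have "J half_plane = 2 *\<^sub>R J cone" using 1 U V mp by (simp add: scaleR_2)
  then show ?thesis by (simp add: J_def)
qed

text \<open>The integral over \<open>\<lambda>\<close> in the definition of the operator, at fixed \<open>y\<close>: rectangles whose second side is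
  the shorter one.\<close>
definition transverse :: "real^2 \<Rightarrow> real^2 \<Rightarrow> complex" where
  "transverse K y = (\<integral>l. indicator {-1..1} l *\<^sub>R tri g K y (l *\<^sub>R perp y) \<partial>lborel)"

lemma transverse_measurable [measurable]: "transverse K \<in> borel_measurable borel"
proof -
  have "(\<lambda>y. \<integral>l. indicator {-1..1} l *\<^sub>R tri g K y (l *\<^sub>R perp y) \<partial>lborel) \<in> borel_measurable borel"
    by (intro lborel.borel_measurable_lebesgue_integral) measurable
  then show ?thesis by (simp add: transverse_def[abs_def])
qed

lemma tri_le_one_weight: "norm (tri g K y z) \<le> B ^ 3 * wt \<sigma> (K + y)"
proof -
  have "norm (tri g K y z) \<le> B ^ 3 * rect_wt \<sigma> K y z" by (rule tri_bound')
  also have "\<dots> \<le> B ^ 3 * (wt \<sigma> (K + y) * 1 * 1)"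
    unfolding rect_wt_def using B \<sigma> by (intro mult_left_mono mult_mono wt_le_1) (auto simp: wt_nonneg)
  finally show ?thesis by simp
qed

lemma plane_strip_integrable:
  "integrable (lborel \<Otimes>\<^sub>M lborel) (\<lambda>(l, y). indicator {-1..1} l *\<^sub>R tri g K y (l *\<^sub>R perp y))"
proof (rule integrableI_bounded)
  have "(\<integral>\<^sup>+z. ennreal (norm (case z of (l, y) \<Rightarrow> indicator {-1..1} l *\<^sub>R tri g K y (l *\<^sub>R perp y))) \<partial>(lborel \<Otimes>\<^sub>M lborel))
     \<le> (\<integral>\<^sup>+z. ennreal (B ^ 3) * (indicator {-1..1::real} (fst z) * ewt \<sigma> (K + snd z)) \<partial>(lborel \<Otimes>\<^sub>M lborel))"
  proof (intro nn_integral_mono)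
    fix z :: "real \<times> (real^2)"
    obtain l y where z: "z = (l, y)" by (cases z)
    have "ennreal (norm (tri g K y (l *\<^sub>R perp y))) \<le> ennreal (B ^ 3) * ewt \<sigma> (K + y)"
      using tri_le_one_weight[of K y "l *\<^sub>R perp y"] B by (simp add: ennreal_mult'[symmetric] ennreal_leI)
    then show "ennreal (norm (case z of (l, y) \<Rightarrow> indicator {-1..1} l *\<^sub>R tri g K y (l *\<^sub>R perp y))) \<le> ennreal (B ^ 3) * (indicator {-1..1::real} (fst z) * ewt \<sigma> (K + snd z))"
      unfolding z by (cases "l \<in> {-1..1}") auto
  qed
  also have "\<dots> = ennreal (B ^ 3) * (\<integral>\<^sup>+z. indicator {-1..1::real} (fst z) * ewt \<sigma> (K + snd z) \<partial>(lborel \<Otimes>\<^sub>M lborel))"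
    by (rule nn_integral_cmult) measurable
  also have "(\<integral>\<^sup>+z. indicator {-1..1::real} (fst z) * ewt \<sigma> (K + snd z) \<partial>(lborel \<Otimes>\<^sub>M lborel))
     = (\<integral>\<^sup>+l. \<integral>\<^sup>+y. indicator {-1..1::real} l * ewt \<sigma> (K + y) \<partial>lborel \<partial>lborel)"
    by (subst lborel.nn_integral_fst[symmetric]) auto
  also have "\<dots> = 2 * (\<integral>\<^sup>+y. ewt \<sigma> (K + y) \<partial>lborel)"
    by (simp add: nn_integral_cmult nn_integral_multc)
  also have "ennreal (B ^ 3) * (2 * (\<integral>\<^sup>+y. ewt \<sigma> (K + y) \<partial>lborel)) < \<infinity>"
    using wt_plane_integral[OF \<sigma>, of K] by (simp add: ennreal_mult_less_top)
  finally show "(\<integral>\<^sup>+z. ennreal (norm (case z of (l, y) \<Rightarrow> indicator {-1..1} l *\<^sub>R tri g K y (l *\<^sub>R perp y))) \<partial>(lborel \<Otimes>\<^sub>M lborel)) < \<infinity>" .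
qed measurable

lemma transverse_integral:
  "integrable lborel (transverse K)" "(\<integral>y. transverse K y \<partial>lborel) = CR_T g g g K"
proof -
  note i = plane_strip_integrable[of K]
  show "integrable lborel (transverse K)"
    using lborel_pair.integrable_snd[OF i] by (simp add: transverse_def[abs_def])
  have "(\<integral>y. transverse K y \<partial>lborel) = (\<integral>l. (\<integral>y. indicator {-1..1} l *\<^sub>R tri g K y (l *\<^sub>R perp y) \<partial>lborel) \<partial>lborel)"
    unfolding transverse_def by (rule lborel_pair.Fubini_integral[OF i])
  also have "\<dots> = CR_T g g g K"
    unfolding CR_T_def set_lebesgue_integral_def tri_def by simp
  finally show "(\<integral>y. transverse K y \<partial>lborel) = CR_T g g g K" .
qed

text \<open>The substitution \<open>z = (u, u l)\<close> maps \<open>u > 0\<close>, \<open>|l| \<le> 1\<close> to the central sector with Jacobian \<open>u\<close>.\<close>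
lemma cone_fan:
  assumes x: "x \<noteq> 0"
  shows "fan_integral cone K x = (\<integral>u. indicator {0<..} u *\<^sub>R (u *\<^sub>R transverse K (u *\<^sub>R x)) \<partial>lborel)"
proof -
  have "fan_integral cone K x = (\<integral>a. \<integral>b. indicator cone (vec2 a b) *\<^sub>R tri g K (a *\<^sub>R x) (b *\<^sub>R perp x) \<partial>lborel \<partial>lborel)"
    unfolding fan_integral_def using integral_real2[OF fan_integrable[OF sector_sets(1) x, of K]] by simp
  also have "\<dots> = (\<integral>a. indicator {0<..} a *\<^sub>R (a *\<^sub>R transverse K (a *\<^sub>R x)) \<partial>lborel)"
  proof (intro Bochner_Integration.integral_cong refl)
    fix a :: real
    show "(\<integral>b. indicator cone (vec2 a b) *\<^sub>R tri g K (a *\<^sub>R x) (b *\<^sub>R perp x) \<partial>lborel) = indicator {0<..} a *\<^sub>R (a *\<^sub>R transverse K (a *\<^sub>R x))"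
    proof (cases "a > 0")
      case True
      have "(\<integral>b. indicator cone (vec2 a b) *\<^sub>R tri g K (a *\<^sub>R x) (b *\<^sub>R perp x) \<partial>lborel)
        = \<bar>a\<bar> *\<^sub>R (\<integral>l. indicator cone (vec2 a (0 + a * l)) *\<^sub>R tri g K (a *\<^sub>R x) ((0 + a * l) *\<^sub>R perp x) \<partial>lborel)"
        using True by (intro lborel_integral_real_affine) auto
      also have "(\<integral>l. indicator cone (vec2 a (0 + a * l)) *\<^sub>R tri g K (a *\<^sub>R x) ((0 + a * l) *\<^sub>R perp x) \<partial>lborel) = transverse K (a *\<^sub>R x)"
        unfolding transverse_def using True
        by (intro Bochner_Integration.integral_cong refl) (auto simp: indicator_def abs_mult perp_scaleR mult.commute)
      finally show ?thesis using True by simp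
    next
      case False
      then have "(\<integral>b. indicator cone (vec2 a b) *\<^sub>R tri g K (a *\<^sub>R x) (b *\<^sub>R perp x) \<partial>lborel) = (\<integral>b. 0 \<partial>(lborel :: real measure))"
        by (intro Bochner_Integration.integral_cong) (auto simp: indicator_def)
      then show ?thesis using False by simp
    qed
  qed
  finally show ?thesis .
qed

end

context profile
begin

text \<open>With \<open>cone_fan\<close> and \<open>y = u x\<close> for fixed \<open>u\<close>, the integral becomes that of \<open>transverse K y\<close> times the
  measure of the dilates of \<open>y\<close> that meet the annulus; the latter is the same for every \<open>y\<close>.\<close>
lemma annulus_cone:
  assumes N: "N \<ge> 1"
  shows "(\<integral>x. indicator (annulus N) x *\<^sub>R fan_integral cone K x \<partial>lborel) = ln (2 * real N + 1) *\<^sub>R CR_T g g g K"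
proof -
  define A where "A = annulus N"
  have Am [measurable]: "A \<in> sets borel" by (simp add: A_def)
  define T where "T = transverse K"
  have Tm [measurable]: "T \<in> borel_measurable borel" unfolding T_def by (rule transverse_measurable)
  define r where "r = (\<lambda>u y. indicator {0<..} u * indicator A ((1/u) *\<^sub>R y) * (1 / u) :: real)"
  have rm [measurable]: "(\<lambda>(u, y). r u y) \<in> borel_measurable (lborel \<Otimes>\<^sub>M lborel)"
    unfolding r_def by measurable
  have rm1 [measurable]: "(\<lambda>u. r u y) \<in> borel_measurable lborel" for y
    unfolding r_def by measurable
  have rm2 [measurable]: "r u \<in> borel_measurable lborel" for u
    unfolding r_def by measurable
  have rnn: "r u y \<ge> 0" for u y by (auto simp: r_def indicator_def)
  define H where "H = (\<lambda>x u. indicator A x *\<^sub>R (indicator {0<..} u *\<^sub>R (u *\<^sub>R T (u *\<^sub>R x))))"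
  have Hm: "(\<lambda>(x, u). H x u) \<in> borel_measurable (lborel \<Otimes>\<^sub>M lborel)"
    unfolding H_def by measurable
  have Hm2: "(\<lambda>x. H x u) \<in> borel_measurable lborel" for u unfolding H_def by measurable
  \<comment> \<open>for fixed \<open>u\<close>, substitute \<open>y = u x\<close>\<close>
  have nnx: "(\<integral>\<^sup>+x. ennreal (norm (H x u)) \<partial>lborel) = (\<integral>\<^sup>+y. ennreal (r u y * norm (T y)) \<partial>lborel)" for u
  proof (cases "u > 0")
    case True
    have "(\<integral>\<^sup>+y. ennreal (r u y * norm (T y)) \<partial>lborel) = ennreal (\<bar>u\<bar> ^ 2) * (\<integral>\<^sup>+x. ennreal (r u (0 + u *\<^sub>R x) * norm (T (0 + u *\<^sub>R x))) \<partial>lborel)"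
      using True by (subst nn_integral_scaleR[of _ u 0]) auto
    also have "\<dots> = (\<integral>\<^sup>+x. ennreal (\<bar>u\<bar> ^ 2) * ennreal (r u (0 + u *\<^sub>R x) * norm (T (0 + u *\<^sub>R x))) \<partial>lborel)"
      by (rule nn_integral_cmult[symmetric]) simp
    also have "\<dots> = (\<integral>\<^sup>+x. ennreal (norm (H x u)) \<partial>lborel)"
      using True rnn by (intro nn_integral_cong) (auto simp: H_def r_def indicator_def ennreal_mult'[symmetric] power2_eq_square)
    finally show ?thesis by simp
  qed (auto simp: H_def r_def)
  have intx: "(\<integral>x. H x u \<partial>lborel) = (\<integral>y. r u y *\<^sub>R T y \<partial>lborel)" for u
  proof (cases "u > 0")
    case True
    have "(\<integral>y. r u y *\<^sub>R T y \<partial>lborel) = (\<bar>u\<bar> ^ 2) *\<^sub>R (\<integral>x. r u (0 + u *\<^sub>R x) *\<^sub>R T (0 + u *\<^sub>R x) \<partial>lborel)"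
      using True by (subst integral_scaleR_arg[of _ u 0]) auto
    also have "\<dots> = (\<integral>x. (\<bar>u\<bar> ^ 2) *\<^sub>R (r u (0 + u *\<^sub>R x) *\<^sub>R T (0 + u *\<^sub>R x)) \<partial>lborel)"
      by (rule integral_scaleR_right[symmetric])
    also have "\<dots> = (\<integral>x. H x u \<partial>lborel)"
      using True by (intro Bochner_Integration.integral_cong) (auto simp: H_def r_def indicator_def power2_eq_square)
    finally show ?thesis by simp
  qed (auto simp: H_def r_def)
  have T1: "(\<integral>\<^sup>+y. ennreal (norm (T y)) \<partial>lborel) < \<infinity>"
    using transverse_integral(1)[of K] unfolding T_def by (simp add: integrable_iff_bounded)
  have dil: "(\<integral>\<^sup>+u. ennreal (r u y) \<partial>lborel) = ennreal (ln (2 * real N + 1))" "(\<integral>u. r u y \<partial>lborel) = ln (2 * real N + 1)" if "y \<noteq> 0" for y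
    using dilation_measure[OF that N] by (simp_all add: r_def A_def)
  have AE0: "AE y in (lborel :: (real^2) measure). y \<noteq> 0" by (rule AE_lborel_singleton)
  have fin: "(\<integral>\<^sup>+u. \<integral>\<^sup>+y. ennreal (r u y * norm (T y)) \<partial>lborel \<partial>lborel) < \<infinity>"
  proof -
    have "(\<integral>\<^sup>+u. \<integral>\<^sup>+y. ennreal (r u y * norm (T y)) \<partial>lborel \<partial>lborel) = (\<integral>\<^sup>+y. \<integral>\<^sup>+u. ennreal (r u y * norm (T y)) \<partial>lborel \<partial>lborel)"
      by (rule lborel_pair.Fubini'[symmetric]) measurable
    also have "\<dots> = (\<integral>\<^sup>+y. ennreal (ln (2 * real N + 1)) * ennreal (norm (T y)) \<partial>lborel)"
    proof (rule nn_integral_cong_AE)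
      show "AE y in lborel. (\<integral>\<^sup>+u. ennreal (r u y * norm (T y)) \<partial>lborel) = ennreal (ln (2 * real N + 1)) * ennreal (norm (T y))"
        using AE0 by eventually_elim (simp add: ennreal_mult' rnn nn_integral_multc dil)
    qed
    also have "\<dots> = ennreal (ln (2 * real N + 1)) * (\<integral>\<^sup>+y. ennreal (norm (T y)) \<partial>lborel)"
      by (rule nn_integral_cmult) simp
    also have "\<dots> < \<infinity>" using T1 by (simp add: ennreal_mult_less_top)
    finally show ?thesis .
  qed
  have Hi: "integrable (lborel \<Otimes>\<^sub>M lborel) (\<lambda>(x, u). H x u)"
  proof (rule integrableI_bounded[OF Hm])
    have "(\<integral>\<^sup>+z. ennreal (norm (case z of (x, u) \<Rightarrow> H x u)) \<partial>(lborel \<Otimes>\<^sub>M lborel)) = (\<integral>\<^sup>+u. \<integral>\<^sup>+x. ennreal (norm (H x u)) \<partial>lborel \<partial>lborel)"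
      using Hm by (subst lborel_pair.nn_integral_snd[symmetric]) auto
    also have "\<dots> < \<infinity>" unfolding nnx by (rule fin)
    finally show "(\<integral>\<^sup>+z. ennreal (norm (case z of (x, u) \<Rightarrow> H x u)) \<partial>(lborel \<Otimes>\<^sub>M lborel)) < \<infinity>" .
  qed
  have Ri: "integrable (lborel \<Otimes>\<^sub>M lborel) (\<lambda>(u, y). r u y *\<^sub>R T y)"
  proof (rule integrableI_bounded)
    show "(\<lambda>(u, y). r u y *\<^sub>R T y) \<in> borel_measurable (lborel \<Otimes>\<^sub>M lborel)" by measurable
    have "(\<integral>\<^sup>+z. ennreal (norm (case z of (u, y) \<Rightarrow> r u y *\<^sub>R T y)) \<partial>(lborel \<Otimes>\<^sub>M lborel)) = (\<integral>\<^sup>+u. \<integral>\<^sup>+y. ennreal (r u y * norm (T y)) \<partial>lborel \<partial>lborel)"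
      by (subst lborel.nn_integral_fst[symmetric]) (auto simp: rnn)
    also note fin
    finally show "(\<integral>\<^sup>+z. ennreal (norm (case z of (u, y) \<Rightarrow> r u y *\<^sub>R T y)) \<partial>(lborel \<Otimes>\<^sub>M lborel)) < \<infinity>" .
  qed
  have "(\<integral>x. indicator A x *\<^sub>R fan_integral cone K x \<partial>lborel) = (\<integral>x. (\<integral>u. H x u \<partial>lborel) \<partial>lborel)"
  proof (intro Bochner_Integration.integral_cong refl)
    fix x
    show "indicator A x *\<^sub>R fan_integral cone K x = (\<integral>u. H x u \<partial>lborel)"
    proof (cases "x \<in> A")
      case True
      then have "x \<noteq> 0" using annulus_nonzero by (auto simp: A_def)
      from cone_fan[OF this, of K] show ?thesis using True by (simp add: H_def T_def)
    qed (simp add: H_def)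
  qed
  also have "\<dots> = (\<integral>u. (\<integral>x. H x u \<partial>lborel) \<partial>lborel)"
    by (rule lborel_pair.Fubini_integral[OF Hi, symmetric])
  also have "\<dots> = (\<integral>u. (\<integral>y. r u y *\<^sub>R T y \<partial>lborel) \<partial>lborel)" unfolding intx ..
  also have "\<dots> = (\<integral>y. (\<integral>u. r u y *\<^sub>R T y \<partial>lborel) \<partial>lborel)"
    by (rule lborel_pair.Fubini_integral[OF Ri, symmetric])
  also have "\<dots> = (\<integral>y. ln (2 * real N + 1) *\<^sub>R T y \<partial>lborel)"
  proof (rule integral_cong_AE)
    show "(\<lambda>y. \<integral>u. r u y *\<^sub>R T y \<partial>lborel) \<in> borel_measurable lborel"
      using lborel_pair.integrable_snd[OF Ri] by auto
    show "AE y in lborel. (\<integral>u. r u y *\<^sub>R T y \<partial>lborel) = ln (2 * real N + 1) *\<^sub>R T y"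
      using AE0
    proof eventually_elim
      case (elim y)
      have ri: "integrable lborel (\<lambda>u. r u y)"
        using dil(1)[OF elim] rnn by (intro integrableI_bounded) auto
      have "(\<integral>u. r u y *\<^sub>R T y \<partial>lborel) = (\<integral>u. r u y \<partial>lborel) *\<^sub>R T y"
        by (rule integral_scaleR_left) (rule ri)
      then show ?case using dil(2)[OF elim] by simp
    qed
  qed simp
  also have "\<dots> = ln (2 * real N + 1) *\<^sub>R CR_T g g g K"
    using transverse_integral(2)[of K] unfolding T_def integral_scaleR_right by simp
  finally show ?thesis by (simp add: A_def)
qed

end

lemma inverse_square_telescope:
  assumes "n \<ge> 1"
  shows "1 / (real (Suc n))\<^sup>2 \<le> 1 / real n - 1 / real (Suc n)"
proof -
  have "1 / (real (Suc n))\<^sup>2 \<le> 1 / (real n * real (Suc n))"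
    using assms by (intro divide_left_mono) (auto simp: power2_eq_square intro!: mult_right_mono)
  also have "\<dots> = 1 / real n - 1 / real (Suc n)" using assms by (simp add: field_simps)
  finally show ?thesis .
qed

lemma sum_inverse_squares_le: "(\<Sum>k=1..N. 1 / (real k)\<^sup>2) \<le> 2"
proof -
  have "(\<Sum>k=1..N. 1 / (real k)\<^sup>2) \<le> 2 - 1 / real N" if "N \<ge> 1" for N
    using that
  proof (induction N rule: nat_induct_at_least)
    case (Suc n)
    have "1 / (real (Suc n))\<^sup>2 \<le> 1 / real n - 1 / real (Suc n)"
      using Suc by (intro inverse_square_telescope) auto
    then show ?case using Suc by simp
  qed simp
  then show ?thesis by (cases "N \<ge> 1") (smt (verit) divide_nonneg_nonneg of_nat_0_le_iff, simp)
qed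

lemma sum_inverse_squares_from_2: "(\<Sum>k=2..N. 1 / (real k)\<^sup>2) \<le> 3/4"
proof -
  have "(\<Sum>k=2..N. 1 / (real k)\<^sup>2) \<le> 3/4 - 1 / real N" if "N \<ge> 2" for N
    using that
  proof (induction N rule: nat_induct_at_least)
    case (Suc n)
    have "1 / (real (Suc n))\<^sup>2 \<le> 1 / real n - 1 / real (Suc n)"
      using Suc by (intro inverse_square_telescope) auto
    then show ?case using Suc by simp
  qed (simp add: power2_eq_square)
  then show ?thesis by (cases "N \<ge> 2") (smt (verit) divide_nonneg_nonneg of_nat_0_le_iff, simp)
qed

context profile
begin

abbreviation Psi :: "real^2 \<Rightarrow> int \<times> int \<Rightarrow> complex" where
  "Psi K n \<equiv> fan_integral half_plane K (ivec n)"

text \<open>The sum is compared with the integral over the annulus cell by cell. The errors \<open>1 / |n|\<^sup>3\<close> are summable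
  over the plane lattice, so that they stay bounded while the integral grows like \<open>ln N\<close>.\<close>
lemma fan_box_sum:
  assumes N: "N \<ge> 1"
  shows "norm ((\<Sum>n | supn n \<le> N \<and> n \<noteq> 0. Psi K n) - (2 * ln (2 * real N + 1)) *\<^sub>R CR_T g g g K) \<le> 16 * cell_const * (B ^ 3 * wt \<sigma> K)"
proof -
  define I where "I = {n. supn n \<le> N \<and> n \<noteq> 0}"
  have finI: "finite I" unfolding I_def by (rule finite_subset[OF _ finite_box[of N]]) auto
  define A where "A = annulus N"
  define C where "C = (\<lambda>n. {z::real^2. ivec n$1 - 1/2 < z$1 \<and> z$1 \<le> ivec n$1 + 1/2 \<and> ivec n$2 - 1/2 < z$2 \<and> z$2 \<le> ivec n$2 + 1/2})"
  define Q where "Q = (\<lambda>n. A \<inter> C n)"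
  define E where "E = B ^ 3 * wt \<sigma> K"
  have E: "E \<ge> 0" using B by (simp add: E_def wt_nonneg)
  have Cm [measurable]: "C n \<in> sets borel" for n unfolding C_def by simp
  have Qm [measurable]: "Q n \<in> sets borel" for n unfolding Q_def A_def by simp
  have CI: "z \<in> C n \<longleftrightarrow> n = (\<lceil>z$1 - 1/2\<rceil>, \<lceil>z$2 - 1/2\<rceil>)" for z n
    by (cases n) (auto simp: C_def ceiling_eq_iff eq_commute[of _ "\<lceil>_\<rceil>"])
  have UQ: "(\<Union>n\<in>I. Q n) = A"
  proof
    show "A \<subseteq> (\<Union>n\<in>I. Q n)"
    proof
      fix z assume z: "z \<in> A"
      define n where "n = (\<lceil>z$1 - 1/2\<rceil>, \<lceil>z$2 - 1/2\<rceil>)"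
      have zb: "\<bar>z$1\<bar> < real N + 1/2" "\<bar>z$2\<bar> < real N + 1/2" "1/2 < \<bar>z$1\<bar> \<or> 1/2 < \<bar>z$2\<bar>"
        using z by (auto simp: A_def annulus_def supnorm_def)
      have zC: "z \<in> C n" unfolding CI n_def ..
      have "\<bar>\<lceil>z$i - 1/2\<rceil>\<bar> \<le> int N" if "\<bar>z$i\<bar> < real N + 1/2" for i
        using that by linarith
      from this[OF zb(1)] this[OF zb(2)] have "supn n \<le> N" by (auto simp: n_def supn_def)
      moreover have "n \<noteq> 0"
      proof
        assume "n = 0"
        then have "\<bar>z$1\<bar> \<le> 1/2" "\<bar>z$2\<bar> \<le> 1/2" using zC by (auto simp: C_def)
        then show False using zb by linarith
      qed
      ultimately have "n \<in> I" "z \<in> Q n" using z zC by (simp_all add: Q_def I_def)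
      then show "z \<in> (\<Union>n\<in>I. Q n)" by (rule UN_I)
    qed
  qed (auto simp: Q_def)
  have one: "emeasure lborel (Q n) = 1" if n: "n \<in> I" for n
  proof (rule antisym)
    have "emeasure lborel (Q n) \<le> emeasure lborel (C n)" by (intro emeasure_mono) (auto simp: Q_def)
    also have "\<dots> = 1" unfolding C_def by (subst emeasure_cell_real2) auto
    finally show "emeasure lborel (Q n) \<le> 1" .
    let ?b = "box (vec2 (ivec n$1 - 1/2) (ivec n$2 - 1/2)) (vec2 (ivec n$1 + 1/2) (ivec n$2 + 1/2))"
    have "?b \<subseteq> Q n"
    proof
      fix z assume "z \<in> ?b"
      then have "of_int (fst n) - 1/2 < z$1" "z$1 < of_int (fst n) + 1/2" "of_int (snd n) - 1/2 < z$2" "z$2 < of_int (snd n) + 1/2"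
        by (simp_all add: box_real2)
      then have z: "\<bar>z$1 - of_int (fst n)\<bar> < 1/2" "\<bar>z$2 - of_int (snd n)\<bar> < 1/2" by linarith+
      have s: "\<bar>fst n\<bar> \<le> int N" "\<bar>snd n\<bar> \<le> int N" "\<bar>fst n\<bar> \<ge> 1 \<or> \<bar>snd n\<bar> \<ge> 1"
        using n by (auto simp: I_def supn_def prod_eq_iff)
      have "\<bar>z$1\<bar> < real N + 1/2" "\<bar>z$2\<bar> < real N + 1/2" using z s by linarith+
      moreover have "1/2 < \<bar>z$1\<bar> \<or> 1/2 < \<bar>z$2\<bar>" using z s by linarith
      ultimately have "z \<in> A" by (auto simp: A_def annulus_def supnorm_def)
      moreover have "z \<in> C n" unfolding C_def mem_Collect_eq ivec_nth using z by (intro conjI; linarith)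
      ultimately show "z \<in> Q n" by (simp add: Q_def)
    qed
    then have "emeasure lborel ?b \<le> emeasure lborel (Q n)" by (intro emeasure_mono) auto
    moreover have "emeasure lborel ?b = 1"
      by (subst emeasure_lborel_box) (auto simp: Basis_real2 inner_axis axis_12)
    ultimately show "1 \<le> emeasure lborel (Q n)" by simp
  qed
  define e where "e = (\<lambda>n. cell_const * E / real (supn n) ^ 3)"
  have e: "e n \<ge> 0" for n using E cell_const_nonneg by (simp add: e_def)
  define m where "m = (\<lambda>x. \<Sum>n\<in>I. ennreal (e n) * indicator (Q n) x)"
  have p1: "countable I" using finI by (rule countable_finite)
  have p2: "sigma_finite_measure (lborel :: (real^2) measure)" by (rule lborel.sigma_finite_measure_axioms)
  have p3: "Q n \<in> sets lborel" for n by simp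
  have p4: "disjoint_family_on Q I" by (auto simp: disjoint_family_on_def Q_def CI)
  have p6: "integrable lborel (\<lambda>x. indicator (\<Union>n\<in>I. Q n) x *\<^sub>R fan_integral half_plane K x)"
    unfolding UQ A_def by (rule annulus_fan_integrable) simp
  have p7: "fan_integral half_plane K \<in> borel_measurable lborel" using fan_measurable[OF half_plane_sets] by simp
  have p8: "m \<in> borel_measurable lborel" unfolding m_def by measurable
  have p10: "ennreal (norm (Psi K n - fan_integral half_plane K x)) \<le> m x" if n: "n \<in> I" and x: "x \<in> Q n" for n x
  proof -
    have "ivec n$1 - 1/2 < x$1" "x$1 \<le> ivec n$1 + 1/2" "ivec n$2 - 1/2 < x$2" "x$2 \<le> ivec n$2 + 1/2"
      using x by (simp_all add: Q_def C_def)
    then have d: "\<bar>x$1 - ivec n$1\<bar> \<le> 1/2" "\<bar>x$2 - ivec n$2\<bar> \<le> 1/2" by linarith+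
    have "norm (Psi K n - fan_integral half_plane K x) \<le> e n"
      unfolding e_def E_def using n by (intro cell_fan d half_plane_sets) (simp add: I_def)
    then have "ennreal (norm (Psi K n - fan_integral half_plane K x)) \<le> ennreal (e n) * indicator (Q n) x"
      using x by (simp add: ennreal_leI)
    also have "\<dots> \<le> m x" unfolding m_def using finI n by (intro member_le_sum) auto
    finally show ?thesis .
  qed
  have p9: "(\<integral>\<^sup>+x. m x \<partial>lborel) \<le> ennreal (16 * cell_const * E)"
  proof -
    have "(\<integral>\<^sup>+x. m x \<partial>lborel) = (\<Sum>n\<in>I. \<integral>\<^sup>+x. ennreal (e n) * indicator (Q n) x \<partial>lborel)"
      unfolding m_def by (rule nn_integral_sum) simp
    also have "\<dots> = (\<Sum>n\<in>I. ennreal (e n))"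
      by (intro sum.cong refl) (simp add: nn_integral_cmult_indicator one)
    also have "\<dots> = ennreal (\<Sum>n\<in>I. e n)" by (intro sum_ennreal e)
    also have "(\<Sum>n\<in>I. e n) = (\<Sum>k=1..N. 8 * real k * (cell_const * E / real k ^ 3))"
      unfolding e_def I_def by (rule sum_box)
    also have "\<dots> = 8 * (cell_const * E) * (\<Sum>k=1..N. 1 / (real k)\<^sup>2)"
      unfolding sum_distrib_left by (intro sum.cong) (auto simp: power2_eq_square power3_eq_cube)
    also have "\<dots> \<le> 8 * (cell_const * E) * 2"
      using E cell_const_nonneg by (intro mult_left_mono sum_inverse_squares_le) auto
    finally show ?thesis by (simp add: ennreal_leI mult.assoc)
  qed
  have E0: "0 \<le> 16 * cell_const * E" using E cell_const_nonneg by simp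
  have "norm (infsum (Psi K) I - (\<integral>x. indicator (\<Union>n\<in>I. Q n) x *\<^sub>R fan_integral half_plane K x \<partial>lborel)) \<le> 16 * cell_const * E"
    by (rule cell_sum(3)[OF p1 p2 p3 p4 one p6 p7 p8 p10 p9 E0])
  then show ?thesis
    unfolding UQ A_def annulus_half_plane annulus_cone[OF N] using finI
    by (simp add: infsum_finite I_def E_def)
qed

definition CR_const :: real where
  "CR_const = 8 * psi_const + 16 * cell_const"

text \<open>Instead of a direct estimate: the case \<open>N = 1\<close> of \<open>fan_box_sum\<close>, where eight fans are left.\<close>
lemma CR_T_bound: "norm (CR_T g g g K) \<le> CR_const * (B ^ 3 * wt \<sigma> K)"
proof -
  define E where "E = B ^ 3 * wt \<sigma> K"
  have E: "E \<ge> 0" using B by (simp add: E_def wt_nonneg)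
  define I where "I = {n. supn n \<le> 1 \<and> n \<noteq> 0}"
  have "norm (\<Sum>n\<in>I. Psi K n) \<le> (\<Sum>n\<in>I. psi_const * E)"
  proof (rule order_trans[OF norm_sum], rule sum_mono)
    fix n assume n: "n \<in> I"
    then have n1: "norm (ivec n) \<ge> 1" by (intro norm_ivec_ge_1) (auto simp: I_def)
    have "norm (Psi K n) \<le> psi_const * E / (norm (ivec n))\<^sup>2"
      unfolding E_def using n by (intro fan_bound) (auto simp: I_def)
    also have "\<dots> \<le> psi_const * E / 1" using n1 E psi_const_nonneg by (intro divide_left_mono) (auto simp: one_le_power)
    finally show "norm (Psi K n) \<le> psi_const * E" by simp
  qed
  also have "\<dots> = 8 * psi_const * E"
    using sum_box[of "\<lambda>k. psi_const * E" 1] by (simp add: I_def)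
  finally have 1: "norm (\<Sum>n\<in>I. Psi K n) \<le> 8 * psi_const * E" .
  have 2: "norm ((\<Sum>n\<in>I. Psi K n) - (2 * ln (2 * real 1 + 1)) *\<^sub>R CR_T g g g K) \<le> 16 * cell_const * E"
    unfolding I_def E_def by (rule fan_box_sum) simp
  have "ln 3 \<ge> (1::real)" using exp_le by (subst ln_ge_iff) auto
  then have "norm (CR_T g g g K) \<le> norm ((2 * ln (2 * real 1 + 1)) *\<^sub>R CR_T g g g K)"
    by (simp add: mult_le_cancel_right1)
  also have "\<dots> \<le> norm (\<Sum>n\<in>I. Psi K n) + norm ((\<Sum>n\<in>I. Psi K n) - (2 * ln (2 * real 1 + 1)) *\<^sub>R CR_T g g g K)"
    by (metis norm_minus_commute norm_triangle_sub)
  finally show ?thesis using 1 2 by (simp add: CR_const_def E_def[symmetric] distrib_right)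
qed

end

section \<open>Primitive directions\<close>

definition zeta2 :: real where "zeta2 = pi\<^sup>2 / 6"

lemma zeta2_sums: "(\<lambda>n. 1 / (real (Suc n))\<^sup>2) sums zeta2"
  using inverse_squares_sums by (simp add: zeta2_def add.commute)

lemma sum_le_zeta2: "(\<Sum>d=1..N. 1 / (real d)\<^sup>2) \<le> zeta2"
proof -
  have "(\<Sum>d=1..N. 1 / (real d)\<^sup>2) = (\<Sum>n<N. 1 / (real (Suc n))\<^sup>2)"
    by (simp add: sum.atLeast1_atMost_eq)
  also have "\<dots> \<le> (\<Sum>n. 1 / (real (Suc n))\<^sup>2)"
    by (rule sum_le_suminf) (use zeta2_sums in \<open>auto simp: sums_iff\<close>)
  finally show ?thesis using zeta2_sums by (simp add: sums_iff)
qed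

lemma zeta2_ge_1: "zeta2 \<ge> 1"
  using sum_le_zeta2[of 1] by simp

lemma zeta2_tail:
  assumes "N \<ge> 1"
  shows "zeta2 \<le> (\<Sum>d=1..N. 1 / (real d)\<^sup>2) + 1 / real N"
proof (rule LIMSEQ_le_const2)
  show "(\<lambda>M. \<Sum>n<M. 1 / (real (Suc n))\<^sup>2) \<longlonglongrightarrow> zeta2" using zeta2_sums by (simp add: sums_def)
  have *: "(\<Sum>d=1..M. 1 / (real d)\<^sup>2) \<le> (\<Sum>d=1..N. 1 / (real d)\<^sup>2) + 1 / real N - 1 / real M" if "M \<ge> N" for M
    using that
  proof (induction M rule: nat_induct_at_least)
    case (Suc n)
    have "1 / (real (Suc n))\<^sup>2 \<le> 1 / real n - 1 / real (Suc n)"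
      using Suc assms by (intro inverse_square_telescope) auto
    then show ?case using Suc by simp
  qed simp
  show "\<exists>M0. \<forall>M\<ge>M0. (\<Sum>n<M. 1 / (real (Suc n))\<^sup>2) \<le> (\<Sum>d=1..N. 1 / (real d)\<^sup>2) + 1 / real N"
  proof (intro exI[of _ N] allI impI)
    fix M assume "N \<le> M"
    then have "(\<Sum>d=1..M. 1 / (real d)\<^sup>2) \<le> (\<Sum>d=1..N. 1 / (real d)\<^sup>2) + 1 / real N"
      using *[of M] by (smt (verit) divide_nonneg_nonneg of_nat_0_le_iff)
    then show "(\<Sum>n<M. 1 / (real (Suc n))\<^sup>2) \<le> (\<Sum>d=1..N. 1 / (real d)\<^sup>2) + 1 / real N"
      by (simp add: sum.atLeast1_atMost_eq)
  qed
qed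

text \<open>\<open>ln (N div d)\<close> differs from \<open>ln N - ln d\<close> by a bounded amount, \<open>\<Sum>d. ln d / d\<^sup>2\<close> converges, and the weights
  \<open>1 / d\<^sup>2\<close> add up to \<open>\<zeta>(2)\<close> with a tail of \<open>1 / N\<close>, small enough to be multiplied by \<open>ln N\<close>.\<close>
lemma log_average:
  obtains C where "C \<ge> 0"
    "\<And>N. N \<ge> 1 \<Longrightarrow> \<bar>ln (2 * real N + 1) - (\<Sum>d=1..N. ln (real (N div d)) / (real d)\<^sup>2) / zeta2\<bar> \<le> C"
proof -
  have sm: "summable (\<lambda>n. real n powr (-3/2))" by (subst summable_real_powr_iff) auto
  define Z where "Z = (\<Sum>n. real n powr (-3/2))"
  have Z: "(\<Sum>d=1..N. real d powr (-3/2)) \<le> Z" for N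
    unfolding Z_def using sm by (intro sum_le_suminf) auto
  have Z0: "Z \<ge> 0" using Z[of 0] by simp
  show ?thesis
  proof (rule that[of "3 + 3 * Z"])
    fix N :: nat assume N: "N \<ge> 1"
    define S where "S = (\<Sum>d=1..N. 1 / (real d)\<^sup>2)"
    define R where "R = (\<Sum>d=1..N. (ln (real N) - ln (real (N div d))) / (real d)\<^sup>2)"
    have S: "S \<le> zeta2" "zeta2 \<le> S + 1 / real N" unfolding S_def by (rule sum_le_zeta2, rule zeta2_tail[OF N])
    have lnN: "0 \<le> ln (real N)" "ln (real N) \<le> real N" using N ln_bound[of "real N"] by auto
    have tm: "0 \<le> (ln (real N) - ln (real (N div d))) / (real d)\<^sup>2 \<and> (ln (real N) - ln (real (N div d))) / (real d)\<^sup>2 \<le> 3 * real d powr (-3/2)"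
      if d: "d \<in> {1..N}" for d
    proof -
      have q: "N div d \<ge> 1" using d by (simp add: Suc_le_eq div_greater_zero_iff)
      have "N < d * (N div d + 1)" using d by (simp add: dividend_less_times_div)
      also have "\<dots> \<le> d * (2 * (N div d))" using q by (intro mult_left_mono) auto
      finally have "real N \<le> real (2 * d * (N div d))" by (subst of_nat_le_iff) simp
      then have "ln (real N) \<le> ln (2 * real d * real (N div d))" using N d q by (subst ln_le_cancel_iff) auto
      also have "\<dots> = ln (2 * real d) + ln (real (N div d))" using d q by (subst ln_mult) auto
      finally have up: "ln (real N) - ln (real (N div d)) \<le> ln (2 * real d)" by simp
      have "ln (2 * real d) = 2 * ln (sqrt (2 * real d))" using d by (simp add: ln_sqrt)
      moreover have "ln (sqrt (2 * real d)) \<le> sqrt (2 * real d) - 1" using d by (intro ln_le_minus_one) auto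
      moreover have "sqrt 2 \<le> 3/2" by (rule real_le_lsqrt) (auto simp: power2_eq_square)
      then have "sqrt (2 * real d) \<le> 3/2 * sqrt (real d)" using mult_right_mono[of "sqrt 2" "3/2" "sqrt (real d)"] by (simp add: real_sqrt_mult)
      ultimately have up2: "ln (2 * real d) \<le> 3 * sqrt (real d)" by linarith
      have "ln (real (N div d)) \<le> ln (real N)" using q N d by (subst ln_le_cancel_iff) auto
      moreover have "(ln (real N) - ln (real (N div d))) / (real d)\<^sup>2 \<le> 3 * sqrt (real d) / (real d)\<^sup>2"
        using up up2 by (intro divide_right_mono) auto
      moreover have "sqrt (real d) / (real d)\<^sup>2 = real d powr (-3/2)"
      proof -
        have "real d powr (-3/2) = real d powr (1/2 - 2)" by simp
        also have "\<dots> = real d powr (1/2) / real d powr 2" by (rule powr_diff)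
        finally show ?thesis using d by (simp add: powr_half_sqrt)
      qed
      ultimately show ?thesis by simp
    qed
    have R: "0 \<le> R" "R \<le> 3 * Z"
    proof -
      show "0 \<le> R" unfolding R_def using tm by (intro sum_nonneg) auto
      have "R \<le> (\<Sum>d=1..N. 3 * real d powr (-3/2))" unfolding R_def using tm by (intro sum_mono) auto
      also have "\<dots> \<le> 3 * Z" using Z[of N] by (simp add: sum_distrib_left[symmetric])
      finally show "R \<le> 3 * Z" .
    qed
    have av: "(\<Sum>d=1..N. ln (real (N div d)) / (real d)\<^sup>2) = ln (real N) * S - R"
      unfolding R_def S_def by (simp add: sum_distrib_left diff_divide_distrib sum_subtractf)
    have l3: "0 \<le> ln (2 * real N + 1) - ln (real N)" "ln (2 * real N + 1) - ln (real N) \<le> 2"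
    proof -
      show "0 \<le> ln (2 * real N + 1) - ln (real N)" using N by simp
      have "ln (2 * real N + 1) \<le> ln (3 * real N)" using N by (subst ln_le_cancel_iff) auto
      also have "\<dots> = ln 3 + ln (real N)" using N by (subst ln_mult) auto
      also have "ln 3 \<le> (2::real)" using ln_le_minus_one[of 3] by simp
      finally show "ln (2 * real N + 1) - ln (real N) \<le> 2" by simp
    qed
    have d1: "0 \<le> ln (real N) - ln (real N) * S / zeta2" "ln (real N) - ln (real N) * S / zeta2 \<le> 1"
    proof -
      have e: "ln (real N) - ln (real N) * S / zeta2 = ln (real N) * (zeta2 - S) / zeta2"
        using zeta2_ge_1 by (simp add: field_simps)
      show "0 \<le> ln (real N) - ln (real N) * S / zeta2" unfolding e using S lnN zeta2_ge_1 by simp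
      have "ln (real N) * (zeta2 - S) \<le> real N * (1 / real N)" using S lnN by (intro mult_mono) auto
      then have "ln (real N) * (zeta2 - S) \<le> 1 * zeta2" using zeta2_ge_1 N by simp
      then show "ln (real N) - ln (real N) * S / zeta2 \<le> 1" unfolding e using zeta2_ge_1 by (simp add: divide_le_eq)
    qed
    have d2: "0 \<le> R / zeta2" "R / zeta2 \<le> 3 * Z"
    proof -
      show "0 \<le> R / zeta2" using R zeta2_ge_1 by simp
      have "R / zeta2 \<le> R / 1" using R zeta2_ge_1 by (intro divide_left_mono) auto
      then show "R / zeta2 \<le> 3 * Z" using R by simp
    qed
    show "\<bar>ln (2 * real N + 1) - (\<Sum>d=1..N. ln (real (N div d)) / (real d)\<^sup>2) / zeta2\<bar> \<le> 3 + 3 * Z"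
      unfolding av diff_divide_distrib using l3 d1 d2 by linarith
  qed (use Z0 in simp)
qed

lemma supn_iscale: "a \<ge> 0 \<Longrightarrow> supn (iscale a w) = nat a * supn w"
  by (simp add: supn_def iscale_def abs_mult nat_mult_distrib nat_mult_max_right)

text \<open>Every nonzero lattice vector is \<open>d w\<close> for exactly one primitive \<open>w\<close> and \<open>d \<ge> 1\<close>.\<close>
lemma sum_box_by_direction:
  fixes F :: "int \<times> int \<Rightarrow> complex"
  shows "(\<Sum>n | supn n \<le> N \<and> n \<noteq> 0. F n)
     = (\<Sum>d=1..N. \<Sum>w | w \<in> primitive \<and> supn w \<le> N div d. F (iscale (int d) w))"
proof -
  let ?D = "SIGMA d:{1..N}. {w. w \<in> primitive \<and> supn w \<le> N div d}"
  have b: "bij_betw (\<lambda>(d, w). iscale (int d) w) ?D {n. supn n \<le> N \<and> n \<noteq> 0}"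
  proof (rule bij_betwI')
    fix x y assume "x \<in> ?D" "y \<in> ?D"
    then obtain d w e v where x: "x = (d, w)" "w \<in> primitive" "d \<ge> 1" and y: "y = (e, v)" "v \<in> primitive" "e \<ge> 1"
      by auto
    have "inj_on (\<lambda>(w, a). iscale a w) (primitive \<times> {1..})" by (rule bij_betw_imp_inj_on[OF bij_primitive])
    then have "iscale (int d) w = iscale (int e) v \<Longrightarrow> (w, int d) = (v, int e)"
      using inj_onD[of "\<lambda>(w, a). iscale a w" "primitive \<times> {1..}" "(w, int d)" "(v, int e)"] x y by simp
    then show "((case x of (d, w) \<Rightarrow> iscale (int d) w) = (case y of (d, w) \<Rightarrow> iscale (int d) w)) = (x = y)"
      using x y by auto
  next
    fix x assume "x \<in> ?D"
    then obtain d w where x: "x = (d, w)" "w \<in> primitive" "d \<ge> 1" "supn w \<le> N div d" by auto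
    have "d * supn w \<le> d * (N div d)" using x by simp
    also have "\<dots> \<le> N" by simp
    finally have "supn (iscale (int d) w) \<le> N" by (simp add: supn_iscale)
    moreover have "iscale (int d) w \<noteq> 0" using bij_betw_apply[OF bij_primitive, of "(w, int d)"] x by auto
    ultimately show "(case x of (d, w) \<Rightarrow> iscale (int d) w) \<in> {n. supn n \<le> N \<and> n \<noteq> 0}" using x by simp
  next
    fix n assume n: "n \<in> {n. supn n \<le> N \<and> n \<noteq> 0}"
    then have "n \<in> (\<lambda>(w, a). iscale a w) ` (primitive \<times> {1..})"
      using bij_betw_imp_surj_on[OF bij_primitive] by auto
    then obtain w a where w: "w \<in> primitive" "a \<ge> 1" "n = iscale a w" by auto
    define d where "d = nat a"
    have d: "a = int d" "d \<ge> 1" using w by (auto simp: d_def)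
    have dn: "d * supn w \<le> N" using n w d by (simp add: supn_iscale)
    have s1: "supn w \<ge> 1" using primitive_nonzero[OF w(1)] supn_0_iff[of w] by linarith
    have "d \<le> N" using mult_le_mono2[OF s1, of d] dn by linarith
    moreover have "supn w \<le> N div d" using dn d by (simp add: less_eq_div_iff_mult_less_eq mult.commute)
    ultimately show "\<exists>x\<in>?D. n = (case x of (d, w) \<Rightarrow> iscale (int d) w)"
      using w d by (intro bexI[of _ "(d, w)"]) auto
  qed
  have fin: "finite {w. w \<in> primitive \<and> supn w \<le> k}" for k
    by (rule finite_subset[OF _ finite_box[of k]]) auto
  have "(\<Sum>n | supn n \<le> N \<and> n \<noteq> 0. F n) = (\<Sum>x\<in>?D. F (case x of (d, w) \<Rightarrow> iscale (int d) w))"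
    by (rule sum.reindex_bij_betw[OF b, symmetric])
  also have "\<dots> = (\<Sum>d=1..N. \<Sum>w | w \<in> primitive \<and> supn w \<le> N div d. F (iscale (int d) w))"
    by (subst sum.Sigma) (auto simp: fin case_prod_beta')
  finally show ?thesis .
qed

text \<open>A substitute for Moebius inversion: \<open>c N\<close> is the average minus its terms with \<open>d \<ge> 2\<close>, whose
  weights \<open>1 / d\<^sup>2\<close> add up to at most \<open>3/4\<close>, so that the bound \<open>4 X\<close> reproduces itself by induction.\<close>
lemma average_inversion:
  fixes c :: "nat \<Rightarrow> complex"
  assumes D: "\<And>N. N \<ge> 1 \<Longrightarrow> norm (\<Sum>d=1..N. c (N div d) /\<^sub>R (real d)\<^sup>2) \<le> X" and X: "X \<ge> 0" and N: "N \<ge> 1"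
  shows "norm (c N) \<le> 4 * X"
  using N
proof (induction N rule: less_induct)
  case (less N)
  have split: "{1..N} = insert 1 {2..N}" using less.prems by auto
  have "(\<Sum>d=1..N. c (N div d) /\<^sub>R (real d)\<^sup>2) = c N + (\<Sum>d=2..N. c (N div d) /\<^sub>R (real d)\<^sup>2)"
    unfolding split by (subst sum.insert) auto
  then have eq: "c N = (\<Sum>d=1..N. c (N div d) /\<^sub>R (real d)\<^sup>2) - (\<Sum>d=2..N. c (N div d) /\<^sub>R (real d)\<^sup>2)"
    by simp
  have "norm (c N) \<le> norm (\<Sum>d=1..N. c (N div d) /\<^sub>R (real d)\<^sup>2) + norm (\<Sum>d=2..N. c (N div d) /\<^sub>R (real d)\<^sup>2)"
    by (subst eq) (rule norm_triangle_ineq4)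
  also have "norm (\<Sum>d=2..N. c (N div d) /\<^sub>R (real d)\<^sup>2) \<le> (\<Sum>d=2..N. 4 * X * (1 / (real d)\<^sup>2))"
  proof (rule order_trans[OF norm_sum], rule sum_mono)
    fix d assume d: "d \<in> {2..N}"
    then have "N div d < N" "N div d \<ge> 1" by (auto simp: Suc_le_eq div_greater_zero_iff)
    then have "norm (c (N div d)) \<le> 4 * X" by (rule less.IH)
    then have "norm (c (N div d)) * (1 / (real d)\<^sup>2) \<le> 4 * X * (1 / (real d)\<^sup>2)" by (intro mult_right_mono) auto
    then show "norm (c (N div d) /\<^sub>R (real d)\<^sup>2) \<le> 4 * X * (1 / (real d)\<^sup>2)" by (simp add: divide_inverse mult.commute)
  qed
  also have "\<dots> = 4 * X * (\<Sum>d=2..N. 1 / (real d)\<^sup>2)" by (simp only: sum_distrib_left)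
  also have "\<dots> \<le> 4 * X * (3/4)" using X by (intro mult_left_mono sum_inverse_squares_from_2) auto
  finally show ?case using D[OF less.prems] by simp
qed

context profile
begin

text \<open>By homogeneity the sum of \<open>Psi\<close> over all lattice points of a box is \<open>\<Sum>d. P (N div d) / d\<^sup>2\<close> with \<open>P\<close> the
  sum over primitive points. Both this sum and the corresponding average of the claimed main term are
  \<open>2 ln N\<close> times the operator up to a bounded error, and the average can be inverted.\<close>
lemma primitive_fan_sum:
  assumes C: "\<And>N. N \<ge> 1 \<Longrightarrow> \<bar>ln (2 * real N + 1) - (\<Sum>d=1..N. ln (real (N div d)) / (real d)\<^sup>2) / zeta2\<bar> \<le> C"
    and C0: "C \<ge> 0" and N: "N \<ge> 1"
  shows "norm ((\<Sum>w | w \<in> primitive \<and> supn w \<le> N. Psi K w) - (2 * ln (real N) / zeta2) *\<^sub>R CR_T g g g K)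
     \<le> 4 * (16 * cell_const + 2 * C * CR_const) * (B ^ 3 * wt \<sigma> K)"
proof -
  define E where "E = B ^ 3 * wt \<sigma> K"
  have E: "E \<ge> 0" using B by (simp add: E_def wt_nonneg)
  define T where "T = CR_T g g g K"
  have T: "norm T \<le> CR_const * E" unfolding T_def E_def by (rule CR_T_bound)
  define P where "P = (\<lambda>N. \<Sum>w | w \<in> primitive \<and> supn w \<le> N. Psi K w)"
  define c where "c = (\<lambda>N. P N - (2 * ln (real N) / zeta2) *\<^sub>R T)"
  have CR0: "CR_const \<ge> 0" using psi_const_nonneg cell_const_nonneg by (simp add: CR_const_def)
  define X where "X = 16 * cell_const * E + 2 * C * (CR_const * E)"
  have X: "X \<ge> 0" using E C0 CR0 cell_const_nonneg by (simp add: X_def)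
  have "norm (c N) \<le> 4 * X"
  proof (rule average_inversion[OF _ X N])
    fix N :: nat assume N: "N \<ge> 1"
    have h: "Psi K (iscale (int d) w) = Psi K w /\<^sub>R (real d)\<^sup>2" if "d \<ge> 1" for d w
      using fan_homogeneous[of "real d" K "ivec w"] that by (simp add: ivec_iscale inverse_eq_divide)
    have Q: "(\<Sum>n | supn n \<le> N \<and> n \<noteq> 0. Psi K n) = (\<Sum>d=1..N. P (N div d) /\<^sub>R (real d)\<^sup>2)"
      unfolding sum_box_by_direction P_def scaleR_right.sum[symmetric]
      by (intro sum.cong refl) (simp add: h scaleR_sum_right)
    have "(\<Sum>d=1..N. c (N div d) /\<^sub>R (real d)\<^sup>2) = (\<Sum>d=1..N. P (N div d) /\<^sub>R (real d)\<^sup>2) - (\<Sum>d=1..N. ((2 * ln (real (N div d)) / zeta2) *\<^sub>R T) /\<^sub>R (real d)\<^sup>2)"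
      unfolding c_def by (simp add: scaleR_diff_right sum_subtractf)
    also have "(\<Sum>d=1..N. ((2 * ln (real (N div d)) / zeta2) *\<^sub>R T) /\<^sub>R (real d)\<^sup>2) = (2 * ((\<Sum>d=1..N. ln (real (N div d)) / (real d)\<^sup>2) / zeta2)) *\<^sub>R T"
      unfolding sum_divide_distrib sum_distrib_left scaleR_sum_left
      by (intro sum.cong refl) (simp add: divide_inverse ac_simps)
    finally have eq: "(\<Sum>d=1..N. c (N div d) /\<^sub>R (real d)\<^sup>2) = ((\<Sum>n | supn n \<le> N \<and> n \<noteq> 0. Psi K n) - (2 * ln (2 * real N + 1)) *\<^sub>R T)
       + (2 * (ln (2 * real N + 1) - (\<Sum>d=1..N. ln (real (N div d)) / (real d)\<^sup>2) / zeta2)) *\<^sub>R T"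
      unfolding Q by (simp add: algebra_simps)
    have "norm (\<Sum>d=1..N. c (N div d) /\<^sub>R (real d)\<^sup>2) \<le> 16 * cell_const * E + 2 * \<bar>ln (2 * real N + 1) - (\<Sum>d=1..N. ln (real (N div d)) / (real d)\<^sup>2) / zeta2\<bar> * norm T"
    proof -
      have n2: "norm ((2 * z) *\<^sub>R T) = 2 * \<bar>z\<bar> * norm T" for z :: real by (simp add: abs_mult)
      show ?thesis unfolding eq n2[symmetric]
        using fan_box_sum[OF N, of K] by (intro order_trans[OF norm_triangle_ineq] add_right_mono) (simp add: T_def E_def)
    qed
    also have "\<dots> \<le> 16 * cell_const * E + 2 * C * (CR_const * E)"
      using C[OF N] T C0 by (intro add_left_mono mult_mono) auto
    finally show "norm (\<Sum>d=1..N. c (N div d) /\<^sub>R (real d)\<^sup>2) \<le> X" by (simp add: X_def)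
  qed
  then show ?thesis by (simp add: c_def P_def T_def X_def E_def algebra_simps)
qed

end

section \<open>Asymptotics of the resonant sum\<close>

lemma norm_infsum_le_nsum:
  fixes c :: "'a \<Rightarrow> 'b::banach"
  shows "ennreal (norm (infsum c I)) \<le> nsum (\<lambda>i. ennreal (norm (c i))) I"
proof (cases "nsum (\<lambda>i. ennreal (norm (c i))) I = \<infinity>")
  case False
  then obtain r where r: "r \<ge> 0" "nsum (\<lambda>i. ennreal (norm (c i))) I = ennreal r"
    by (metis ennreal_cases infinity_ennreal_def)
  then show ?thesis using summable_of_nsum(3)[where c=c and I=I and C=r] by (simp add: ennreal_leI)
qed simp

context profile
begin

definition equi_const :: "real \<Rightarrow> real" where
  "equi_const C = 8 * riem_const + 4 * (16 * cell_const + 2 * C * CR_const) + 2 * CR_const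
     + 44 * 3 powr \<sigma> * lsum_const \<sigma> ^ 3 + 4 * (lsum_const \<sigma>)\<^sup>2"

text \<open>The short directions give \<open>L\<^sup>2\<close> times their fan integral, with relative errors \<open>|w| / L\<close> that add up to
  \<open>L\<^sup>2\<close>, and the sum of the fan integrals is \<open>primitive_fan_sum\<close> with \<open>N = \<lfloor>L\<rfloor>\<close>. Everything else is
  of order \<open>L\<^sup>2\<close> without a logarithm.\<close>
theorem resonant_sum_asymptotics:
  assumes C: "\<And>N. N \<ge> 1 \<Longrightarrow> \<bar>ln (2 * real N + 1) - (\<Sum>d=1..N. ln (real (N div d)) / (real d)\<^sup>2) / zeta2\<bar> \<le> C"
    and C0: "C \<ge> 0" and L: "L \<ge> exp 1"
  shows "norm ((\<Sum>\<^sub>\<infinity>(p, q)\<in>{(p, q). idot p q = 0}. tri g K ((1/L) *\<^sub>R ivec p) ((1/L) *\<^sub>R ivec q))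
      - (2 * L\<^sup>2 * ln L / zeta2) *\<^sub>R CR_T g g g K) \<le> equi_const C * (B ^ 3 * wt \<sigma> K) * L\<^sup>2"
proof -
  have L1: "L \<ge> 1" "L > 0" using L exp_ge_add_one_self[of 1] by linarith+
  define E where "E = B ^ 3 * wt \<sigma> K"
  have E: "E \<ge> 0" using B by (simp add: E_def wt_nonneg)
  define T where "T = CR_T g g g K"
  have T: "norm T \<le> CR_const * E" unfolding T_def E_def by (rule CR_T_bound)
  define N where "N = nat \<lfloor>L\<rfloor>"
  have N: "real N \<le> L" "L < real N + 1" "N \<ge> 1" using L1 by (auto simp: N_def le_nat_iff)
  define t where "t = (\<lambda>(p, q). tri g K ((1/L) *\<^sub>R ivec p) ((1/L) *\<^sub>R ivec q))"
  have t_le: "ennreal (norm (t (p, q))) \<le> ennreal (B ^ 3) * lrect \<sigma> L K p q" for p q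
    using tri_bound'[of K "(1/L) *\<^sub>R ivec p" "(1/L) *\<^sub>R ivec q"] B
    by (simp add: t_def ennreal_mult'[symmetric] ennreal_leI)
  define R where "R = {(p, q). idot p q = 0}"
  define R0 where "R0 = ({0} \<times> UNIV :: ((int \<times> int) \<times> (int \<times> int)) set)"
  define R1 where "R1 = {(p, q). p \<noteq> 0 \<and> idot p q = 0}"
  have RU: "R = R0 \<union> R1" "R0 \<inter> R1 = {}" by (auto simp: R_def R0_def R1_def idot_def)
  have "nsum (\<lambda>z. ennreal (norm (t z))) R \<le> nsum (\<lambda>(p, q). ennreal (B ^ 3) * lrect \<sigma> L K p q) R"
    using t_le by (intro nsum_mono) auto
  also have "\<dots> = ennreal (B ^ 3) * nsum (\<lambda>(p, q). lrect \<sigma> L K p q) R"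
    by (simp add: case_prod_beta' nsum_cmult)
  also have "\<dots> \<le> ennreal (B ^ 3) * ennreal (res_const \<sigma> * L\<^sup>2 * ln L * wt \<sigma> K)"
    unfolding R_def by (intro mult_left_mono res_sum[OF \<sigma> L]) auto
  also have "\<dots> = ennreal (B ^ 3 * (res_const \<sigma> * L\<^sup>2 * ln L * wt \<sigma> K))" using B by (intro ennreal_mult'[symmetric]) auto
  finally have nR: "nsum (\<lambda>z. ennreal (norm (t z))) R \<le> ennreal (B ^ 3 * (res_const \<sigma> * L\<^sup>2 * ln L * wt \<sigma> K))" .
  have rc: "0 \<le> B ^ 3 * (res_const \<sigma> * L\<^sup>2 * ln L * wt \<sigma> K)"
    using B L1 lsum_const_ge_1[of \<sigma>] by (simp add: res_const_def wt_nonneg)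
  have sR: "t summable_on R" by (rule summable_of_nsum(2)[OF nR rc])
  have sR0: "t summable_on R0" and sR1: "t summable_on R1"
    using sR RU by (auto intro: summable_on_subset_banach)
  have 1: "infsum t R = infsum t R0 + infsum t R1"
    unfolding RU(1) by (rule infsum_Un_disjoint[OF sR0 sR1 RU(2)])
  \<comment> \<open>degenerate rectangles are as many as lattice points, of which there are \<open>L\<^sup>2\<close> per unit area\<close>
  have 2: "norm (infsum t R0) \<le> 4 * (lsum_const \<sigma>)\<^sup>2 * L\<^sup>2 * E"
  proof -
    have "nsum (\<lambda>z. ennreal (norm (t z))) R0 = nsum (\<lambda>q. ennreal (norm (t (0, q)))) UNIV"
      unfolding R0_def nsum_pair by (simp add: nn_integral_count_space_finite)
    also have "\<dots> \<le> nsum (\<lambda>q. ennreal (B ^ 3) * lrect \<sigma> L K 0 q) UNIV" by (intro nsum_mono t_le)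
    also have "\<dots> = ennreal (B ^ 3) * nsum (\<lambda>q. lrect \<sigma> L K 0 q) UNIV" by (rule nsum_cmult)
    also have "\<dots> \<le> ennreal (B ^ 3) * ennreal (4 * (lsum_const \<sigma>)\<^sup>2 * L\<^sup>2 * wt \<sigma> K)"
      by (intro mult_left_mono degenerate_sum \<sigma> L1) auto
    also have "\<dots> = ennreal (4 * (lsum_const \<sigma>)\<^sup>2 * L\<^sup>2 * E)"
      using B by (subst ennreal_mult'[symmetric]) (auto simp: E_def ac_simps)
    finally show ?thesis using E by (intro summable_of_nsum(3)) auto
  qed
  define I where "I = ({1..} \<times> UNIV :: (int \<times> int) set)"
  define u where "u = (\<lambda>w (a, b). t (iscale a w, iscale b (iperp w)))"
  define G where "G = (\<lambda>w. infsum (u w) I)"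
  have sS: "(\<lambda>(w, z). u w z) summable_on (primitive \<times> I)"
    and iS: "infsum t R1 = infsum (\<lambda>(w, z). u w z) (primitive \<times> I)"
  proof -
    have e: "(\<lambda>x. t (case x of (w, a, b) \<Rightarrow> (iscale a w, iscale b (iperp w)))) = (\<lambda>(w, z). u w z)"
      by (auto simp: u_def fun_eq_iff)
    show "(\<lambda>(w, z). u w z) summable_on (primitive \<times> I)"
      using summable_on_reindex_bij_betw[OF bij_orthogonal, of t] sR1 unfolding e I_def R1_def by simp
    show "infsum t R1 = infsum (\<lambda>(w, z). u w z) (primitive \<times> I)"
      using infsum_reindex_bij_betw[OF bij_orthogonal, of t] unfolding e I_def R1_def by simp
  qed
  have sG: "G summable_on primitive" unfolding G_def
    using summable_on_Sigma_banach[OF sS] by simp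
  have iG: "infsum t R1 = infsum G primitive"
    unfolding iS G_def using infsum_Sigma'_banach[OF sS] by simp
  define Pn where "Pn = {w. w \<in> primitive \<and> supn w \<le> N}"
  define Pl where "Pl = primitive - {w. supn w \<le> N}"
  have finP: "finite Pn" unfolding Pn_def by (rule finite_subset[OF _ finite_box[of N]]) auto
  have PU: "primitive = Pn \<union> Pl" "Pn \<inter> Pl = {}" by (auto simp: Pn_def Pl_def)
  have sGl: "G summable_on Pl" using sG PU by (auto intro: summable_on_subset_banach)
  have 3: "infsum t R1 = (\<Sum>w\<in>Pn. G w) + infsum G Pl"
    unfolding iG by (subst PU(1), subst infsum_Un_disjoint) (use finP sGl PU in \<open>auto simp: infsum_finite\<close>)
  have 4: "norm (infsum G Pl) \<le> 44 * 3 powr \<sigma> * lsum_const \<sigma> ^ 3 * L\<^sup>2 * E"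
  proof -
    have "nsum (\<lambda>w. ennreal (norm (G w))) Pl \<le> nsum (\<lambda>w. ennreal (B ^ 3) * nsum (\<lambda>a. nsum (\<lambda>b. lrect \<sigma> L K (iscale a w) (iscale b (iperp w))) UNIV) {1..}) Pl"
    proof (intro nsum_mono)
      fix w
      have "ennreal (norm (G w)) \<le> nsum (\<lambda>z. ennreal (norm (u w z))) I" unfolding G_def by (rule norm_infsum_le_nsum)
      also have "\<dots> \<le> nsum (\<lambda>(a, b). ennreal (B ^ 3) * lrect \<sigma> L K (iscale a w) (iscale b (iperp w))) I"
        by (intro nsum_mono) (auto simp: u_def t_le)
      also have "\<dots> = ennreal (B ^ 3) * nsum (\<lambda>a. nsum (\<lambda>b. lrect \<sigma> L K (iscale a w) (iscale b (iperp w))) UNIV) {1..}"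
        unfolding I_def nsum_pair by (simp add: nsum_cmult)
      finally show "ennreal (norm (G w)) \<le> ennreal (B ^ 3) * nsum (\<lambda>a. nsum (\<lambda>b. lrect \<sigma> L K (iscale a w) (iscale b (iperp w))) UNIV) {1..}" .
    qed
    also have "\<dots> = ennreal (B ^ 3) * nsum (\<lambda>w. nsum (\<lambda>a. nsum (\<lambda>b. lrect \<sigma> L K (iscale a w) (iscale b (iperp w))) UNIV) {1..}) Pl"
      by (rule nsum_cmult)
    also have "\<dots> \<le> ennreal (B ^ 3) * ennreal (44 * 3 powr \<sigma> * lsum_const \<sigma> ^ 3 * L\<^sup>2 * wt \<sigma> K)"
      unfolding Pl_def using N by (intro mult_left_mono large_direction_sum \<sigma> L1) auto
    also have "\<dots> = ennreal (44 * 3 powr \<sigma> * lsum_const \<sigma> ^ 3 * L\<^sup>2 * E)"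
      using B by (subst ennreal_mult'[symmetric]) (auto simp: E_def ac_simps)
    finally show ?thesis using E lsum_const_ge_1[of \<sigma>] by (intro summable_of_nsum(3)) auto
  qed
  \<comment> \<open>each short direction is a Riemann sum; \<open>\<Sum>k\<le>N. 8 k (L / k)\<close> is the total error\<close>
  define F where "F = (\<lambda>w. Psi K w)"
  have rc0: "riem_const \<ge> 0" using psi_const_nonneg by (simp add: riem_const_def)
  have 5: "norm ((\<Sum>w\<in>Pn. G w) - L\<^sup>2 *\<^sub>R (\<Sum>w\<in>Pn. F w)) \<le> 8 * riem_const * L\<^sup>2 * E"
  proof -
    have "norm ((\<Sum>w\<in>Pn. G w) - L\<^sup>2 *\<^sub>R (\<Sum>w\<in>Pn. F w)) = norm (\<Sum>w\<in>Pn. G w - L\<^sup>2 *\<^sub>R F w)"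
      by (simp add: sum_subtractf scaleR_sum_right)
    also have "\<dots> \<le> (\<Sum>w\<in>Pn. riem_const * E * L * (1 / real (supn w)))"
    proof (rule order_trans[OF norm_sum], rule sum_mono)
      fix w assume "w \<in> Pn"
      then have w: "w \<noteq> 0" "supn w \<le> N" using primitive_nonzero by (auto simp: Pn_def)
      have s1: "real (supn w) \<ge> 1" using w supn_0_iff[of w] by linarith
      have "norm (ivec w) \<le> 2 * real (supn w)" by (rule norm_le_supn)
      also have "\<dots> \<le> 2 * L" using w N by linarith
      finally have wL: "norm (ivec w) \<le> 2 * L" .
      have "norm (G w - L\<^sup>2 *\<^sub>R F w) \<le> riem_const * E * (L / norm (ivec w))"
        using riemann_fan(2)[OF w(1) L1(2) wL, of K] unfolding G_def F_def E_def I_def u_def t_def by simp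
      also have "\<dots> \<le> riem_const * E * (L / real (supn w))"
        using s1 supn_le_norm[of w] L1 E rc0 by (intro mult_left_mono divide_left_mono) (auto intro!: mult_pos_pos)
      finally show "norm (G w - L\<^sup>2 *\<^sub>R F w) \<le> riem_const * E * L * (1 / real (supn w))" by simp
    qed
    also have "\<dots> \<le> (\<Sum>w | supn w \<le> N \<and> w \<noteq> 0. riem_const * E * L * (1 / real (supn w)))"
      using E L1 rc0 primitive_nonzero by (intro sum_mono2 finite_subset[OF _ finite_box[of N]]) (auto simp: Pn_def)
    also have "\<dots> = (\<Sum>k=1..N. 8 * real k * (riem_const * E * L * (1 / real k)))" by (rule sum_box)
    also have "\<dots> = (\<Sum>k=1..N. 8 * (riem_const * E * L))" by (intro sum.cong) auto
    also have "\<dots> = 8 * (riem_const * E * L) * real N" by simp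
    also have "\<dots> \<le> 8 * (riem_const * E * L) * L" using N E L1 rc0 by (intro mult_left_mono) auto
    finally show ?thesis by (simp add: power2_eq_square ac_simps)
  qed
  have 6: "norm ((\<Sum>w\<in>Pn. F w) - (2 * ln (real N) / zeta2) *\<^sub>R T) \<le> 4 * (16 * cell_const + 2 * C * CR_const) * E"
    unfolding Pn_def F_def T_def E_def by (rule primitive_fan_sum[OF C C0 N(3)])
  have 7: "norm ((2 * ln (real N) / zeta2) *\<^sub>R T - (2 * ln L / zeta2) *\<^sub>R T) \<le> 2 * CR_const * E"
  proof -
    have a: "ln (real N) \<le> ln L" using N by (subst ln_le_cancel_iff) auto
    have "real N \<ge> 1" using N by simp
    then have "ln L \<le> ln (2 * real N)" using N(2) L1 by (subst ln_le_cancel_iff) linarith+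
    also have "\<dots> = ln 2 + ln (real N)" using N by (subst ln_mult) auto
    finally have b: "ln L - ln (real N) \<le> 1" using ln_2_less_1 by linarith
    have "2 * ln (real N) / zeta2 - 2 * ln L / zeta2 = - (2 * (ln L - ln (real N)) / zeta2)"
      using zeta2_ge_1 by (simp add: field_simps)
    then have "\<bar>2 * ln (real N) / zeta2 - 2 * ln L / zeta2\<bar> = 2 * (ln L - ln (real N)) / zeta2" using a zeta2_ge_1 by simp
    also have "\<dots> \<le> 2 * 1 / 1" using a b zeta2_ge_1 by (intro frac_le) auto
    finally have "norm ((2 * ln (real N) / zeta2 - 2 * ln L / zeta2) *\<^sub>R T) \<le> 2 * (CR_const * E)"
      using T by (simp add: mult_mono)
    then show ?thesis by (simp add: scaleR_diff_left mult.assoc)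
  qed
  have "infsum t R - (2 * L\<^sup>2 * ln L / zeta2) *\<^sub>R T
     = infsum t R0 + infsum G Pl + ((\<Sum>w\<in>Pn. G w) - L\<^sup>2 *\<^sub>R (\<Sum>w\<in>Pn. F w))
       + L\<^sup>2 *\<^sub>R ((\<Sum>w\<in>Pn. F w) - (2 * ln (real N) / zeta2) *\<^sub>R T)
       + L\<^sup>2 *\<^sub>R ((2 * ln (real N) / zeta2) *\<^sub>R T - (2 * ln L / zeta2) *\<^sub>R T)"
    unfolding 1 3 by (simp add: algebra_simps)
  also have "norm \<dots> \<le> norm (infsum t R0) + norm (infsum G Pl) + norm ((\<Sum>w\<in>Pn. G w) - L\<^sup>2 *\<^sub>R (\<Sum>w\<in>Pn. F w))
       + norm (L\<^sup>2 *\<^sub>R ((\<Sum>w\<in>Pn. F w) - (2 * ln (real N) / zeta2) *\<^sub>R T))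
       + norm (L\<^sup>2 *\<^sub>R ((2 * ln (real N) / zeta2) *\<^sub>R T - (2 * ln L / zeta2) *\<^sub>R T))"
    by (intro norm_triangle_le add_mono order.refl)
  also have "\<dots> \<le> 4 * (lsum_const \<sigma>)\<^sup>2 * L\<^sup>2 * E + 44 * 3 powr \<sigma> * lsum_const \<sigma> ^ 3 * L\<^sup>2 * E + 8 * riem_const * L\<^sup>2 * E
       + L\<^sup>2 * (4 * (16 * cell_const + 2 * C * CR_const) * E) + L\<^sup>2 * (2 * CR_const * E)"
    unfolding norm_scaleR abs_power2 using 2 4 5 6 7 by (intro add_mono mult_left_mono) auto
  also have "\<dots> = equi_const C * E * L\<^sup>2" by (simp add: equi_const_def algebra_simps)
  finally show ?thesis unfolding R_def t_def T_def E_def .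
qed

end

section \<open>Pointwise bounds from the weak gradient\<close>

lemma continuous_AE_le:
  fixes h :: "real^2 \<Rightarrow> real"
  assumes h: "continuous_on UNIV h" and ae: "AE x in lborel. h x \<le> 0"
  shows "h x \<le> 0"
proof (rule ccontr)
  assume "\<not> h x \<le> 0"
  then have ne: "{x. 0 < h x} \<noteq> {}" by (auto simp: not_le)
  have op: "open {x. 0 < h x}" by (rule open_Collect_less[OF continuous_on_const h])
  then have m: "{x. 0 < h x} \<in> sets borel" by (rule borel_open)
  have "{x. 0 < h x} \<in> null_sets lborel"
    using AE_iff_null[of lborel "\<lambda>x. h x \<le> 0"] ae m by (simp add: not_le)
  then have "negligible {x. 0 < h x}" using m by (simp add: negligible_iff_null_sets null_sets_completionI)
  with open_not_negligible[OF op ne] show False by simp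
qed

lemma nn_integral_real2_product:
  assumes [measurable]: "f \<in> borel_measurable borel" "g \<in> borel_measurable borel" and ij: "(i::2) \<noteq> j"
  shows "(\<integral>\<^sup>+z. f (z$i) * g (z$j) \<partial>(lborel :: (real^2) measure)) = (\<integral>\<^sup>+a. f a \<partial>lborel) * (\<integral>\<^sup>+b. g b \<partial>lborel)"
proof -
  consider "i = 1" "j = 2" | "i = 2" "j = 1" using ij exhaust_2[of i] exhaust_2[of j] by metis
  then show ?thesis
  proof cases
    case 1
    show ?thesis unfolding 1 by (subst nn_integral_real2(1)) (auto simp: nn_integral_cmult nn_integral_multc)
  next
    case 2
    show ?thesis unfolding 2 by (subst nn_integral_real2(2)) (auto simp: nn_integral_cmult nn_integral_multc)
  qed
qed

lemma DERIV_pospart_square: "((\<lambda>y. (max 0 y)\<^sup>2) has_real_derivative 2 * max 0 y) (at (y::real))"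
proof -
  consider "y > 0" | "y < 0" | "y = 0" by linarith
  then show ?thesis
  proof cases
    case 1
    have d: "((\<lambda>y. y\<^sup>2) has_real_derivative 2 * y) (at y)" by (auto intro!: derivative_eq_intros)
    have ev: "eventually (\<lambda>z. z\<^sup>2 = (max 0 z)\<^sup>2) (nhds y)"
      using 1 by (auto simp: eventually_nhds intro!: exI[of _ "{0<..}"])
    from DERIV_cong_ev[OF refl ev refl, THEN iffD1, OF d] show ?thesis using 1 by simp
  next
    case 2
    have d: "((\<lambda>y::real. 0) has_real_derivative 0) (at y)" by simp
    have ev: "eventually (\<lambda>z. 0 = (max 0 z)\<^sup>2) (nhds y)"
      using 2 by (auto simp: eventually_nhds intro!: exI[of _ "{..<0}"])
    from DERIV_cong_ev[OF refl ev refl, THEN iffD1, OF d] show ?thesis using 2 by simp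
  next
    case 3
    have "((\<lambda>h. ((max 0 (0 + h))\<^sup>2 - (max 0 0)\<^sup>2) / h) \<longlongrightarrow> 0) (at (0::real))"
    proof (rule Lim_null_comparison[where g="\<lambda>h. \<bar>h\<bar>"])
      show "\<forall>\<^sub>F h in at (0::real). norm (((max 0 (0 + h))\<^sup>2 - (max 0 0)\<^sup>2) / h) \<le> \<bar>h\<bar>"
        by (intro always_eventually allI) (auto simp: max_def power2_eq_square)
      show "((\<lambda>h::real. \<bar>h\<bar>) \<longlongrightarrow> 0) (at 0)" by (rule tendsto_rabs_zero) (rule tendsto_ident_at)
    qed
    then show ?thesis unfolding 3 by (simp add: DERIV_def)
  qed
qed

text \<open>Piecewise polynomials, so that all derivatives are explicit: \<open>hat_step\<close> is a continuously
  differentiable antiderivative of \<open>hat\<close>, and a difference of two of its translates is a smoothed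
  indicator function of a segment. The bump localises in the other coordinate.\<close>
definition hat :: "real \<Rightarrow> real \<Rightarrow> real" where
  "hat \<eta> s = max 0 (s + \<eta>) - 2 * max 0 s + max 0 (s - \<eta>)"

definition hat_step :: "real \<Rightarrow> real \<Rightarrow> real" where
  "hat_step \<eta> s = ((max 0 (s + \<eta>))\<^sup>2 - 2 * (max 0 s)\<^sup>2 + (max 0 (s - \<eta>))\<^sup>2) / 2"

definition bump :: "real \<Rightarrow> real \<Rightarrow> real" where
  "bump \<eta> r = (max 0 (\<eta>\<^sup>2 - r\<^sup>2))\<^sup>2"

lemma DERIV_hat_step: "(hat_step \<eta> has_real_derivative hat \<eta> s) (at s)"
proof -
  have d: "((\<lambda>s. (max 0 (s + a))\<^sup>2) has_real_derivative 2 * max 0 (s + a)) (at s)" for a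
  proof -
    have "((\<lambda>s. s + a) has_real_derivative 1) (at s)" by (auto intro!: derivative_eq_intros)
    from DERIV_chain2[where f="\<lambda>y. (max 0 y)\<^sup>2" and g="\<lambda>s. s + a", OF DERIV_pospart_square this]
    show ?thesis by simp
  qed
  have "((\<lambda>s. ((max 0 (s + \<eta>))\<^sup>2 - 2 * (max 0 (s + 0))\<^sup>2 + (max 0 (s + - \<eta>))\<^sup>2) / 2) has_real_derivative
     (2 * max 0 (s + \<eta>) - 2 * (2 * max 0 (s + 0)) + 2 * max 0 (s + - \<eta>)) / 2) (at s)"
    by (intro DERIV_cdivide DERIV_add DERIV_diff DERIV_cmult d)
  then have "(hat_step \<eta> has_real_derivative (2 * max 0 (s + \<eta>) - 2 * (2 * max 0 (s + 0)) + 2 * max 0 (s + - \<eta>)) / 2) (at s)"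
    by (simp add: hat_step_def[abs_def])
  then show ?thesis by (rule DERIV_cong) (simp add: hat_def field_simps)
qed

lemma DERIV_bump: "(bump \<eta> has_real_derivative 2 * max 0 (\<eta>\<^sup>2 - r\<^sup>2) * (- (2 * r))) (at r)"
proof -
  have "((\<lambda>r. \<eta>\<^sup>2 - r\<^sup>2) has_real_derivative - (2 * r)) (at r)"
    by (auto intro!: derivative_eq_intros)
  from DERIV_chain2[where f="\<lambda>y. (max 0 y)\<^sup>2" and g="\<lambda>r. \<eta>\<^sup>2 - r\<^sup>2", OF DERIV_pospart_square this] show ?thesis by (simp add: bump_def[abs_def])
qed

lemma hat_props:
  assumes "\<eta> > 0"
  shows "hat \<eta> s \<ge> 0" "\<bar>s\<bar> \<ge> \<eta> \<Longrightarrow> hat \<eta> s = 0"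
    "hat_step \<eta> s \<ge> 0" "hat_step \<eta> s \<le> \<eta>\<^sup>2" "s \<le> - \<eta> \<Longrightarrow> hat_step \<eta> s = 0" "s \<ge> \<eta> \<Longrightarrow> hat_step \<eta> s = \<eta>\<^sup>2"
proof -
  show h0: "hat \<eta> s \<ge> 0" for s using assms by (auto simp: hat_def max_def)
  show "\<bar>s\<bar> \<ge> \<eta> \<Longrightarrow> hat \<eta> s = 0" using assms by (auto simp: hat_def max_def)
  show l: "s \<le> - \<eta> \<Longrightarrow> hat_step \<eta> s = 0" for s using assms by (auto simp: hat_step_def max_def)
  show r: "s \<ge> \<eta> \<Longrightarrow> hat_step \<eta> s = \<eta>\<^sup>2" for s using assms by (auto simp: hat_step_def max_def power2_eq_square algebra_simps)
  have mono: "hat_step \<eta> a \<le> hat_step \<eta> b" if "a \<le> b" for a b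
    by (rule DERIV_nonneg_imp_nondecreasing[OF that]) (use DERIV_hat_step h0 in blast)
  show "hat_step \<eta> s \<ge> 0" using mono[of "min s (- \<eta>)" s] l[of "min s (- \<eta>)"] by simp
  show "hat_step \<eta> s \<le> \<eta>\<^sup>2" using mono[of s "max s \<eta>"] r[of "max s \<eta>"] by simp
qed

lemma bump_props: "bump \<eta> r \<ge> 0" "\<bar>r\<bar> \<ge> \<bar>\<eta>\<bar> \<Longrightarrow> bump \<eta> r = 0"
proof -
  show "bump \<eta> r \<ge> 0" by (simp add: bump_def)
  assume "\<bar>r\<bar> \<ge> \<bar>\<eta>\<bar>"
  then have "\<eta>\<^sup>2 \<le> r\<^sup>2" by (rule abs_le_square_iff[THEN iffD1])
  then show "bump \<eta> r = 0" by (simp add: bump_def)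
qed

lemma hat_continuous: "continuous_on UNIV (hat \<eta>)"
  unfolding hat_def[abs_def] by (intro continuous_intros)

lemma hat_step_continuous: "continuous_on UNIV (hat_step \<eta>)"
  unfolding hat_step_def[abs_def] by (intro continuous_intros) auto

lemma bump_continuous: "continuous_on UNIV (bump \<eta>)"
  unfolding bump_def[abs_def] by (intro continuous_intros)

lemma hat_integral:
  assumes "\<eta> > 0"
  shows "(\<integral>\<^sup>+s. ennreal (hat \<eta> (s - c)) \<partial>lborel) = ennreal (\<eta>\<^sup>2)"
proof -
  have m: "(\<lambda>s. ennreal (hat \<eta> s)) \<in> borel_measurable borel"
    using borel_measurable_continuous_onI[OF hat_continuous[of \<eta>]] by measurable
  have "(\<integral>\<^sup>+s. ennreal (hat \<eta> (s - c)) \<partial>lborel) = (\<integral>\<^sup>+s. ennreal (hat \<eta> s) \<partial>lborel)"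
    using nn_integral_real_affine[OF m, of 1 "- c"] by (simp add: algebra_simps)
  also have "\<dots> = (\<integral>\<^sup>+s. ennreal (hat \<eta> s) * indicator {-\<eta>..\<eta>} s \<partial>lborel)"
    using hat_props(2)[OF assms] by (intro nn_integral_cong) (auto simp: indicator_def not_le abs_le_iff split: if_splits)
  also have "\<dots> = ennreal (hat_step \<eta> \<eta> - hat_step \<eta> (- \<eta>))"
    using assms borel_measurable_continuous_onI[OF hat_continuous[of \<eta>]]
    by (intro nn_integral_FTC_Icc DERIV_hat_step hat_props(1)) auto
  also have "\<dots> = ennreal (\<eta>\<^sup>2)" using hat_props[OF assms, of \<eta>] hat_props[OF assms, of "- \<eta>"] by simp
  finally show ?thesis .
qed

lemma bump_integral:
  assumes "\<eta> > 0"
  obtains J where "J > 0" "\<And>c. (\<integral>\<^sup>+s. ennreal (bump \<eta> (s - c)) \<partial>lborel) = ennreal J"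
proof -
  have m: "bump \<eta> \<in> borel_measurable borel"
    by (rule borel_measurable_continuous_onI[OF bump_continuous])
  have shift: "(\<integral>\<^sup>+s. ennreal (bump \<eta> (s - c)) \<partial>lborel) = (\<integral>\<^sup>+s. ennreal (bump \<eta> s) \<partial>lborel)" for c
    using nn_integral_real_affine[of "\<lambda>s. ennreal (bump \<eta> s)" 1 "- c"] m by (simp add: algebra_simps)
  let ?J = "\<integral>\<^sup>+s. ennreal (bump \<eta> s) \<partial>lborel"
  have fin: "?J < \<infinity>"
  proof -
    have "?J \<le> (\<integral>\<^sup>+s. ennreal ((\<eta>\<^sup>2)\<^sup>2) * indicator {-\<eta>..\<eta>} s \<partial>lborel)"
    proof (intro nn_integral_mono)
      fix s
      show "ennreal (bump \<eta> s) \<le> ennreal ((\<eta>\<^sup>2)\<^sup>2) * indicator {-\<eta>..\<eta>} s"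
      proof (cases "s \<in> {-\<eta>..\<eta>}")
        case True
        have "bump \<eta> s \<le> (\<eta>\<^sup>2)\<^sup>2" unfolding bump_def by (intro power_mono) auto
        then show ?thesis using True by (simp add: ennreal_leI)
      next
        case False
        then have "bump \<eta> s = 0" using assms by (intro bump_props(2)) auto
        then show ?thesis by simp
      qed
    qed
    also have "\<dots> < \<infinity>" using assms by (simp add: nn_integral_cmult_indicator ennreal_mult_less_top)
    finally show ?thesis .
  qed
  have pos: "?J > 0"
  proof -
    have "ennreal ((3 * \<eta>\<^sup>2 / 4)\<^sup>2) * emeasure lborel {-\<eta>/2..\<eta>/2} = (\<integral>\<^sup>+s. ennreal ((3 * \<eta>\<^sup>2 / 4)\<^sup>2) * indicator {-\<eta>/2..\<eta>/2} s \<partial>lborel)"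
      by (simp add: nn_integral_cmult_indicator)
    also have "\<dots> \<le> ?J"
    proof (intro nn_integral_mono)
      fix s
      show "ennreal ((3 * \<eta>\<^sup>2 / 4)\<^sup>2) * indicator {-\<eta>/2..\<eta>/2} s \<le> ennreal (bump \<eta> s)"
      proof (cases "s \<in> {-\<eta>/2..\<eta>/2}")
        case True
        then have "\<bar>s\<bar> \<le> \<bar>\<eta>/2\<bar>" by auto
        then have "s\<^sup>2 \<le> (\<eta>/2)\<^sup>2" by (rule abs_le_square_iff[THEN iffD1])
        then have "3 * \<eta>\<^sup>2 / 4 \<le> \<eta>\<^sup>2 - s\<^sup>2" by (simp add: power_divide)
        then have "3 * \<eta>\<^sup>2 / 4 \<le> max 0 (\<eta>\<^sup>2 - s\<^sup>2)" by (rule max.coboundedI2)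
        then have "(3 * \<eta>\<^sup>2 / 4)\<^sup>2 \<le> bump \<eta> s" unfolding bump_def by (intro power_mono) auto
        then show ?thesis using True by (simp add: ennreal_leI)
      qed simp
    qed
    finally have "ennreal ((3 * \<eta>\<^sup>2 / 4)\<^sup>2) * emeasure lborel {-\<eta>/2..\<eta>/2} \<le> ?J" .
    moreover have "0 < ennreal ((3 * \<eta>\<^sup>2 / 4)\<^sup>2) * emeasure lborel {-\<eta>/2..\<eta>/2}"
      using assms by (simp add: ennreal_zero_less_mult_iff)
    ultimately show ?thesis by order
  qed
  have "?J = ennreal (enn2real ?J)" "enn2real ?J > 0"
    using fin pos by (auto simp: enn2real_positive_iff)
  then show ?thesis using shift that[of "enn2real ?J"] by simp
qed

lemma hat_measurable [measurable]: "hat \<eta> \<in> borel_measurable borel"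
  and hat_step_measurable [measurable]: "hat_step \<eta> \<in> borel_measurable borel"
  and bump_measurable [measurable]: "bump \<eta> \<in> borel_measurable borel"
  by (auto intro: borel_measurable_continuous_onI hat_continuous hat_step_continuous bump_continuous)

text \<open>The kernel has total mass \<open>\<eta>\<^sup>2 J\<close> and is supported within \<open>2 \<eta>\<close> of \<open>x\<close>.\<close>
lemma bump_average:
  fixes f :: "real^2 \<Rightarrow> complex" and i j :: 2
  assumes ij: "i \<noteq> j" and \<eta>: "\<eta> > 0" and J: "J > 0" "\<And>c. (\<integral>\<^sup>+s. ennreal (bump \<eta> (s - c)) \<partial>lborel) = ennreal J"
    and f: "\<And>S. compact S \<Longrightarrow> set_integrable lborel S f" and fm: "continuous_on UNIV f"
    and e: "e \<ge> 0" "\<And>z. norm (z - x) \<le> 2 * \<eta> \<Longrightarrow> norm (f z - f x) \<le> e"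
  shows "integrable lborel (\<lambda>z. (hat \<eta> (z$i - x$i) * bump \<eta> (z$j - x$j)) *\<^sub>R f z)"
    "norm ((\<integral>z. (hat \<eta> (z$i - x$i) * bump \<eta> (z$j - x$j)) *\<^sub>R f z \<partial>lborel) - (\<eta>\<^sup>2 * J) *\<^sub>R f x) \<le> \<eta>\<^sup>2 * J * e"
proof -
  define w where "w = (\<lambda>z::real^2. hat \<eta> (z$i - x$i) * bump \<eta> (z$j - x$j))"
  have wm [measurable]: "w \<in> borel_measurable borel" unfolding w_def by measurable
  have w0: "w z \<ge> 0" for z unfolding w_def using hat_props(1)[OF \<eta>] bump_props(1) by simp
  have supp: "norm (z - x) \<le> 2 * \<eta>" if "w z \<noteq> 0" for z
  proof -
    have "\<bar>z$i - x$i\<bar> < \<eta>" "\<bar>z$j - x$j\<bar> < \<eta>"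
      using that hat_props(2)[OF \<eta>, of "z$i - x$i"] bump_props(2)[of \<eta> "z$j - x$j"] \<eta> by (auto simp: w_def not_le[symmetric])
    moreover have "norm (z - x) \<le> \<bar>(z - x)$i\<bar> + \<bar>(z - x)$j\<bar>"
      using norm_le_l1_cart[of "z - x"] ij exhaust_2[of i] exhaust_2[of j] by (auto simp: UNIV_2)
    ultimately show ?thesis by simp
  qed
  have wint: "(\<integral>\<^sup>+z. ennreal (w z) \<partial>lborel) = ennreal (\<eta>\<^sup>2 * J)"
  proof -
    have "(\<integral>\<^sup>+z. ennreal (w z) \<partial>lborel) = (\<integral>\<^sup>+z. ennreal (hat \<eta> (z$i - x$i)) * ennreal (bump \<eta> (z$j - x$j)) \<partial>(lborel :: (real^2) measure))"
      unfolding w_def by (intro nn_integral_cong ennreal_mult' hat_props(1)[OF \<eta>])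
    also have "\<dots> = ennreal (\<eta>\<^sup>2) * ennreal J"
      using nn_integral_real2_product[of "\<lambda>s. ennreal (hat \<eta> (s - x$i))" "\<lambda>s. ennreal (bump \<eta> (s - x$j))", OF _ _ ij] J(2)
      by (simp add: hat_integral[OF \<eta>])
    finally show ?thesis by (simp add: ennreal_mult')
  qed
  have wi: "integrable lborel w" by (rule integrableI_bounded) (use wint w0 in auto)
  have wI: "(\<integral>z. w z \<partial>lborel) = \<eta>\<^sup>2 * J" using wint w0 J by (subst integral_eq_nn_integral) auto
  have fb [measurable]: "f \<in> borel_measurable borel" by (rule borel_measurable_continuous_onI[OF fm])
  have d_le: "norm (w z *\<^sub>R (f z - f x)) \<le> e * w z" for z
    using e(2)[OF supp, of z] w0[of z] by (cases "w z = 0") (auto simp: mult.commute mult_left_mono)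
  have di: "integrable lborel (\<lambda>z. w z *\<^sub>R (f z - f x))"
    by (rule Bochner_Integration.integrable_bound[OF integrable_mult_right[OF wi, of e]])
       (use d_le e(1) w0 in \<open>auto intro!: AE_I2 simp: abs_mult\<close>)
  have ci: "integrable lborel (\<lambda>z. w z *\<^sub>R f x)" by (rule integrable_scaleR_left) (rule wi)
  have "integrable lborel (\<lambda>z. w z *\<^sub>R (f z - f x) + w z *\<^sub>R f x)" by (rule Bochner_Integration.integrable_add[OF di ci])
  then have fi: "integrable lborel (\<lambda>z. w z *\<^sub>R f z)" by (simp add: scaleR_diff_right)
  then show "integrable lborel (\<lambda>z. (hat \<eta> (z$i - x$i) * bump \<eta> (z$j - x$j)) *\<^sub>R f z)" by (simp add: w_def)
  have "(\<integral>z. w z *\<^sub>R f z \<partial>lborel) - (\<integral>z. w z *\<^sub>R f x \<partial>lborel) = (\<integral>z. w z *\<^sub>R (f z - f x) \<partial>lborel)"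
    using Bochner_Integration.integral_diff[OF fi ci] by (simp add: scaleR_diff_right)
  moreover have "(\<integral>z. w z *\<^sub>R f x \<partial>lborel) = (\<eta>\<^sup>2 * J) *\<^sub>R f x" unfolding wI[symmetric] by (rule integral_scaleR_left) (rule wi)
  moreover have "norm (\<integral>z. w z *\<^sub>R (f z - f x) \<partial>lborel) \<le> (\<integral>z. e * w z \<partial>lborel)"
    by (rule Bochner_Integration.integral_norm_bound_integral[OF di]) (use wi d_le in auto)
  ultimately show "norm ((\<integral>z. (hat \<eta> (z$i - x$i) * bump \<eta> (z$j - x$j)) *\<^sub>R f z \<partial>lborel) - (\<eta>\<^sup>2 * J) *\<^sub>R f x) \<le> \<eta>\<^sup>2 * J * e"
    using wI by (simp add: w_def mult.commute)
qed

lemma norm_integral_le: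
  fixes f :: "'a \<Rightarrow> 'b::{banach, second_countable_topology}"
  assumes "(\<integral>\<^sup>+x. ennreal (norm (f x)) \<partial>M) \<le> ennreal r" "r \<ge> 0"
  shows "norm (\<integral>x. f x \<partial>M) \<le> r"
proof (cases "integrable M f")
  case True
  show ?thesis using integral_norm_bound_ennreal[OF True] assms by (meson ennreal_le_iff order_trans)
qed (use assms in \<open>simp add: not_integrable_integral_eq\<close>)

text \<open>The test function is a smoothed indicator function of the segment from \<open>x\<close> to \<open>x'\<close> times a bump across
  it. Its derivative along the segment is a difference of two approximations of the identity at \<open>x\<close> and
  \<open>x'\<close>, while its mass is that of one approximation times the length of the segment.\<close>
lemma weak_gradient_axis:
  fixes f :: "real^2 \<Rightarrow> complex" and i j :: 2
  assumes ij: "i \<noteq> j" and f: "continuous_on UNIV f" and wg: "weak_gradient f G"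
    and ae: "AE z in lborel. norm (G z) \<le> \<Gamma> z" and \<Gamma>: "\<And>z. norm (z - x) \<le> 3 \<Longrightarrow> \<Gamma> z \<le> \<Gamma>0" and \<Gamma>0: "\<Gamma>0 \<ge> 0"
    and h: "0 \<le> h" "h \<le> 1" and x': "x' = x + h *\<^sub>R axis i 1"
  shows "norm (f x - f x') \<le> \<Gamma>0 * h"
proof (rule field_le_epsilon)
  fix e0 :: real assume e0: "e0 > 0"
  define e where "e = e0 / (2 + 2 * \<Gamma>0)"
  have e: "e > 0" using e0 \<Gamma>0 by (simp add: e_def)
  have x'n: "x'$i = x$i + h" "x'$j = x$j" using ij by (simp_all add: x' axis_def)
  obtain d1 where d1: "d1 > 0" "\<And>z. dist z x < d1 \<Longrightarrow> dist (f z) (f x) < e"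
    using f e unfolding continuous_on_iff by (metis UNIV_I)
  obtain d2 where d2: "d2 > 0" "\<And>z. dist z x' < d2 \<Longrightarrow> dist (f z) (f x') < e"
    using f e unfolding continuous_on_iff by (metis UNIV_I)
  define \<eta> where "\<eta> = min (min (d1/3) (d2/3)) (min e (1/2))"
  have \<eta>: "\<eta> > 0" "\<eta> \<le> e" "\<eta> \<le> 1/2" "2 * \<eta> < d1" "2 * \<eta> < d2" using d1(1) d2(1) e by (auto simp: \<eta>_def)
  obtain J where J: "J > 0" "\<And>c. (\<integral>\<^sup>+s. ennreal (bump \<eta> (s - c)) \<partial>lborel) = ennreal J"
    using bump_integral[OF \<eta>(1)] by metis
  define k where "k = \<eta>\<^sup>2 * J"
  have k: "k > 0" using \<eta> J by (simp add: k_def)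
  have fint: "set_integrable lborel S f" if "compact S" for S using wg that by (simp add: weak_gradient_def)
  define W where "W = (\<lambda>y z::real^2. hat \<eta> (z$i - y$i) * bump \<eta> (z$j - y$j))"
  have b1: "integrable lborel (\<lambda>z. W x z *\<^sub>R f z)" "norm ((\<integral>z. W x z *\<^sub>R f z \<partial>lborel) - k *\<^sub>R f x) \<le> k * e"
  proof -
    have "norm (f z - f x) \<le> e" if "norm (z - x) \<le> 2 * \<eta>" for z using d1(2)[of z] that \<eta> by (auto simp: dist_norm)
    note b = bump_average[OF ij \<eta>(1) J fint f less_imp_le[OF e] this]
    show "integrable lborel (\<lambda>z. W x z *\<^sub>R f z)" "norm ((\<integral>z. W x z *\<^sub>R f z \<partial>lborel) - k *\<^sub>R f x) \<le> k * e"
      using b unfolding W_def k_def by simp_all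
  qed
  have b2: "integrable lborel (\<lambda>z. W x' z *\<^sub>R f z)" "norm ((\<integral>z. W x' z *\<^sub>R f z \<partial>lborel) - k *\<^sub>R f x') \<le> k * e"
  proof -
    have "norm (f z - f x') \<le> e" if "norm (z - x') \<le> 2 * \<eta>" for z using d2(2)[of z] that \<eta> by (auto simp: dist_norm)
    note b = bump_average[OF ij \<eta>(1) J fint f less_imp_le[OF e] this]
    show "integrable lborel (\<lambda>z. W x' z *\<^sub>R f z)" "norm ((\<integral>z. W x' z *\<^sub>R f z \<partial>lborel) - k *\<^sub>R f x') \<le> k * e"
      using b unfolding W_def k_def by simp_all
  qed
  define A where "A = (\<lambda>s. hat_step \<eta> (s - x$i) - hat_step \<eta> (s - x'$i))"
  define A' where "A' = (\<lambda>s. hat \<eta> (s - x$i) - hat \<eta> (s - x'$i))"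
  define \<beta> where "\<beta> = (\<lambda>s. bump \<eta> (s - x$j))"
  define \<beta>' where "\<beta>' = (\<lambda>s. 2 * max 0 (\<eta>\<^sup>2 - (s - x$j)\<^sup>2) * (- (2 * (s - x$j))))"
  have dA: "(A has_real_derivative A' s) (at s)" for s
  proof -
    have sh: "((\<lambda>s. hat_step \<eta> (s - c)) has_real_derivative hat \<eta> (s - c)) (at s)" for c
    proof -
      have "((\<lambda>s. s - c) has_real_derivative 1) (at s)" by (auto intro!: derivative_eq_intros)
      from DERIV_chain2[where f="hat_step \<eta>" and g="\<lambda>s. s - c", OF DERIV_hat_step this] show ?thesis by simp
    qed
    show ?thesis unfolding A_def A'_def by (intro DERIV_diff sh)
  qed
  have d\<beta>: "(\<beta> has_real_derivative \<beta>' s) (at s)" for s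
  proof -
    have "((\<lambda>s. s - x$j) has_real_derivative 1) (at s)" by (auto intro!: derivative_eq_intros)
    from DERIV_chain2[where f="bump \<eta>" and g="\<lambda>s. s - x$j", OF DERIV_bump this] show ?thesis by (simp add: \<beta>_def \<beta>'_def)
  qed
  define \<phi> where "\<phi> = (\<lambda>z::real^2. A (z$i) * \<beta> (z$j))"
  define D where "D = (\<lambda>z::real^2. (A' (z$i) * \<beta> (z$j)) *\<^sub>R axis i 1 + (A (z$i) * \<beta>' (z$j)) *\<^sub>R axis j (1::real))"
  have gd: "GDERIV \<phi> z :> D z" for z
  proof -
    have c: "((\<lambda>z::real^2. z$l) has_derivative (\<lambda>v. v$l)) (at z)" for l by (rule bounded_linear_imp_has_derivative[OF bounded_linear_vec_nth])
    have 1: "((\<lambda>z::real^2. A (z$i)) has_derivative (\<lambda>v. v$i * A' (z$i))) (at z)"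
      using has_derivative_compose[OF c dA[unfolded has_field_derivative_def]] by (simp add: mult.commute)
    have 2: "((\<lambda>z::real^2. \<beta> (z$j)) has_derivative (\<lambda>v. v$j * \<beta>' (z$j))) (at z)"
      using has_derivative_compose[OF c d\<beta>[unfolded has_field_derivative_def]] by (simp add: mult.commute)
    have "(\<phi> has_derivative (\<lambda>v. A (z$i) * (v$j * \<beta>' (z$j)) + v$i * A' (z$i) * \<beta> (z$j))) (at z)"
      unfolding \<phi>_def by (rule has_derivative_mult[OF 1 2])
    moreover have "(\<lambda>v. A (z$i) * (v$j * \<beta>' (z$j)) + v$i * A' (z$i) * \<beta> (z$j)) = (\<lambda>v. inner v (D z))"
      by (rule ext) (simp add: D_def inner_add_right inner_axis)
    ultimately show ?thesis by (simp add: gderiv_def)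
  qed
  have cD: "continuous_on UNIV D"
  proof -
    have cc: "continuous_on UNIV (\<lambda>z::real^2. h (z$l - c))" if "continuous_on UNIV h" for h :: "real \<Rightarrow> real" and l c
      by (rule continuous_on_compose2[OF that]) (auto intro!: continuous_intros)
    show ?thesis unfolding D_def A'_def A_def \<beta>_def \<beta>'_def
      by (intro continuous_intros cc hat_continuous hat_step_continuous bump_continuous)
  qed
  have A0: "0 \<le> A s" "A s \<le> \<eta>\<^sup>2 * indicator {x$i - \<eta>..x$i + h + \<eta>} s" for s
  proof -
    have mono: "hat_step \<eta> a \<le> hat_step \<eta> b" if "a \<le> b" for a b
      by (rule DERIV_nonneg_imp_nondecreasing[OF that]) (use DERIV_hat_step hat_props(1)[OF \<eta>(1)] in blast)
    show "0 \<le> A s" unfolding A_def x'n using mono[of "s - (x$i + h)" "s - x$i"] h by simp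
    show "A s \<le> \<eta>\<^sup>2 * indicator {x$i - \<eta>..x$i + h + \<eta>} s"
    proof (cases "s \<in> {x$i - \<eta>..x$i + h + \<eta>}")
      case True
      then show ?thesis unfolding A_def using hat_props(3)[OF \<eta>(1), of "s - x'$i"] hat_props(4)[OF \<eta>(1), of "s - x$i"] by simp
    next
      case False
      then consider "s \<le> x$i - \<eta>" | "s \<ge> x$i + h + \<eta>" by fastforce
      then have "A s = 0"
      proof cases
        case 1
        then show ?thesis unfolding A_def x'n using hat_props(5)[OF \<eta>(1), of "s - x$i"] hat_props(5)[OF \<eta>(1), of "s - (x$i + h)"] h by simp
      next
        case 2
        then show ?thesis unfolding A_def x'n using hat_props(6)[OF \<eta>(1), of "s - x$i"] hat_props(6)[OF \<eta>(1), of "s - (x$i + h)"] h by simp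
      qed
      then show ?thesis using False by simp
    qed
  qed
  have supp: "norm (z - x) \<le> 3" if "\<phi> z \<noteq> 0" for z
  proof -
    have "A (z$i) \<noteq> 0" "\<beta> (z$j) \<noteq> 0" using that by (auto simp: \<phi>_def)
    then have "z$i \<in> {x$i - \<eta>..x$i + h + \<eta>}" using A0[of "z$i"] by (cases "z$i \<in> {x$i - \<eta>..x$i + h + \<eta>}") auto
    moreover have "\<bar>z$j - x$j\<bar> < \<eta>" using \<open>\<beta> (z$j) \<noteq> 0\<close> bump_props(2)[of \<eta> "z$j - x$j"] \<eta> by (auto simp: \<beta>_def not_le[symmetric])
    ultimately have "\<bar>(z - x)$i\<bar> + \<bar>(z - x)$j\<bar> \<le> 3"
      using \<eta>(3) h unfolding vector_minus_component atLeastAtMost_iff by linarith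
    moreover have "norm (z - x) \<le> \<bar>(z - x)$i\<bar> + \<bar>(z - x)$j\<bar>"
      using norm_le_l1_cart[of "z - x"] ij exhaust_2[of i] exhaust_2[of j] by (auto simp: UNIV_2)
    ultimately show ?thesis by simp
  qed
  have cs: "compact (closure {z. \<phi> z \<noteq> 0})"
  proof -
    have "{z. \<phi> z \<noteq> 0} \<subseteq> cball x 3" using supp by (auto simp: dist_norm norm_minus_commute)
    then have "bounded {z. \<phi> z \<noteq> 0}" using bounded_cball bounded_subset by blast
    then show ?thesis by (simp add: compact_closure)
  qed
  have "(\<integral>z. (D z $ i) *\<^sub>R f z \<partial>lborel) = - (\<integral>z. \<phi> z *\<^sub>R (G z $ i) \<partial>lborel)"
    using wg gd cD cs unfolding weak_gradient_def by blast
  moreover have "D z $ i = W x z - W x' z" for z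
    using ij by (simp add: D_def W_def A'_def \<beta>_def x'n axis_def algebra_simps)
  moreover have "(\<integral>z. (W x z - W x' z) *\<^sub>R f z \<partial>lborel) = (\<integral>z. W x z *\<^sub>R f z \<partial>lborel) - (\<integral>z. W x' z *\<^sub>R f z \<partial>lborel)"
    using Bochner_Integration.integral_diff[OF b1(1) b2(1)] by (simp add: scaleR_diff_left)
  ultimately have key: "(\<integral>z. W x z *\<^sub>R f z \<partial>lborel) - (\<integral>z. W x' z *\<^sub>R f z \<partial>lborel) = - (\<integral>z. \<phi> z *\<^sub>R (G z $ i) \<partial>lborel)"
    by simp
  have A_m [measurable]: "A \<in> borel_measurable borel" and \<beta>_m [measurable]: "\<beta> \<in> borel_measurable borel" unfolding A_def \<beta>_def by measurable
  have R: "norm (\<integral>z. \<phi> z *\<^sub>R (G z $ i) \<partial>lborel) \<le> \<Gamma>0 * (k * (h + 2 * \<eta>))"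
  proof (rule norm_integral_le)
    have "(\<integral>\<^sup>+z. ennreal (norm (\<phi> z *\<^sub>R (G z $ i))) \<partial>lborel) \<le> (\<integral>\<^sup>+z. ennreal \<Gamma>0 * (ennreal (A (z$i)) * ennreal (\<beta> (z$j))) \<partial>(lborel :: (real^2) measure))"
    proof (rule nn_integral_mono_AE)
      show "AE z in lborel. ennreal (norm (\<phi> z *\<^sub>R (G z $ i))) \<le> ennreal \<Gamma>0 * (ennreal (A (z$i)) * ennreal (\<beta> (z$j)))"
        using ae
      proof eventually_elim
        case (elim z)
        have p0: "\<phi> z \<ge> 0" using A0(1) bump_props(1) by (simp add: \<phi>_def \<beta>_def)
        have "\<phi> z * norm (G z $ i) \<le> \<phi> z * \<Gamma>0"
        proof (cases "\<phi> z = 0")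
          case False
          have "norm (G z $ i) \<le> norm (G z)" by (rule Finite_Cartesian_Product.norm_nth_le)
          also have "\<dots> \<le> \<Gamma>0" using elim \<Gamma>[OF supp[OF False]] by simp
          finally show ?thesis using p0 by (intro mult_left_mono)
        qed simp
        then have "ennreal (norm (\<phi> z *\<^sub>R (G z $ i))) \<le> ennreal (\<phi> z * \<Gamma>0)" using p0 by (intro ennreal_leI) simp
        also have "\<dots> = ennreal \<Gamma>0 * (ennreal (A (z$i)) * ennreal (\<beta> (z$j)))"
          using \<Gamma>0 A0(1) by (simp add: \<phi>_def ennreal_mult'[symmetric] mult.commute)
        finally show ?case .
      qed
    qed
    also have "\<dots> = ennreal \<Gamma>0 * (\<integral>\<^sup>+z. ennreal (A (z$i)) * ennreal (\<beta> (z$j)) \<partial>(lborel :: (real^2) measure))"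
      by (intro nn_integral_cmult) measurable
    also have "(\<integral>\<^sup>+z. ennreal (A (z$i)) * ennreal (\<beta> (z$j)) \<partial>(lborel :: (real^2) measure)) = (\<integral>\<^sup>+s. ennreal (A s) \<partial>lborel) * ennreal J"
      using A_m \<beta>_m by (subst nn_integral_real2_product[OF _ _ ij]) (auto simp: \<beta>_def J)
    also have "(\<integral>\<^sup>+s. ennreal (A s) \<partial>lborel) \<le> (\<integral>\<^sup>+s. ennreal (\<eta>\<^sup>2) * indicator {x$i - \<eta>..x$i + h + \<eta>} s \<partial>lborel)"
    proof (intro nn_integral_mono)
      fix s
      show "ennreal (A s) \<le> ennreal (\<eta>\<^sup>2) * indicator {x$i - \<eta>..x$i + h + \<eta>} s"
        using A0(2)[of s] by (cases "s \<in> {x$i - \<eta>..x$i + h + \<eta>}") (simp_all add: ennreal_leI ennreal_neg)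
    qed
    also have "\<dots> = ennreal (\<eta>\<^sup>2 * (h + 2 * \<eta>))" using \<eta> h by (simp add: nn_integral_cmult_indicator ennreal_mult'[symmetric] ennreal_plus[symmetric] del: ennreal_plus)
    also have "ennreal \<Gamma>0 * (ennreal (\<eta>\<^sup>2 * (h + 2 * \<eta>)) * ennreal J) = ennreal (\<Gamma>0 * (k * (h + 2 * \<eta>)))"
      using \<Gamma>0 J \<eta> h by (simp add: ennreal_mult'[symmetric] k_def ac_simps)
    finally show "(\<integral>\<^sup>+z. ennreal (norm (\<phi> z *\<^sub>R (G z $ i))) \<partial>lborel) \<le> ennreal (\<Gamma>0 * (k * (h + 2 * \<eta>)))"
      by (simp add: mult_left_mono mult_right_mono)
    show "0 \<le> \<Gamma>0 * (k * (h + 2 * \<eta>))" using \<Gamma>0 k h \<eta> by simp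
  qed
  have "k *\<^sub>R (f x - f x') = ((\<integral>z. W x' z *\<^sub>R f z \<partial>lborel) - k *\<^sub>R f x') - ((\<integral>z. W x z *\<^sub>R f z \<partial>lborel) - k *\<^sub>R f x)
      + ((\<integral>z. W x z *\<^sub>R f z \<partial>lborel) - (\<integral>z. W x' z *\<^sub>R f z \<partial>lborel))" by (simp add: scaleR_diff_right)
  also have "norm \<dots> \<le> k * e + k * e + \<Gamma>0 * (k * (h + 2 * \<eta>))"
  proof -
    have "norm ((\<integral>z. W x z *\<^sub>R f z \<partial>lborel) - (\<integral>z. W x' z *\<^sub>R f z \<partial>lborel)) \<le> \<Gamma>0 * (k * (h + 2 * \<eta>))"
      unfolding key norm_minus_cancel by (rule R)
    moreover have "norm (p - q + r) \<le> a + b + c" if "norm p \<le> a" "norm q \<le> b" "norm r \<le> c"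
      for p q r :: complex and a b c
      using that norm_triangle_ineq[of "p - q" r] norm_triangle_ineq4[of p q] by linarith
    ultimately show ?thesis using b1(2) b2(2) by blast
  qed
  also have "\<dots> = k * (2 * e + \<Gamma>0 * (h + 2 * \<eta>))" by (simp add: algebra_simps)
  finally have "k * norm (f x - f x') \<le> k * (2 * e + \<Gamma>0 * (h + 2 * \<eta>))" using k by simp
  then have "norm (f x - f x') \<le> 2 * e + \<Gamma>0 * (h + 2 * \<eta>)" using k by simp
  also have "\<dots> \<le> 2 * e + \<Gamma>0 * (h + 2 * e)" using \<eta> \<Gamma>0 by (intro add_left_mono mult_left_mono) auto
  also have "\<dots> = \<Gamma>0 * h + e * (2 + 2 * \<Gamma>0)" by (simp add: algebra_simps)
  also have "e * (2 + 2 * \<Gamma>0) = e0" using \<Gamma>0 by (simp add: e_def)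
  finally show "norm (f x - f x') \<le> \<Gamma>0 * h + e0" .
qed

definition lip_const :: "real \<Rightarrow> real" where
  "lip_const \<sigma> = 2 * 16 powr (\<sigma> + 1)"

lemma X_norm_pointwise:
  assumes f: "continuous_on UNIV f" and B: "X_norm s f \<le> ennreal B" "B \<ge> 0"
  shows "norm (f x) \<le> B * wt s (x::real^2)"
proof -
  have ae: "AE x in lborel. norm (f x) - B * wt s x \<le> 0"
  proof -
    have "AE x in lborel. ennreal (japanese_bracket x powr s * norm (f x)) \<le> X_norm s f"
      unfolding X_norm_def by (rule esssup_AE)
    then show ?thesis
    proof eventually_elim
      case (elim x)
      then have "japanese_bracket x powr s * norm (f x) \<le> B" using B by (meson ennreal_le_iff order_trans)
      then show ?case using jb_pos[of x] by (simp add: wt_def powr_minus field_simps)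
    qed
  qed
  have "continuous_on UNIV (\<lambda>x. norm (f x) - B * wt s x)"
    by (intro continuous_intros f wt_continuous)
  from continuous_AE_le[OF this ae, of x] show ?thesis by simp
qed

lemma X_norm_AE:
  assumes B: "X_norm s f \<le> ennreal B" "B \<ge> 0"
  shows "AE x in lborel. norm (f x) \<le> B * wt s (x::real^2)"
proof -
  have "AE x in lborel. ennreal (japanese_bracket x powr s * norm (f x)) \<le> X_norm s f"
    unfolding X_norm_def by (rule esssup_AE)
  then show ?thesis
  proof eventually_elim
    case (elim x)
    then have "japanese_bracket x powr s * norm (f x) \<le> B" using B by (meson ennreal_le_iff order_trans)
    then show ?case using jb_pos[of x] by (simp add: wt_def powr_minus field_simps)
  qed
qed

text \<open>One segment along each axis; the weight changes by a bounded factor on the way.\<close>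
lemma weighted_lipschitz:
  fixes f :: "real^2 \<Rightarrow> complex"
  assumes s: "s \<ge> 0" and f: "continuous_on UNIV f" and wg: "weak_gradient f G"
    and G: "X_norm s G \<le> ennreal B" and B: "B \<ge> 0" and xy: "norm (x - y) \<le> 1"
  shows "norm (f x - f y) \<le> 2 * 16 powr s * B * norm (x - y) * wt s x"
proof -
  note ae = X_norm_AE[OF G B]
  have up: "norm (f x - f (x + h *\<^sub>R axis i 1)) \<le> B * (4 powr s * wt s x) * h" if h: "0 \<le> h" "h \<le> 1" for x h and i :: 2
  proof -
    obtain j where ij: "i \<noteq> j" using exhaust_2[of i] by (metis zero_neq_one)
    have near: "B * wt s z \<le> B * (4 powr s * wt s x)" if "norm (z - x) \<le> 3" for z
      using wt_compare[of x z 3 s] that s B by (intro mult_left_mono) (auto simp: norm_minus_commute)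
    show ?thesis
      by (rule weak_gradient_axis[OF ij f wg ae near _ h refl]) (use B in \<open>auto simp: wt_nonneg\<close>)
  qed
  have step: "norm (f x - f (x + h *\<^sub>R axis i 1)) \<le> B * (8 powr s * wt s x) * \<bar>h\<bar>" if h: "\<bar>h\<bar> \<le> 1" for x h and i :: 2
  proof (cases "h \<ge> 0")
    case True
    have "norm (f x - f (x + h *\<^sub>R axis i 1)) \<le> B * (4 powr s * wt s x) * h" using True h by (intro up) auto
    also have "\<dots> \<le> B * (8 powr s * wt s x) * h"
      using True B s by (intro mult_right_mono mult_left_mono powr_mono2) (auto simp: wt_nonneg)
    finally show ?thesis using True by simp
  next
    case False
    define x' where "x' = x + h *\<^sub>R axis i 1"
    have x: "x = x' + (- h) *\<^sub>R axis i 1" by (simp add: x'_def)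
    have "norm (f x' - f x) \<le> B * (4 powr s * wt s x') * (- h)"
      using False h by (subst x, intro up) auto
    also have "\<dots> \<le> B * (4 powr s * (2 powr s * wt s x)) * (- h)"
    proof (intro mult_right_mono mult_left_mono)
      have "wt s x' \<le> (1 + 1) powr s * wt s x" using h s by (intro wt_compare) (auto simp: x'_def)
      then show "wt s x' \<le> 2 powr s * wt s x" by simp
    qed (use B False in auto)
    also have "4 powr s * (2 powr s * wt s x) = 8 powr s * wt s x" by (simp add: powr_mult[symmetric] mult.assoc[symmetric])
    finally show ?thesis using False by (simp add: x'_def norm_minus_commute)
  qed
  define h1 where "h1 = (y - x)$1"
  define h2 where "h2 = (y - x)$2"
  have hn: "\<bar>h1\<bar> \<le> norm (x - y)" "\<bar>h2\<bar> \<le> norm (x - y)"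
    unfolding h1_def h2_def using component_le_norm_cart[of "y - x" 1] component_le_norm_cart[of "y - x" 2] by (simp_all add: norm_minus_commute)
  define m where "m = x + h1 *\<^sub>R axis 1 1"
  have y: "y = m + h2 *\<^sub>R axis 2 1" by (simp add: m_def h1_def h2_def vec_eq_iff forall_2 axis_def)
  have wm: "wt s m \<le> 2 powr s * wt s x"
  proof -
    have "wt s m \<le> (1 + 1) powr s * wt s x" using hn xy s by (intro wt_compare) (auto simp: m_def)
    then show ?thesis by simp
  qed
  have c: "8 powr s \<le> 16 powr s" using s by (intro powr_mono2) auto
  have "norm (f x - f m) \<le> B * (8 powr s * wt s x) * \<bar>h1\<bar>" unfolding m_def using hn xy by (intro step) auto
  also have "\<dots> \<le> B * (16 powr s * wt s x) * norm (x - y)"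
    using B hn c by (intro mult_mono mult_left_mono mult_right_mono) (auto simp: wt_nonneg)
  finally have 1: "norm (f x - f m) \<le> B * (16 powr s * wt s x) * norm (x - y)" .
  have "norm (f m - f y) \<le> B * (8 powr s * wt s m) * \<bar>h2\<bar>" unfolding y using hn xy by (intro step) auto
  also have "\<dots> \<le> B * (8 powr s * (2 powr s * wt s x)) * norm (x - y)"
    using B hn wm by (intro mult_mono mult_left_mono) (auto simp: wt_nonneg)
  also have "8 powr s * (2 powr s * wt s x) = 16 powr s * wt s x" by (simp add: powr_mult[symmetric] mult.assoc[symmetric])
  finally have 2: "norm (f m - f y) \<le> B * (16 powr s * wt s x) * norm (x - y)" .
  have "norm (f x - f y) \<le> norm (f x - f m) + norm (f m - f y)" by (metis dist_norm dist_triangle)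
  with 1 2 show ?thesis by (simp add: algebra_simps)
qed

lemma lip_const_ge_1: "\<sigma> > 2 \<Longrightarrow> lip_const \<sigma> \<ge> 1"
  using ge_one_powr_ge_zero[of 16 "\<sigma> + 1"] by (simp add: lip_const_def)

text \<open>Where the essential bounds on the solution and its weak gradient turn into pointwise ones.\<close>
lemma profile_of_X_norm:
  assumes \<sigma>: "\<sigma> > 2" and f: "continuous_on UNIV f" and wg: "weak_gradient f G"
    and B: "X_norm (\<sigma> + 1) f + X_norm (\<sigma> + 1) G \<le> ennreal B" "B \<ge> 0"
  shows "profile \<sigma> (lip_const \<sigma> * B) f" "\<And>x. norm (f x) \<le> B * wt (\<sigma> + 1) x"
proof -
  have Bf: "X_norm (\<sigma> + 1) f \<le> ennreal B" and BG: "X_norm (\<sigma> + 1) G \<le> ennreal B"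
    using B(1) by (meson add_increasing2 add_increasing order_trans zero_le order.refl)+
  show p: "norm (f x) \<le> B * wt (\<sigma> + 1) x" for x by (rule X_norm_pointwise[OF f Bf B(2)])
  show "profile \<sigma> (lip_const \<sigma> * B) f"
  proof
    show "0 \<le> lip_const \<sigma> * B" using B lip_const_ge_1[OF \<sigma>] by simp
    show "norm (f x) \<le> lip_const \<sigma> * B * wt (\<sigma> + 1) x" for x
    proof -
      have "1 * (B * wt (\<sigma> + 1) x) \<le> lip_const \<sigma> * (B * wt (\<sigma> + 1) x)"
        using B lip_const_ge_1[OF \<sigma>] by (intro mult_right_mono) (auto simp: wt_nonneg)
      then show ?thesis using p[of x] by (simp add: mult.assoc)
    qed
    show "norm (f x - f y) \<le> lip_const \<sigma> * B * norm (x - y) * wt (\<sigma> + 1) x" if "norm (x - y) \<le> 1" for x y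
      using weighted_lipschitz[OF _ f wg BG B(2) that] \<sigma> by (simp add: lip_const_def)
  qed (use \<sigma> f in auto)
qed

section \<open>Oscillatory integrals and Picard iteration\<close>

lemma continuous_on_infsum:
  fixes f :: "'i \<Rightarrow> 'a::topological_space \<Rightarrow> complex"
  assumes c: "\<And>i. i \<in> I \<Longrightarrow> continuous_on S (f i)"
    and m: "\<And>i t. i \<in> I \<Longrightarrow> t \<in> S \<Longrightarrow> norm (f i t) \<le> m i" "m summable_on I"
  shows "continuous_on S (\<lambda>t. \<Sum>\<^sub>\<infinity>i\<in>I. f i t)"
proof (rule uniform_limit_theorem)
  show "uniform_limit S (\<lambda>X t. \<Sum>i\<in>X. f i t) (\<lambda>t. \<Sum>\<^sub>\<infinity>i\<in>I. f i t) (finite_subsets_at_top I)"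
    by (rule Weierstrass_m_test_general) (use m in auto)
  show "\<forall>\<^sub>F X in finite_subsets_at_top I. continuous_on S (\<lambda>t. \<Sum>i\<in>X. f i t)"
    by (rule eventually_finite_subsets_at_top_weakI) (auto intro!: continuous_on_sum c)
  show "finite_subsets_at_top I \<noteq> bot" by simp
qed

text \<open>The domination by \<open>m\<close> gives uniform convergence and lets the integral pass into the sum; the bound
  then comes from the cancellation in the single integrals.\<close>
lemma integral_infsum_bound:
  fixes f :: "'i \<Rightarrow> real \<Rightarrow> complex"
  assumes c: "\<And>i. i \<in> I \<Longrightarrow> continuous_on {a..b} (f i)"
    and m: "\<And>i t. i \<in> I \<Longrightarrow> t \<in> {a..b} \<Longrightarrow> norm (f i t) \<le> m i" "m summable_on I"
    and bd: "\<And>i. i \<in> I \<Longrightarrow> norm (integral {a..b} (f i)) \<le> k i"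
    and C: "nsum (\<lambda>i. ennreal (k i)) I \<le> ennreal C" "C \<ge> 0"
  shows "norm (integral {a..b} (\<lambda>t. \<Sum>\<^sub>\<infinity>i\<in>I. f i t)) \<le> C"
proof -
  have ul: "uniform_limit (cbox a b) (\<lambda>X t. \<Sum>i\<in>X. f i t) (\<lambda>t. \<Sum>\<^sub>\<infinity>i\<in>I. f i t) (finite_subsets_at_top I)"
    by (rule Weierstrass_m_test_general) (use m in auto)
  have ev: "\<forall>\<^sub>F X in finite_subsets_at_top I. continuous_on {a..b} (\<lambda>t. \<Sum>i\<in>X. f i t)"
    by (rule eventually_finite_subsets_at_top_weakI) (auto intro!: continuous_on_sum c)
  have lim: "((\<lambda>X. integral {a..b} (\<lambda>t. \<Sum>i\<in>X. f i t)) \<longlongrightarrow> integral {a..b} (\<lambda>t. \<Sum>\<^sub>\<infinity>i\<in>I. f i t)) (finite_subsets_at_top I)"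
  proof (rule tendstoI)
    fix e :: real assume e: "e > 0"
    define d where "d = e / (2 * (\<bar>b - a\<bar> + 1))"
    have d: "d > 0" unfolding d_def using e by (intro divide_pos_pos) (auto intro!: add_nonneg_pos)
    have ci: "(\<lambda>t. \<Sum>\<^sub>\<infinity>i\<in>I. f i t) integrable_on {a..b}"
      by (intro integrable_continuous_interval continuous_on_infsum[OF c m])
    have "\<forall>\<^sub>F X in finite_subsets_at_top I. \<forall>t\<in>cbox a b. dist (\<Sum>i\<in>X. f i t) (\<Sum>\<^sub>\<infinity>i\<in>I. f i t) < d"
      using ul d by (rule uniform_limitD)
    with ev show "\<forall>\<^sub>F X in finite_subsets_at_top I. dist (integral {a..b} (\<lambda>t. \<Sum>i\<in>X. f i t)) (integral {a..b} (\<lambda>t. \<Sum>\<^sub>\<infinity>i\<in>I. f i t)) < e"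
    proof eventually_elim
      case (elim X)
      have xi: "(\<lambda>t. \<Sum>i\<in>X. f i t) integrable_on {a..b}" by (rule integrable_continuous_interval[OF elim(1)])
      have "norm (integral {a..b} (\<lambda>t. (\<Sum>i\<in>X. f i t) - (\<Sum>\<^sub>\<infinity>i\<in>I. f i t))) \<le> integral {a..b} (\<lambda>t. d)"
        by (rule Henstock_Kurzweil_Integration.integral_norm_bound_integral)
           (use elim(2) xi ci in \<open>auto simp: dist_norm less_imp_le intro!: integrable_diff\<close>)
      also have "\<dots> \<le> d * \<bar>b - a\<bar>" using d by (cases "a \<le> b") (auto simp: mult.commute)
      also have "\<dots> \<le> d * (\<bar>b - a\<bar> + 1)" using d by (intro mult_left_mono) auto
      also have "\<dots> = e / 2"
      proof -
        have "e / (2 * x) * x = e / 2" if "x > 0" for x :: real using that by simp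
        then show ?thesis unfolding d_def by (smt (verit) abs_ge_zero)
      qed
      also have "\<dots> < e" using e by simp
      finally show ?case using xi ci by (simp add: dist_norm Henstock_Kurzweil_Integration.integral_diff)
    qed
  qed
  have "\<forall>\<^sub>F X in finite_subsets_at_top I. norm (integral {a..b} (\<lambda>t. \<Sum>i\<in>X. f i t)) \<le> C"
  proof (rule eventually_finite_subsets_at_top_weakI)
    fix X assume X: "finite X" "X \<subseteq> I"
    have "integral {a..b} (\<lambda>t. \<Sum>i\<in>X. f i t) = (\<Sum>i\<in>X. integral {a..b} (f i))"
      using X by (intro Henstock_Kurzweil_Integration.integral_sum integrable_continuous_interval c) auto
    then have "norm (integral {a..b} (\<lambda>t. \<Sum>i\<in>X. f i t)) \<le> (\<Sum>i\<in>X. k i)"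
      using X bd by (auto intro!: order_trans[OF norm_sum] sum_mono)
    moreover have "(\<Sum>i\<in>X. k i) \<le> C"
    proof -
      have k0: "k i \<ge> 0" if "i \<in> X" for i using bd[of i] X that norm_ge_zero order_trans by blast
      have "ennreal (\<Sum>i\<in>X. k i) = (\<Sum>i\<in>X. ennreal (k i))" by (rule sum_ennreal[symmetric]) (use k0 in auto)
      also have "\<dots> = nsum (\<lambda>i. ennreal (k i)) X" using X by (simp add: nn_integral_count_space_finite)
      also have "\<dots> \<le> nsum (\<lambda>i. ennreal (k i)) I" by (rule nsum_subset[OF X(2)])
      finally show ?thesis using C by (meson ennreal_le_iff order_trans)
    qed
    ultimately show "norm (integral {a..b} (\<lambda>t. \<Sum>i\<in>X. f i t)) \<le> C" by linarith
  qed
  then show ?thesis by (rule tendsto_upperbound[OF tendsto_norm[OF lim]]) simp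
qed

text \<open>The integral is compared with its translate by half a period, where the exponential changes sign, so
  that a Lipschitz bound on the amplitude replaces an integration by parts.\<close>
lemma oscillatory_integral:
  fixes f :: "real \<Rightarrow> complex"
  assumes t: "0 \<le> t" and \<theta>: "\<theta> \<noteq> 0"
    and m: "\<And>s. s \<in> {0..t} \<Longrightarrow> norm (f s) \<le> m"
    and l: "\<And>r s. r \<in> {0..t} \<Longrightarrow> s \<in> {0..t} \<Longrightarrow> norm (f r - f s) \<le> l * \<bar>r - s\<bar>" and l0: "l \<ge> 0"
  shows "norm (integral {0..t} (\<lambda>s. f s * exp (\<i> * complex_of_real (\<theta> * s)))) \<le> pi / \<bar>\<theta>\<bar> * (2 * m + l * t)"
proof -
  define h where "h = pi / \<bar>\<theta>\<bar>"
  have h: "h > 0" using \<theta> by (simp add: h_def)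
  define cl where "cl = (\<lambda>s. max 0 (min t s))"
  have cl: "cl s \<in> {0..t}" "\<bar>cl r - cl s\<bar> \<le> \<bar>r - s\<bar>" for r s using t by (auto simp: cl_def)
  define F where "F = (\<lambda>s. f (cl s))"
  have Fl: "norm (F r - F s) \<le> l * \<bar>r - s\<bar>" for r s
  proof -
    have "norm (F r - F s) \<le> l * \<bar>cl r - cl s\<bar>" unfolding F_def by (rule l[OF cl(1) cl(1)])
    also have "\<dots> \<le> l * \<bar>r - s\<bar>" by (intro mult_left_mono cl l0)
    finally show ?thesis .
  qed
  have Fm: "norm (F s) \<le> m" for s unfolding F_def by (rule m[OF cl(1)])
  have m0: "m \<ge> 0" using m[of 0] t norm_ge_zero order_trans by (metis atLeastAtMost_iff order.refl)
  have Fc: "continuous_on UNIV F"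
  proof -
    have "l-lipschitz_on UNIV F" by (rule lipschitz_onI) (use Fl l0 in \<open>auto simp: dist_norm dist_real_def\<close>)
    then show ?thesis by (rule lipschitz_on_continuous_on)
  qed
  define e where "e = (\<lambda>s. exp (\<i> * complex_of_real (\<theta> * s)))"
  have ec: "continuous_on S e" for S unfolding e_def by (intro continuous_intros)
  have en: "norm (e s) = 1" for s unfolding e_def by (simp add: norm_exp_eq_Re)
  have eh: "e (s - h) = - e s" for s
  proof -
    have "\<theta> * h = pi \<or> \<theta> * h = - pi" using \<theta> by (auto simp: h_def abs_if)
    then have "cis (- (\<theta> * h)) = -1" by (elim disjE) (simp_all add: complex_eq_iff)
    then have "exp (- (\<i> * complex_of_real (\<theta> * h))) = -1" by (simp add: cis_conv_exp)
    moreover have "e (s - h) = e s * exp (- (\<i> * complex_of_real (\<theta> * h)))"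
      unfolding e_def exp_add[symmetric] by (rule arg_cong[where f=exp]) (simp add: algebra_simps)
    ultimately show ?thesis by simp
  qed
  define I where "I = integral {0..t} (\<lambda>s. f s * e s)"
  have io: "(\<lambda>s. F s * e s) integrable_on {a..b}" "(\<lambda>s. F (s - h) * e s) integrable_on {a..b}" for a b
    by (intro integrable_continuous_interval continuous_intros ec continuous_on_subset[OF Fc] continuous_on_compose2[OF Fc]; auto)+
  have IF: "I = integral {0..t} (\<lambda>s. F s * e s)"
    unfolding I_def F_def by (intro integral_cong) (auto simp: cl_def)
  have J: "I = - integral {h..t + h} (\<lambda>s. F (s - h) * e s)"
  proof -
    have "integral {h..t + h} (\<lambda>s. F (s - h) * e s) = - integral {h..t + h} (\<lambda>s. (\<lambda>s. F s * e s) (s - h))"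
      by (simp add: eh)
    also have "integral {h..t + h} (\<lambda>s. (\<lambda>s. F s * e s) (s - h)) = integral {0..t} (\<lambda>s. F s * e s)"
      using integral_shift_real_ivl[of 0 "- h" t "\<lambda>s. F s * e s"] by (simp add: add.commute)
    finally show ?thesis using IF by simp
  qed
  have bnd: "norm (integral {a..b} (\<lambda>s. F (s - c) * e s)) \<le> m * (b - a)" if "a \<le> b" for a b c
  proof -
    have "norm (integral {a..b} (\<lambda>s. F (s - c) * e s)) \<le> integral {a..b} (\<lambda>s. m)"
    proof (rule Henstock_Kurzweil_Integration.integral_norm_bound_integral)
      show "(\<lambda>s. F (s - c) * e s) integrable_on {a..b}"
        by (intro integrable_continuous_interval continuous_intros ec continuous_on_compose2[OF Fc]) auto
    qed (use Fm en in \<open>auto simp: norm_mult\<close>)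
    then show ?thesis using that by (simp add: mult.commute)
  qed
  \<comment> \<open>both integrals are completed to the interval \<open>[0, t+h]\<close>\<close>
  have s1: "integral {0..t + h} (\<lambda>s. F s * e s) = I + integral {t..t + h} (\<lambda>s. F s * e s)"
    unfolding IF using t h io by (intro Henstock_Kurzweil_Integration.integral_combine[symmetric]) auto
  have s2: "integral {0..t + h} (\<lambda>s. F (s - h) * e s) = integral {0..h} (\<lambda>s. F (s - h) * e s) + - I"
    unfolding J using t h io by (subst Henstock_Kurzweil_Integration.integral_combine[symmetric, of 0 h "t + h"]) auto
  have s3: "integral {0..t + h} (\<lambda>s. F s * e s) - integral {0..t + h} (\<lambda>s. F (s - h) * e s) = integral {0..t + h} (\<lambda>s. (F s - F (s - h)) * e s)"
    using io by (subst Henstock_Kurzweil_Integration.integral_diff[symmetric]) (auto simp: left_diff_distrib)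
  have dn: "norm (integral {0..t + h} (\<lambda>s. (F s - F (s - h)) * e s)) \<le> l * h * t + 2 * m * h"
  proof -
    have di: "(\<lambda>s. (F s - F (s - h)) * e s) integrable_on {a..b}" for a b
      using Henstock_Kurzweil_Integration.integrable_diff[OF io] by (simp add: left_diff_distrib)
    have "integral {0..t + h} (\<lambda>s. (F s - F (s - h)) * e s) = integral {0..t} (\<lambda>s. (F s - F (s - h)) * e s) + integral {t..t + h} (\<lambda>s. (F s - F (s - h)) * e s)"
      using t h di by (intro Henstock_Kurzweil_Integration.integral_combine[symmetric]) auto
    moreover have "norm (integral {0..t} (\<lambda>s. (F s - F (s - h)) * e s)) \<le> integral {0..t} (\<lambda>s. l * h)"
    proof (rule Henstock_Kurzweil_Integration.integral_norm_bound_integral[OF di])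
      show "norm ((F s - F (s - h)) * e s) \<le> l * h" for s using Fl[of s "s - h"] h en[of s] by (simp add: norm_mult)
    qed auto
    moreover have "norm (integral {t..t + h} (\<lambda>s. (F s - F (s - h)) * e s)) \<le> integral {t..t + h} (\<lambda>s. 2 * m)"
    proof (rule Henstock_Kurzweil_Integration.integral_norm_bound_integral[OF di])
      show "norm ((F s - F (s - h)) * e s) \<le> 2 * m" for s
        using norm_triangle_ineq4[of "F s" "F (s - h)"] Fm[of s] Fm[of "s - h"] en[of s] by (simp add: norm_mult)
    qed auto
    ultimately show ?thesis using t h norm_triangle_ineq[of "integral {0..t} (\<lambda>s. (F s - F (s - h)) * e s)" "integral {t..t + h} (\<lambda>s. (F s - F (s - h)) * e s)"]
      by (simp add: ac_simps)
  qed
  have "2 * I = integral {0..t + h} (\<lambda>s. (F s - F (s - h)) * e s) - integral {t..t + h} (\<lambda>s. F (s - 0) * e s) + integral {0..h} (\<lambda>s. F (s - h) * e s)"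
    unfolding s3[symmetric] s1 s2 by simp
  also have "norm \<dots> \<le> (l * h * t + 2 * m * h) + m * h + m * h"
    using dn bnd[of t "t + h" 0] bnd[of 0 h h] h
    by (intro order_trans[OF norm_triangle_ineq] add_mono order_trans[OF norm_triangle_ineq4]) auto
  finally have "2 * norm I \<le> l * h * t + 4 * m * h" by (simp add: norm_mult ac_simps)
  moreover have "0 \<le> l * h * t" using l0 h t by simp
  ultimately have "norm I \<le> h * (2 * m + l * t)" by (simp add: algebra_simps)
  then show ?thesis by (simp add: I_def e_def h_def)
qed

text \<open>The sup norm with weights \<open>w\<close> is the one in which the equation is Lipschitz, and the iterates are
  compared with the extra factor \<open>exp (\<mu> t)\<close>, which makes the iteration a contraction by \<open>1/2\<close> on the whole
  interval at once.\<close>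
lemma weighted_picard:
  fixes F :: "real \<Rightarrow> ('i \<Rightarrow> complex) \<Rightarrow> 'i \<Rightarrow> complex" and w :: "'i \<Rightarrow> real"
  assumes \<tau>: "0 \<le> \<tau>" and w: "\<And>i. w i \<ge> 0" and \<Lambda>: "\<Lambda> \<ge> 0" and M: "M \<ge> 0"
    and lip: "\<And>t x y S i. t \<in> {0..\<tau>} \<Longrightarrow> S \<ge> 0 \<Longrightarrow> (\<And>j. norm (x j - y j) \<le> S * w j) \<Longrightarrow> norm (F t x i - F t y i) \<le> \<Lambda> * S * w i"
    and bd: "\<And>t x i. t \<in> {0..\<tau>} \<Longrightarrow> norm (F t x i) \<le> M * w i"
    and cont: "\<And>x i. (\<And>j. continuous_on {0..\<tau>} (\<lambda>t. x t j)) \<Longrightarrow> continuous_on {0..\<tau>} (\<lambda>t. F t (x t) i)"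
  shows "\<exists>\<alpha>. (\<forall>i. \<alpha> 0 i = x0 i) \<and> (\<forall>i. \<forall>t\<in>{0..\<tau>}. ((\<lambda>s. \<alpha> s i) has_vector_derivative F t (\<alpha> t) i) (at t within {0..\<tau>}))"
proof -
  define A where "A = rec_nat (\<lambda>t. x0) (\<lambda>k a t i. x0 i + integral {0..t} (\<lambda>s. F s (a s) i))"
  have A0: "A 0 t i = x0 i" and AS: "A (Suc k) t i = x0 i + integral {0..t} (\<lambda>s. F s (A k s) i)" for k t i
    by (simp_all add: A_def)
  have Ac: "continuous_on {0..\<tau>} (\<lambda>t. A k t i)" for k i
  proof (induction k arbitrary: i)
    case (Suc k)
    have "continuous_on {0..\<tau>} (\<lambda>s. F s (A k s) i)" by (rule cont[OF Suc])
    then show ?case unfolding AS by (intro continuous_intros indefinite_integral_continuous_1 integrable_continuous_interval)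
  qed (simp add: A0)
  have Fi: "(\<lambda>s. F s (A k s) i) integrable_on {0..t}" if "t \<in> {0..\<tau>}" for k i t
    by (rule integrable_continuous_interval) (use that in \<open>auto intro: continuous_on_subset[OF cont[OF Ac]]\<close>)
  define \<mu> where "\<mu> = 2 * \<Lambda> + 1"
  have \<mu>: "\<mu> > 0" using \<Lambda> by (simp add: \<mu>_def)
  define D where "D = M * \<tau>"
  have D: "D \<ge> 0" using M \<tau> by (simp add: D_def)
  have step: "norm (A (Suc k) t i - A k t i) \<le> D * exp (\<mu> * t) / 2 ^ k * w i" if t: "t \<in> {0..\<tau>}" for k t i
    using t
  proof (induction k arbitrary: t i)
    case 0
    have "norm (integral {0..t} (\<lambda>s. F s (A 0 s) i)) \<le> integral {0..t} (\<lambda>s. M * w i)"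
      by (rule Henstock_Kurzweil_Integration.integral_norm_bound_integral[OF Fi[OF 0]]) (use bd 0 in auto)
    also have "\<dots> = M * t * w i" using 0 by simp
    also have "\<dots> \<le> D * 1 * w i" unfolding D_def using 0 M w by (intro mult_right_mono) (auto intro!: mult_left_mono)
    also have "\<dots> \<le> D * exp (\<mu> * t) * w i" using 0 \<mu> D w by (intro mult_right_mono mult_left_mono) auto
    finally show ?case by (simp add: AS A0)
  next
    case (Suc k)
    have "A (Suc (Suc k)) t i - A (Suc k) t i = integral {0..t} (\<lambda>s. F s (A (Suc k) s) i - F s (A k s) i)"
      unfolding AS[of "Suc k"] AS[of k t i] using Fi[OF Suc.prems] by (simp add: Henstock_Kurzweil_Integration.integral_diff)
    also have "norm \<dots> \<le> integral {0..t} (\<lambda>s. \<Lambda> * D / 2 ^ k * w i * exp (\<mu> * s))"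
    proof (rule Henstock_Kurzweil_Integration.integral_norm_bound_integral)
      show "(\<lambda>s. F s (A (Suc k) s) i - F s (A k s) i) integrable_on {0..t}"
        by (intro integrable_diff Fi Suc.prems)
      show "(\<lambda>s. \<Lambda> * D / 2 ^ k * w i * exp (\<mu> * s)) integrable_on {0..t}"
        by (intro integrable_continuous_interval continuous_intros)
      fix s assume "s \<in> {0..t}"
      then have s: "s \<in> {0..\<tau>}" using Suc.prems by auto
      have "norm (F s (A (Suc k) s) i - F s (A k s) i) \<le> \<Lambda> * (D * exp (\<mu> * s) / 2 ^ k) * w i"
        by (rule lip[OF s]) (use D Suc.IH[OF s] in auto)
      then show "norm (F s (A (Suc k) s) i - F s (A k s) i) \<le> \<Lambda> * D / 2 ^ k * w i * exp (\<mu> * s)" by (simp add: ac_simps)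
    qed
    also have "\<dots> = \<Lambda> * D / 2 ^ k * w i * integral {0..t} (\<lambda>s. exp (\<mu> * s))" by simp
    also have "integral {0..t} (\<lambda>s. exp (\<mu> * s)) = exp (\<mu> * t) / \<mu> - exp (\<mu> * 0) / \<mu>"
    proof (rule integral_unique, rule fundamental_theorem_of_calculus)
      show "0 \<le> t" using Suc.prems by simp
      show "((\<lambda>s. exp (\<mu> * s) / \<mu>) has_vector_derivative exp (\<mu> * s)) (at s within {0..t})" for s
        unfolding has_real_derivative_iff_has_vector_derivative[symmetric] using \<mu> by (auto intro!: derivative_eq_intros)
    qed
    also have "\<Lambda> * D / 2 ^ k * w i * (exp (\<mu> * t) / \<mu> - exp (\<mu> * 0) / \<mu>) \<le> \<Lambda> * D / 2 ^ k * w i * (exp (\<mu> * t) / \<mu>)"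
      using \<Lambda> D w[of i] \<mu> by (intro mult_left_mono) auto
    also have "\<dots> = (\<Lambda> / \<mu>) * (D / 2 ^ k * w i * exp (\<mu> * t))" by (simp add: field_simps)
    also have "\<dots> \<le> (1/2) * (D / 2 ^ k * w i * exp (\<mu> * t))"
      using D w[of i] \<Lambda> \<mu> by (intro mult_right_mono) (auto simp: \<mu>_def divide_le_eq)
    finally show ?case by (simp add: ac_simps)
  qed
  define E where "E = D * exp (\<mu> * \<tau>)"
  have E: "E \<ge> 0" using D by (simp add: E_def)
  have step': "norm (A (Suc k) t i - A k t i) \<le> E * w i * (1/2) ^ k" if t: "t \<in> {0..\<tau>}" for k t i
  proof -
    have "D * exp (\<mu> * t) / 2 ^ k * w i \<le> D * exp (\<mu> * \<tau>) / 2 ^ k * w i"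
      using t D w[of i] \<mu> by (intro mult_right_mono divide_right_mono mult_left_mono) auto
    then show ?thesis using step[OF t, of k i] by (simp add: E_def power_divide ac_simps)
  qed
  define \<alpha> where "\<alpha> = (\<lambda>t i. x0 i + (\<Sum>k. A (Suc k) t i - A k t i))"
  have sm: "summable (\<lambda>k. E * w i * (1/2) ^ k)" for i by (intro summable_mult summable_geometric) auto
  have sA: "summable (\<lambda>k. A (Suc k) t i - A k t i)" if "t \<in> {0..\<tau>}" for t i
    by (rule summable_comparison_test'[OF sm]) (use step'[OF that] in auto)
  have part: "A k t i = x0 i + (\<Sum>n<k. A (Suc n) t i - A n t i)" for k t i
    using sum_lessThan_telescope[of "\<lambda>n. A n t i" k] by (simp add: A0)
  have close: "norm (\<alpha> t i - A k t i) \<le> (2 * E * (1/2) ^ k) * w i" if t: "t \<in> {0..\<tau>}" for t i k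
  proof -
    have "\<alpha> t i - A k t i = (\<Sum>n. A (Suc (n + k)) t i - A (n + k) t i)"
      unfolding \<alpha>_def by (subst part) (use suminf_minus_initial_segment[OF sA[OF t], of k i] in simp)
    also have "norm \<dots> \<le> (\<Sum>n. E * w i * (1/2) ^ (n + k))"
    proof (rule order_trans[OF summable_norm suminf_le])
      have sn: "summable (\<lambda>n. E * w i * (1/2) ^ (n + k))" using sm by (subst summable_iff_shift)
      show "summable (\<lambda>n. E * w i * (1/2) ^ (n + k))" by (rule sn)
      show s: "summable (\<lambda>n. norm (A (Suc (n + k)) t i - A (n + k) t i))"
        by (rule summable_comparison_test'[OF sn]) (use step'[OF t] in auto)
      show "summable (\<lambda>n. norm (A (Suc (n + k)) t i - A (n + k) t i))" by (rule s)
      show "norm (A (Suc (n + k)) t i - A (n + k) t i) \<le> E * w i * (1/2) ^ (n + k)" for n by (rule step'[OF t])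
    qed
    also have "\<dots> = (E * w i * (1/2) ^ k) * (\<Sum>n. (1/2) ^ n)"
      by (subst suminf_mult[symmetric]) (auto intro!: summable_geometric simp: power_add ac_simps)
    also have "\<dots> = (2 * E * (1/2) ^ k) * w i" by (simp add: suminf_geometric)
    finally show ?thesis .
  qed
  have dl: "(\<lambda>k. 2 * E * (1/2) ^ k * c) \<longlonglongrightarrow> 0" for c :: real
    using tendsto_mult_right_zero[OF LIMSEQ_power_zero[of "1/2::real"], of "2 * E * c"] by (simp add: ac_simps)
  have \<alpha>c: "continuous_on {0..\<tau>} (\<lambda>t. \<alpha> t i)" for i
  proof (rule uniform_limit_theorem)
    show "uniform_limit {0..\<tau>} (\<lambda>k t. A k t i) (\<lambda>t. \<alpha> t i) sequentially"
    proof (rule uniform_limitI)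
      fix e :: real assume e: "e > 0"
      have "\<forall>\<^sub>F k in sequentially. 2 * E * (1/2) ^ k * w i < e" using order_tendstoD(2)[OF dl e] .
      then show "\<forall>\<^sub>F k in sequentially. \<forall>t\<in>{0..\<tau>}. dist (A k t i) (\<alpha> t i) < e"
      proof eventually_elim
        case (elim k)
        show ?case
        proof
          fix t assume "t \<in> {0..\<tau>}"
          then have "norm (\<alpha> t i - A k t i) < e" using close[of t i k] elim by linarith
          then show "dist (A k t i) (\<alpha> t i) < e" by (simp add: dist_norm norm_minus_commute)
        qed
      qed
    qed
  qed (auto intro!: always_eventually Ac)
  have \<alpha>F: "continuous_on {0..\<tau>} (\<lambda>s. F s (\<alpha> s) i)" for i by (rule cont[OF \<alpha>c])
  have eq: "\<alpha> t i = x0 i + integral {0..t} (\<lambda>s. F s (\<alpha> s) i)" if t: "t \<in> {0..\<tau>}" for t i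
  proof -
    have \<alpha>I: "(\<lambda>s. F s (\<alpha> s) i) integrable_on {0..t}"
      by (rule integrable_continuous_interval) (use t in \<open>auto intro: continuous_on_subset[OF \<alpha>F]\<close>)
    have "norm (integral {0..t} (\<lambda>s. F s (A k s) i) - integral {0..t} (\<lambda>s. F s (\<alpha> s) i)) \<le> 2 * E * (1/2) ^ k * (\<Lambda> * w i * t)" for k
    proof -
      have "norm (integral {0..t} (\<lambda>s. F s (A k s) i - F s (\<alpha> s) i)) \<le> integral {0..t} (\<lambda>s. \<Lambda> * (2 * E * (1/2) ^ k) * w i)"
      proof (rule Henstock_Kurzweil_Integration.integral_norm_bound_integral)
        show "(\<lambda>s. F s (A k s) i - F s (\<alpha> s) i) integrable_on {0..t}" by (intro integrable_diff Fi t \<alpha>I)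
        fix s assume "s \<in> {0..t}"
        then have s: "s \<in> {0..\<tau>}" using t by auto
        show "norm (F s (A k s) i - F s (\<alpha> s) i) \<le> \<Lambda> * (2 * E * (1/2) ^ k) * w i"
          by (rule lip[OF s]) (use E close[OF s] in \<open>auto simp: norm_minus_commute\<close>)
      qed auto
      then show ?thesis using t Fi[OF t] \<alpha>I by (simp add: Henstock_Kurzweil_Integration.integral_diff ac_simps)
    qed
    then have "(\<lambda>k. integral {0..t} (\<lambda>s. F s (A k s) i) - integral {0..t} (\<lambda>s. F s (\<alpha> s) i)) \<longlonglongrightarrow> 0"
      by (intro Lim_null_comparison[OF _ dl[of "\<Lambda> * w i * t"]] always_eventually allI)
    then have "(\<lambda>k. integral {0..t} (\<lambda>s. F s (A k s) i)) \<longlonglongrightarrow> integral {0..t} (\<lambda>s. F s (\<alpha> s) i)" by (simp add: LIM_zero_iff)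
    then have 1: "(\<lambda>k. A (Suc k) t i) \<longlonglongrightarrow> x0 i + integral {0..t} (\<lambda>s. F s (\<alpha> s) i)" unfolding AS by (intro tendsto_intros)
    have "(\<lambda>k. A k t i - \<alpha> t i) \<longlonglongrightarrow> 0"
      by (rule Lim_null_comparison[OF _ dl[of "w i"]]) (use close[OF t] in \<open>auto intro!: always_eventually simp: norm_minus_commute\<close>)
    then have "(\<lambda>k. A k t i) \<longlonglongrightarrow> \<alpha> t i" by (simp add: LIM_zero_iff)
    then have "(\<lambda>k. A (Suc k) t i) \<longlonglongrightarrow> \<alpha> t i" by (rule LIMSEQ_Suc)
    from LIMSEQ_unique[OF this 1] show ?thesis .
  qed
  show ?thesis
  proof (intro exI[of _ \<alpha>] conjI allI ballI)
    show "\<alpha> 0 i = x0 i" for i using eq[of 0 i] \<tau> by simp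
    fix i t assume t: "t \<in> {0..\<tau>}"
    have "((\<lambda>s. integral {0..s} (\<lambda>s. F s (\<alpha> s) i)) has_vector_derivative F t (\<alpha> t) i) (at t within {0..\<tau>})"
      by (rule integral_has_vector_derivative[OF \<alpha>F t])
    then have "((\<lambda>s. x0 i + integral {0..s} (\<lambda>s. F s (\<alpha> s) i)) has_vector_derivative F t (\<alpha> t) i) (at t within {0..\<tau>})"
      by (auto intro!: derivative_eq_intros)
    then show "((\<lambda>s. \<alpha> s i) has_vector_derivative F t (\<alpha> t) i) (at t within {0..\<tau>})"
      by (rule has_vector_derivative_transform[OF t, rotated]) (use eq in auto)
  qed
qed

section \<open>The lattice system in integer coordinates\<close>

lemma vector_derivative_bound:
  fixes f :: "real \<Rightarrow> complex"
  assumes t: "0 \<le> t" and f: "\<And>s. s \<in> {0..t} \<Longrightarrow> (f has_vector_derivative f' s) (at s within {0..t})"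
    and \<phi>: "\<And>s. s \<in> {0..t} \<Longrightarrow> (\<phi> has_vector_derivative \<phi>' s) (at s within {0..t})"
    and le: "\<And>s. s \<in> {0..t} \<Longrightarrow> norm (f' s) \<le> (\<phi>' s :: real)"
  shows "norm (f t - f 0) \<le> \<phi> t - \<phi> 0"
proof (cases "t = 0")
  case False
  show ?thesis
  proof (rule differentiable_bound_general[where f'=f' and \<phi>'=\<phi>'])
    show "0 < t" using t False by simp
    show "continuous_on {0..t} f" by (rule continuous_on_vector_derivative[OF f])
    show "continuous_on {0..t} \<phi>" by (rule continuous_on_vector_derivative[OF \<phi>])
    show "(f has_vector_derivative f' x) (at x)" if "0 < x" "x < t" for x
      using f[of x] that by (simp add: at_within_Icc_at)
    show "(\<phi> has_vector_derivative \<phi>' x) (at x)" if "0 < x" "x < t" for x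
      using \<phi>[of x] that by (simp add: at_within_Icc_at)
    show "norm (f' x) \<le> \<phi>' x" if "0 < x" "x < t" for x using le[of x] that by simp
  qed
qed simp

lemma exp_growth_derivative:
  "\<mu> \<noteq> 0 \<Longrightarrow> ((\<lambda>s. c * exp (\<mu> * s) / \<mu> + d * s) has_vector_derivative (c * exp (\<mu> * t) + d)) (at t within A)"
  unfolding has_real_derivative_iff_has_vector_derivative[symmetric]
  by (auto intro!: derivative_eq_intros)

lemma triple_product_diff:
  fixes a b c :: complex
  assumes "norm (a - a') \<le> S * A" "norm (b - b') \<le> S * B" "norm (c - c') \<le> S * C"
    and "norm a' \<le> R * A" "norm b' \<le> R * B" "norm b \<le> R * B" "norm c \<le> R * C" "norm c' \<le> R * C"
    and nn: "S \<ge> 0" "R \<ge> 0" "A \<ge> 0" "B \<ge> 0" "C \<ge> 0"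
  shows "norm (a * cnj b * c - a' * cnj b' * c') \<le> 3 * R\<^sup>2 * S * (A * B * C)"
proof -
  have "a * cnj b * c - a' * cnj b' * c' = (a - a') * cnj b * c + a' * cnj (b - b') * c + a' * cnj b' * (c - c')"
    by (simp add: algebra_simps)
  also have "norm \<dots> \<le> norm ((a - a') * cnj b * c) + norm (a' * cnj (b - b') * c) + norm (a' * cnj b' * (c - c'))"
    by (intro norm_triangle_le add_mono order.refl)
  also have "\<dots> \<le> (S * A) * (R * B) * (R * C) + (R * A) * (S * B) * (R * C) + (R * A) * (R * B) * (S * C)"
    unfolding norm_mult complex_mod_cnj using assms by (intro add_mono mult_mono) auto
  also have "\<dots> = 3 * R\<^sup>2 * S * (A * B * C)" by (simp add: power2_eq_square algebra_simps)
  finally show ?thesis .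
qed

lemma norm_triple_product_diff_le:
  fixes a b c :: complex
  shows "ennreal (norm (a * cnj b * c - a' * cnj b' * c')) \<le> ennreal (norm (a - a') * norm b * norm c)
     + ennreal (norm a' * norm (b - b') * norm c) + ennreal (norm a' * norm b' * norm (c - c'))"
proof -
  have "a * cnj b * c - a' * cnj b' * c' = (a - a') * cnj b * c + a' * cnj (b - b') * c + a' * cnj b' * (c - c')"
    by (simp add: algebra_simps)
  also have "norm \<dots> \<le> norm ((a - a') * cnj b * c) + norm (a' * cnj (b - b') * c) + norm (a' * cnj b' * (c - c'))"
    by (intro norm_triangle_le add_mono order.refl)
  also have "\<dots> = norm (a - a') * norm b * norm c + norm a' * norm (b - b') * norm c + norm a' * norm b' * norm (c - c')"
    unfolding norm_mult complex_mod_cnj ..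
  finally have "ennreal (norm (a * cnj b * c - a' * cnj b' * c')) \<le> ennreal (norm (a - a') * norm b * norm c + norm a' * norm (b - b') * norm c + norm a' * norm b' * norm (c - c'))"
    by (rule ennreal_leI)
  then show ?thesis by (simp only: ennreal_plus mult_nonneg_nonneg norm_ge_zero add_nonneg_nonneg)
qed

locale nls_box =
  fixes \<sigma> L \<epsilon> :: real
  assumes \<sigma>: "\<sigma> > 2" and L: "L > 1" and \<epsilon>: "\<epsilon> > 0"
begin

definition pt :: "int \<times> int \<Rightarrow> real^2" where "pt n = (1/L) *\<^sub>R ivec n"

definition w :: "int \<times> int \<Rightarrow> real" where "w n = wt \<sigma> (pt n)"

definition \<kappa> :: real where "\<kappa> = \<epsilon>\<^sup>2 / L ^ 4"

text \<open>The value of \<open>4 \<pi>\<^sup>2 \<Omega>\<close> on the interaction of the points \<open>n + p\<close>, \<open>n + p + q\<close>, \<open>n + q\<close>, where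
  \<open>\<Omega> = - 2 p \<cdot> q / L\<^sup>2\<close>: an interaction is resonant iff its four points form a rectangle.\<close>
definition freq :: "(int \<times> int) \<times> (int \<times> int) \<Rightarrow> real" where
  "freq z = - (8 * pi\<^sup>2 * of_int (idot (fst z) (snd z)) / L\<^sup>2)"

definition phase :: "(int \<times> int) \<times> (int \<times> int) \<Rightarrow> real \<Rightarrow> complex" where
  "phase z t = exp (\<i> * complex_of_real (freq z * t))"

definition cub :: "(int \<times> int \<Rightarrow> complex) \<Rightarrow> int \<times> int \<Rightarrow> (int \<times> int) \<times> (int \<times> int) \<Rightarrow> complex" where
  "cub a n z = a (n + fst z) * cnj (a (n + fst z + snd z)) * a (n + snd z)"

definition rect :: "int \<times> int \<Rightarrow> (int \<times> int) \<times> (int \<times> int) \<Rightarrow> real" where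
  "rect n z = w (n + fst z) * w (n + fst z + snd z) * w (n + snd z)"

definition nonlin :: "real \<Rightarrow> (int \<times> int \<Rightarrow> complex) \<Rightarrow> int \<times> int \<Rightarrow> complex" where
  "nonlin t a n = \<i> * (complex_of_real \<kappa> * (\<Sum>\<^sub>\<infinity>z. cub a n z * phase z t))"

lemma L0: "L > 0" "L \<ge> 1" "L \<noteq> 0" using L by auto

lemma \<kappa>_pos: "\<kappa> > 0" using \<epsilon> L0 by (simp add: \<kappa>_def)

lemma w_pos: "w n > 0" by (simp add: w_def wt_pos)

lemma w_nonneg: "w n \<ge> 0" by (simp add: w_def wt_nonneg)

lemma norm_phase [simp]: "norm (phase z t) = 1" by (simp add: phase_def norm_exp_eq_Re)

lemma phase_continuous: "continuous_on S (phase z)"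
  unfolding phase_def by (intro continuous_intros)

lemma pt_add: "pt (m + n) = pt m + pt n" by (simp add: pt_def ivec_add scaleR_add_right)

lemma pt_diff: "pt (m - n) = pt m - pt n" by (simp add: pt_def ivec_diff scaleR_diff_right)

lemma pt_inj: "pt m = pt n \<longleftrightarrow> m = n" using L0 by (simp add: pt_def ivec_inj)

lemma rect_eq: "rect n (p, q) = rect_wt \<sigma> (pt n) ((1/L) *\<^sub>R ivec p) ((1/L) *\<^sub>R ivec q)"
  unfolding rect_def rect_wt_def w_def fst_conv snd_conv pt_add by (simp add: pt_def)

lemma rect_nonneg: "rect n z \<ge> 0" by (simp add: rect_def w_nonneg)

lemma lattice_eq: "lattice_L L = range pt"
proof -
  have "{n :: real^2. \<forall>i. n $ i \<in> \<int>} = range ivec"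
  proof (intro equalityI subsetI)
    fix x :: "real^2" assume "x \<in> {n. \<forall>i. n $ i \<in> \<int>}"
    then have "x $ 1 \<in> \<int>" "x $ 2 \<in> \<int>" by auto
    then obtain a b where "x $ 1 = of_int a" "x $ 2 = of_int b" by (meson Ints_cases)
    then have "x = ivec (a, b)" by (simp add: vec_eq_iff forall_2)
    then show "x \<in> range ivec" by blast
  qed (auto simp: forall_2)
  then show ?thesis by (auto simp: lattice_L_def pt_def image_image)
qed

lemma bij_pt: "bij_betw pt UNIV (lattice_L L)"
  by (auto simp: bij_betw_def lattice_eq inj_on_def pt_inj)

lemma bij_interactions:
  "bij_betw (\<lambda>z. (pt (n + fst z), pt (n + fst z + snd z), pt (n + snd z))) UNIV (interactions L (pt n))"
proof (rule bij_betwI')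
  show "(pt (n + fst x), pt (n + fst x + snd x), pt (n + snd x)) = (pt (n + fst y), pt (n + fst y + snd y), pt (n + snd y)) \<longleftrightarrow> x = y" for x y
    by (auto simp: pt_inj prod_eq_iff)
  show "(pt (n + fst x), pt (n + fst x + snd x), pt (n + snd x)) \<in> interactions L (pt n)" for x
    unfolding interactions_def lattice_eq
    by (simp only: mem_Collect_eq case_prod_conv rangeI simp_thms) (simp add: pt_add)
  fix y assume "y \<in> interactions L (pt n)"
  then obtain a b c where y: "y = (pt a, pt b, pt c)" and e: "pt a - pt b + pt c = pt n"
    by (auto simp: interactions_def lattice_eq)
  have "a - b + c = n" using e pt_inj[of "a - b + c" n] by (simp add: pt_add pt_diff)
  then have b: "b = a + (c - n)" by (auto simp: prod_eq_iff)
  show "\<exists>x\<in>UNIV. y = (pt (n + fst x), pt (n + fst x + snd x), pt (n + snd x))"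
    unfolding y b by (intro bexI[of _ "(a - n, c - n)"]) auto
qed

lemma Omega_eq: "4 * pi\<^sup>2 * Omega (pt n) (pt (n + p)) (pt (n + p + q)) (pt (n + q)) = freq (p, q)"
proof -
  have o: "Omega K (K + x) (K + x + y) (K + y) = - 2 * (x \<bullet> y)" for K x y :: "real^2"
    by (simp add: Omega_def power2_norm_eq_inner inner_add_left inner_add_right inner_commute algebra_simps)
  have "pt p \<bullet> pt q = of_int (idot p q) / L\<^sup>2"
    by (simp add: pt_def inner_ivec power2_eq_square)
  then show ?thesis unfolding pt_add by (simp add: o freq_def)
qed

text \<open>The constraint \<open>K1 - K2 + K3 = K\<close> is solved by the sides \<open>p = K1 - K\<close> and \<open>q = K3 - K\<close> of a
  parallelogram, which are free.\<close>
lemma interaction_sum: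
  "(\<Sum>\<^sub>\<infinity>(K1, K2, K3)\<in>interactions L (pt n). a K1 * cnj (a K2) * a K3 *
       exp (\<i> * complex_of_real (4 * pi\<^sup>2 * Omega (pt n) K1 K2 K3 * t)))
   = (\<Sum>\<^sub>\<infinity>z. cub (\<lambda>m. a (pt m)) n z * phase z t)"
  by (subst infsum_reindex_bij_betw[OF bij_interactions, symmetric])
     (simp only: cub_def phase_def case_prod_conv Omega_eq prod.collapse)

lemma NLS_solution_index:
  "NLS_solution L \<epsilon> a0 \<tau> a \<longleftrightarrow>
     (\<forall>t\<in>{0..\<tau>}. (\<lambda>n. norm (a t (pt n))) summable_on UNIV) \<and>
     bdd_above ((\<lambda>t. \<Sum>\<^sub>\<infinity>n. norm (a t (pt n))) ` {0..\<tau>}) \<and>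
     (\<forall>n. a 0 (pt n) = a0 (pt n)) \<and>
     (\<forall>t\<in>{0..\<tau>}. \<forall>n. ((\<lambda>s. a s (pt n)) has_vector_derivative nonlin t (\<lambda>m. a t (pt m)) n) (at t within {0..\<tau>}))"
proof -
  have s: "(\<lambda>K. norm (a t K)) summable_on lattice_L L \<longleftrightarrow> (\<lambda>n. norm (a t (pt n))) summable_on UNIV" for t
    using summable_on_reindex_bij_betw[OF bij_pt, of "\<lambda>K. norm (a t K)"] by simp
  have i: "(\<Sum>\<^sub>\<infinity>K\<in>lattice_L L. norm (a t K)) = (\<Sum>\<^sub>\<infinity>n. norm (a t (pt n)))" for t
    using infsum_reindex_bij_betw[OF bij_pt, of "\<lambda>K. norm (a t K)"] by simp
  have q: "(\<forall>K\<in>lattice_L L. P K) \<longleftrightarrow> (\<forall>n. P (pt n))" for P by (auto simp: lattice_eq)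
  show ?thesis
    unfolding NLS_solution_def s i q nonlin_def \<kappa>_def interaction_sum ..
qed

text \<open>The map \<open>(n, p, q) \<mapsto> (n + p, n + p + q, n + q)\<close> is a bijection, which makes the cubic nonlinearity
  bounded on \<open>\<ell>\<^sup>1\<close>.\<close>
lemma triple_sum_product:
  fixes x y v :: "int \<times> int \<Rightarrow> ennreal"
  shows "nsum (\<lambda>n. nsum (\<lambda>z. x (n + fst z) * y (n + fst z + snd z) * v (n + snd z)) UNIV) UNIV = nsum x UNIV * nsum y UNIV * nsum v UNIV"
proof -
  let ?f = "\<lambda>(n, z). (n + fst z, n + fst z + snd z, n + snd z) :: (int \<times> int) \<times> (int \<times> int) \<times> (int \<times> int)"
  have b: "bij_betw ?f (UNIV \<times> UNIV) (UNIV \<times> UNIV \<times> UNIV)"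
    by (rule bij_betw_byWitness[where f'="\<lambda>(a, b, c). (a - b + c, (b - c, b - a))"]) auto
  have "nsum (\<lambda>n. nsum (\<lambda>z. x (n + fst z) * y (n + fst z + snd z) * v (n + snd z)) UNIV) UNIV
     = nsum (\<lambda>u. (\<lambda>(a, b, c). x a * y b * v c) (?f u)) (UNIV \<times> UNIV)"
    by (simp only: nsum_pair case_prod_conv)
  also have "\<dots> = nsum (\<lambda>(a, b, c). x a * y b * v c) (UNIV \<times> UNIV \<times> UNIV)"
    using nsum_bij[OF b, where f="\<lambda>(a, b, c). x a * y b * v c"] by (rule sym)
  also have "\<dots> = nsum (\<lambda>a. nsum (\<lambda>b. nsum (\<lambda>c. x a * y b * v c) UNIV) UNIV) UNIV"
    by (simp only: nsum_pair case_prod_conv)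
  also have "\<dots> = nsum x UNIV * nsum y UNIV * nsum v UNIV"
    by (simp only: nsum_cmult nsum_multc)
  finally show ?thesis .
qed

lemma cub_l1_bound:
  fixes x y v :: "int \<times> int \<Rightarrow> complex"
  assumes "nsum (\<lambda>n. ennreal (norm (x n))) UNIV \<le> ennreal X" "nsum (\<lambda>n. ennreal (norm (y n))) UNIV \<le> ennreal Y"
    "nsum (\<lambda>n. ennreal (norm (v n))) UNIV \<le> ennreal V" and nn: "X \<ge> 0" "Y \<ge> 0" "V \<ge> 0"
  shows "nsum (\<lambda>n. nsum (\<lambda>z. ennreal (norm (x (n + fst z)) * norm (y (n + fst z + snd z)) * norm (v (n + snd z)))) UNIV) UNIV \<le> ennreal (X * Y * V)"
proof -
  have "nsum (\<lambda>n. nsum (\<lambda>z. ennreal (norm (x (n + fst z)) * norm (y (n + fst z + snd z)) * norm (v (n + snd z)))) UNIV) UNIV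
     = nsum (\<lambda>n. ennreal (norm (x n))) UNIV * nsum (\<lambda>n. ennreal (norm (y n))) UNIV * nsum (\<lambda>n. ennreal (norm (v n))) UNIV"
    unfolding triple_sum_product[symmetric] by (simp add: ennreal_mult'')
  also have "\<dots> \<le> ennreal X * ennreal Y * ennreal V" by (intro mult_mono assms) auto
  also have "\<dots> = ennreal (X * Y * V)" using nn by (simp add: ennreal_mult')
  finally show ?thesis .
qed

lemma cub_summable:
  assumes "(\<lambda>n. norm (a n)) summable_on UNIV"
  shows "(\<lambda>z. cub a n z * phase z t) summable_on UNIV"
proof -
  define M where "M = (\<Sum>\<^sub>\<infinity>n. norm (a n))"
  have M: "M \<ge> 0" unfolding M_def by (rule infsum_nonneg) auto
  have e: "nsum (\<lambda>n. ennreal (norm (a n))) UNIV \<le> ennreal M"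
    unfolding M_def using nsum_of_summable[OF assms] by simp
  have "nsum (\<lambda>z. ennreal (norm (cub a n z * phase z t))) UNIV
     \<le> nsum (\<lambda>n. nsum (\<lambda>z. ennreal (norm (a (n + fst z)) * norm (a (n + fst z + snd z)) * norm (a (n + snd z)))) UNIV) {n}"
    by (simp add: nn_integral_count_space_finite cub_def norm_mult)
  also have "\<dots> \<le> nsum (\<lambda>n. nsum (\<lambda>z. ennreal (norm (a (n + fst z)) * norm (a (n + fst z + snd z)) * norm (a (n + snd z)))) UNIV) UNIV"
    by (rule nsum_subset) simp
  also have "\<dots> \<le> ennreal (M * M * M)" by (rule cub_l1_bound[OF e e e M M M])
  finally show ?thesis by (rule summable_of_nsum(2)) (use M in simp)
qed

lemma nonlin_l1_diff:
  assumes a: "(\<lambda>n. norm (a n)) summable_on UNIV" "(\<Sum>\<^sub>\<infinity>n. norm (a n)) \<le> M"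
    and b: "(\<lambda>n. norm (b n)) summable_on UNIV" "(\<Sum>\<^sub>\<infinity>n. norm (b n)) \<le> M"
    and d: "(\<Sum>\<^sub>\<infinity>n. norm (a n - b n)) \<le> D" and F: "finite F"
  shows "(\<Sum>n\<in>F. norm (nonlin t a n - nonlin t b n)) \<le> 3 * \<kappa> * M\<^sup>2 * D"
proof -
  have M: "M \<ge> 0" by (rule order_trans[OF infsum_nonneg a(2)]) simp
  have ds: "(\<lambda>n. norm (a n - b n)) summable_on UNIV"
    by (rule summable_on_comparison_test[OF summable_on_add[OF a(1) b(1)]]) (auto intro: norm_triangle_ineq4)
  have D: "D \<ge> 0" by (rule order_trans[OF infsum_nonneg d]) simp
  have ea: "nsum (\<lambda>n. ennreal (norm (a n))) UNIV \<le> ennreal M" using nsum_of_summable[OF a(1)] a(2) by (simp add: ennreal_leI)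
  have eb: "nsum (\<lambda>n. ennreal (norm (b n))) UNIV \<le> ennreal M" using nsum_of_summable[OF b(1)] b(2) by (simp add: ennreal_leI)
  have ed: "nsum (\<lambda>n. ennreal (norm (a n - b n))) UNIV \<le> ennreal D" using nsum_of_summable[OF ds] d by (simp add: ennreal_leI)
  let ?t = "\<lambda>x y v n z. ennreal (norm (x (n + fst z)) * norm (y (n + fst z + snd z)) * norm (v (n + snd z)))"
  let ?d = "\<lambda>n. a n - b n"
  have pw: "ennreal (norm (cub a n z * phase z t - cub b n z * phase z t)) \<le> ?t ?d a a n z + ?t b ?d a n z + ?t b b ?d n z" for n z
    unfolding cub_def left_diff_distrib[symmetric] norm_mult norm_phase mult_1_right by (rule norm_triple_product_diff_le)
  have n1: "ennreal (norm (nonlin t a n - nonlin t b n)) \<le> ennreal \<kappa> * (nsum (?t ?d a a n) UNIV + nsum (?t b ?d a n) UNIV + nsum (?t b b ?d n) UNIV)" for n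
  proof -
    have "nonlin t a n - nonlin t b n = \<i> * (complex_of_real \<kappa> * (\<Sum>\<^sub>\<infinity>z. cub a n z * phase z t - cub b n z * phase z t))"
    proof -
      have "((\<lambda>z. cub a n z * phase z t + - (cub b n z * phase z t)) has_sum ((\<Sum>\<^sub>\<infinity>z. cub a n z * phase z t) + - (\<Sum>\<^sub>\<infinity>z. cub b n z * phase z t))) UNIV"
        by (intro has_sum_add has_sum_uminusI has_sum_infsum cub_summable a(1) b(1))
      then show ?thesis unfolding nonlin_def diff_conv_add_uminus by (simp only: infsumI) (simp add: algebra_simps)
    qed
    then have "ennreal (norm (nonlin t a n - nonlin t b n)) = ennreal \<kappa> * ennreal (norm (\<Sum>\<^sub>\<infinity>z. cub a n z * phase z t - cub b n z * phase z t))"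
      using \<kappa>_pos by (simp add: norm_mult ennreal_mult')
    also have "\<dots> \<le> ennreal \<kappa> * nsum (\<lambda>z. ?t ?d a a n z + ?t b ?d a n z + ?t b b ?d n z) UNIV"
      by (intro mult_left_mono order_trans[OF norm_infsum_le_nsum nsum_mono] pw) auto
    finally show ?thesis by (simp only: nsum_add)
  qed
  have "ennreal (\<Sum>n\<in>F. norm (nonlin t a n - nonlin t b n)) = nsum (\<lambda>n. ennreal (norm (nonlin t a n - nonlin t b n))) F"
    using F by (simp add: nn_integral_count_space_finite sum_ennreal)
  also have "\<dots> \<le> nsum (\<lambda>n. ennreal (norm (nonlin t a n - nonlin t b n))) UNIV" by (rule nsum_subset) simp
  also have "\<dots> \<le> nsum (\<lambda>n. ennreal \<kappa> * (nsum (?t ?d a a n) UNIV + nsum (?t b ?d a n) UNIV + nsum (?t b b ?d n) UNIV)) UNIV"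
    by (intro nsum_mono n1)
  also have "\<dots> = ennreal \<kappa> * (nsum (\<lambda>n. nsum (?t ?d a a n) UNIV) UNIV + nsum (\<lambda>n. nsum (?t b ?d a n) UNIV) UNIV + nsum (\<lambda>n. nsum (?t b b ?d n) UNIV) UNIV)"
    by (simp only: nsum_cmult nsum_add)
  also have "\<dots> \<le> ennreal \<kappa> * (ennreal (D * M * M) + ennreal (M * D * M) + ennreal (M * M * D))"
    by (intro mult_left_mono add_mono cub_l1_bound ea eb ed M D) auto
  also have "\<dots> = ennreal (\<kappa> * (D * M * M + M * D * M + M * M * D))"
    using \<kappa>_pos M D by (simp only: ennreal_plus ennreal_mult' mult_nonneg_nonneg add_nonneg_nonneg less_imp_le)
  also have "\<kappa> * (D * M * M + M * D * M + M * M * D) = 3 * \<kappa> * M\<^sup>2 * D" by (simp add: power2_eq_square algebra_simps)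
  finally show ?thesis using \<kappa>_pos D by (subst (asm) ennreal_le_iff) auto
qed

text \<open>In place of a Gronwall lemma for the \<open>\<ell>\<^sup>1\<close> distance \<open>\<Delta>\<close>, which need not be differentiable: the best
  constant \<open>D\<close> in \<open>\<Delta> t \<le> D exp (\<Lambda> t)\<close> is at most \<open>D / 2\<close>. A finite partial sum of \<open>\<Delta> t\<close> is the value at \<open>t\<close>
  of a linear combination of the components, with coefficients fixed at time \<open>t\<close>, and this
  combination can be differentiated.\<close>
lemma l1_uniqueness:
  assumes \<tau>: "0 \<le> \<tau>"
    and a: "\<And>t. t \<in> {0..\<tau>} \<Longrightarrow> (\<lambda>n. norm (a t n)) summable_on UNIV" "\<And>t. t \<in> {0..\<tau>} \<Longrightarrow> (\<Sum>\<^sub>\<infinity>n. norm (a t n)) \<le> M"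
    and b: "\<And>t. t \<in> {0..\<tau>} \<Longrightarrow> (\<lambda>n. norm (b t n)) summable_on UNIV" "\<And>t. t \<in> {0..\<tau>} \<Longrightarrow> (\<Sum>\<^sub>\<infinity>n. norm (b t n)) \<le> M"
    and da: "\<And>t n. t \<in> {0..\<tau>} \<Longrightarrow> ((\<lambda>s. a s n) has_vector_derivative nonlin t (a t) n) (at t within {0..\<tau>})"
    and db: "\<And>t n. t \<in> {0..\<tau>} \<Longrightarrow> ((\<lambda>s. b s n) has_vector_derivative nonlin t (b t) n) (at t within {0..\<tau>})"
    and i: "\<And>n. a 0 n = b 0 n" and t: "t \<in> {0..\<tau>}"
  shows "a t n = b t n"
proof -
  define \<Delta> where "\<Delta> = (\<lambda>t. \<Sum>\<^sub>\<infinity>n. norm (a t n - b t n))"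
  have ds: "(\<lambda>n. norm (a t n - b t n)) summable_on UNIV" if "t \<in> {0..\<tau>}" for t
    by (rule summable_on_comparison_test[OF summable_on_add[OF a(1)[OF that] b(1)[OF that]]]) (auto intro: norm_triangle_ineq4)
  have \<Delta>0: "\<Delta> t \<ge> 0" for t unfolding \<Delta>_def by (rule infsum_nonneg) auto
  have \<Delta>M: "\<Delta> t \<le> 2 * M" if t: "t \<in> {0..\<tau>}" for t
  proof -
    have "\<Delta> t \<le> (\<Sum>\<^sub>\<infinity>n. norm (a t n) + norm (b t n))"
      unfolding \<Delta>_def by (rule infsum_mono[OF ds[OF t] summable_on_add[OF a(1)[OF t] b(1)[OF t]]]) (rule norm_triangle_ineq4)
    also have "\<dots> = (\<Sum>\<^sub>\<infinity>n. norm (a t n)) + (\<Sum>\<^sub>\<infinity>n. norm (b t n))" by (rule infsum_add[OF a(1)[OF t] b(1)[OF t]])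
    finally show ?thesis using a(2)[OF t] b(2)[OF t] by linarith
  qed
  have M: "M \<ge> 0" using \<Delta>M[OF t] \<Delta>0[of t] by linarith
  define c where "c = 3 * \<kappa> * M\<^sup>2"
  have c: "c \<ge> 0" using \<kappa>_pos by (simp add: c_def)
  define \<Lambda> where "\<Lambda> = 2 * c + 1"
  have \<Lambda>: "\<Lambda> > 0" using c by (simp add: \<Lambda>_def)
  define D where "D = (SUP t\<in>{0..\<tau>}. exp (- \<Lambda> * t) * \<Delta> t)"
  have bdd: "bdd_above ((\<lambda>t. exp (- \<Lambda> * t) * \<Delta> t) ` {0..\<tau>})"
  proof (rule bdd_aboveI2)
    fix t assume t: "t \<in> {0..\<tau>}"
    have "exp (- \<Lambda> * t) * \<Delta> t \<le> 1 * (2 * M)" using t \<Lambda> \<Delta>M[OF t] \<Delta>0 by (intro mult_mono) auto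
    then show "exp (- \<Lambda> * t) * \<Delta> t \<le> 2 * M" by simp
  qed
  have Dle: "\<Delta> t \<le> D * exp (\<Lambda> * t)" if t: "t \<in> {0..\<tau>}" for t
  proof -
    have "exp (- \<Lambda> * t) * \<Delta> t \<le> D" unfolding D_def by (rule cSUP_upper[OF t bdd])
    then show ?thesis by (simp add: exp_minus field_simps)
  qed
  have D0: "D \<ge> 0" using Dle[of 0] \<Delta>0[of 0] \<tau> by simp
  have half: "\<Delta> t \<le> D / 2 * exp (\<Lambda> * t)" if t: "t \<in> {0..\<tau>}" for t
    unfolding \<Delta>_def
  proof (rule infsum_le_finite_sums[OF ds[OF t]])
    fix F :: "(int \<times> int) set" assume F: "finite F"
    define u where "u = (\<lambda>n. cnj (sgn (a t n - b t n)))"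
    have un: "norm (u n) \<le> 1" for n by (simp add: u_def norm_sgn)
    define f where "f = (\<lambda>s. \<Sum>n\<in>F. u n * (a s n - b s n))"
    have ft: "f t = complex_of_real (\<Sum>n\<in>F. norm (a t n - b t n))"
    proof -
      have "u n * (a t n - b t n) = complex_of_real (norm (a t n - b t n))" for n
      proof (cases "a t n - b t n = 0")
        case False
        have "cnj (sgn z) * z = complex_of_real (norm z)" if "z \<noteq> 0" for z :: complex
          using that by (simp add: sgn_div_norm scaleR_conv_of_real mult.assoc complex_norm_square[symmetric] power2_eq_square divide_simps mult.commute[of "cnj z"])
        then show ?thesis using False unfolding u_def by blast
      qed (simp add: u_def)
      then show ?thesis by (simp add: f_def)
    qed
    have f0: "f 0 = 0" by (simp add: f_def i)
    have "norm (f t - f 0) \<le> (c * D * exp (\<Lambda> * t) / \<Lambda> + 0 * t) - (c * D * exp (\<Lambda> * 0) / \<Lambda> + 0 * 0)"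
    proof (rule vector_derivative_bound)
      show "0 \<le> t" using t by simp
      fix s assume "s \<in> {0..t}"
      then have s: "s \<in> {0..\<tau>}" and sub: "{0..t} \<subseteq> {0..\<tau>}" using t by auto
      have "(f has_vector_derivative (\<Sum>n\<in>F. u n * (nonlin s (a s) n - nonlin s (b s) n))) (at s within {0..\<tau>})"
        unfolding f_def by (intro has_vector_derivative_sum has_vector_derivative_mult_right has_vector_derivative_diff da db s)
      then show "(f has_vector_derivative (\<Sum>n\<in>F. u n * (nonlin s (a s) n - nonlin s (b s) n))) (at s within {0..t})"
        by (rule has_vector_derivative_within_subset[OF _ sub])
      show "((\<lambda>s. c * D * exp (\<Lambda> * s) / \<Lambda> + 0 * s) has_vector_derivative c * D * exp (\<Lambda> * s) + 0) (at s within {0..t})"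
        using \<Lambda> by (intro exp_growth_derivative) auto
      have "norm (\<Sum>n\<in>F. u n * (nonlin s (a s) n - nonlin s (b s) n)) \<le> (\<Sum>n\<in>F. norm (nonlin s (a s) n - nonlin s (b s) n))"
        by (rule order_trans[OF norm_sum], rule sum_mono) (auto simp: norm_mult intro!: mult_left_le_one_le un)
      also have "\<dots> \<le> 3 * \<kappa> * M\<^sup>2 * (D * exp (\<Lambda> * s))"
        by (rule nonlin_l1_diff[OF a(1)[OF s] a(2)[OF s] b(1)[OF s] b(2)[OF s] Dle[OF s, unfolded \<Delta>_def] F])
      finally show "norm (\<Sum>n\<in>F. u n * (nonlin s (a s) n - nonlin s (b s) n)) \<le> c * D * exp (\<Lambda> * s) + 0"
        by (simp add: c_def mult.assoc)
    qed
    also have "\<dots> \<le> c * D * exp (\<Lambda> * t) / \<Lambda>" using c D0 \<Lambda> by simp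
    also have "\<dots> = (c / \<Lambda>) * (D * exp (\<Lambda> * t))" by simp
    also have "\<dots> \<le> (1/2) * (D * exp (\<Lambda> * t))" using c D0 \<Lambda> by (intro mult_right_mono) (auto simp: \<Lambda>_def divide_le_eq)
    finally have "norm (f t) \<le> D / 2 * exp (\<Lambda> * t)" using f0 by simp
    then show "(\<Sum>n\<in>F. norm (a t n - b t n)) \<le> D / 2 * exp (\<Lambda> * t)" unfolding ft norm_of_real by linarith
  qed
  have "D \<le> D / 2" unfolding D_def
  proof (rule cSUP_least)
    show "{0..\<tau>} \<noteq> {}" using \<tau> by auto
    fix t assume t: "t \<in> {0..\<tau>}"
    show "exp (- \<Lambda> * t) * \<Delta> t \<le> (SUP t\<in>{0..\<tau>}. exp (- \<Lambda> * t) * \<Delta> t) / 2"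
      using half[OF t] unfolding D_def[symmetric] by (simp add: exp_minus field_simps)
  qed
  then have "D \<le> 0" by simp
  then have "\<Delta> t \<le> 0" using half[OF t] D0 by simp
  then have z: "(\<Sum>\<^sub>\<infinity>n. norm (a t n - b t n)) = 0" using \<Delta>0[of t] by (simp add: \<Delta>_def)
  have "norm (a t n - b t n) = 0"
    by (rule nonneg_infsum_le_0D[OF _ ds[OF t]]) (use z in auto)
  then show ?thesis by simp
qed

end

section \<open>Truncation and removal of the non-resonant interactions\<close>

definition full_const :: "real \<Rightarrow> real" where
  "full_const \<sigma> = 48 * 3 powr \<sigma> * lsum_const \<sigma> ^ 4"

lemma full_const_pos: "full_const \<sigma> > 0"
  using lsum_const_ge_1[of \<sigma>] by (auto simp: full_const_def intro!: mult_pos_pos)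

lemma res_const_pos: "res_const \<sigma> > 0"
  using lsum_const_ge_1[of \<sigma>] by (auto simp: res_const_def intro!: mult_pos_pos)

lemma nonres_const_pos: "nonres_const \<sigma> > 0"
  using lsum_const_ge_1[of \<sigma>] by (auto simp: nonres_const_def intro!: mult_pos_pos)

context nls_box
begin

definition resonant :: "((int \<times> int) \<times> (int \<times> int)) set" where
  "resonant = {z. idot (fst z) (snd z) = 0}"

text \<open>The nearest point projection is a contraction, so that the truncated equation inherits all Lipschitz
  bounds of the ball in which it agrees with the original one.\<close>
definition trunc :: "real \<Rightarrow> (int \<times> int \<Rightarrow> complex) \<Rightarrow> int \<times> int \<Rightarrow> complex" where
  "trunc R a n = closest_point (cball 0 (R * w n)) (a n)"

definition resonant_part :: "(int \<times> int \<Rightarrow> complex) \<Rightarrow> int \<times> int \<Rightarrow> complex" where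
  "resonant_part a n = \<i> * (complex_of_real \<kappa> * (\<Sum>\<^sub>\<infinity>z\<in>resonant. cub a n z))"

lemma phase_resonant: "z \<in> resonant \<Longrightarrow> phase z t = 1"
  by (simp add: resonant_def phase_def freq_def)

lemma trunc_bound: assumes "R \<ge> 0" shows "norm (trunc R a n) \<le> R * w n"
proof -
  have "trunc R a n \<in> cball 0 (R * w n)"
    unfolding trunc_def by (rule closest_point_in_set) (use mult_nonneg_nonneg[OF assms w_nonneg[of n]] in auto)
  then show ?thesis by simp
qed

lemma trunc_self: "norm (a n) \<le> R * w n \<Longrightarrow> trunc R a n = a n"
  unfolding trunc_def by (rule closest_point_self) simp

lemma trunc_lipschitz:
  assumes R: "R \<ge> 0" shows "norm (trunc R a n - trunc R b n) \<le> norm (a n - b n)"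
proof -
  have "R * w n \<ge> 0" using R w_nonneg by simp
  then have "dist (closest_point (cball 0 (R * w n)) (a n)) (closest_point (cball 0 (R * w n)) (b n)) \<le> dist (a n) (b n)"
    by (intro closest_point_lipschitz) simp_all
  then show ?thesis by (simp only: trunc_def dist_norm)
qed

lemma trunc_continuous:
  assumes R: "R \<ge> 0" and c: "continuous_on S (\<lambda>t. a t n)"
  shows "continuous_on S (\<lambda>t. trunc R (a t) n)"
proof -
  have "continuous_on UNIV (closest_point (cball (0::complex) (R * w n)))"
    by (rule continuous_on_closest_point) (use mult_nonneg_nonneg[OF R w_nonneg[of n]] in auto)
  from continuous_on_compose2[OF this c] show ?thesis by (simp add: trunc_def)
qed

lemma rect_sum_full: "nsum (\<lambda>z. ennreal (rect n z)) UNIV \<le> ennreal (full_const \<sigma> * L ^ 4 * w n)"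
proof -
  have "(\<lambda>z. ennreal (rect n z)) = (\<lambda>(p, q). ennreal (rect_wt \<sigma> (pt n) ((1/L) *\<^sub>R ivec p) ((1/L) *\<^sub>R ivec q)))"
    by (auto simp: fun_eq_iff rect_eq)
  then show ?thesis using full_sum[OF \<sigma> L0(2), of "pt n"] by (simp only: full_const_def w_def)
qed

lemma rect_sum_resonant:
  assumes "L \<ge> exp 1"
  shows "nsum (\<lambda>z. ennreal (rect n z)) resonant \<le> ennreal (res_const \<sigma> * L\<^sup>2 * ln L * w n)"
proof -
  have "(\<lambda>z. ennreal (rect n z)) = (\<lambda>(p, q). ennreal (rect_wt \<sigma> (pt n) ((1/L) *\<^sub>R ivec p) ((1/L) *\<^sub>R ivec q)))"
    by (auto simp: fun_eq_iff rect_eq)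
  moreover have "resonant = {(p, q). idot p q = 0}" by (auto simp: resonant_def)
  ultimately show ?thesis using res_sum[OF \<sigma> assms, of "pt n"] by (simp only: w_def)
qed

lemma rect_sum_nonresonant:
  assumes "L \<ge> exp 1"
  shows "nsum (\<lambda>z. ennreal (rect n z * (1 / \<bar>of_int (idot (fst z) (snd z))\<bar>))) (- resonant) \<le> ennreal (nonres_const \<sigma> * L\<^sup>2 * ln L * w n)"
proof -
  have "nsum (\<lambda>z. ennreal (rect n z * (1 / \<bar>of_int (idot (fst z) (snd z))\<bar>))) (- resonant)
     \<le> nsum (\<lambda>z. ennreal (rect n z * (1 / \<bar>of_int (idot (fst z) (snd z))\<bar>))) UNIV"
    by (rule nsum_subset) simp
  moreover have "(\<lambda>z. ennreal (rect n z * (1 / \<bar>of_int (idot (fst z) (snd z))\<bar>)))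
     = (\<lambda>(p, q). ennreal (rect_wt \<sigma> (pt n) ((1/L) *\<^sub>R ivec p) ((1/L) *\<^sub>R ivec q)) * ennreal (1 / \<bar>of_int (idot p q)\<bar>))"
  proof (rule ext)
    fix z :: "(int \<times> int) \<times> (int \<times> int)"
    obtain p q where z: "z = (p, q)" by (cases z)
    show "ennreal (rect n z * (1 / \<bar>of_int (idot (fst z) (snd z))\<bar>))
     = (case z of (p, q) \<Rightarrow> ennreal (rect_wt \<sigma> (pt n) ((1/L) *\<^sub>R ivec p) ((1/L) *\<^sub>R ivec q)) * ennreal (1 / \<bar>of_int (idot p q)\<bar>))"
      unfolding z case_prod_conv fst_conv snd_conv rect_eq[symmetric] by (rule ennreal_mult'[OF rect_nonneg])
  qed
  ultimately show ?thesis using nonres_sum[OF \<sigma> assms, of "pt n"] unfolding w_def by (metis (no_types, lifting) order_trans)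
qed

lemma weighted_sum_bound:
  fixes c :: "(int \<times> int) \<times> (int \<times> int) \<Rightarrow> complex"
  assumes c: "\<And>z. z \<in> I \<Longrightarrow> norm (c z) \<le> k * rect n z" and k: "k \<ge> 0"
    and X: "nsum (\<lambda>z. ennreal (rect n z)) I \<le> ennreal X" "X \<ge> 0"
  shows "c summable_on I" "norm (infsum c I) \<le> k * X"
proof -
  have "nsum (\<lambda>z. ennreal (norm (c z))) I \<le> nsum (\<lambda>z. ennreal k * ennreal (rect n z)) I"
    using c k by (intro nsum_mono) (simp add: ennreal_mult'[symmetric] ennreal_leI)
  also have "\<dots> = ennreal k * nsum (\<lambda>z. ennreal (rect n z)) I" by (rule nsum_cmult)
  also have "\<dots> \<le> ennreal k * ennreal X" by (intro mult_left_mono X) auto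
  also have "\<dots> = ennreal (k * X)" using k by (simp add: ennreal_mult')
  finally have le: "nsum (\<lambda>z. ennreal (norm (c z))) I \<le> ennreal (k * X)" .
  have "k * X \<ge> 0" using k X by simp
  from summable_of_nsum(2,3)[OF le this] show "c summable_on I" "norm (infsum c I) \<le> k * X" .
qed

lemma rect_summable: "(\<lambda>z. rect n z) summable_on I"
proof -
  have "(\<lambda>z. norm (rect n z)) summable_on UNIV"
    by (rule summable_of_nsum(1)[where C="full_const \<sigma> * L ^ 4 * w n"])
       (use rect_sum_full[of n] rect_nonneg full_const_pos[of \<sigma>] w_nonneg[of n] L0 in auto)
  then have "(\<lambda>z. rect n z) summable_on UNIV" using rect_nonneg by simp
  then show ?thesis by (rule summable_on_subset_banach) simp
qed

lemma cub_bound: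
  assumes x: "\<And>m. norm (x m) \<le> R * w m" and R: "R \<ge> 0"
  shows "norm (cub x n z) \<le> R ^ 3 * rect n z"
proof -
  have "norm (cub x n z) \<le> (R * w (n + fst z)) * (R * w (n + fst z + snd z)) * (R * w (n + snd z))"
    unfolding cub_def norm_mult complex_mod_cnj by (intro mult_mono x mult_nonneg_nonneg R w_nonneg norm_ge_zero)
  also have "\<dots> = R ^ 3 * rect n z" by (simp add: rect_def power3_eq_cube)
  finally show ?thesis .
qed

lemma cub_diff:
  assumes x: "\<And>m. norm (x m) \<le> R * w m" and y: "\<And>m. norm (y m) \<le> R * w m"
    and d: "\<And>m. norm (x m - y m) \<le> S * w m" and nn: "R \<ge> 0" "S \<ge> 0"
  shows "norm (cub x n z - cub y n z) \<le> 3 * R\<^sup>2 * S * rect n z"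
  unfolding cub_def rect_def
  by (rule triple_product_diff[OF d d d y y x x y nn(2,1) w_nonneg w_nonneg w_nonneg])

lemma cub_sum_diff:
  assumes x: "\<And>m. norm (x m) \<le> R * w m" and y: "\<And>m. norm (y m) \<le> R * w m"
    and d: "\<And>m. norm (x m - y m) \<le> S * w m" and nn: "R \<ge> 0" "S \<ge> 0"
    and X: "nsum (\<lambda>z. ennreal (rect n z)) I \<le> ennreal X" "X \<ge> 0"
  shows "norm (\<i> * (complex_of_real \<kappa> * (\<Sum>\<^sub>\<infinity>z\<in>I. cub x n z * phase z t)) - \<i> * (complex_of_real \<kappa> * (\<Sum>\<^sub>\<infinity>z\<in>I. cub y n z * phase z t)))
    \<le> \<kappa> * (3 * R\<^sup>2 * S * X)"
proof -
  have k: "3 * R\<^sup>2 * S \<ge> 0" and k3: "R ^ 3 \<ge> 0" using nn by auto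
  have s: "(\<lambda>z. cub a n z * phase z t) summable_on I" if "\<And>m. norm (a m) \<le> R * w m" for a
    by (rule weighted_sum_bound(1)[OF _ k3 X]) (simp add: norm_mult cub_bound[OF that nn(1)])
  have "((\<lambda>z. cub x n z * phase z t + - (cub y n z * phase z t)) has_sum ((\<Sum>\<^sub>\<infinity>z\<in>I. cub x n z * phase z t) + - (\<Sum>\<^sub>\<infinity>z\<in>I. cub y n z * phase z t))) I"
    by (intro has_sum_add has_sum_uminusI has_sum_infsum s x y)
  from infsumI[OF this] have e: "(\<Sum>\<^sub>\<infinity>z\<in>I. cub x n z * phase z t) - (\<Sum>\<^sub>\<infinity>z\<in>I. cub y n z * phase z t) = (\<Sum>\<^sub>\<infinity>z\<in>I. (cub x n z - cub y n z) * phase z t)"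
    by (simp add: left_diff_distrib)
  have "norm (\<Sum>\<^sub>\<infinity>z\<in>I. (cub x n z - cub y n z) * phase z t) \<le> 3 * R\<^sup>2 * S * X"
    by (rule weighted_sum_bound(2)[OF _ k X]) (simp add: norm_mult cub_diff[OF x y d nn])
  then show ?thesis
    unfolding right_diff_distrib[symmetric] e norm_mult using \<kappa>_pos by simp
qed

lemma full_X: "full_const \<sigma> * L ^ 4 * w n \<ge> 0"
  using full_const_pos[of \<sigma>] w_nonneg[of n] L0 by (auto intro!: mult_nonneg_nonneg)

lemma nonlin_bound:
  assumes x: "\<And>m. norm (x m) \<le> R * w m" and R: "R \<ge> 0"
  shows "norm (nonlin t x n) \<le> \<epsilon>\<^sup>2 * R ^ 3 * full_const \<sigma> * w n"
proof -
  have "norm (\<Sum>\<^sub>\<infinity>z. cub x n z * phase z t) \<le> R ^ 3 * (full_const \<sigma> * L ^ 4 * w n)"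
    by (rule weighted_sum_bound(2)[OF _ _ rect_sum_full full_X]) (use R in \<open>auto simp: norm_mult cub_bound[OF x R]\<close>)
  then have "norm (nonlin t x n) \<le> \<kappa> * (R ^ 3 * (full_const \<sigma> * L ^ 4 * w n))"
    unfolding nonlin_def norm_mult using \<kappa>_pos by simp
  also have "\<dots> = \<epsilon>\<^sup>2 * R ^ 3 * full_const \<sigma> * w n" using L0 by (simp add: \<kappa>_def)
  finally show ?thesis .
qed

lemma cub_continuous:
  assumes "\<And>m. continuous_on S (\<lambda>t. x t m)"
  shows "continuous_on S (\<lambda>t. cub (x t) n z)"
  unfolding cub_def by (intro continuous_intros assms)

lemma cub_sum_continuous:
  assumes c: "\<And>m. continuous_on S (\<lambda>t. x t m)" and b: "\<And>t m. norm (x t m) \<le> R * w m" and R: "R \<ge> 0"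
  shows "continuous_on S (\<lambda>t. \<i> * (complex_of_real \<kappa> * (\<Sum>\<^sub>\<infinity>z\<in>I. cub (x t) n z * phase z t)))"
proof -
  have "continuous_on S (\<lambda>t. \<Sum>\<^sub>\<infinity>z\<in>I. cub (x t) n z * phase z t)"
  proof (rule continuous_on_infsum)
    show "continuous_on S (\<lambda>t. cub (x t) n z * phase z t)" for z
      by (intro continuous_intros cub_continuous c phase_continuous)
    show "norm (cub (x t) n z * phase z t) \<le> R ^ 3 * rect n z" for z t
      by (simp add: norm_mult cub_bound[OF b R])
    show "(\<lambda>z. R ^ 3 * rect n z) summable_on I" by (intro summable_on_cmult_right rect_summable)
  qed
  then show ?thesis by (intro continuous_intros)
qed

text \<open>Truncating at \<open>R w\<close> makes the nonlinearity globally Lipschitz and bounded in the weighted sup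
  norm, so that solutions of the truncated system exist on any time interval.\<close>
lemma truncated_solution:
  assumes \<tau>: "0 \<le> \<tau>" and R: "R \<ge> 0"
  shows "\<exists>\<alpha>. (\<forall>n. \<alpha> 0 n = x0 n) \<and>
     (\<forall>n. \<forall>t\<in>{0..\<tau>}. ((\<lambda>s. \<alpha> s n) has_vector_derivative nonlin t (trunc R (\<alpha> t)) n) (at t within {0..\<tau>}))"
proof (rule weighted_picard[where F="\<lambda>t x. nonlin t (trunc R x)" and w=w
      and \<Lambda>="3 * \<epsilon>\<^sup>2 * R\<^sup>2 * full_const \<sigma>" and M="\<epsilon>\<^sup>2 * R ^ 3 * full_const \<sigma>"])
  show "3 * \<epsilon>\<^sup>2 * R\<^sup>2 * full_const \<sigma> \<ge> 0" "\<epsilon>\<^sup>2 * R ^ 3 * full_const \<sigma> \<ge> 0"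
    using R full_const_pos[of \<sigma>] by auto
  fix t :: real and x y :: "int \<times> int \<Rightarrow> complex" and S n
  assume S: "S \<ge> 0" "\<And>j. norm (x j - y j) \<le> S * w j"
  have d: "norm (trunc R x m - trunc R y m) \<le> S * w m" for m
    by (rule order_trans[OF trunc_lipschitz[OF R] S(2)])
  have "norm (nonlin t (trunc R x) n - nonlin t (trunc R y) n) \<le> \<kappa> * (3 * R\<^sup>2 * S * (full_const \<sigma> * L ^ 4 * w n))"
    unfolding nonlin_def
    by (rule cub_sum_diff[OF trunc_bound[OF R] trunc_bound[OF R] d R S(1) rect_sum_full full_X])
  also have "\<dots> = 3 * \<epsilon>\<^sup>2 * R\<^sup>2 * full_const \<sigma> * S * w n" using L0 by (simp add: \<kappa>_def)
  finally show "norm (nonlin t (trunc R x) n - nonlin t (trunc R y) n) \<le> 3 * \<epsilon>\<^sup>2 * R\<^sup>2 * full_const \<sigma> * S * w n" .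
next
  fix x :: "real \<Rightarrow> int \<times> int \<Rightarrow> complex" and n assume "\<And>j. continuous_on {0..\<tau>} (\<lambda>t. x t j)"
  then show "continuous_on {0..\<tau>} (\<lambda>t. nonlin t (trunc R (x t)) n)"
    unfolding nonlin_def by (intro cub_sum_continuous[OF trunc_continuous[OF R] trunc_bound[OF R] R])
qed (use \<tau> w_nonneg nonlin_bound[OF trunc_bound[OF R] R] in auto)

text \<open>The non-resonant interactions oscillate with frequency \<open>8 \<pi>\<^sup>2 |p \<cdot> q| / L\<^sup>2\<close>. The factor \<open>1 / |p \<cdot> q|\<close>
  gained by integration in time reduces the size of their sum from \<open>L\<^sup>4\<close> to \<open>L\<^sup>2 ln L\<close>, and a factor \<open>L\<^sup>2\<close>
  is lost to the small frequencies.\<close>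
lemma nonresonant_integral:
  assumes Le: "L \<ge> exp 1" and R: "R \<ge> 0" and t: "0 \<le> t" and l: "l \<ge> 0"
    and c: "\<And>m. continuous_on {0..t} (\<lambda>s. x s m)" and b: "\<And>s m. norm (x s m) \<le> R * w m"
    and lip: "\<And>r s m. r \<in> {0..t} \<Longrightarrow> s \<in> {0..t} \<Longrightarrow> norm (x r m - x s m) \<le> l * \<bar>r - s\<bar> * w m"
  shows "norm (integral {0..t} (\<lambda>s. \<i> * (complex_of_real \<kappa> * (\<Sum>\<^sub>\<infinity>z\<in>- resonant. cub (x s) n z * phase z s))))
    \<le> \<epsilon>\<^sup>2 * ln L * nonres_const \<sigma> * (2 * R ^ 3 + 3 * R\<^sup>2 * l * t) / (8 * pi) * w n"
proof -
  define q where "q = 2 * R ^ 3 + 3 * R\<^sup>2 * l * t"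
  have q: "q \<ge> 0" using R t l by (simp add: q_def)
  define k where "k = (\<lambda>z. L\<^sup>2 / (8 * pi) * q * (rect n z * (1 / \<bar>of_int (idot (fst z) (snd z))\<bar>)))"
  have lnL: "ln L \<ge> 0" using L by simp
  have kn: "L\<^sup>2 / (8 * pi) * q \<ge> 0" using q by simp
  have Xn: "nonres_const \<sigma> * L\<^sup>2 * ln L * w n \<ge> 0" using lnL nonres_const_pos[of \<sigma>] w_nonneg[of n] by simp
  have "norm (integral {0..t} (\<lambda>s. \<Sum>\<^sub>\<infinity>z\<in>- resonant. cub (x s) n z * phase z s)) \<le> L\<^sup>2 / (8 * pi) * q * (nonres_const \<sigma> * L\<^sup>2 * ln L * w n)"
  proof (rule integral_infsum_bound[where k=k and m="\<lambda>z. R ^ 3 * rect n z"])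
    show "continuous_on {0..t} (\<lambda>s. cub (x s) n z * phase z s)" for z
      by (intro continuous_intros cub_continuous c phase_continuous)
    show "norm (cub (x s) n z * phase z s) \<le> R ^ 3 * rect n z" for z s
      by (simp add: norm_mult cub_bound[OF b R])
    show "(\<lambda>z. R ^ 3 * rect n z) summable_on (- resonant)" by (intro summable_on_cmult_right rect_summable)
    show "L\<^sup>2 / (8 * pi) * q * (nonres_const \<sigma> * L\<^sup>2 * ln L * w n) \<ge> 0" by (rule mult_nonneg_nonneg[OF kn Xn])
    have "nsum (\<lambda>z. ennreal (k z)) (- resonant)
      = ennreal (L\<^sup>2 / (8 * pi) * q) * nsum (\<lambda>z. ennreal (rect n z * (1 / \<bar>of_int (idot (fst z) (snd z))\<bar>))) (- resonant)"
      unfolding k_def ennreal_mult'[OF kn] by (rule nsum_cmult)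
    also have "\<dots> \<le> ennreal (L\<^sup>2 / (8 * pi) * q) * ennreal (nonres_const \<sigma> * L\<^sup>2 * ln L * w n)"
      by (intro mult_left_mono rect_sum_nonresonant[OF Le]) auto
    also have "\<dots> = ennreal (L\<^sup>2 / (8 * pi) * q * (nonres_const \<sigma> * L\<^sup>2 * ln L * w n))" by (rule ennreal_mult'[OF kn, symmetric])
    finally show "nsum (\<lambda>z. ennreal (k z)) (- resonant) \<le> ennreal (L\<^sup>2 / (8 * pi) * q * (nonres_const \<sigma> * L\<^sup>2 * ln L * w n))" .
    fix z assume "z \<in> - resonant"
    then have i: "idot (fst z) (snd z) \<noteq> 0" by (simp add: resonant_def)
    then have f: "freq z \<noteq> 0" using L0 by (simp add: freq_def)
    have d: "norm (cub (x r) n z - cub (x s) n z) \<le> (3 * R\<^sup>2 * l * rect n z) * \<bar>r - s\<bar>" if "r \<in> {0..t}" "s \<in> {0..t}" for r s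
    proof -
      have "norm (cub (x r) n z - cub (x s) n z) \<le> 3 * R\<^sup>2 * (l * \<bar>r - s\<bar>) * rect n z"
        by (rule cub_diff[OF b b lip[OF that] R]) (use l in simp)
      then show ?thesis by (simp add: ac_simps)
    qed
    have l0: "3 * R\<^sup>2 * l * rect n z \<ge> 0" using l rect_nonneg[of n z] by simp
    have "norm (integral {0..t} (\<lambda>s. cub (x s) n z * exp (\<i> * complex_of_real (freq z * s))))
      \<le> pi / \<bar>freq z\<bar> * (2 * (R ^ 3 * rect n z) + 3 * R\<^sup>2 * l * rect n z * t)"
      by (rule oscillatory_integral[OF t f cub_bound[OF b R] d l0])
    also have "pi / \<bar>freq z\<bar> = L\<^sup>2 / (8 * pi) * (1 / \<bar>of_int (idot (fst z) (snd z))\<bar>)"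
      using i L0 by (simp add: freq_def abs_mult power2_eq_square field_simps)
    also have "\<dots> * (2 * (R ^ 3 * rect n z) + 3 * R\<^sup>2 * l * rect n z * t) = k z"
      unfolding k_def q_def by (simp add: algebra_simps add_divide_distrib)
    finally show "norm (integral {0..t} (\<lambda>s. cub (x s) n z * phase z s)) \<le> k z" by (simp only: phase_def)
  qed
  then have "\<kappa> * norm (integral {0..t} (\<lambda>s. \<Sum>\<^sub>\<infinity>z\<in>- resonant. cub (x s) n z * phase z s))
     \<le> \<kappa> * (L\<^sup>2 / (8 * pi) * q * (nonres_const \<sigma> * L\<^sup>2 * ln L * w n))"
    using \<kappa>_pos by (intro mult_left_mono) auto
  also have "\<dots> = \<epsilon>\<^sup>2 * ln L * nonres_const \<sigma> * q / (8 * pi) * w n"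
    using L0 by (simp add: \<kappa>_def field_simps power2_eq_square power4_eq_xxxx)
  finally show ?thesis using \<kappa>_pos by (simp add: norm_mult q_def)
qed

lemma nonlin_split:
  assumes b: "\<And>m. norm (x m) \<le> R * w m" and R: "R \<ge> 0"
  shows "nonlin t x n = resonant_part x n + \<i> * (complex_of_real \<kappa> * (\<Sum>\<^sub>\<infinity>z\<in>- resonant. cub x n z * phase z t))"
proof -
  have s: "(\<lambda>z. cub x n z * phase z t) summable_on UNIV"
    by (rule weighted_sum_bound(1)[OF _ _ rect_sum_full[of n] full_X[of n], where k="R ^ 3"]) (use R in \<open>auto simp: norm_mult cub_bound[OF b R]\<close>)
  have "(\<Sum>\<^sub>\<infinity>z\<in>resonant \<union> - resonant. cub x n z * phase z t) = (\<Sum>\<^sub>\<infinity>z\<in>resonant. cub x n z * phase z t) + (\<Sum>\<^sub>\<infinity>z\<in>- resonant. cub x n z * phase z t)"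
    by (rule infsum_Un_disjoint) (auto intro: summable_on_subset_banach[OF s])
  moreover have "(\<Sum>\<^sub>\<infinity>z\<in>resonant. cub x n z * phase z t) = (\<Sum>\<^sub>\<infinity>z\<in>resonant. cub x n z)"
    by (rule infsum_cong) (simp add: phase_resonant)
  ultimately show ?thesis by (simp add: nonlin_def resonant_part_def distrib_left)
qed

text \<open>The non-resonant interactions are removed by subtracting their time integral, which is a small
  correction of \<open>\<alpha> - g\<close>; what is left obeys the resonant system up to \<open>\<delta>\<close>. As in the uniqueness proof,
  the best constant \<open>S\<close> in exponential growth at rate \<open>2 \<beta>\<close> is bounded by \<open>S / 2\<close> plus the errors.\<close>
lemma truncated_close:
  assumes Le: "L \<ge> exp 1" and R: "R > 0" and \<tau>: "0 \<le> \<tau>" and \<delta>: "\<delta> \<ge> 0"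
    and d\<alpha>: "\<And>n t. t \<in> {0..\<tau>} \<Longrightarrow> ((\<lambda>s. \<alpha> s n) has_vector_derivative nonlin t (trunc R (\<alpha> t)) n) (at t within {0..\<tau>})"
    and dg: "\<And>n t. t \<in> {0..\<tau>} \<Longrightarrow> ((\<lambda>s. g s n) has_vector_derivative g' t n) (at t within {0..\<tau>})"
    and g: "\<And>n t. t \<in> {0..\<tau>} \<Longrightarrow> norm (g t n) \<le> R * w n"
    and i: "\<And>n. \<alpha> 0 n = g 0 n"
    and res: "\<And>n t. t \<in> {0..\<tau>} \<Longrightarrow> norm (resonant_part (g t) n - g' t n) \<le> \<delta> * w n"
    and \<beta>: "\<beta> = 3 * \<epsilon>\<^sup>2 * R\<^sup>2 * res_const \<sigma> * ln L / L\<^sup>2"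
    and \<eta>: "\<eta> = \<epsilon>\<^sup>2 * ln L * nonres_const \<sigma> * (2 * R ^ 3 + 3 * R\<^sup>2 * (\<epsilon>\<^sup>2 * R ^ 3 * full_const \<sigma>) * \<tau>) / (8 * pi)"
    and t: "t \<in> {0..\<tau>}"
  shows "norm (\<alpha> t n - g t n) \<le> 2 * (\<eta> + \<delta> * \<tau>) * exp (2 * \<beta> * \<tau>) * w n"
proof -
  have R0: "R \<ge> 0" using R by simp
  have lnL: "ln L > 0" using L by simp
  have \<beta>0: "\<beta> > 0" using R \<epsilon> res_const_pos[of \<sigma>] lnL L0 by (simp add: \<beta>)
  define \<Lambda> where "\<Lambda> = 2 * \<beta>"
  have \<Lambda>: "\<Lambda> > 0" using \<beta>0 by (simp add: \<Lambda>_def)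
  define l where "l = \<epsilon>\<^sup>2 * R ^ 3 * full_const \<sigma>"
  have l: "l \<ge> 0" using R full_const_pos[of \<sigma>] by (simp add: l_def)
  have \<eta>0: "\<eta> \<ge> 0" unfolding \<eta> using R \<tau> lnL nonres_const_pos[of \<sigma>] full_const_pos[of \<sigma>]
    by (intro divide_nonneg_nonneg mult_nonneg_nonneg add_nonneg_nonneg) auto
  define x where "x = (\<lambda>t. trunc R (\<alpha> t))"
  have xb: "norm (x t m) \<le> R * w m" for t m unfolding x_def by (rule trunc_bound[OF R0])
  have \<alpha>c: "continuous_on {0..\<tau>} (\<lambda>t. \<alpha> t m)" for m by (rule continuous_on_vector_derivative[OF d\<alpha>])
  have xc: "continuous_on {0..\<tau>} (\<lambda>t. x t m)" for m unfolding x_def by (rule trunc_continuous[OF R0 \<alpha>c])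
  have \<alpha>l: "norm (\<alpha> r m - \<alpha> s m) \<le> l * \<bar>r - s\<bar> * w m" if "r \<in> {0..\<tau>}" "s \<in> {0..\<tau>}" for r s m
  proof -
    have "norm (\<alpha> r m - \<alpha> s m) \<le> (l * w m) * norm (r - s)"
    proof (rule differentiable_bound[where S="{0..\<tau>}" and f="\<lambda>s. \<alpha> s m" and f'="\<lambda>t h. h *\<^sub>R nonlin t (x t) m"])
      show "((\<lambda>s. \<alpha> s m) has_derivative (\<lambda>h. h *\<^sub>R nonlin u (x u) m)) (at u within {0..\<tau>})" if "u \<in> {0..\<tau>}" for u
        using d\<alpha>[OF that, of m] by (simp only: has_vector_derivative_def x_def)
      show "onorm (\<lambda>h. h *\<^sub>R nonlin u (x u) m) \<le> l * w m" for u
      proof (rule onorm_bound)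
        show "0 \<le> l * w m" using l w_nonneg by simp
        show "norm (h *\<^sub>R nonlin u (x u) m) \<le> l * w m * norm h" for h
          using mult_right_mono[OF nonlin_bound[OF xb[of u] R0, where t=u and n=m], of "\<bar>h\<bar>"] by (simp add: l_def ac_simps)
      qed
    qed (use that in auto)
    then show ?thesis by (simp add: ac_simps)
  qed
  have xl: "norm (x r m - x s m) \<le> l * \<bar>r - s\<bar> * w m" if "r \<in> {0..\<tau>}" "s \<in> {0..\<tau>}" for r s m
    unfolding x_def by (rule order_trans[OF trunc_lipschitz[OF R0] \<alpha>l[OF that]])
  define \<Delta> where "\<Delta> = (\<lambda>(t, n). exp (- \<Lambda> * t) * (norm (\<alpha> t n - g t n) / w n))"
  define S where "S = (SUP u\<in>{0..\<tau>} \<times> UNIV. \<Delta> u)"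
  have bdd: "bdd_above (\<Delta> ` ({0..\<tau>} \<times> UNIV))"
  proof (rule bdd_aboveI2)
    fix u :: "real \<times> (int \<times> int)" assume "u \<in> {0..\<tau>} \<times> UNIV"
    then obtain t n where u: "u = (t, n)" and t: "t \<in> {0..\<tau>}" by auto
    have "norm (\<alpha> t n - \<alpha> 0 n) \<le> l * \<tau> * w n"
      by (rule order_trans[OF \<alpha>l]) (use t \<tau> l w_nonneg[of n] in \<open>auto intro!: mult_right_mono mult_left_mono\<close>)
    moreover have "norm (\<alpha> 0 n) \<le> R * w n" "norm (g t n) \<le> R * w n" using g[of 0 n] g[OF t, of n] i \<tau> by auto
    moreover have "norm (\<alpha> t n - g t n) \<le> norm (\<alpha> t n - \<alpha> 0 n) + norm (\<alpha> 0 n) + norm (g t n)"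
      by norm
    ultimately have "norm (\<alpha> t n - g t n) \<le> (l * \<tau> + R + R) * w n" by (simp add: algebra_simps)
    then have "norm (\<alpha> t n - g t n) / w n \<le> l * \<tau> + R + R" using w_pos[of n] by (simp add: divide_le_eq)
    moreover have "exp (- \<Lambda> * t) \<le> 1" using t \<Lambda> by simp
    moreover have "norm (\<alpha> t n - g t n) / w n \<ge> 0" using w_nonneg by simp
    ultimately show "\<Delta> u \<le> l * \<tau> + R + R" unfolding u \<Delta>_def case_prod_conv
      by (smt (verit) exp_ge_zero mult_left_le_one_le)
  qed
  have Sle: "norm (\<alpha> t n - g t n) \<le> S * exp (\<Lambda> * t) * w n" if t: "t \<in> {0..\<tau>}" for t n
  proof -
    have "\<Delta> (t, n) \<le> S" unfolding S_def by (rule cSUP_upper[OF _ bdd]) (use t in simp)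
    then show ?thesis using w_pos[of n] by (simp add: \<Delta>_def exp_minus field_simps)
  qed
  have S0: "S \<ge> 0"
  proof -
    have "0 \<le> S * w 0" using Sle[of 0 0] i[of 0] \<tau> by simp
    then show ?thesis using w_pos[of 0] by (simp add: zero_le_mult_iff)
  qed
  define NR where "NR = (\<lambda>n s. \<i> * (complex_of_real \<kappa> * (\<Sum>\<^sub>\<infinity>z\<in>- resonant. cub (x s) n z * phase z s)))"
  have NRc: "continuous_on {0..\<tau>} (NR n)" for n
    unfolding NR_def by (rule cub_sum_continuous[OF xc xb R0])
  have NRb: "norm (integral {0..t} (NR n)) \<le> \<eta> * w n" if t: "t \<in> {0..\<tau>}" for t n
  proof -
    have sub: "{0..t} \<subseteq> {0..\<tau>}" using t by auto
    have "norm (integral {0..t} (NR n)) \<le> \<epsilon>\<^sup>2 * ln L * nonres_const \<sigma> * (2 * R ^ 3 + 3 * R\<^sup>2 * l * t) / (8 * pi) * w n"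
      unfolding NR_def
      by (rule nonresonant_integral[OF Le R0 _ l continuous_on_subset[OF xc sub] xb xl]) (use t in auto)
    also have "\<dots> \<le> \<eta> * w n"
      unfolding \<eta> l_def[symmetric] using t l lnL nonres_const_pos[of \<sigma>] w_nonneg[of n]
      by (intro mult_right_mono divide_right_mono mult_left_mono add_left_mono) auto
    finally show ?thesis .
  qed
  have key: "norm (\<alpha> t n - g t n) \<le> (S / 2 * exp (\<Lambda> * t) + \<delta> * \<tau> + \<eta>) * w n" if t: "t \<in> {0..\<tau>}" for t n
  proof -
    define \<psi> where "\<psi> = (\<lambda>s. \<alpha> s n - g s n - integral {0..s} (NR n))"
    define \<psi>' where "\<psi>' = (\<lambda>s. nonlin s (x s) n - g' s n - NR n s)"
    have \<psi>0: "\<psi> 0 = 0" by (simp add: \<psi>_def i)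
    have "norm (\<psi> t - \<psi> 0) \<le> (\<beta> * S * w n * exp (\<Lambda> * t) / \<Lambda> + \<delta> * w n * t) - (\<beta> * S * w n * exp (\<Lambda> * 0) / \<Lambda> + \<delta> * w n * 0)"
    proof (rule vector_derivative_bound)
      show "0 \<le> t" using t by simp
      fix s assume "s \<in> {0..t}"
      then have s: "s \<in> {0..\<tau>}" and sub: "{0..t} \<subseteq> {0..\<tau>}" using t by auto
      have "(\<psi> has_vector_derivative \<psi>' s) (at s within {0..\<tau>})"
        unfolding \<psi>_def \<psi>'_def x_def
        by (intro has_vector_derivative_diff d\<alpha> dg s integral_has_vector_derivative[OF NRc s])
      then show "(\<psi> has_vector_derivative \<psi>' s) (at s within {0..t})"
        by (rule has_vector_derivative_within_subset[OF _ sub])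
      show "((\<lambda>s. \<beta> * S * w n * exp (\<Lambda> * s) / \<Lambda> + \<delta> * w n * s) has_vector_derivative \<beta> * S * w n * exp (\<Lambda> * s) + \<delta> * w n) (at s within {0..t})"
        using \<Lambda> by (intro exp_growth_derivative) auto
      have d: "norm (x s m - g s m) \<le> S * exp (\<Lambda> * s) * w m" for m
      proof -
        have "x s m - g s m = trunc R (\<alpha> s) m - trunc R (g s) m" by (simp only: x_def trunc_self[OF g[OF s]])
        also have "norm \<dots> \<le> S * exp (\<Lambda> * s) * w m" by (rule order_trans[OF trunc_lipschitz[OF R0] Sle[OF s]])
        finally show ?thesis .
      qed
      have Xn: "res_const \<sigma> * L\<^sup>2 * ln L * w n \<ge> 0" using lnL res_const_pos[of \<sigma>] w_nonneg[of n] by simp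
      have Sn: "S * exp (\<Lambda> * s) \<ge> 0" using S0 by simp
      have ph: "(\<Sum>\<^sub>\<infinity>z\<in>resonant. cub a n z * phase z s) = (\<Sum>\<^sub>\<infinity>z\<in>resonant. cub a n z)" for a
        by (rule infsum_cong) (simp add: phase_resonant)
      have "norm (resonant_part (x s) n - resonant_part (g s) n) \<le> \<kappa> * (3 * R\<^sup>2 * (S * exp (\<Lambda> * s)) * (res_const \<sigma> * L\<^sup>2 * ln L * w n))"
        using cub_sum_diff[OF xb g[OF s] d R0 Sn rect_sum_resonant[OF Le, of n] Xn, of s] unfolding ph resonant_part_def .
      also have "\<dots> = \<beta> * S * w n * exp (\<Lambda> * s)" using L0 by (simp add: \<kappa>_def \<beta> field_simps power2_eq_square power4_eq_xxxx)
      finally have 1: "norm (resonant_part (x s) n - resonant_part (g s) n) \<le> \<beta> * S * w n * exp (\<Lambda> * s)" .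
      have "\<psi>' s = (resonant_part (x s) n - resonant_part (g s) n) + (resonant_part (g s) n - g' s n)"
        unfolding \<psi>'_def nonlin_split[OF xb R0] NR_def by simp
      then show "norm (\<psi>' s) \<le> \<beta> * S * w n * exp (\<Lambda> * s) + \<delta> * w n"
        using norm_triangle_mono[OF 1 res[OF s, of n]] by (simp only:)
    qed
    also have "\<dots> \<le> \<beta> * S * w n * exp (\<Lambda> * t) / \<Lambda> + \<delta> * w n * t" using \<beta>0 S0 \<Lambda> w_nonneg[of n] by simp
    also have "\<beta> * S * w n * exp (\<Lambda> * t) / \<Lambda> = S / 2 * exp (\<Lambda> * t) * w n" using \<beta>0 by (simp add: \<Lambda>_def)
    also have "\<delta> * w n * t \<le> \<delta> * w n * \<tau>" using t \<delta> w_nonneg[of n] by (intro mult_left_mono) auto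
    finally have "norm (\<psi> t) \<le> S / 2 * exp (\<Lambda> * t) * w n + \<delta> * w n * \<tau>" using \<psi>0 by simp
    moreover have "norm (\<alpha> t n - g t n) \<le> norm (\<psi> t) + norm (integral {0..t} (NR n))" unfolding \<psi>_def by norm
    ultimately show ?thesis using NRb[OF t, of n] by (simp add: algebra_simps)
  qed
  have e0: "\<delta> * \<tau> + \<eta> \<ge> 0" using \<delta> \<tau> \<eta>0 by simp
  have "S \<le> S / 2 + (\<delta> * \<tau> + \<eta>)" unfolding S_def
  proof (rule cSUP_least)
    show "{0..\<tau>} \<times> (UNIV :: (int \<times> int) set) \<noteq> {}" using \<tau> by auto
    fix u :: "real \<times> (int \<times> int)" assume "u \<in> {0..\<tau>} \<times> UNIV"
    then obtain t n where u: "u = (t, n)" and t: "t \<in> {0..\<tau>}" by auto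
    have "norm (\<alpha> t n - g t n) / w n \<le> S / 2 * exp (\<Lambda> * t) + (\<delta> * \<tau> + \<eta>)"
      using key[OF t, of n] w_pos[of n] by (simp add: divide_le_eq algebra_simps)
    then have "\<Delta> u \<le> exp (- \<Lambda> * t) * (S / 2 * exp (\<Lambda> * t) + (\<delta> * \<tau> + \<eta>))"
      unfolding u \<Delta>_def case_prod_conv by (rule mult_left_mono) simp
    also have "\<dots> = S / 2 + exp (- \<Lambda> * t) * (\<delta> * \<tau> + \<eta>)" by (simp add: distrib_left exp_minus)
    also have "exp (- \<Lambda> * t) * (\<delta> * \<tau> + \<eta>) \<le> 1 * (\<delta> * \<tau> + \<eta>)" using t \<Lambda> e0 by (intro mult_right_mono) auto
    finally show "\<Delta> u \<le> (SUP u\<in>{0..\<tau>} \<times> UNIV. \<Delta> u) / 2 + (\<delta> * \<tau> + \<eta>)" by (simp add: S_def)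
  qed
  then have S2: "S \<le> 2 * (\<eta> + \<delta> * \<tau>)" by simp
  have "S * exp (\<Lambda> * t) \<le> 2 * (\<eta> + \<delta> * \<tau>) * exp (2 * \<beta> * \<tau>)"
    using S2 S0 e0 t \<beta>0 by (intro mult_mono) (auto simp: \<Lambda>_def)
  then show ?thesis using order_trans[OF Sle[OF t, of n] mult_right_mono[OF _ w_nonneg[of n]]] by blast
qed

end

section \<open>Approximation by the limit equation\<close>

text \<open>The time restriction bounds \<open>C \<epsilon>\<^sup>2 B\<^sup>2 \<tau>\<close> by \<open>\<zeta>(2) L\<^sup>2 \<gamma> ln (ln L) / (2 ln L)\<close>. Put \<open>p = ln L powr (\<gamma> / 2)\<close>.
  With \<open>C\<close> large, the exponential is at most \<open>p\<close>, and, as \<open>\<gamma> ln (ln L) \<le> 2 p\<close>, the accumulated consistency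
  error \<open>\<delta> \<tau>\<close> is at most \<open>B p / (4 ln L)\<close>. The non-resonant error \<open>\<eta>\<close> is of order
  \<open>B (\<epsilon> B)\<^sup>2 L\<^sup>2 p\<close>, and \<open>(\<epsilon> B)\<^sup>2 L\<^sup>2 \<le> c\<^sup>2 L powr (- 2 \<gamma>)\<close>, a negative power of \<open>L\<close> that beats the missing
  logarithm. Together the errors leave \<open>B p\<^sup>2 / ln L\<close>.\<close>
lemma error_budget:
  fixes \<gamma> L B \<epsilon> \<tau> T cr cn cf ce c C :: real
  assumes \<gamma>: "0 < \<gamma>" "\<gamma> < 1" and L: "L \<ge> exp 1" and B: "B > 0" and \<epsilon>: "\<epsilon> > 0" and \<tau>: "\<tau> \<ge> 0"
    and k: "cr > 0" "cn > 0" "cf > 0" "ce > 0"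
    and c: "c > 0" "c\<^sup>2 * (cn * (16 + 96 * cf)) \<le> \<gamma> / 2"
    and C: "C \<ge> 1" "C \<ge> zeta2" "C \<ge> 24 * cr * zeta2" "C \<ge> 4 * ce * zeta2"
    and small: "\<epsilon> * B < c * L powr (- 1 - \<gamma>)"
    and T: "T = zeta2 * L\<^sup>2 / (2 * \<epsilon>\<^sup>2 * ln L)"
    and time: "C * B\<^sup>2 * \<tau> \<le> T * (\<gamma> * ln (ln L))"
    and \<beta>: "\<beta> = 3 * \<epsilon>\<^sup>2 * (2 * B)\<^sup>2 * cr * ln L / L\<^sup>2"
    and \<eta>: "\<eta> = \<epsilon>\<^sup>2 * ln L * cn * (2 * (2 * B) ^ 3 + 3 * (2 * B)\<^sup>2 * (\<epsilon>\<^sup>2 * (2 * B) ^ 3 * cf) * \<tau>)"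
    and \<delta>: "\<delta> = \<epsilon>\<^sup>2 / L\<^sup>2 * (ce * B ^ 3)"
  shows "2 * (\<eta> + \<delta> * \<tau>) * exp (2 * \<beta> * \<tau>) \<le> B / ln L powr (1 - \<gamma>)"
proof -
  have L0: "L > 0" using L exp_gt_zero[of "1::real"] by linarith
  have lL: "ln L \<le> L" using ln_le_minus_one[OF L0] by linarith
  have LL: "L \<le> L\<^sup>2"
  proof -
    have "1 \<le> L" using L exp_ge_add_one_self[of 1] by linarith
    then show ?thesis by (simp add: power2_eq_square)
  qed
  define l where "l = ln L"
  have l: "l \<ge> 1" unfolding l_def using L L0 by (metis ln_ge_iff)
  have lL2: "l \<le> L\<^sup>2" using lL LL by (simp add: l_def)
  have L2: "L\<^sup>2 > 0" using L0 by simp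
  have z: "zeta2 > 0" using zeta2_ge_1 by linarith
  define u where "u = ln l"
  have u: "u \<ge> 0" using l by (simp add: u_def)
  define p where "p = exp (\<gamma> / 2 * u)"
  have p0: "p > 0" by (simp add: p_def)
  have p1: "p \<ge> 1" using u \<gamma> by (simp add: p_def)
  have up: "\<gamma> * u \<le> 2 * p" using exp_ge_add_one_self[of "\<gamma> / 2 * u"] unfolding p_def by linarith
  have lp: "p * p / l = 1 / l powr (1 - \<gamma>)"
  proof -
    have "p * p = exp (\<gamma> * u)" unfolding p_def by (simp add: exp_add[symmetric])
    also have "\<dots> = l powr \<gamma>" using l by (simp add: powr_def u_def)
    finally show ?thesis using l by (simp add: powr_diff)
  qed
  define s where "s = \<epsilon>\<^sup>2 * B\<^sup>2 * \<tau>"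
  have s0: "s \<ge> 0" using \<tau> by (simp add: s_def)
  have Cs: "C * s \<le> zeta2 * L\<^sup>2 * (\<gamma> * u) / (2 * l)"
  proof -
    have "C * s = \<epsilon>\<^sup>2 * (C * B\<^sup>2 * \<tau>)" by (simp add: s_def)
    also have "\<dots> \<le> \<epsilon>\<^sup>2 * (T * (\<gamma> * u))" using time by (intro mult_left_mono) (auto simp: u_def l_def)
    also have "\<dots> = zeta2 * L\<^sup>2 * (\<gamma> * u) / (2 * l)" unfolding T l_def[symmetric] using \<epsilon> l by (simp add: field_simps)
    finally show ?thesis .
  qed
  have Cp: "C * s \<le> zeta2 * L\<^sup>2 * p / l"
  proof -
    have "zeta2 * L\<^sup>2 * (\<gamma> * u) / (2 * l) \<le> zeta2 * L\<^sup>2 * (2 * p) / (2 * l)"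
      using up z l by (intro divide_right_mono mult_left_mono) auto
    then show ?thesis using Cs by simp
  qed
  have exp_le: "exp (2 * \<beta> * \<tau>) \<le> p"
  proof -
    have "2 * \<beta> * \<tau> = 24 * cr * l / L\<^sup>2 * s" unfolding \<beta> s_def l_def by (simp add: power_mult_distrib)
    also have "\<dots> \<le> (C / zeta2) * l / L\<^sup>2 * s"
      using C(3) z l s0 by (intro mult_right_mono divide_right_mono) (auto simp: le_divide_eq)
    also have "\<dots> = (l / (zeta2 * L\<^sup>2)) * (C * s)" by simp
    also have "\<dots> \<le> (l / (zeta2 * L\<^sup>2)) * (zeta2 * L\<^sup>2 * (\<gamma> * u) / (2 * l))" using Cs l z by (intro mult_left_mono) auto
    also have "\<dots> = \<gamma> / 2 * u" using l z L0 by (simp add: field_simps)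
    finally show ?thesis by (simp add: p_def)
  qed
  have d: "\<delta> * \<tau> \<le> B * p / (4 * l)"
  proof -
    have "\<delta> * \<tau> = B / L\<^sup>2 * (ce * s)" by (simp add: \<delta> s_def power2_eq_square power3_eq_cube)
    also have "\<dots> \<le> B / L\<^sup>2 * (C / (4 * zeta2) * s)"
      using C(4) z s0 B by (intro mult_left_mono mult_right_mono) (auto simp: le_divide_eq)
    also have "\<dots> = B / L\<^sup>2 / (4 * zeta2) * (C * s)" by simp
    also have "\<dots> \<le> B / L\<^sup>2 / (4 * zeta2) * (zeta2 * L\<^sup>2 * p / l)" using Cp B z by (intro mult_left_mono) auto
    also have "\<dots> = B * p / (4 * l)" using l z L0 by (simp add: field_simps)
    finally show ?thesis .
  qed
  have sp: "s \<le> L\<^sup>2 * p / l"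
  proof -
    have "zeta2 * s \<le> C * s" using C(2) s0 by (intro mult_right_mono)
    also have "\<dots> \<le> zeta2 * (L\<^sup>2 * p / l)" using Cp by (simp add: ac_simps)
    finally show ?thesis using z by (simp only: mult_le_cancel_left_pos)
  qed
  have one: "1 \<le> L\<^sup>2 * p / l"
  proof -
    have "l * 1 \<le> L\<^sup>2 * p" using lL2 p1 l by (intro mult_mono) auto
    then show ?thesis using l by (simp add: le_divide_eq)
  qed
  have e: "\<eta> \<le> B * p / (4 * l)"
  proof -
    have eq: "\<eta> = (\<epsilon> * B)\<^sup>2 * l * B * cn * (16 + 96 * cf * s)"
      unfolding \<eta> s_def l_def by (simp add: power2_eq_square power3_eq_cube algebra_simps)
    define P where "P = L\<^sup>2 * p / l"
    have P: "P \<ge> 1" "s \<le> P" using one sp by (auto simp: P_def)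
    have q: "16 + 96 * cf * s \<le> (16 + 96 * cf) * P"
    proof -
      have "96 * cf * s \<le> 96 * cf * P" using P k by (intro mult_left_mono) auto
      then show ?thesis using P(1) unfolding distrib_right by linarith
    qed
    have sm: "(\<epsilon> * B)\<^sup>2 \<le> c\<^sup>2 * (L powr (- (2 * \<gamma>)) / L\<^sup>2)"
    proof -
      have "(\<epsilon> * B)\<^sup>2 \<le> (c * L powr (- 1 - \<gamma>))\<^sup>2" using small \<epsilon> B by (intro power_mono) auto
      also have "\<dots> = c\<^sup>2 * (L powr (- 1 - \<gamma>) * L powr (- 1 - \<gamma>))" by (simp add: power2_eq_square)
      also have "L powr (- 1 - \<gamma>) * L powr (- 1 - \<gamma>) = L powr (- (2 * \<gamma>)) / L powr 2"
        unfolding powr_add[symmetric] powr_diff[symmetric] by (rule arg_cong[where f="(powr) L"]) simp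
      finally show ?thesis using L0 by simp
    qed
    have lg: "l * L powr (- (2 * \<gamma>)) \<le> 1 / (2 * \<gamma>)"
    proof -
      have "2 * \<gamma> * l \<le> exp (2 * \<gamma> * l)" using exp_ge_add_one_self[of "2 * \<gamma> * l"] by linarith
      also have "\<dots> = L powr (2 * \<gamma>)" using L0 by (simp add: powr_def l_def)
      finally show ?thesis using \<gamma> L0 by (simp add: powr_minus field_simps)
    qed
    have bn: "l * B * cn \<ge> 0" using l B k by simp
    have Pn: "(16 + 96 * cf) * P \<ge> 0" using P k by simp
    have "\<eta> \<le> c\<^sup>2 * (L powr (- (2 * \<gamma>)) / L\<^sup>2) * (l * B * cn) * ((16 + 96 * cf) * P)"
      unfolding eq mult.assoc[of "(\<epsilon> * B)\<^sup>2"] using mult_mono[OF mult_right_mono[OF sm bn] q] bn s0 k by (simp add: mult.assoc)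
    also have "\<dots> = (c\<^sup>2 * (cn * (16 + 96 * cf))) * (l * L powr (- (2 * \<gamma>))) * (B * (P / L\<^sup>2))" by simp
    also have "P / L\<^sup>2 = p / l" using L0 by (simp add: P_def)
    also have "(c\<^sup>2 * (cn * (16 + 96 * cf))) * (l * L powr (- (2 * \<gamma>))) * (B * (p / l)) \<le> (\<gamma> / 2) * (1 / (2 * \<gamma>)) * (B * (p / l))"
      using c lg \<gamma> B p0 l k by (intro mult_right_mono mult_mono) auto
    also have "\<dots> = B * p / (4 * l)" using \<gamma> by simp
    finally show ?thesis .
  qed
  have en: "\<eta> + \<delta> * \<tau> \<ge> 0" unfolding \<eta> \<delta> using \<tau> B k l by (auto simp: l_def intro!: add_nonneg_nonneg mult_nonneg_nonneg)
  have "2 * (\<eta> + \<delta> * \<tau>) * exp (2 * \<beta> * \<tau>) \<le> (B * p / l) * p"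
    using d e exp_le en B p0 l by (intro mult_mono) (auto simp: field_simps)
  also have "\<dots> = B * (p * p / l)" by simp
  also have "\<dots> = B / ln L powr (1 - \<gamma>)" unfolding lp by (simp add: l_def)
  finally show ?thesis .
qed

context nls_box
begin

lemma w_summable: "w summable_on UNIV" "(\<Sum>\<^sub>\<infinity>n. w n) \<le> 4 * (lsum_const \<sigma>)\<^sup>2 * L\<^sup>2"
proof -
  have le: "nsum (\<lambda>n. ennreal (norm (w n))) UNIV \<le> ennreal (4 * (lsum_const \<sigma>)\<^sup>2 * L\<^sup>2)"
    using wt_lattice_sum[OF \<sigma> L0(2), of 0] w_nonneg by (simp add: w_def pt_def)
  from summable_of_nsum(1,4)[OF this] show "w summable_on UNIV" "(\<Sum>\<^sub>\<infinity>n. w n) \<le> 4 * (lsum_const \<sigma>)\<^sup>2 * L\<^sup>2"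
    using w_nonneg by auto
qed

text \<open>A solution bounded by the weights is in \<open>\<ell>\<^sup>1\<close> uniformly in time, hence the only one.\<close>
lemma NLS_approximated_of_bound:
  assumes \<tau>: "0 \<le> \<tau>" and R: "R \<ge> 0" and \<delta>: "\<delta> \<ge> 0"
    and i: "\<And>n. \<alpha> 0 n = g 0 (pt n)" and b: "\<And>t n. t \<in> {0..\<tau>} \<Longrightarrow> norm (\<alpha> t n) \<le> R * w n"
    and d: "\<And>t n. t \<in> {0..\<tau>} \<Longrightarrow> ((\<lambda>s. \<alpha> s n) has_vector_derivative nonlin t (\<alpha> t) n) (at t within {0..\<tau>})"
    and close: "\<And>t n. t \<in> {0..\<tau>} \<Longrightarrow> norm (\<alpha> t n - g (t / T_star L \<epsilon>) (pt n)) \<le> \<delta> * w n"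
  shows "NLS_approximated \<sigma> L \<epsilon> g \<delta> \<tau>"
proof -
  define a where "a = (\<lambda>t K. \<alpha> t (inv pt K))"
  have inj: "inj pt" by (simp add: inj_def pt_inj)
  have a: "a t (pt n) = \<alpha> t n" for t n by (simp add: a_def inv_f_f[OF inj])
  define M where "M = R * (4 * (lsum_const \<sigma>)\<^sup>2 * L\<^sup>2)"
  have ws: "(\<lambda>n. R * w n) summable_on UNIV" by (intro summable_on_cmult_right w_summable)
  have s: "(\<lambda>n. norm (\<alpha> t n)) summable_on UNIV" if "t \<in> {0..\<tau>}" for t
    by (rule summable_on_comparison_test[OF ws]) (use b[OF that] in auto)
  have m: "(\<Sum>\<^sub>\<infinity>n. norm (\<alpha> t n)) \<le> M" if t: "t \<in> {0..\<tau>}" for t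
  proof -
    have "(\<Sum>\<^sub>\<infinity>n. norm (\<alpha> t n)) \<le> (\<Sum>\<^sub>\<infinity>n. R * w n)" by (rule infsum_mono[OF s[OF t] ws]) (rule b[OF t])
    also have "\<dots> = R * (\<Sum>\<^sub>\<infinity>n. w n)" by (rule infsum_cmult_right) (rule w_summable)
    also have "\<dots> \<le> M" unfolding M_def by (rule mult_left_mono[OF w_summable(2) R])
    finally show ?thesis .
  qed
  have sol: "NLS_solution L \<epsilon> (g 0) \<tau> a"
    unfolding NLS_solution_index a using s m i d by (auto intro!: bdd_aboveI2[where M=M])
  have uniq: "b t K = a t K" if sb: "NLS_solution L \<epsilon> (g 0) \<tau> b" and t: "t \<in> {0..\<tau>}" and K: "K \<in> lattice_L L" for b t K
  proof -
    note sb = sb[unfolded NLS_solution_index]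
    obtain M' where M': "\<And>t. t \<in> {0..\<tau>} \<Longrightarrow> (\<Sum>\<^sub>\<infinity>n. norm (b t (pt n))) \<le> M'"
      using sb unfolding bdd_above_def by blast
    obtain n where n: "K = pt n" using K by (auto simp: lattice_eq)
    have "(\<lambda>t n. b t (pt n)) t n = \<alpha> t n"
    proof (rule l1_uniqueness[OF \<tau>, where M="max M M'"])
      show "(\<Sum>\<^sub>\<infinity>n. norm (b t (pt n))) \<le> max M M'" if "t \<in> {0..\<tau>}" for t using M'[OF that] by simp
      show "(\<Sum>\<^sub>\<infinity>n. norm (\<alpha> t n)) \<le> max M M'" if "t \<in> {0..\<tau>}" for t using m[OF that] by simp
    qed (use sb s d t i in auto)
    then show ?thesis by (simp add: n a)
  qed
  have X: "XL_norm L \<sigma> (\<lambda>K. a t K - g (t / T_star L \<epsilon>) K) \<le> ennreal \<delta>" if t: "t \<in> {0..\<tau>}" for t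
    unfolding XL_norm_def
  proof (rule SUP_least)
    fix K assume "K \<in> lattice_L L"
    then obtain n where n: "K = pt n" by (auto simp: lattice_eq)
    have "japanese_bracket K powr \<sigma> * norm (a t K - g (t / T_star L \<epsilon>) K) \<le> japanese_bracket K powr \<sigma> * (\<delta> * w n)"
      unfolding n a by (intro mult_left_mono close t) simp
    also have "\<dots> = \<delta>" using jb_pos[of K] by (simp add: w_def wt_def n powr_minus)
    finally show "ennreal (japanese_bracket K powr \<sigma> * norm (a t K - g (t / T_star L \<epsilon>) K)) \<le> ennreal \<delta>" by (rule ennreal_leI)
  qed
  show ?thesis unfolding NLS_approximated_def using sol uniq X by blast
qed

lemma T_star_eq: "T_star L \<epsilon> = zeta2 * L\<^sup>2 / (2 * \<epsilon>\<^sup>2 * ln L)"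
  by (simp add: T_star_def zeta2_def)

lemma T_star_pos: "T_star L \<epsilon> > 0"
  unfolding T_star_eq using L \<epsilon> zeta2_ge_1 by (intro divide_pos_pos mult_pos_pos) auto

text \<open>The time scale \<open>T_star\<close> is the one on which the main term of the resonant sum, multiplied by
  \<open>\<epsilon>\<^sup>2 / L ^ 4\<close>, becomes the right-hand side of the limit equation.\<close>
lemma resonant_part_CR:
  assumes p: "profile \<sigma> B g" and Le: "L \<ge> exp 1"
    and C: "\<And>N. N \<ge> 1 \<Longrightarrow> \<bar>ln (2 * real N + 1) - (\<Sum>d=1..N. ln (real (N div d)) / (real d)\<^sup>2) / zeta2\<bar> \<le> C" "C \<ge> 0"
  shows "norm (resonant_part (\<lambda>m. g (pt m)) n - (1 / T_star L \<epsilon>) *\<^sub>R (\<i> * CR_T g g g (pt n)))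
    \<le> \<epsilon>\<^sup>2 / L\<^sup>2 * (profile.equi_const \<sigma> C * B ^ 3) * w n"
proof -
  have r: "resonant = {(p, q). idot p q = 0}" by (auto simp: resonant_def)
  have s: "(\<Sum>\<^sub>\<infinity>z\<in>resonant. cub (\<lambda>m. g (pt m)) n z) = (\<Sum>\<^sub>\<infinity>(p, q)\<in>{(p, q). idot p q = 0}. tri g (pt n) ((1/L) *\<^sub>R ivec p) ((1/L) *\<^sub>R ivec q))"
    unfolding r
  proof (rule infsum_cong)
    fix z :: "(int \<times> int) \<times> (int \<times> int)"
    obtain p q where z: "z = (p, q)" by (cases z)
    show "cub (\<lambda>m. g (pt m)) n z = (case z of (p, q) \<Rightarrow> tri g (pt n) ((1/L) *\<^sub>R ivec p) ((1/L) *\<^sub>R ivec q))"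
      unfolding z case_prod_conv cub_def tri_def fst_conv snd_conv pt_add pt_def[symmetric] ..
  qed
  define X where "X = (\<Sum>\<^sub>\<infinity>z\<in>resonant. cub (\<lambda>m. g (pt m)) n z)"
  define c where "c = 2 * L\<^sup>2 * ln L / zeta2"
  have z: "zeta2 > 0" using zeta2_ge_1 by linarith
  have T: "1 / T_star L \<epsilon> = \<kappa> * c"
    using L0 \<epsilon> z L by (simp add: T_star_eq \<kappa>_def c_def field_simps power2_eq_square power4_eq_xxxx)
  have "resonant_part (\<lambda>m. g (pt m)) n - (1 / T_star L \<epsilon>) *\<^sub>R (\<i> * CR_T g g g (pt n))
     = \<i> * (complex_of_real \<kappa> * (X - c *\<^sub>R CR_T g g g (pt n)))"
    unfolding T resonant_part_def X_def[symmetric] by (simp add: scaleR_conv_of_real algebra_simps)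
  then have "norm (resonant_part (\<lambda>m. g (pt m)) n - (1 / T_star L \<epsilon>) *\<^sub>R (\<i> * CR_T g g g (pt n)))
     = \<kappa> * norm (X - c *\<^sub>R CR_T g g g (pt n))" using \<kappa>_pos by (simp add: norm_mult)
  also have "\<dots> \<le> \<kappa> * (profile.equi_const \<sigma> C * (B ^ 3 * wt \<sigma> (pt n)) * L\<^sup>2)"
    using profile.resonant_sum_asymptotics[OF p C Le, of "pt n"] \<kappa>_pos unfolding X_def s c_def by (intro mult_left_mono) auto
  also have "\<dots> = \<epsilon>\<^sup>2 / L\<^sup>2 * (profile.equi_const \<sigma> C * B ^ 3) * w n"
    using L0 by (simp add: \<kappa>_def w_def field_simps power2_eq_square power4_eq_xxxx)
  finally show ?thesis .
qed

text \<open>The truncation level \<open>2 B\<close> leaves room for an error of size \<open>B\<close> around the limit profile, and the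
  estimate shows that the error is not larger than that. The truncated solution is therefore a solution.
  The time restriction with \<open>\<tau> \<ge> 0\<close> forces \<open>ln (ln L) \<ge> 0\<close>, whence \<open>L \<ge> e\<close>.\<close>
lemma CR_approximation:
  assumes \<gamma>: "0 < \<gamma>" "\<gamma> < 1" and M: "0 \<le> M" and CR: "CR_solution M g"
    and wg: "\<And>t. t \<in> {0..M} \<Longrightarrow> weak_gradient (g t) (Dg t)" and B: "0 \<le> B"
    and X: "\<And>t. t \<in> {0..M} \<Longrightarrow> X_norm (\<sigma> + 1) (g t) + X_norm (\<sigma> + 1) (Dg t) \<le> ennreal B"
    and C0: "\<And>N. N \<ge> 1 \<Longrightarrow> \<bar>ln (2 * real N + 1) - (\<Sum>d=1..N. ln (real (N div d)) / (real d)\<^sup>2) / zeta2\<bar> \<le> C0" "C0 \<ge> 0"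
    and ce: "ce = max 1 (profile.equi_const \<sigma> C0) * lip_const \<sigma> ^ 3"
    and c: "c > 0" "c\<^sup>2 * (nonres_const \<sigma> / (8 * pi) * (16 + 96 * full_const \<sigma>)) \<le> \<gamma> / 2"
    and C: "C \<ge> 1" "C \<ge> zeta2" "C \<ge> 24 * res_const \<sigma> * zeta2" "C \<ge> 4 * ce * zeta2"
    and small: "\<epsilon> * B < c * L powr (- 1 - \<gamma>)"
    and \<tau>: "0 \<le> \<tau>" "\<tau> \<le> T_star L \<epsilon> * M" and time: "C * B\<^sup>2 * \<tau> \<le> T_star L \<epsilon> * (\<gamma> * ln (ln L))"
  shows "NLS_approximated \<sigma> L \<epsilon> g (B / ln L powr (1 - \<gamma>)) \<tau>"
proof -
  define T where "T = T_star L \<epsilon>"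
  have T: "T > 0" unfolding T_def by (rule T_star_pos)
  have "0 \<le> C * B\<^sup>2 * \<tau>" using C \<tau> by simp
  then have "0 \<le> T * (\<gamma> * ln (ln L))" using time by (simp add: T_def)
  then have "ln (ln L) \<ge> 0" using T \<gamma> by (simp add: zero_le_mult_iff)
  then have l1: "ln L \<ge> 1" using L by (simp add: ln_ge_zero_iff)
  then have Le: "L \<ge> exp 1" using L0 by (metis ln_ge_iff)
  have tT: "t / T \<in> {0..M}" if "t \<in> {0..\<tau>}" for t
    using that T \<tau> by (simp add: divide_le_eq T_def mult.commute)
  have gc: "continuous_on UNIV (g u)" if "u \<in> {0..M}" for u using CR that by (simp add: CR_solution_def)
  have prof: "profile \<sigma> (lip_const \<sigma> * B) (g u)" if "u \<in> {0..M}" for u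
    by (rule profile_of_X_norm(1)[OF \<sigma> gc[OF that] wg[OF that] X[OF that] B])
  have gb: "norm (g u (pt n)) \<le> B * w n" if "u \<in> {0..M}" for u n
  proof -
    have "norm (g u (pt n)) \<le> B * wt (\<sigma> + 1) (pt n)"
      by (rule profile_of_X_norm(2)[OF \<sigma> gc[OF that] wg[OF that] X[OF that] B])
    also have "\<dots> \<le> B * w n" unfolding w_def using B by (intro mult_left_mono wt_mono_exp) auto
    finally show ?thesis .
  qed
  show ?thesis
  proof (cases "B = 0")
    case True
    have z: "g u (pt n) = 0" if "u \<in> {0..M}" for u n using gb[OF that, of n] True by simp
    have g0: "g 0 (pt n) = 0" for n by (rule z) (use M in simp)
    have n0: "nonlin t (\<lambda>n. 0) n = 0" for t n by (simp add: nonlin_def cub_def)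
    show ?thesis
      by (rule NLS_approximated_of_bound[where \<alpha>="\<lambda>t n. 0" and R=0])
         (use \<tau> True in \<open>auto simp: n0 g0 z tT[unfolded T_def] atLeastAtMost_iff[symmetric] simp del: atLeastAtMost_iff\<close>)
  next
    case False
    then have Bp: "B > 0" using B by simp
    define R where "R = 2 * B"
    have R: "R > 0" using Bp by (simp add: R_def)
    define G where "G = (\<lambda>t n. g (t / T) (pt n))"
    define G' where "G' = (\<lambda>t n. (1 / T) *\<^sub>R (\<i> * CR_T (g (t / T)) (g (t / T)) (g (t / T)) (pt n)))"
    define \<delta> where "\<delta> = \<epsilon>\<^sup>2 / L\<^sup>2 * (ce * B ^ 3)"
    define \<beta> where "\<beta> = 3 * \<epsilon>\<^sup>2 * R\<^sup>2 * res_const \<sigma> * ln L / L\<^sup>2"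
    define \<eta> where "\<eta> = \<epsilon>\<^sup>2 * ln L * nonres_const \<sigma> * (2 * R ^ 3 + 3 * R\<^sup>2 * (\<epsilon>\<^sup>2 * R ^ 3 * full_const \<sigma>) * \<tau>) / (8 * pi)"
    have lc: "lip_const \<sigma> > 0" using lip_const_ge_1[OF \<sigma>] by linarith
    have ce0: "ce > 0" unfolding ce using lc by (intro mult_pos_pos) auto
    have \<delta>0: "\<delta> \<ge> 0" using ce0 Bp by (simp add: \<delta>_def)
    have Gb: "norm (G t n) \<le> R * w n" if "t \<in> {0..\<tau>}" for t n
      using gb[OF tT[OF that], of n] mult_nonneg_nonneg[OF B w_nonneg[of n]] unfolding G_def R_def by linarith
    have dG: "((\<lambda>s. G s n) has_vector_derivative G' t n) (at t within {0..\<tau>})" if t: "t \<in> {0..\<tau>}" for n t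
    proof -
      have "((\<lambda>s. g s (pt n)) has_vector_derivative \<i> * CR_T (g (t / T)) (g (t / T)) (g (t / T)) (pt n)) (at (t / T) within {0..M})"
        using CR tT[OF t] unfolding CR_solution_def by blast
      then have 1: "((\<lambda>s. g s (pt n)) has_vector_derivative \<i> * CR_T (g (t / T)) (g (t / T)) (g (t / T)) (pt n)) (at (t / T) within (\<lambda>s. s / T) ` {0..\<tau>})"
        by (rule has_vector_derivative_within_subset) (use tT in blast)
      have 2: "((\<lambda>s. s / T) has_vector_derivative 1 / T) (at t within {0..\<tau>})"
        unfolding has_real_derivative_iff_has_vector_derivative[symmetric] using T by (auto intro!: derivative_eq_intros)
      show ?thesis using vector_diff_chain_within[OF 2 1] by (simp add: o_def G_def G'_def)
    qed
    have res: "norm (resonant_part (G t) n - G' t n) \<le> \<delta> * w n" if t: "t \<in> {0..\<tau>}" for n t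
    proof -
      have "norm (resonant_part (G t) n - G' t n) \<le> \<epsilon>\<^sup>2 / L\<^sup>2 * (profile.equi_const \<sigma> C0 * (lip_const \<sigma> * B) ^ 3) * w n"
        unfolding G_def G'_def T_def by (rule resonant_part_CR[OF prof[OF tT[OF t, unfolded T_def]] Le C0])
      also have "\<dots> \<le> \<epsilon>\<^sup>2 / L\<^sup>2 * (max 1 (profile.equi_const \<sigma> C0) * (lip_const \<sigma> * B) ^ 3) * w n"
        using lc Bp w_nonneg by (intro mult_right_mono mult_left_mono) auto
      also have "\<dots> = \<delta> * w n" unfolding \<delta>_def ce by (simp add: power_mult_distrib)
      finally show ?thesis .
    qed
    obtain \<alpha> where i: "\<And>n. \<alpha> 0 n = G 0 n"
      and d: "\<And>n t. t \<in> {0..\<tau>} \<Longrightarrow> ((\<lambda>s. \<alpha> s n) has_vector_derivative nonlin t (trunc R (\<alpha> t)) n) (at t within {0..\<tau>})"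
      using truncated_solution[OF \<tau>(1) less_imp_le[OF R], of "G 0"] by metis
    define E where "E = B / ln L powr (1 - \<gamma>)"
    have E0: "E \<ge> 0" using B by (simp add: E_def)
    have EB: "E \<le> B"
    proof -
      have "1 \<le> ln L powr (1 - \<gamma>)" using l1 \<gamma> by (intro ge_one_powr_ge_zero) auto
      then show ?thesis using B by (simp add: E_def divide_le_eq mult_le_cancel_left1)
    qed
    have bud: "2 * (\<eta> + \<delta> * \<tau>) * exp (2 * \<beta> * \<tau>) \<le> E" unfolding E_def
    proof (rule error_budget[OF \<gamma> Le Bp \<epsilon> \<tau>(1) res_const_pos _ full_const_pos ce0 c C small T_star_eq time])
      show "nonres_const \<sigma> / (8 * pi) > 0" using nonres_const_pos[of \<sigma>] by simp
    qed (simp_all add: \<beta>_def \<eta>_def \<delta>_def R_def)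
    have close: "norm (\<alpha> t n - G t n) \<le> E * w n" if t: "t \<in> {0..\<tau>}" for t n
      using truncated_close[OF Le R \<tau>(1) \<delta>0 d dG Gb i res \<beta>_def \<eta>_def t, of n] mult_right_mono[OF bud w_nonneg[of n]]
      by (rule order_trans)
    have \<alpha>b: "norm (\<alpha> t n) \<le> R * w n" if t: "t \<in> {0..\<tau>}" for t n
    proof -
      have "norm (\<alpha> t n) \<le> norm (\<alpha> t n - G t n) + norm (G t n)" by norm
      also have "\<dots> \<le> E * w n + B * w n" using close[OF t, of n] gb[OF tT[OF t], of n] by (simp add: G_def)
      also have "\<dots> \<le> R * w n" using mult_right_mono[OF EB w_nonneg[of n]] by (simp add: R_def)
      finally show ?thesis .
    qed
    show ?thesis unfolding E_def[symmetric]
    proof (rule NLS_approximated_of_bound[OF \<tau>(1) less_imp_le[OF R] E0 _ \<alpha>b])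
      show "\<alpha> 0 n = g 0 (pt n)" for n by (simp add: i G_def)
      show "norm (\<alpha> t n - g (t / T_star L \<epsilon>) (pt n)) \<le> E * w n" if "t \<in> {0..\<tau>}" for t n
        using close[OF that] by (simp add: G_def T_def)
      fix t n assume t: "t \<in> {0..\<tau>}"
      \<comment> \<open>the truncation is inactive along the solution\<close>
      have "trunc R (\<alpha> t) = \<alpha> t" by (rule ext) (rule trunc_self[OF \<alpha>b[OF t]])
      then show "((\<lambda>s. \<alpha> s n) has_vector_derivative nonlin t (\<alpha> t) n) (at t within {0..\<tau>})" using d[OF t, of n] by simp
    qed
  qed
qed

end

theorem theorem2p4:
  fixes \<sigma> \<gamma> :: real
  assumes "\<sigma> > 2" and "0 < \<gamma>" and "\<gamma> < 1"
  shows "\<exists>c>0. \<exists>C>0. \<exists>A>0.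
    \<forall>(M::real) (g :: real \<Rightarrow> real^2 \<Rightarrow> complex) (Dg :: real \<Rightarrow> real^2 \<Rightarrow> complex^2) (B::real) (L::real) (\<epsilon>::real).
      0 \<le> M \<longrightarrow>
      CR_solution M g \<longrightarrow>
      (\<forall>t\<in>{0..M}. weak_gradient (g t) (Dg t)) \<longrightarrow>
      X_norm (\<sigma> + 1) (g 0) < \<infinity> \<longrightarrow>
      X_norm (\<sigma> + 1) (Dg 0) < \<infinity> \<longrightarrow>
      0 \<le> B \<longrightarrow>
      ennreal B = (SUP t\<in>{0..M}. X_norm (\<sigma> + 1) (g t) + X_norm (\<sigma> + 1) (Dg t)) \<longrightarrow>
      1 < L \<longrightarrow>
      0 < \<epsilon> \<longrightarrow>
      \<epsilon> * B < c * L powr (- 1 - \<gamma>) \<longrightarrow>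
      (\<forall>\<tau>\<ge>0. \<tau> \<le> T_star L \<epsilon> * M \<and> C * B\<^sup>2 * \<tau> \<le> T_star L \<epsilon> * (\<gamma> * ln (ln L)) \<longrightarrow>
         NLS_approximated \<sigma> L \<epsilon> g (A * (B / ln L powr (1 - \<gamma>))) \<tau>) \<and>
      (exp (exp (C * M * B\<^sup>2 / \<gamma>)) \<le> L \<longrightarrow>
         NLS_approximated \<sigma> L \<epsilon> g (A * (B / ln L powr (1 - \<gamma>))) (M * T_star L \<epsilon>))"
proof -
  obtain C0 where C0: "C0 \<ge> 0" "\<And>N. N \<ge> 1 \<Longrightarrow> \<bar>ln (2 * real N + 1) - (\<Sum>d=1..N. ln (real (N div d)) / (real d)\<^sup>2) / zeta2\<bar> \<le> C0"
    by (rule log_average) (rule that)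
  define ce where "ce = max 1 (profile.equi_const \<sigma> C0) * lip_const \<sigma> ^ 3"
  define D where "D = nonres_const \<sigma> / (8 * pi) * (16 + 96 * full_const \<sigma>)"
  have D: "D > 0" unfolding D_def using nonres_const_pos[of \<sigma>] full_const_pos[of \<sigma>]
    by (intro mult_pos_pos divide_pos_pos add_pos_pos) auto
  define c where "c = sqrt (\<gamma> / (2 * D))"
  have c: "c > 0" "c\<^sup>2 * D \<le> \<gamma> / 2" using assms D by (simp_all add: c_def)
  define C where "C = Max {1, zeta2, 24 * res_const \<sigma> * zeta2, 4 * ce * zeta2}"
  have C: "C \<ge> 1" "C \<ge> zeta2" "C \<ge> 24 * res_const \<sigma> * zeta2" "C \<ge> 4 * ce * zeta2"
    unfolding C_def by (intro Max_ge; simp)+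
  have main: "NLS_approximated \<sigma> L \<epsilon> g (1 * (B / ln L powr (1 - \<gamma>))) \<tau>"
    if h: "0 \<le> M" "CR_solution M g" "\<forall>t\<in>{0..M}. weak_gradient (g t) (Dg t)" "0 \<le> B"
      "ennreal B = (SUP t\<in>{0..M}. X_norm (\<sigma> + 1) (g t) + X_norm (\<sigma> + 1) (Dg t))" "1 < L" "0 < \<epsilon>"
      "\<epsilon> * B < c * L powr (- 1 - \<gamma>)" "0 \<le> \<tau>" "\<tau> \<le> T_star L \<epsilon> * M" "C * B\<^sup>2 * \<tau> \<le> T_star L \<epsilon> * (\<gamma> * ln (ln L))"
    for M B L \<epsilon> \<tau> :: real and g :: "real \<Rightarrow> real^2 \<Rightarrow> complex" and Dg :: "real \<Rightarrow> real^2 \<Rightarrow> complex^2"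
  proof -
    interpret nls_box \<sigma> L \<epsilon> by standard (use assms h in auto)
    have X: "X_norm (\<sigma> + 1) (g t) + X_norm (\<sigma> + 1) (Dg t) \<le> ennreal B" if "t \<in> {0..M}" for t
      unfolding h(5) by (rule SUP_upper[OF that])
    show ?thesis unfolding mult_1
      by (rule CR_approximation[OF assms(2,3) h(1,2) _ h(4) X C0(2,1) ce_def c[unfolded D_def] C h(8-11)]) (use h(3) in auto)
  qed
  have T: "T_star L \<epsilon> > 0" if "1 < L" "0 < \<epsilon>" for L \<epsilon>
    using that assms by (intro nls_box.T_star_pos[of \<sigma>] nls_box.intro) auto
  have full: "C * B\<^sup>2 * (M * T_star L \<epsilon>) \<le> T_star L \<epsilon> * (\<gamma> * ln (ln L))"
    if "exp (exp (C * M * B\<^sup>2 / \<gamma>)) \<le> L" "1 < L" "0 < \<epsilon>" for M B L \<epsilon>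
  proof -
    have "exp (C * M * B\<^sup>2 / \<gamma>) \<le> ln L" using that by (subst ln_ge_iff) auto
    then have "C * M * B\<^sup>2 / \<gamma> \<le> ln (ln L)" using that by (subst ln_ge_iff) auto
    then have "C * M * B\<^sup>2 \<le> \<gamma> * ln (ln L)" using assms by (simp add: divide_le_eq mult.commute)
    then have "T_star L \<epsilon> * (C * M * B\<^sup>2) \<le> T_star L \<epsilon> * (\<gamma> * ln (ln L))" using T[OF that(2,3)] by (intro mult_left_mono) auto
    then show ?thesis by (simp add: ac_simps)
  qed
  show ?thesis
  proof (rule exI[of _ c], rule conjI[OF c(1)], rule exI[of _ C], rule conjI)
    show "C > 0" using C(1) by linarith
    show "\<exists>A>0. \<forall>M g Dg B L \<epsilon>.
      0 \<le> M \<longrightarrow> CR_solution M g \<longrightarrow> (\<forall>t\<in>{0..M}. weak_gradient (g t) (Dg t)) \<longrightarrow>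
      X_norm (\<sigma> + 1) (g 0) < \<infinity> \<longrightarrow> X_norm (\<sigma> + 1) (Dg 0) < \<infinity> \<longrightarrow> 0 \<le> B \<longrightarrow>
      ennreal B = (SUP t\<in>{0..M}. X_norm (\<sigma> + 1) (g t) + X_norm (\<sigma> + 1) (Dg t)) \<longrightarrow>
      1 < L \<longrightarrow> 0 < \<epsilon> \<longrightarrow> \<epsilon> * B < c * L powr (- 1 - \<gamma>) \<longrightarrow>
      (\<forall>\<tau>\<ge>0. \<tau> \<le> T_star L \<epsilon> * M \<and> C * B\<^sup>2 * \<tau> \<le> T_star L \<epsilon> * (\<gamma> * ln (ln L)) \<longrightarrow>
         NLS_approximated \<sigma> L \<epsilon> g (A * (B / ln L powr (1 - \<gamma>))) \<tau>) \<and>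
      (exp (exp (C * M * B\<^sup>2 / \<gamma>)) \<le> L \<longrightarrow>
         NLS_approximated \<sigma> L \<epsilon> g (A * (B / ln L powr (1 - \<gamma>))) (M * T_star L \<epsilon>))"
    proof (rule exI[of _ 1], rule conjI[OF zero_less_one], intro allI impI conjI; (elim conjE)?)
      fix M g Dg B L \<epsilon> \<tau>
      assume h: "0 \<le> M" "CR_solution M g" "\<forall>t\<in>{0..M}. weak_gradient (g t) (Dg t)" "0 \<le> B"
        "ennreal B = (SUP t\<in>{0..M}. X_norm (\<sigma> + 1) (g t) + X_norm (\<sigma> + 1) (Dg t))" "1 < L" "0 < \<epsilon>"
        "\<epsilon> * B < c * L powr (- 1 - \<gamma>)"
      show "NLS_approximated \<sigma> L \<epsilon> g (1 * (B / ln L powr (1 - \<gamma>))) \<tau>"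
        if "0 \<le> \<tau>" "\<tau> \<le> T_star L \<epsilon> * M" "C * B\<^sup>2 * \<tau> \<le> T_star L \<epsilon> * (\<gamma> * ln (ln L))"
        by (rule main[OF h that])
      show "NLS_approximated \<sigma> L \<epsilon> g (1 * (B / ln L powr (1 - \<gamma>))) (M * T_star L \<epsilon>)"
        if "exp (exp (C * M * B\<^sup>2 / \<gamma>)) \<le> L"
        by (rule main[OF h _ _ full[OF that h(6,7)]]) (use h(1) T[OF h(6,7)] in \<open>simp_all add: mult.commute\<close>)
    qed
  qed
qed

end
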